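(* Let $n\ge1$, $\mu\in\mathbb R$, and let $\Lambda_l,\Lambda_r$, $\tilde z_0$, $\tilde A_0^l,\tilde A_1^l,\bar A_0^{lr},\bar A_1^{lr}$ be as specified in the context. With suitably chosen strictly lower triangular matrix functions $\check A_0^r(z),\check A_1^r(z)\in\mathbb R^{n\times n}$, $z\in[0,1]$ (determined together with $P$ and $Q$), the coupled kernel equations $$\Lambda_r(z)P_{zz}(z,\zeta)-(P(z,\zeta)\Lambda_l(\zeta))_{\zeta\zeta}=0,\qquad P_\zeta(z,1)\Lambda_l(1)+P(z,1)\Lambda_l'(1)=0,$$ $$P(0,\zeta)=0,\qquad P_z(0,\zeta)=0,$$ $$\Lambda_r(z)Q_{zz}(z,\zeta)-(Q(z,\zeta)\Lambda_r(\zeta))_{\zeta\zeta}=0,$$ $$Q_\zeta(z,z)\Lambda_r(z)+Q(z,z)\Lambda_r'(z)+\Lambda_r(z)\tfrac d{dz}Q(z,z)+\Lambda_r(z)Q_z(z,z)=0,$$ $$\Lambda_r(z)Q(z,z)-Q(z,z)\Lambda_r(z)=0,\qquad Q(0,0)=0,$$ with the coupling boundary conditions $$P(z,0)\Lambda_l(0)-\tfrac1{\tilde z_0}Q(z,0)\Lambda_r(0)=\bar A_1^{lr}(z)-\int_0^zQ(z,\zeta)\bar A_1^{lr}(\zeta)\,d\zeta-\int_0^1P(z,\zeta)\tilde A_1^l(\zeta)\,d\zeta+\tfrac1{\tilde z_0}\check A_1^r(z),$$ $$Q_\zeta(z,0)\Lambda_r(0)+Q(z,0)\Lambda_r'(0)+P_\zeta(z,0)\Lambda_l(0)+P(z,0)\Lambda_l'(0)=-\bar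 A_0^{lr}(z)+\int_0^zQ(z,\zeta)\bar A_0^{lr}(\zeta)\,d\zeta+\int_0^1P(z,\zeta)\tilde A_0^l(\zeta)\,d\zeta+\check A_0^r(z),$$ have a piecewise continuous solution $P(z,\zeta)\in\mathbb R^{n\times n}$ on the spatial domain $0\le z\le1$, $0\le\zeta\le1$ and $Q(z,\zeta)\in\mathbb R^{n\times n}$ on the spatial domain $0\le\zeta\le z\le1$.
   Context: **Data.** $\check\lambda_i\in C^2[0,1]$, $i=1,\dots,n$, with $\overline{\check\lambda}\ge\check\lambda_1(y)>\dots>\check\lambda_n(y)\ge\underline{\check\lambda}$ on $[0,1]$ for positive constants $\overline{\check\lambda},\underline{\check\lambda}$; $\check A\in(C[0,1])^{n\times n}$; $y_0\in(0,1)$, $\tilde z_0=y_0/(1-y_0)$. For $z\in[0,1]$: $\lambda_i(z)=\check\lambda_i(y_0-y_0z)/y_0^2$ for $i\le n$, $\lambda_i(z)=\check\lambda_{i-n}(y_0+(1-y_0)z)/(1-y_0)^2$ for $n<i\le2n$; $\Lambda_l=\operatorname{diag}(\lambda_1,\dots,\lambda_n)$, $\Lambda_r=\operatorname{diag}(\lambda_{n+1},\dots,\lambda_{2n})$, $\Lambda=\operatorname{diag}(\lambda_1,\dots,\lambda_{2n})$; $A(z)$ is the block diagonal matrix with diagonal blocks $\check A(y_0-y_0z)$ and $\check A(y_0+(1-y_0)z)$. Standing assumption: $y_0$ is chosen such that $\lambda_1(z)>\dots>\lambda_{2n}(z)>0$ for all $z\in[0,1]$. **Origin of $\tilde A_i^l$,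 $\bar A_i^{lr}$.** Let $K(z,\zeta)\in\mathbb R^{2n\times2n}$ ($0\le\zeta\le z\le1$), together with strictly lower triangular $\tilde A_0(z),\tilde A_1(z)\in\mathbb R^{2n\times2n}$ (chosen together with $K$), be the piecewise continuous solution of - $\Lambda(z)K_{zz}(z,\zeta)-(K(z,\zeta)\Lambda(\zeta))_{\zeta\zeta}=K(z,\zeta)(A(\zeta)+\mu I)$, $0<\zeta<z<1$, - $\Lambda(z)\frac{d}{dz}K(z,z)+\Lambda(z)K_z(z,z)+K_\zeta(z,z)\Lambda(z)+K(z,z)\Lambda'(z)=-(A(z)+\mu I)$, - $K(z,z)\Lambda(z)-\Lambda(z)K(z,z)=0$, $K(0,0)=0$, - $K(z,0)\Lambda(0)S_1+\tilde A_1(z)S_1=0$, $\ K_\zeta(z,0)\Lambda(0)S_2+K(z,0)\Lambda'(0)S_2-\tilde A_0(z)S_2=0$, with $S_1=\begin{bmatrix} -\tilde z_0I_n \\ I_n \end{bmatrix}$, $S_2=\begin{bmatrix} I_n \\ I_n \end{bmatrix}$, whose remaining freedom is fixed as follows. With $\phi_i(z)=\int_0^z\lambda_i(\bar z)^{-1/2}d\bar z$, $s_{ij}=1$ for $i\le j$, $s_{ij}=-1$ for $i>j$, the coordinates $\xi_{ij}=\frac12(1-s_{ij})(\phi_i(1)+\phi_j(1))+s_{ij}(\phi_i(z)+\phi_j(\zeta))$, $\eta_{ij}=-\frac12(1-s_{ij})(\phi_i(1)-\phi_j(1))+\phi_i(z)-\phi_j(\zeta)$, and $G_{ij}(\xi_{ij},\eta_{ij})=\lambda_j(\zeta)K_{ij}(z,\zeta)$,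 the artificial boundary conditions $G_{ij}(\eta,\eta)=g_{ij}(\eta)$ for $j>n,\ i>j-n$, and $\partial_\eta G_{ij}(\eta,\eta)=g_{ij}(\eta)$ for $j\le n,\ i>j$, are imposed, where the continuous functions $g_{ij}$ on $[0,\bar\eta_{ij}]$ ($\bar\eta_{ij}=\phi_i(1)$ for $i\le j$, $\bar\eta_{ij}=\phi_j(1)$ for $i>j$) are degrees of freedom. Write $\tilde A_i=\begin{bmatrix} \tilde A_i^l & 0 \\ \tilde A_i^{lr} & \tilde A_i^r \end{bmatrix}$ in $n\times n$ blocks ($i=0,1$) and set $\bar A_0^{lr}=\tilde A_0^{lr}+\tilde A_0^r$, $\bar A_1^{lr}=\tilde A_1^{lr}-\frac1{\tilde z_0}\tilde A_1^r$. It is asserted in the source that $(\bar A_1^{lr})'$ is piecewise continuous. **Notation.** $Q_z(z,z)=Q_z(z,\zeta)|_{\zeta=z}$, $Q_\zeta(z,z)=Q_\zeta(z,\zeta)|_{\zeta=z}$, and likewise for $K$. Strictly lower triangular means that only entries with row index larger than column index may be nonzero. The matrices $\check A_0^r,\check A_1^r$ are not given data: their entries below the diagonal are chosen so that the corresponding components of the two coupling boundary conditions are satisfied. *)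

theory Defs
  imports "HOL-Analysis.Analysis"
begin

text \<open>Vectors of length n are indexed by a finite linearly ordered type \<open>'n\<close>, vectors of length 2n
  by \<open>'n + 'n\<close>. The order on the sum puts the first block before the second one, so that
  \<open>Inl i\<close> is the index i and \<open>Inr i\<close> the index n + i.\<close>

instantiation sum :: (linorder, linorder) linorder
begin

definition less_eq_sum :: "'a + 'b \<Rightarrow> 'a + 'b \<Rightarrow> bool" where
  "less_eq_sum x y = (case x of
      Inl a \<Rightarrow> (case y of Inl a' \<Rightarrow> a \<le> a' | Inr _ \<Rightarrow> True)
    | Inr b \<Rightarrow> (case y of Inl _ \<Rightarrow> False | Inr b' \<Rightarrow> b \<le> b'))"

definition less_sum :: "'a + 'b \<Rightarrow> 'a + 'b \<Rightarrow> bool" where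
  "less_sum x y = (x \<le> y \<and> \<not> y \<le> x)"

instance
  by standard (auto simp: less_eq_sum_def less_sum_def split: sum.splits)

end

definition diag :: "real^'k \<Rightarrow> real^'k^'k" where
  "diag v = (\<chi> i j. if i = j then v $ i else 0)"

definition strictly_lower :: "real^('k::{finite,linorder})^('k::{finite,linorder}) \<Rightarrow> bool" where
  "strictly_lower M \<longleftrightarrow> (\<forall>i j. i \<le> j \<longrightarrow> M $ i $ j = 0)"

definition block_l :: "real^('n+'n)^('n+'n) \<Rightarrow> real^'n^'n" where
  "block_l M = (\<chi> i j. M $ Inl i $ Inl j)"

definition block_lr :: "real^('n+'n)^('n+'n) \<Rightarrow> real^'n^'n" where
  "block_lr M = (\<chi> i j. M $ Inr i $ Inl j)"

definition block_r :: "real^('n+'n)^('n+'n) \<Rightarrow> real^'n^'n" where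
  "block_r M = (\<chi> i j. M $ Inr i $ Inr j)"

definition off_finite :: "'a set \<Rightarrow> ('a \<Rightarrow> bool) \<Rightarrow> bool" where
  "off_finite S R \<longleftrightarrow> finite {x \<in> S. \<not> R x}"

definition C2_interval :: "(real \<Rightarrow> 'a::real_normed_vector) \<Rightarrow> bool" where
  "C2_interval f \<longleftrightarrow> (\<exists>f' f''.
     (\<forall>x\<in>{0..1}. (f has_vector_derivative f' x) (at x within {0..1})) \<and>
     (\<forall>x\<in>{0..1}. (f' has_vector_derivative f'' x) (at x within {0..1})) \<and>
     continuous_on {0..1} f'')"

definition pw_continuous :: "(real \<Rightarrow> 'a::real_normed_vector) \<Rightarrow> bool" where
  "pw_continuous f \<longleftrightarrow>
     off_finite {0..1} (\<lambda>x. continuous (at x within {0..1}) f) \<and>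
     (\<forall>x\<in>{0..<1}. \<exists>l. (f \<longlongrightarrow> l) (at_right x)) \<and>
     (\<forall>x\<in>{0<..1}. \<exists>l. (f \<longlongrightarrow> l) (at_left x))"

text \<open>The derivative exists off a finite set and is piecewise continuous; the function itself may
  jump at the exceptional points.\<close>

definition pw_continuous_deriv :: "(real \<Rightarrow> 'a::real_normed_vector) \<Rightarrow> bool" where
  "pw_continuous_deriv f \<longleftrightarrow> (\<exists>f'.
     off_finite {0..1} (\<lambda>x. (f has_vector_derivative f' x) (at x within {0..1})) \<and>
     pw_continuous f')"

definition triangle :: "(real \<times> real) set" where
  "triangle = {(z, \<zeta>). 0 \<le> \<zeta> \<and> \<zeta> \<le> z \<and> z \<le> 1}"

definition square :: "(real \<times> real) set" where
  "square = {0..1} \<times> {0..1}"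

text \<open>Partial derivatives relative to a domain \<open>D\<close>; one-sided on its boundary.\<close>

definition pd_z :: "(real \<times> real) set \<Rightarrow> (real \<Rightarrow> real \<Rightarrow> 'a::real_normed_vector) \<Rightarrow> real \<Rightarrow> real \<Rightarrow> 'a"
  where "pd_z D f z \<zeta> = vector_derivative (\<lambda>x. f x \<zeta>) (at z within {x. (x, \<zeta>) \<in> D})"

definition pd_zeta :: "(real \<times> real) set \<Rightarrow> (real \<Rightarrow> real \<Rightarrow> 'a::real_normed_vector) \<Rightarrow> real \<Rightarrow> real \<Rightarrow> 'a"
  where "pd_zeta D f z \<zeta> = vector_derivative (\<lambda>y. f z y) (at \<zeta> within {y. (z, y) \<in> D})"

text \<open>Regularity of a piecewise continuous kernel. The kernel and its first partial derivatives
  (which enter the boundary conditions) are continuous on finitely many pieces that exhaust \<open>D\<close> up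
  to finitely many curves, and they extend continuously to the closure of each piece: this is what
  uniform continuity on the bounded piece says. The pieces are open relative to \<open>D\<close>, hence may
  contain boundary points of \<open>D\<close>, and all but finitely many boundary points belong to a piece. So the
  values and one-sided derivatives on the boundary are, up to finitely many points, the limits from
  inside. Jumps of the kernel and of its derivatives across the curves are allowed.\<close>

definition pw_C1 :: "(real \<times> real) set \<Rightarrow> (real \<Rightarrow> real \<Rightarrow> 'a::real_normed_vector) \<Rightarrow> bool" where
  "pw_C1 D f \<longleftrightarrow> (\<exists>\<U> \<Gamma>. finite \<U> \<and> finite \<Gamma> \<and>
     (\<forall>\<gamma>\<in>\<Gamma>. valid_path \<gamma>) \<and>
     D \<subseteq> \<Union>\<U> \<union> (\<Union>\<gamma>\<in>\<Gamma>. path_image \<gamma>) \<and>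
     finite (frontier D - \<Union>\<U>) \<and>
     (\<forall>U\<in>\<U>. openin (top_of_set D) U \<and>
        (\<forall>p\<in>U. (\<lambda>(z, \<zeta>). f z \<zeta>) differentiable (at p within D)) \<and>
        uniformly_continuous_on U (\<lambda>(z, \<zeta>). f z \<zeta>) \<and>
        uniformly_continuous_on U (\<lambda>(z, \<zeta>). pd_z D f z \<zeta>) \<and>
        uniformly_continuous_on U (\<lambda>(z, \<zeta>). pd_zeta D f z \<zeta>)))"

definition Dz :: "(real \<Rightarrow> real \<Rightarrow> real) \<Rightarrow> real \<Rightarrow> real \<Rightarrow> real" where
  "Dz f z \<zeta> = deriv (\<lambda>x. f x \<zeta>) z"

definition Dzeta :: "(real \<Rightarrow> real \<Rightarrow> real) \<Rightarrow> real \<Rightarrow> real \<Rightarrow> real" where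
  "Dzeta f z \<zeta> = deriv (\<lambda>y. f z y) \<zeta>"

definition C1_plane :: "(real \<Rightarrow> real \<Rightarrow> real) \<Rightarrow> bool" where
  "C1_plane f \<longleftrightarrow>
     (\<forall>z \<zeta>. (\<lambda>x. f x \<zeta>) differentiable (at z) \<and> (\<lambda>y. f z y) differentiable (at \<zeta>)) \<and>
     continuous_on UNIV (\<lambda>(z, \<zeta>). Dz f z \<zeta>) \<and> continuous_on UNIV (\<lambda>(z, \<zeta>). Dzeta f z \<zeta>)"

definition test_function :: "(real \<times> real) set \<Rightarrow> (real \<Rightarrow> real \<Rightarrow> real) \<Rightarrow> bool" where
  "test_function D \<psi> \<longleftrightarrow>
     C1_plane \<psi> \<and> C1_plane (Dz \<psi>) \<and> C1_plane (Dzeta \<psi>) \<and>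
     (\<exists>C. compact C \<and> C \<subseteq> interior D \<and> (\<forall>z \<zeta>. (z, \<zeta>) \<notin> C \<longrightarrow> \<psi> z \<zeta> = 0))"

text \<open>The equation
    \<open>diag (a z) K\<^sub>z\<^sub>z(z, \<zeta>) - (K(z, \<zeta>) diag (b \<zeta>))\<^sub>\<zeta>\<^sub>\<zeta> = R(z, \<zeta>)\<close> in the interior of \<open>D\<close>.
  The coefficients are such that second derivatives of the kernels need not exist and the kernels
  may jump, so the equation is understood in the weak sense: each component is tested with
  compactly supported \<open>C\<^sup>2\<close> functions and both derivatives are moved to the test function. Unlike
  requiring the equation piecewise, this also forces jumps to propagate along characteristics.\<close>

definition weak_kernel_pde ::
  "(real \<times> real) set \<Rightarrow> (real \<Rightarrow> real^'r) \<Rightarrow> (real \<Rightarrow> real^'c) \<Rightarrow>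
   (real \<Rightarrow> real \<Rightarrow> real^'c^'r) \<Rightarrow> (real \<Rightarrow> real \<Rightarrow> real^'c^'r) \<Rightarrow> bool" where
  "weak_kernel_pde D a b K R \<longleftrightarrow> (\<forall>\<psi> i j. test_function D \<psi> \<longrightarrow>
     integral D (\<lambda>(z, \<zeta>). K z \<zeta> $ i $ j * Dz (Dz (\<lambda>z \<zeta>. a z $ i * \<psi> z \<zeta>)) z \<zeta>
                        - K z \<zeta> $ i $ j * b \<zeta> $ j * Dzeta (Dzeta \<psi>) z \<zeta>)
     = integral D (\<lambda>(z, \<zeta>). R z \<zeta> $ i $ j * \<psi> z \<zeta>))"

definition fold_lam :: "real \<Rightarrow> (real \<Rightarrow> real^'n) \<Rightarrow> real \<Rightarrow> real^('n+'n)" where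
  "fold_lam y0 lamc z = (\<chi> k. case k of
       Inl i \<Rightarrow> lamc (y0 - y0 * z) $ i / y0\<^sup>2
     | Inr i \<Rightarrow> lamc (y0 + (1 - y0) * z) $ i / (1 - y0)\<^sup>2)"

definition fold_A :: "real \<Rightarrow> (real \<Rightarrow> real^'n^'n) \<Rightarrow> real \<Rightarrow> real^('n+'n)^('n+'n)" where
  "fold_A y0 Ac z = (\<chi> k l. case (k, l) of
       (Inl i, Inl j) \<Rightarrow> Ac (y0 - y0 * z) $ i $ j
     | (Inr i, Inr j) \<Rightarrow> Ac (y0 + (1 - y0) * z) $ i $ j
     | _ \<Rightarrow> 0)"

definition lam_l :: "(real \<Rightarrow> real^('n+'n)) \<Rightarrow> real \<Rightarrow> real^'n" where
  "lam_l lam z = (\<chi> i. lam z $ Inl i)"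

definition lam_r :: "(real \<Rightarrow> real^('n+'n)) \<Rightarrow> real \<Rightarrow> real^'n" where
  "lam_r lam z = (\<chi> i. lam z $ Inr i)"

definition diag' :: "(real \<Rightarrow> real^'k) \<Rightarrow> real \<Rightarrow> real^'k^'k" where
  "diag' v z = vector_derivative (\<lambda>x. diag (v x)) (at z within {0..1})"

definition S1 :: "real \<Rightarrow> real^'n^('n+'n)" where
  "S1 zt0 = (\<chi> k j. case k of Inl i \<Rightarrow> (if i = j then - zt0 else 0) | Inr i \<Rightarrow> (if i = j then 1 else 0))"

definition S2 :: "real^'n^('n+'n)" where
  "S2 = (\<chi> k j. case k of Inl i \<Rightarrow> (if i = j then 1 else 0) | Inr i \<Rightarrow> (if i = j then 1 else 0))"

definition phi :: "(real \<Rightarrow> real^'k) \<Rightarrow> 'k \<Rightarrow> real \<Rightarrow> real" where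
  "phi lam i z = integral {0..z} (\<lambda>x. (lam x $ i) powr (- 1 / 2))"

definition sgn_ij :: "'k::linorder \<Rightarrow> 'k \<Rightarrow> real" where
  "sgn_ij i j = (if i \<le> j then 1 else - 1)"

definition xi :: "(real \<Rightarrow> real^('k::{finite,linorder})) \<Rightarrow> 'k \<Rightarrow> 'k \<Rightarrow> real \<Rightarrow> real \<Rightarrow> real" where
  "xi lam i j z \<zeta> = 1 / 2 * (1 - sgn_ij i j) * (phi lam i 1 + phi lam j 1)
                    + sgn_ij i j * (phi lam i z + phi lam j \<zeta>)"

definition eta :: "(real \<Rightarrow> real^('k::{finite,linorder})) \<Rightarrow> 'k \<Rightarrow> 'k \<Rightarrow> real \<Rightarrow> real \<Rightarrow> real" where
  "eta lam i j z \<zeta> = - 1 / 2 * (1 - sgn_ij i j) * (phi lam i 1 - phi lam j 1)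
                     + phi lam i z - phi lam j \<zeta>"

definition eta_bar :: "(real \<Rightarrow> real^('k::{finite,linorder})) \<Rightarrow> 'k \<Rightarrow> 'k \<Rightarrow> real" where
  "eta_bar lam i j = (if i \<le> j then phi lam i 1 else phi lam j 1)"

text \<open>The artificial boundary conditions with free continuous functions \<open>g i j\<close>. The column index
  \<open>Inr m\<close> is j = n + m, so that the condition i > j - n reads \<open>Inl m < i\<close>. The derivative with
  respect to the second argument of \<open>G i j\<close> is one-sided, taken within the transformed triangle.
  The conditions hold off finitely many points: \<open>\<eta> = 0\<close> is a corner of the triangle, where
  K(0, 0) = 0 and the condition on the diagonal would otherwise force \<open>g i j 0 = 0\<close>.\<close>

definition artificial_bc ::
  "(real \<Rightarrow> real^('n+'n)) \<Rightarrow> (real \<Rightarrow> real \<Rightarrow> real^('n+'n)^('n+'n::{finite,linorder})) \<Rightarrow> bool" where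
  "artificial_bc lam K \<longleftrightarrow> (\<exists>G g.
     (\<forall>i j. \<forall>(z, \<zeta>)\<in>triangle.
        G i j (xi lam i j z \<zeta>) (eta lam i j z \<zeta>) = lam \<zeta> $ j * K z \<zeta> $ i $ j) \<and>
     (\<forall>i m. Inl m < i \<longrightarrow> continuous_on {0..eta_bar lam i (Inr m)} (g i (Inr m)) \<and>
        off_finite {0..eta_bar lam i (Inr m)} (\<lambda>\<eta>. G i (Inr m) \<eta> \<eta> = g i (Inr m) \<eta>)) \<and>
     (\<forall>i m. Inl m < i \<longrightarrow> continuous_on {0..eta_bar lam i (Inl m)} (g i (Inl m)) \<and>
        off_finite {0..eta_bar lam i (Inl m)} (\<lambda>\<eta>.
          ((\<lambda>t. G i (Inl m) \<eta> t) has_real_derivative g i (Inl m) \<eta>)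
            (at \<eta> within {t. \<exists>(z, \<zeta>)\<in>triangle.
               xi lam i (Inl m) z \<zeta> = \<eta> \<and> eta lam i (Inl m) z \<zeta> = t}))))"

definition kernel_K ::
  "(real \<Rightarrow> real^('n+'n)) \<Rightarrow> (real \<Rightarrow> real^('n+'n)^('n+'n)) \<Rightarrow> real \<Rightarrow> real \<Rightarrow>
   (real \<Rightarrow> real \<Rightarrow> real^('n+'n)^('n+'n::{finite,linorder})) \<Rightarrow>
   (real \<Rightarrow> real^('n+'n)^('n+'n)) \<Rightarrow> (real \<Rightarrow> real^('n+'n)^('n+'n)) \<Rightarrow> bool" where
  "kernel_K lam A mu zt0 K At0 At1 \<longleftrightarrow>
     (\<forall>z\<in>{0..1}. strictly_lower (At0 z) \<and> strictly_lower (At1 z)) \<and>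
     pw_C1 triangle K \<and>
     weak_kernel_pde triangle lam lam K (\<lambda>z \<zeta>. K z \<zeta> ** (A \<zeta> + mat mu)) \<and>
     off_finite {0..1} (\<lambda>z.
       diag (lam z) ** vector_derivative (\<lambda>x. K x x) (at z within {0..1})
       + diag (lam z) ** pd_z triangle K z z
       + pd_zeta triangle K z z ** diag (lam z)
       + K z z ** diag' lam z = - (A z + mat mu)) \<and>
     (\<forall>z\<in>{0..1}. K z z ** diag (lam z) - diag (lam z) ** K z z = 0) \<and>
     K 0 0 = 0 \<and>
     (\<forall>z\<in>{0..1}. K z 0 ** diag (lam 0) ** S1 zt0 + At1 z ** S1 zt0 = 0) \<and>
     off_finite {0..1} (\<lambda>z.
       pd_zeta triangle K z 0 ** diag (lam 0) ** S2 + K z 0 ** diag' lam 0 ** S2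
       - At0 z ** S2 = 0) \<and>
     artificial_bc lam K"

text \<open>Boundary conditions without derivatives hold at every point, those with derivatives up to
  finitely many points, as usual for piecewise continuous derivatives. \<open>Al0\<close>, \<open>Al1\<close>, \<open>Ab0\<close>, \<open>Ab1\<close>
  are the given matrix functions and \<open>Acr0\<close>, \<open>Acr1\<close> are those chosen with \<open>P\<close> and \<open>Q\<close>.\<close>

definition kernel_PQ ::
  "(real \<Rightarrow> real^'n) \<Rightarrow> (real \<Rightarrow> real^'n) \<Rightarrow> real \<Rightarrow>
   (real \<Rightarrow> real^'n^'n) \<Rightarrow> (real \<Rightarrow> real^'n^'n) \<Rightarrow> (real \<Rightarrow> real^'n^'n) \<Rightarrow> (real \<Rightarrow> real^'n^'n) \<Rightarrow>
   (real \<Rightarrow> real \<Rightarrow> real^'n^'n) \<Rightarrow> (real \<Rightarrow> real \<Rightarrow> real^'n^'n) \<Rightarrow>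
   (real \<Rightarrow> real^'n^'n) \<Rightarrow> (real \<Rightarrow> real^'n^'n) \<Rightarrow> bool" where
  "kernel_PQ ll lr zt0 Al0 Al1 Ab0 Ab1 P Q Acr0 Acr1 \<longleftrightarrow>
     pw_C1 square P \<and>
     pw_C1 triangle Q \<and>
     weak_kernel_pde square lr ll P (\<lambda>z \<zeta>. 0) \<and>
     off_finite {0..1} (\<lambda>z. pd_zeta square P z 1 ** diag (ll 1) + P z 1 ** diag' ll 1 = 0) \<and>
     (\<forall>\<zeta>\<in>{0..1}. P 0 \<zeta> = 0) \<and>
     off_finite {0..1} (\<lambda>\<zeta>. pd_z square P 0 \<zeta> = 0) \<and>
     weak_kernel_pde triangle lr lr Q (\<lambda>z \<zeta>. 0) \<and>
     off_finite {0..1} (\<lambda>z.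
       pd_zeta triangle Q z z ** diag (lr z) + Q z z ** diag' lr z
       + diag (lr z) ** vector_derivative (\<lambda>x. Q x x) (at z within {0..1})
       + diag (lr z) ** pd_z triangle Q z z = 0) \<and>
     (\<forall>z\<in>{0..1}. diag (lr z) ** Q z z - Q z z ** diag (lr z) = 0) \<and>
     Q 0 0 = 0 \<and>
     (\<forall>z\<in>{0..1}.
       (\<lambda>\<zeta>. Q z \<zeta> ** Ab0 \<zeta>) integrable_on {0..z} \<and> (\<lambda>\<zeta>. P z \<zeta> ** Al0 \<zeta>) integrable_on {0..1} \<and>
       (\<lambda>\<zeta>. Q z \<zeta> ** Ab1 \<zeta>) integrable_on {0..z} \<and> (\<lambda>\<zeta>. P z \<zeta> ** Al1 \<zeta>) integrable_on {0..1}) \<and>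
     (\<forall>z\<in>{0..1}.
       P z 0 ** diag (ll 0) - (1 / zt0) *\<^sub>R (Q z 0 ** diag (lr 0))
       = Ab1 z - integral {0..z} (\<lambda>\<zeta>. Q z \<zeta> ** Ab1 \<zeta>)
         - integral {0..1} (\<lambda>\<zeta>. P z \<zeta> ** Al1 \<zeta>) + (1 / zt0) *\<^sub>R Acr1 z) \<and>
     off_finite {0..1} (\<lambda>z.
       pd_zeta triangle Q z 0 ** diag (lr 0) + Q z 0 ** diag' lr 0
       + pd_zeta square P z 0 ** diag (ll 0) + P z 0 ** diag' ll 0
       = - Ab0 z + integral {0..z} (\<lambda>\<zeta>. Q z \<zeta> ** Ab0 \<zeta>)
         + integral {0..1} (\<lambda>\<zeta>. P z \<zeta> ** Al0 \<zeta>) + Acr0 z)"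

end

theory Submission
 imports Defs
begin

text \<open>The rows of P and Q decouple, and the entries with row index above the column index may be put to
  zero, since there the strictly lower triangular matrices absorb both coupling conditions. For a
  row i let \<open>p\<^sub>k = \<lambda>\<^sub>k\<^sup>1\<^sup>/\<^sup>4\<close> and let x, y be the travel times of row and column. An entry is
  \<open>p\<^sub>i(z)/p\<^sub>k(\<zeta>)\<^sup>3\<close> times a solution w of \<open>w\<^sub>s\<^sub>t = m w\<close>, where \<open>s = x - y\<close> and \<open>t = x + y\<close>. So
  \<open>w = f(s) + g(t) + C(s, t)\<close> with \<open>f = g = C = 0\<close> for \<open>s \<le> 0\<close>; for P the condition at \<open>\<zeta> = 1\<close> expresses g
  as the reflection of f, for Q we take \<open>g = 0\<close>. The jumps of f and g are step functions that can be
  read off the jumps of the data. For the rest, one coupling condition differentiated in z and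
  the other one are a regular 2 by 2 system for \<open>f'\<close> of P and Q, which together with the equation for C is solved
  by a contraction in a norm with exponential weights.\<close>

section \<open>Piecewise continuous functions\<close>

text \<open>The data of the first coupling condition may jump, so it cannot simply be
  differentiated. The jumps are fixed beforehand, and the unknowns are the derivatives of f and g
  off the jumps. P carries all jumps; this spares Q a jump at s = 0, which is its diagonal when row
  and column agree. Reflection repeats a jump after the delay \<open>2 * L k\<close>, so the finite
  set S of exceptional points is closed under these shifts. The system is not of Volterra type: the
  derivative of f contains that of g at the same argument, g contains that of f at
  \<open>t - 2 * L k\<close>, both without an integral, and the convolutions look ahead up to
  \<open>x + L k\<close>. This dictates the shift by \<open>L k\<close> in the weight of g and the
  powers of a small \<epsilon> that rank the unknowns. Second derivatives of the kernels need not
  exist; the weak equation is verified by integrating along characteristics, across which f and g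
  may jump freely. The fourth root is the Liouville substitution, which removes the first order
  terms; as \<lambda> is C^2, the remaining potential m is continuous. At z = 0 the first condition
  holds because K(0, 0) = 0 forces its datum to vanish.\<close>

definition locbm :: "('a::euclidean_space \<Rightarrow> real) \<Rightarrow> bool" where
 "locbm f \<longleftrightarrow> f \<in> borel_measurable borel \<and> (\<forall>R. bounded (f ` cball 0 R))"

lemma locbm_measurable: "locbm f \<Longrightarrow> f \<in> borel_measurable borel"
 by (simp add: locbm_def)

lemma locbm_bound:
 assumes "locbm f"
 obtains B where "B \<ge> 0" "\<And>x. norm x \<le> R \<Longrightarrow> \<bar>f x\<bar> \<le> B"
proof -
 have "bounded (f ` cball 0 R)" using assms by (simp add: locbm_def)
 then obtain B where "B > 0" "\<forall>y\<in>f ` cball 0 R. norm y \<le> B" by (auto simp: bounded_pos)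
 then show ?thesis using that[of B] by auto
qed

lemma locbmI:
 assumes "f \<in> borel_measurable borel" "\<And>R. \<exists>B. \<forall>x. norm x \<le> R \<longrightarrow> \<bar>f x\<bar> \<le> B"
 shows "locbm f"
 unfolding locbm_def bounded_iff using assms by fastforce

lemma locbm_continuous: "continuous_on UNIV f \<Longrightarrow> locbm f"
 unfolding locbm_def
 by (meson borel_measurable_continuous_onI compact_cball compact_continuous_image compact_imp_bounded
   continuous_on_subset top_greatest)

lemma locbm_compose:
 fixes f :: "'a::euclidean_space \<Rightarrow> real" and g :: "'b::euclidean_space \<Rightarrow> 'a"
 assumes f: "locbm f" and g: "continuous_on UNIV g"
 shows "locbm (\<lambda>x. f (g x))"
proof (rule locbmI)
 show "(\<lambda>x. f (g x)) \<in> borel_measurable borel"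
  by (rule measurable_compose[OF borel_measurable_continuous_onI[OF g] locbm_measurable[OF f]])
next
 fix R
 have "compact (g ` cball 0 R)"
  using g by (meson compact_cball compact_continuous_image continuous_on_subset top_greatest)
 then obtain R' where R': "\<forall>y\<in>g ` cball 0 R. norm y \<le> R'"
  using compact_imp_bounded bounded_iff by blast
 obtain B where "\<And>x. norm x \<le> R' \<Longrightarrow> \<bar>f x\<bar> \<le> B" using locbm_bound[OF f] by metis
 then show "\<exists>B. \<forall>x. norm x \<le> R \<longrightarrow> \<bar>f (g x)\<bar> \<le> B" using R' by force
qed

lemma locbm_const: "locbm (\<lambda>x. c)"
 by (simp add: locbm_continuous)

lemma locbm_add:
 assumes "locbm f" "locbm g"
 shows "locbm (\<lambda>x. f x + g x)"
proof (rule locbmI)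
 show "(\<lambda>x. f x + g x) \<in> borel_measurable borel"
  using assms[THEN locbm_measurable] by measurable
 fix R
 obtain B where "\<And>x. norm x \<le> R \<Longrightarrow> \<bar>f x\<bar> \<le> B" using locbm_bound[OF assms(1)] by metis
 moreover obtain B' where "\<And>x. norm x \<le> R \<Longrightarrow> \<bar>g x\<bar> \<le> B'" using locbm_bound[OF assms(2)] by metis
 ultimately have "\<forall>x. norm x \<le> R \<longrightarrow> \<bar>f x + g x\<bar> \<le> B + B'"
  by (meson abs_triangle_ineq add_mono order_trans)
 then show "\<exists>B. \<forall>x. norm x \<le> R \<longrightarrow> \<bar>f x + g x\<bar> \<le> B" by blast
qed

lemma locbm_mult:
 assumes "locbm f" "locbm g"
 shows "locbm (\<lambda>x. f x * g x)"
proof (rule locbmI)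
 show "(\<lambda>x. f x * g x) \<in> borel_measurable borel"
  using assms[THEN locbm_measurable] by measurable
 fix R
 obtain B where B: "B \<ge> 0" "\<And>x. norm x \<le> R \<Longrightarrow> \<bar>f x\<bar> \<le> B" using locbm_bound[OF assms(1)] by metis
 moreover obtain B' where "\<And>x. norm x \<le> R \<Longrightarrow> \<bar>g x\<bar> \<le> B'" using locbm_bound[OF assms(2)] by metis
 ultimately have "\<forall>x. norm x \<le> R \<longrightarrow> \<bar>f x * g x\<bar> \<le> B * B'"
  unfolding abs_mult by (intro allI impI mult_mono) auto
 then show "\<exists>B. \<forall>x. norm x \<le> R \<longrightarrow> \<bar>f x * g x\<bar> \<le> B" by blast
qed

lemma locbm_uminus: "locbm f \<Longrightarrow> locbm (\<lambda>x. - f x)"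
 using locbm_mult[OF locbm_const[of "-1"]] by simp

lemma locbm_diff: "locbm f \<Longrightarrow> locbm g \<Longrightarrow> locbm (\<lambda>x. f x - g x)"
 using locbm_add[OF _ locbm_uminus, of f g] by simp

lemma locbm_sum: "(\<And>i. i \<in> I \<Longrightarrow> locbm (f i)) \<Longrightarrow> locbm (\<lambda>x. \<Sum>i\<in>I. f i x)"
 by (induction I rule: infinite_finite_induct) (auto intro: locbm_add locbm_const)

lemma locbm_if:
 assumes "{x. P x} \<in> sets borel" "locbm f" "locbm g"
 shows "locbm (\<lambda>x. if P x then f x else g x)"
proof (rule locbmI)
 show "(\<lambda>x. if P x then f x else g x) \<in> borel_measurable borel"
  using assms by (intro measurable_If) (auto simp: locbm_def)
 fix R
 obtain B where "\<And>x. norm x \<le> R \<Longrightarrow> \<bar>f x\<bar> \<le> B" using locbm_bound[OF assms(2)] by metis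
 moreover obtain B' where "\<And>x. norm x \<le> R \<Longrightarrow> \<bar>g x\<bar> \<le> B'" using locbm_bound[OF assms(3)] by metis
 ultimately have "\<forall>x. norm x \<le> R \<longrightarrow> \<bar>if P x then f x else g x\<bar> \<le> max B B'"
  by (simp add: le_max_iff_disj)
 then show "\<exists>B. \<forall>x. norm x \<le> R \<longrightarrow> \<bar>if P x then f x else g x\<bar> \<le> B" by blast
qed

lemma locbm_set_integrable:
 fixes f :: "'a::euclidean_space \<Rightarrow> real"
 assumes "locbm f" "bounded A" "A \<in> sets borel"
 shows "set_integrable lborel A f"
proof -
 obtain R where R: "\<forall>x\<in>A. norm x \<le> R" using assms(2) bounded_iff by blast
 obtain B where B: "\<And>x. norm x \<le> R \<Longrightarrow> \<bar>f x\<bar> \<le> B" using locbm_bound[OF assms(1)] by metis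
 show ?thesis unfolding set_integrable_def
 proof (rule integrableI_bounded_set_indicator[where B=B])
  show "A \<in> sets lborel" using assms by simp
  show "f \<in> borel_measurable lborel" using assms by (simp add: locbm_def)
  show "emeasure lborel A < \<infinity>" using assms(2) emeasure_bounded_finite by blast
  show "AE x in lborel. x \<in> A \<longrightarrow> norm (f x) \<le> B" using R B by auto
 qed
qed

lemma locbm_integrable:
 fixes f :: "real \<Rightarrow> real"
 shows "locbm f \<Longrightarrow> f integrable_on {a..b}"
 by (rule set_borel_integral_eq_integral(1)[OF locbm_set_integrable]) simp_all

lemma locbm_integral_eq:
 fixes f :: "real \<Rightarrow> real"
 shows "locbm f \<Longrightarrow> integral {a..b} f = (LINT x:{a..b}|lborel. f x)"
 by (rule set_borel_integral_eq_integral(2)[OF locbm_set_integrable, symmetric]) simp_all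

lemma integral_bound:
 fixes f :: "real \<Rightarrow> real"
 assumes f: "locbm f" and B: "\<And>x. x \<in> {a..b} \<Longrightarrow> \<bar>f x\<bar> \<le> B" "B \<ge> 0"
 shows "\<bar>integral {a..b} f\<bar> \<le> B * \<bar>b - a\<bar>"
proof (cases "a \<le> b")
 case True
 then show ?thesis
  using integral_norm_bound_integral[OF locbm_integrable[OF f, of a b], of "\<lambda>_. B"] B
   integrable_const_ivl[of B a b] by (auto simp: mult.commute)
next
 case False then show ?thesis using B by simp
qed

text \<open>Writing the integral over \<open>{0..snd p}\<close> as one over the line with a
  measurable cut-off reduces joint measurability to the Fubini theorem. The class is thereby closed
  under the parameter integrals from which \<open>cs\<close>, \<open>ct\<close> and C are
  built.\<close>

lemma locbm_integral:
 fixes h :: "'a::euclidean_space \<times> real \<Rightarrow> real"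
 assumes h: "locbm h"
 shows "locbm (\<lambda>p. integral {0..snd p} (\<lambda>\<tau>. h (fst p, \<tau>)))"
proof -
 have sec: "locbm (\<lambda>\<tau>. h (q, \<tau>))" for q
  by (rule locbm_compose[OF h]) (auto intro!: continuous_intros)
 have eq: "integral {0..snd p} (\<lambda>\<tau>. h (fst p, \<tau>)) =
   (\<integral>\<tau>. (if 0 \<le> \<tau> \<and> \<tau> \<le> snd p then h (fst p, \<tau>) else 0) \<partial>lborel)" for p :: "'a \<times> real"
  unfolding locbm_integral_eq[OF sec] set_lebesgue_integral_def
  by (rule Bochner_Integration.integral_cong) (auto simp: indicator_def)
 have [measurable]: "h \<in> borel_measurable (borel \<Otimes>\<^sub>M borel)"
  using h by (simp add: locbm_def borel_prod)
 show ?thesis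
 proof (rule locbmI)
  have "(\<lambda>p. \<integral>\<tau>. (if 0 \<le> \<tau> \<and> \<tau> \<le> snd p then h (fst p, \<tau>) else 0) \<partial>lborel)
   \<in> borel_measurable ((borel::'a measure) \<Otimes>\<^sub>M (borel::real measure))"
   by (rule lborel.borel_measurable_lebesgue_integral) measurable
  then show "(\<lambda>p. integral {0..snd p} (\<lambda>\<tau>. h (fst p, \<tau>))) \<in> borel_measurable borel"
   unfolding eq by (simp add: borel_prod)
  fix R :: real
  obtain B where B: "B \<ge> 0" "\<And>x. norm x \<le> \<bar>R\<bar> + \<bar>R\<bar> \<Longrightarrow> \<bar>h x\<bar> \<le> B" using locbm_bound[OF h] by metis
  have "\<bar>integral {0..snd p} (\<lambda>\<tau>. h (fst p, \<tau>))\<bar> \<le> B * R" if p: "norm p \<le> R" for p :: "'a \<times> real"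
  proof -
   have n: "norm (fst p) \<le> R" "\<bar>snd p\<bar> \<le> R"
    using p norm_fst_le[of "fst p" "snd p"] norm_snd_le[of "snd p" "fst p"] by auto
   have "\<bar>integral {0..snd p} (\<lambda>\<tau>. h (fst p, \<tau>))\<bar> \<le> B * \<bar>snd p - 0\<bar>"
   proof (rule integral_bound[OF sec _ B(1)], rule B(2))
    fix \<tau> assume "\<tau> \<in> {0..snd p}"
    then show "norm (fst p, \<tau>) \<le> \<bar>R\<bar> + \<bar>R\<bar>"
     using n norm_Pair_le[of "fst p" \<tau>] by auto
   qed
   also have "\<dots> \<le> B * R" using n B(1) by (simp add: mult_left_mono)
   finally show ?thesis .
  qed
  then show "\<exists>B. \<forall>p::'a \<times> real. norm p \<le> R \<longrightarrow> \<bar>integral {0..snd p} (\<lambda>\<tau>. h (fst p, \<tau>))\<bar> \<le> B"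
   by blast
 qed
qed

text \<open>Fubini on a rectangle for a bounded measurable integrand; for a negative b or d the
  interval is empty and both sides vanish. It yields the two iterated forms of C and lets the
  differentiated coupling condition be integrated.\<close>

lemma integral_swap_locbm:
 fixes h :: "real \<times> real \<Rightarrow> real"
 assumes h: "locbm h"
 shows "integral {0..b} (\<lambda>x. integral {0..d} (\<lambda>y. h (x, y)))
   = integral {0..d} (\<lambda>y. integral {0..b} (\<lambda>x. h (x, y)))"
proof -
 have "set_integrable lborel ({0..b} \<times> {0..d}) h"
  by (rule locbm_set_integrable[OF h]) (auto intro: bounded_Times borel_closed closed_Times)
 then have int: "integrable (lborel \<Otimes>\<^sub>M lborel) (\<lambda>(x, y). indicator ({0..b} \<times> {0..d}) (x, y) *\<^sub>R h (x, y))"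
  by (simp add: set_integrable_def lborel_prod case_prod_beta')
 have s1: "locbm (\<lambda>y. h (x, y))" "locbm (\<lambda>x. h (x, y))" for x y
  by (rule locbm_compose[OF h], intro continuous_intros)+
 have *: "(\<integral>y. \<integral>x. indicator ({0..b} \<times> {0..d}) (x, y) *\<^sub>R h (x, y) \<partial>lborel \<partial>lborel)
   = (\<integral>x. \<integral>y. indicator ({0..b} \<times> {0..d}) (x, y) *\<^sub>R h (x, y) \<partial>lborel \<partial>lborel)"
  using lborel_pair.Fubini_integral[OF int] .
 have l: "(\<integral>x. indicator ({0..b} \<times> {0..d}) (x, y) *\<^sub>R h (x, y) \<partial>lborel)
   = indicator {0..d} y *\<^sub>R integral {0..b} (\<lambda>x. h (x, y))" for y
  unfolding locbm_integral_eq[OF s1(2)] set_lebesgue_integral_def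
   Bochner_Integration.integral_scaleR_right[symmetric]
  by (rule Bochner_Integration.integral_cong) (auto simp: indicator_def)
 have r: "(\<integral>y. indicator ({0..b} \<times> {0..d}) (x, y) *\<^sub>R h (x, y) \<partial>lborel)
   = indicator {0..b} x *\<^sub>R integral {0..d} (\<lambda>y. h (x, y))" for x
  unfolding locbm_integral_eq[OF s1(1)] set_lebesgue_integral_def
   Bochner_Integration.integral_scaleR_right[symmetric]
  by (rule Bochner_Integration.integral_cong) (auto simp: indicator_def)
 have loc1: "locbm (\<lambda>y. integral {0..b} (\<lambda>x. h (x, y)))"
 proof -
  have "locbm (\<lambda>p. h (snd p, fst p))"
   by (rule locbm_compose[OF h]) (intro continuous_intros)
  from locbm_compose[OF locbm_integral[OF this], of "\<lambda>y. (y, b)"]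
  show ?thesis by (simp add: continuous_intros)
 qed
 have loc2: "locbm (\<lambda>x. integral {0..d} (\<lambda>y. h (x, y)))"
  using locbm_compose[OF locbm_integral[OF h], of "\<lambda>x. (x, d)"] by (simp add: continuous_intros)
 show ?thesis
  using * unfolding l r locbm_integral_eq[OF loc1] locbm_integral_eq[OF loc2] set_lebesgue_integral_def
  by simp
qed

text \<open>\<open>pc S f\<close>: f is uniformly continuous on every bounded gap of \<open>S\<close>, i.e. it is
  piecewise continuous with one-sided limits and exceptional set \<open>S\<close>.\<close>

definition pc :: "real set \<Rightarrow> (real \<Rightarrow> real) \<Rightarrow> bool" where
 "pc S f \<longleftrightarrow> (\<forall>I. connected I \<and> bounded I \<and> I \<inter> S = {} \<longrightarrow> uniformly_continuous_on I f)"

text \<open>A uniformly continuous function extends to the compact closure of the interval, and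
  clamping the argument to that closure extends it to the line. With such extensions, products and
  compositions on a gap become statements about continuous functions.\<close>

lemma uniformly_continuous_extend:
 fixes f :: "real \<Rightarrow> real"
 assumes "uniformly_continuous_on I f" "connected I" "bounded I"
 obtains h where "continuous_on UNIV h" "\<And>x. x \<in> I \<Longrightarrow> f x = h x"
proof (cases "I = {}")
 case True
 then show ?thesis using that[of "\<lambda>_. 0"] by auto
next
 case False
 obtain g where g: "uniformly_continuous_on (closure I) g" "\<And>x. x \<in> I \<Longrightarrow> f x = g x"
  using uniformly_continuous_on_extension_on_closure[OF assms(1)] by metis
 have "connected (closure I)" "compact (closure I)" "closure I \<noteq> {}"
  using assms(2,3) False connected_imp_connected_closure by auto
 then obtain a b where ab: "closure I = {a..b}" by (meson connected_compact_interval_1)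
 with False have le: "a \<le> b" by (metis atLeastatMost_empty_iff closure_eq_empty)
 define h where "h x = g (max a (min b x))" for x
 have "continuous_on UNIV h" unfolding h_def
  by (rule continuous_on_compose2[OF uniformly_continuous_imp_continuous[OF g(1)]])
   (use le in \<open>auto intro!: continuous_intros simp: ab\<close>)
 moreover have "f x = h x" if "x \<in> I" for x
 proof -
  have "x \<in> {a..b}" using that closure_subset ab by blast
  then show ?thesis using g(2)[OF that] by (simp add: h_def)
 qed
 ultimately show ?thesis using that by blast
qed

lemma pc_ext:
 assumes "pc S f" "connected I" "bounded I" "I \<inter> S = {}"
 obtains h where "continuous_on UNIV h" "\<And>x. x \<in> I \<Longrightarrow> f x = h x"
 using uniformly_continuous_extend assms unfolding pc_def by metis

lemma continuous_imp_uniformly_continuous_bounded: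
 fixes h :: "'a::euclidean_space \<Rightarrow> 'b::metric_space"
 assumes "continuous_on UNIV h" "bounded I"
 shows "uniformly_continuous_on I h"
proof -
 have "compact (closure I)" using assms(2) by simp
 then have "uniformly_continuous_on (closure I) h"
  using assms(1) compact_uniformly_continuous continuous_on_subset by blast
 then show ?thesis using closure_subset[of I] unfolding uniformly_continuous_on_def by (meson subsetD)
qed

lemma pcI_ext:
 assumes "\<And>I. connected I \<Longrightarrow> bounded I \<Longrightarrow> I \<inter> S = {} \<Longrightarrow>
  \<exists>h. continuous_on UNIV h \<and> (\<forall>x\<in>I. f x = h x)"
 shows "pc S f"
 unfolding pc_def
proof (intro allI impI)
 fix I assume I: "connected I \<and> bounded I \<and> I \<inter> S = {}"
 then obtain h where h: "continuous_on UNIV h" "\<forall>x\<in>I. f x = h x" using assms by blast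
 then have "uniformly_continuous_on I h" using I continuous_imp_uniformly_continuous_bounded by blast
 then show "uniformly_continuous_on I f" using h(2)
  by (simp add: uniformly_continuous_on_def)
qed

lemma pc_continuous: "continuous_on UNIV f \<Longrightarrow> pc S f"
 by (rule pcI_ext) auto

lemma pc_const: "pc S (\<lambda>x. c)"
 by (simp add: pc_continuous)

lemma pc_mono: "pc S f \<Longrightarrow> S \<subseteq> S' \<Longrightarrow> pc S' f"
 unfolding pc_def by blast

lemma pc_add: "pc S f \<Longrightarrow> pc S g \<Longrightarrow> pc S (\<lambda>x. f x + g x)"
 unfolding pc_def by (blast intro: uniformly_continuous_on_add)

lemma pc_sum: "(\<And>i. i \<in> A \<Longrightarrow> pc S (f i)) \<Longrightarrow> pc S (\<lambda>x. \<Sum>i\<in>A. f i x)"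
 unfolding pc_def by (blast intro: uniformly_continuous_on_sum)

lemma pc_mult:
 assumes "pc S f" "pc S g" shows "pc S (\<lambda>x. f x * g x)"
proof (rule pcI_ext)
 fix I assume I: "connected I" "bounded I" "I \<inter> S = {}"
 obtain h where h: "continuous_on UNIV h" "\<And>x. x \<in> I \<Longrightarrow> f x = h x" using pc_ext[OF assms(1) I] by metis
 obtain k where k: "continuous_on UNIV k" "\<And>x. x \<in> I \<Longrightarrow> g x = k x" using pc_ext[OF assms(2) I] by metis
 show "\<exists>u. continuous_on UNIV u \<and> (\<forall>x\<in>I. f x * g x = u x)"
  by (rule exI[of _ "\<lambda>x. h x * k x"]) (auto intro!: continuous_intros simp: h k)
qed

lemma pc_cmult: "pc S f \<Longrightarrow> pc S (\<lambda>x. c * f x)"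
 by (rule pc_mult[OF pc_const])

lemma pc_uminus: "pc S f \<Longrightarrow> pc S (\<lambda>x. - f x)"
 using pc_cmult[of S f "-1"] by simp

lemma pc_diff: "pc S f \<Longrightarrow> pc S g \<Longrightarrow> pc S (\<lambda>x. f x - g x)"
 using pc_add[OF _ pc_uminus, of S f g] by simp

lemma pc_compose:
 assumes f: "pc S f" and u: "continuous_on UNIV u" and S': "\<And>x. u x \<in> S \<Longrightarrow> x \<in> S'"
 shows "pc S' (\<lambda>x. f (u x))"
proof (rule pcI_ext)
 fix I assume I: "connected I" "bounded I" "I \<inter> S' = {}"
 have "connected (u ` I)" using I(1) u by (meson connected_continuous_image continuous_on_subset top_greatest)
 moreover have "bounded (u ` I)"
  using continuous_imp_uniformly_continuous_bounded[OF u I(2)] I(2) bounded_uniformly_continuous_image by blast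
 moreover have "u ` I \<inter> S = {}" using S' I(3) by blast
 ultimately obtain h where h: "continuous_on UNIV h" "\<And>x. x \<in> u ` I \<Longrightarrow> f x = h x"
  using pc_ext[OF f] by metis
 show "\<exists>k. continuous_on UNIV k \<and> (\<forall>x\<in>I. f (u x) = k x)"
  by (rule exI[of _ "\<lambda>x. h (u x)"]) (auto intro!: h(2) continuous_on_compose2[OF h(1) u])
qed

text \<open>A gap that meets neither endpoint lies inside or outside the interval.\<close>

lemma pc_if_interval:
 assumes f: "pc S f" and g: "pc S g" and ab: "a \<in> S" "b \<in> S"
 shows "pc S (\<lambda>x. if a < x \<and> x \<le> b then f x else g x)"
proof (rule pcI_ext)
 fix I assume I: "connected I" "bounded I" "I \<inter> S = {}"
 obtain h where h: "continuous_on UNIV h" "\<And>x. x \<in> I \<Longrightarrow> f x = h x" using pc_ext[OF f I] by metis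
 obtain k where k: "continuous_on UNIV k" "\<And>x. x \<in> I \<Longrightarrow> g x = k x" using pc_ext[OF g I] by metis
 have "(\<forall>x\<in>I. a < x \<and> x \<le> b) \<or> (\<forall>x\<in>I. \<not> (a < x \<and> x \<le> b))"
 proof (rule ccontr)
  assume "\<not> ?thesis"
  then obtain x y where xy: "x \<in> I" "y \<in> I" "a < x \<and> x \<le> b" "y \<le> a \<or> b < y" by force
  then have "a \<in> I \<or> b \<in> I"
   using connected_contains_Icc[OF I(1) xy(1,2)] connected_contains_Icc[OF I(1) xy(2,1)] by fastforce
  then show False using I(3) ab by blast
 qed
 then show "\<exists>u. continuous_on UNIV u \<and> (\<forall>x\<in>I. (if a < x \<and> x \<le> b then f x else g x) = u x)"
  using h k by metis
qed

text \<open>A gap of S, indexed by the set A of the points of S to its left. A subset A that is not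
  an initial segment of S gives the empty set, so \<open>Pow S\<close> is a finite index set of all
  gaps when S is finite.\<close>

definition cell :: "real set \<Rightarrow> real set \<Rightarrow> real set" where
 "cell S A = {x. \<forall>s\<in>S. (s \<in> A \<longrightarrow> s < x) \<and> (s \<notin> A \<longrightarrow> x < s)}"

lemma cell_disjoint: "cell S A \<inter> S = {}"
 by (auto simp: cell_def)

lemma cell_self: "x \<notin> S \<Longrightarrow> x \<in> cell S {s\<in>S. s < x}"
 unfolding cell_def using linorder_less_linear[of x] by (auto simp: less_le)

lemma open_cell: assumes "finite S" shows "open (cell S A)"
proof -
 have "cell S A = (\<Inter>s\<in>S. if s \<in> A then {s<..} else {..<s})"
  unfolding cell_def by (auto split: if_splits)
 then show ?thesis using assms by (auto intro: open_INT)
qed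

lemma cell_convex: "x \<in> cell S A \<Longrightarrow> y \<in> cell S A \<Longrightarrow> x \<le> z \<Longrightarrow> z \<le> y \<Longrightarrow> z \<in> cell S A"
 unfolding cell_def by fastforce

lemma connected_cell_Icc: "connected (cell S A \<inter> {a..b})"
 unfolding connected_iff_interval using cell_convex[of _ S A] by auto

lemma pc_isCont:
 assumes f: "pc S f" and S: "finite S" and x: "x \<notin> S"
 shows "isCont f x"
proof -
 let ?I = "cell S {s\<in>S. s < x} \<inter> {x - 1<..<x + 1}"
 have c: "connected ?I" unfolding connected_iff_interval using cell_convex[of _ S] by auto
 have b: "bounded ?I" by (rule bounded_subset[of "{x-1..x+1}"]) auto
 have d: "?I \<inter> S = {}" using cell_disjoint by blast
 obtain h where h: "continuous_on UNIV h" "\<And>x. x \<in> ?I \<Longrightarrow> f x = h x" using pc_ext[OF f c b d] by metis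
 have o: "open ?I" "x \<in> ?I" using open_cell[OF S] cell_self[OF x] by auto
 have "continuous_on ?I f"
  using h continuous_on_cong[of ?I ?I f h] continuous_on_subset by blast
 then show ?thesis using o continuous_on_eq_continuous_at by blast
qed

text \<open>Off the finite set S the function is continuous, hence it is measurable; boundedness on
  a ball follows cell by cell, since on each cell the function agrees with a continuous one.\<close>

lemma pc_locbm:
 assumes f: "pc S f" and S: "finite S"
 shows "locbm f"
proof (rule locbmI)
 show "f \<in> borel_measurable borel"
  using pc_isCont[OF f S] S
  by (intro borel_measurable_continuous_countable_exceptions[of S])
   (auto simp: countable_finite continuous_at_imp_continuous_on)
 fix R :: real
 have "bounded (f ` (cell S A \<inter> {-R..R}))" for A
 proof -
  obtain h where h: "continuous_on UNIV h" "\<And>x. x \<in> cell S A \<inter> {-R..R} \<Longrightarrow> f x = h x"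
   using pc_ext[OF f connected_cell_Icc[of S A "-R" R]] cell_disjoint by (metis (no_types, lifting)
   bounded_Int bounded_closed_interval inf_assoc inf_bot_right inf_commute)
  have "f ` (cell S A \<inter> {-R..R}) \<subseteq> h ` {-R..R}" using h(2) by auto
  moreover have "compact (h ` {-R..R})"
   using h(1) by (meson compact_Icc compact_continuous_image continuous_on_subset top_greatest)
  ultimately show ?thesis using bounded_subset compact_imp_bounded by blast
 qed
 then have "bounded (\<Union>A\<in>Pow S. f ` (cell S A \<inter> {-R..R}))"
  using S by (intro bounded_UN) auto
 moreover have "bounded (f ` S)" using S by (simp add: finite_imp_bounded)
 ultimately have "bounded (f ` S \<union> (\<Union>A\<in>Pow S. f ` (cell S A \<inter> {-R..R})))" by simp
 moreover have "f ` {-R..R} \<subseteq> f ` S \<union> (\<Union>A\<in>Pow S. f ` (cell S A \<inter> {-R..R}))"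
 proof
  fix y assume "y \<in> f ` {-R..R}"
  then obtain x where x: "x \<in> {-R..R}" "y = f x" by blast
  show "y \<in> f ` S \<union> (\<Union>A\<in>Pow S. f ` (cell S A \<inter> {-R..R}))"
   using x cell_self[of x S] by (cases "x \<in> S") (auto intro!: bexI[of _ "{s\<in>S. s < x}"])
 qed
 ultimately have "bounded (f ` {-R..R})" using bounded_subset by blast
 then obtain B where "\<forall>y\<in>f ` {-R..R}. \<bar>y\<bar> \<le> B" by (auto simp: bounded_real)
 then show "\<exists>B. \<forall>x. norm x \<le> R \<longrightarrow> \<bar>f x\<bar> \<le> B" by (intro exI[of _ B]) (auto simp: image_iff abs_le_iff)
qed

text \<open>An \<epsilon>/3 argument on each gap. It makes the class of candidates closed under the
  convergence of the fixed point iteration.\<close>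

lemma pc_uniform_limit:
 assumes f: "\<And>n. pc S (f n)" and lim: "uniform_limit UNIV f g sequentially"
 shows "pc S g"
 unfolding pc_def
proof (intro allI impI)
 fix I assume I: "connected I \<and> bounded I \<and> I \<inter> S = {}"
 show "uniformly_continuous_on I g" unfolding uniformly_continuous_on_def
 proof (intro allI impI)
  fix e :: real assume e: "e > 0"
  have "eventually (\<lambda>n. \<forall>x\<in>UNIV. dist (f n x) (g x) < e/3) sequentially"
   using uniform_limitD[OF lim, of "e/3"] e by simp
  then obtain n where n: "\<And>x. dist (f n x) (g x) < e/3" by (auto simp: eventually_sequentially)
  have "uniformly_continuous_on I (f n)" using f I unfolding pc_def by blast
  then obtain d where d: "d > 0" "\<And>x x'. x \<in> I \<Longrightarrow> x' \<in> I \<Longrightarrow> dist x' x < d \<Longrightarrow> dist (f n x') (f n x) < e/3"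
   using uniformly_continuous_onE[of I "f n" "e/3"] e by auto
  have "dist (g x') (g x) < e" if "x \<in> I" "x' \<in> I" "dist x' x < d" for x x'
  proof -
   have "dist (g x') (g x) \<le> dist (f n x') (g x') + dist (f n x') (f n x) + dist (f n x) (g x)"
    by (simp add: dist_real_def)
   then show ?thesis using d(2)[OF that] n[of x] n[of x'] by linarith
  qed
  with d(1) show "\<exists>d>0. \<forall>x\<in>I. \<forall>x'\<in>I. dist x' x < d \<longrightarrow> dist (g x') (g x) < e" by blast
 qed
qed

text \<open>If f varies by \<open>\<epsilon>\<close> between two close points, it takes m + 1 values in between that are
  pairwise \<open>\<epsilon>/m\<close> apart; two of them belong to the same one of m covering sets.\<close>

lemma uniformly_continuous_on_finite_cover:
 fixes f :: "real \<Rightarrow> real"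
 assumes fin: "finite \<A>" and cov: "I \<subseteq> \<Union>\<A>" and conn: "connected I" and cont: "continuous_on I f"
  and uc: "\<And>A. A \<in> \<A> \<Longrightarrow> uniformly_continuous_on (A \<inter> I) f"
 shows "uniformly_continuous_on I f"
 unfolding uniformly_continuous_on_def
proof (intro allI impI)
 fix e :: real assume e: "e > 0"
 define m where "m = card \<A> + 1"
 define e' where "e' = e / real m"
 have e': "e' > 0" using e by (simp add: e'_def m_def)
 have "\<forall>A\<in>\<A>. \<exists>d>0. \<forall>x\<in>A\<inter>I. \<forall>y\<in>A\<inter>I. dist y x < d \<longrightarrow> dist (f y) (f x) < e'"
  using uc e' unfolding uniformly_continuous_on_def by blast
 then obtain d where d: "\<And>A. A \<in> \<A> \<Longrightarrow> d A > 0"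
   "\<And>A x y. A \<in> \<A> \<Longrightarrow> x \<in> A \<inter> I \<Longrightarrow> y \<in> A \<inter> I \<Longrightarrow> dist y x < d A \<Longrightarrow> dist (f y) (f x) < e'"
  by metis
 define D where "D = Min (insert 1 (d ` \<A>))"
 have D: "D > 0" "\<And>A. A \<in> \<A> \<Longrightarrow> D \<le> d A" using fin d(1) by (auto simp: D_def)
 have key: "\<bar>f y - f x\<bar> < e" if xy: "x \<in> I" "y \<in> I" "x \<le> y" "y - x < D" for x y
 proof (rule ccontr)
  assume "\<not> \<bar>f y - f x\<bar> < e"
  then have ge: "\<bar>f y - f x\<bar> \<ge> e" by simp
  have sub: "{x..y} \<subseteq> I" using connected_contains_Icc[OF conn xy(1,2)] .
  define v where "v i = f x + real i / real m * (f y - f x)" for i :: nat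
  have "\<exists>p\<in>{x..y}. f p = v i" if "i \<in> {..m}" for i
  proof -
   have "0 \<le> real i / real m" "real i / real m \<le> 1" using that by (auto simp: m_def)
   then have "v i \<in> closed_segment (f x) (f y)"
    unfolding v_def closed_segment_def
    by (auto simp: algebra_simps diff_divide_distrib intro!: exI[of _ "real i / real m"])
   moreover have "connected (f ` {x..y})" "f x \<in> f ` {x..y}" "f y \<in> f ` {x..y}"
    using cont sub xy(3) by (auto intro!: connected_continuous_image continuous_on_subset[OF cont])
   ultimately have "v i \<in> f ` {x..y}"
    using is_interval_connected_1 is_interval_convex_1 convex_contains_segment by (metis subsetD)
   then show ?thesis by force
  qed
  then obtain p where p: "\<And>i. i \<in> {..m} \<Longrightarrow> p i \<in> {x..y} \<and> f (p i) = v i" by metis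
  then have "\<forall>i\<in>{..m}. \<exists>A\<in>\<A>. p i \<in> A" using sub cov by blast
  then obtain a where a: "\<And>i. i \<in> {..m} \<Longrightarrow> a i \<in> \<A> \<and> p i \<in> a i" by metis
  have "\<not> inj_on a {..m}"
  proof
   assume "inj_on a {..m}"
   then have "card {..m} \<le> card \<A>" using card_inj_on_le[of a "{..m}" \<A>] a fin by auto
   then show False by (simp add: m_def)
  qed
  then obtain i j where ij: "i \<in> {..m}" "j \<in> {..m}" "i \<noteq> j" "a i = a j" unfolding inj_on_def by blast
  have "dist (p j) (p i) < D" using p[OF ij(1)] p[OF ij(2)] xy by (auto simp: dist_real_def)
  moreover have "p i \<in> I" "p j \<in> I" using p[OF ij(1)] p[OF ij(2)] sub by blast+
  ultimately have "dist (f (p j)) (f (p i)) < e'"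
   using d(2)[of "a i" "p i" "p j"] a[OF ij(1)] a[OF ij(2)] ij(4) D(2)[of "a i"] by auto
  then have "\<bar>v j - v i\<bar> < e'" using p[OF ij(1)] p[OF ij(2)] by (simp add: dist_real_def)
  moreover have "v j - v i = (real j - real i) / real m * (f y - f x)"
   by (simp add: v_def algebra_simps diff_divide_distrib)
  moreover have "\<bar>real j - real i\<bar> \<ge> 1" using ij(3) by linarith
  then have "\<bar>real j - real i\<bar> * (\<bar>f y - f x\<bar> / real m) \<ge> 1 * (e / real m)"
   using ge e by (intro mult_mono divide_right_mono) auto
  ultimately show False by (simp add: e'_def abs_mult)
 qed
 have "dist (f y) (f x) < e" if "x \<in> I" "y \<in> I" "dist y x < D" for x y
  using key[of x y] key[of y x] that by (cases "x \<le> y") (auto simp: dist_real_def abs_minus_commute)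
 then show "\<exists>d>0. \<forall>x\<in>I. \<forall>x'\<in>I. dist x' x < d \<longrightarrow> dist (f x') (f x) < e" using D(1) by blast
qed

section \<open>Integrals with a parameter and a variable upper limit\<close>

text \<open>Dominated convergence along a sequence tending to p. The indicator of the interval of
  integration converges at every \<tau> other than 0 and \<open>t p\<close>, the integrand at every
  \<tau> outside N; the exceptions form a null set. Hence integration removes jumps whose position
  moves with the parameter.\<close>

lemma isCont_param_integral:
 fixes h :: "'a::euclidean_space \<times> real \<Rightarrow> real"
 assumes h: "locbm h" and t: "isCont t p" and N: "finite N"
  and c: "\<And>\<tau>. \<tau> \<notin> N \<Longrightarrow> isCont (\<lambda>q. h (q, \<tau>)) p"
 shows "isCont (\<lambda>q. integral {0..t q} (\<lambda>\<tau>. h (q, \<tau>))) p"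
 unfolding continuous_at_sequentially comp_def
proof (intro allI impI)
 fix q assume q: "q \<longlonglongrightarrow> p"
 have sec: "locbm (\<lambda>\<tau>. h (a, \<tau>))" for a
  by (rule locbm_compose[OF h]) (auto intro!: continuous_intros)
 have tq: "(\<lambda>n. t (q n)) \<longlonglongrightarrow> t p" using isCont_tendsto_compose[OF t q] .
 obtain R1 where R1: "\<And>n. norm (q n) \<le> R1"
  using convergent_imp_Bseq[OF convergentI[OF q]] by (auto simp: Bseq_def)
 obtain R2 where R2: "\<And>n. \<bar>t (q n)\<bar> \<le> R2"
  using convergent_imp_Bseq[OF convergentI[OF tq]] by (auto simp: Bseq_def)
 obtain B where B: "\<And>x. norm x \<le> R1 + R2 \<Longrightarrow> \<bar>h x\<bar> \<le> B" using locbm_bound[OF h] by metis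
 have "(\<lambda>n. \<integral>\<tau>. indicator {0..t (q n)} \<tau> *\<^sub>R h (q n, \<tau>) \<partial>lborel)
   \<longlonglongrightarrow> (\<integral>\<tau>. indicator {0..t p} \<tau> *\<^sub>R h (p, \<tau>) \<partial>lborel)"
 proof (rule integral_dominated_convergence[where w="\<lambda>\<tau>. indicator {0..R2} \<tau> *\<^sub>R B"])
  have [measurable]: "(\<lambda>\<tau>. h (a, \<tau>)) \<in> borel_measurable borel" for a
   using locbm_measurable[OF sec] .
  show "(\<lambda>\<tau>. indicator {0..t p} \<tau> *\<^sub>R h (p, \<tau>)) \<in> borel_measurable lborel" by measurable
  show "(\<lambda>\<tau>. indicator {0..t (q n)} \<tau> *\<^sub>R h (q n, \<tau>)) \<in> borel_measurable lborel" for n by measurable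
  show "integrable lborel (\<lambda>\<tau>. indicator {0..R2} \<tau> *\<^sub>R B)"
   using locbm_set_integrable[OF locbm_const[of B], of "{0..R2}"] by (simp add: set_integrable_def)
  show "AE \<tau> in lborel. norm (indicator {0..t (q n)} \<tau> *\<^sub>R h (q n, \<tau>)) \<le> indicator {0..R2} \<tau> *\<^sub>R B" for n
  proof (rule AE_I2)
   fix \<tau> :: real
   show "norm (indicator {0..t (q n)} \<tau> *\<^sub>R h (q n, \<tau>)) \<le> indicator {0..R2} \<tau> *\<^sub>R B"
   proof (cases "\<tau> \<in> {0..t (q n)}")
    case True
    then have "norm (q n, \<tau>) \<le> R1 + R2"
     using norm_Pair_le[of "q n" \<tau>] R1[of n] R2[of n] by auto
    then show ?thesis using True R2[of n] B by (auto simp: indicator_def)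
   next
    case False
    have "norm (q n, 0::real) \<le> R1 + R2" using R1[of n] R2[of n] norm_Pair_le[of "q n" "0::real"] by simp
    from B[OF this] have "0 \<le> B" by linarith
    then show ?thesis using False by (auto simp: indicator_def)
   qed
  qed
  have null: "N \<union> {0, t p} \<in> null_sets lborel"
   using N by (intro finite_imp_null_set_lborel) auto
  show "AE \<tau> in lborel. (\<lambda>n. indicator {0..t (q n)} \<tau> *\<^sub>R h (q n, \<tau>)) \<longlonglongrightarrow> indicator {0..t p} \<tau> *\<^sub>R h (p, \<tau>)"
  proof (rule AE_I'[OF null], intro subsetI, rule ccontr)
   fix \<tau>
   assume "\<tau> \<in> {\<tau> \<in> space lborel. \<not> (\<lambda>n. indicator {0..t (q n)} \<tau> *\<^sub>R h (q n, \<tau>))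
     \<longlonglongrightarrow> indicator {0..t p} \<tau> *\<^sub>R h (p, \<tau>)}" and "\<tau> \<notin> N \<union> {0, t p}"
   then have nl: "\<not> (\<lambda>n. indicator {0..t (q n)} \<tau> *\<^sub>R h (q n, \<tau>)) \<longlonglongrightarrow> indicator {0..t p} \<tau> *\<^sub>R h (p, \<tau>)"
    and "\<tau> \<noteq> t p" "\<tau> \<noteq> 0" and tN: "\<tau> \<notin> N" by auto
   have hl: "(\<lambda>n. h (q n, \<tau>)) \<longlonglongrightarrow> h (p, \<tau>)"
    using isCont_tendsto_compose[OF c[OF tN] q] .
   have "eventually (\<lambda>n. indicator {0..t (q n)} \<tau> = (indicator {0..t p} \<tau> :: real)) sequentially"
   proof (cases "\<tau> < t p")
    case True
    then show ?thesis using order_tendstoD(1)[OF tq True]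
     by (auto elim!: eventually_mono simp: indicator_def)
   next
    case False
    then have "t p < \<tau>" using \<open>\<tau> \<noteq> t p\<close> by simp
    from order_tendstoD(2)[OF tq this] show ?thesis
     by (rule eventually_mono) (use \<open>t p < \<tau>\<close> in \<open>auto simp: indicator_def\<close>)
   qed
   then have "(\<lambda>n. indicator {0..t (q n)} \<tau> :: real) \<longlonglongrightarrow> indicator {0..t p} \<tau>"
    by (rule tendsto_eventually)
   from tendsto_scaleR[OF this hl] nl show False by contradiction
  qed
 qed
 then show "(\<lambda>n. integral {0..t (q n)} (\<lambda>\<tau>. h (q n, \<tau>))) \<longlonglongrightarrow> integral {0..t p} (\<lambda>\<tau>. h (p, \<tau>))"
  unfolding locbm_integral_eq[OF sec] set_lebesgue_integral_def .
qed

lemma continuous_on_integral0: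
 fixes v :: "real \<Rightarrow> real"
 assumes "locbm v"
 shows "continuous_on UNIV (\<lambda>x. integral {0..x} v)"
proof (rule continuous_at_imp_continuous_on, intro ballI)
 fix x :: real
 have "locbm (\<lambda>p::real \<times> real. v (snd p))" by (rule locbm_compose[OF assms]) (intro continuous_intros)
 from isCont_param_integral[OF this, where t="\<lambda>x. x" and p=x and N="{}"]
 show "isCont (\<lambda>x. integral {0..x} v) x" by simp
qed

text \<open>As v vanishes to the left of 0, the lower limit may be moved below any point at which
  the integral is to be differentiated; the fundamental theorem then applies at an interior point,
  also for nonpositive x.\<close>

lemma integral0_extend:
 fixes v :: "real \<Rightarrow> real"
 assumes "locbm v" "\<And>x. x \<le> 0 \<Longrightarrow> v x = 0" "a \<le> 0"
 shows "integral {0..x} v = integral {a..x} v"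
proof (cases "x \<ge> 0")
 case True
 have "integral {a..0} v = integral {a..0} (\<lambda>_. 0)"
  by (rule integral_cong) (use assms(2) in auto)
 then show ?thesis
  using Henstock_Kurzweil_Integration.integral_combine[OF assms(3) True locbm_integrable[OF assms(1)]] by simp
next
 case False
 have "integral {a..x} v = integral {a..x} (\<lambda>_. 0)"
  by (rule integral_cong) (use assms(2) False in auto)
 then show ?thesis using False by simp
qed

lemma integral0_has_derivative:
 fixes v :: "real \<Rightarrow> real"
 assumes v: "locbm v" and z: "\<And>x. x \<le> 0 \<Longrightarrow> v x = 0" and c: "isCont v x"
 shows "((\<lambda>u. integral {0..u} v) has_real_derivative v x) (at x)"
proof -
 let ?a = "- \<bar>x\<bar> - 1" let ?b = "\<bar>x\<bar> + 1"
 have "((\<lambda>u. integral {?a..u} v) has_vector_derivative v x) (at x within ({?a..?b} - {}))"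
  by (rule integral_has_vector_derivative_continuous_at[OF locbm_integrable[OF v]])
   (use continuous_at_imp_continuous_at_within[OF c] in auto)
 moreover have "at x within ({?a..?b} - {}) = at x"
  using at_within_Icc_at[of ?a x ?b] by auto
 ultimately have "((\<lambda>u. integral {?a..u} v) has_real_derivative v x) (at x)"
  by (simp add: has_real_derivative_iff_has_vector_derivative)
 moreover have "integral {?a..u} v = integral {0..u} v" for u
  using integral0_extend[OF v z, of ?a u] by simp
 ultimately show ?thesis by simp
qed

text \<open>Integrating the weight exp (l \<sigma>) gains the factor 1/l, the source of smallness
  for terms whose weight grows with the integration variable. The shift c allows for the weight exp
  (l (t - L k)) of g.\<close>

lemma integral_exp_bound:
 fixes h :: "real \<Rightarrow> real"
 assumes h: "locbm h" and l: "l > 0" and B: "B \<ge> 0"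
  and bd: "\<And>\<sigma>. 0 \<le> \<sigma> \<Longrightarrow> \<sigma> \<le> s \<Longrightarrow> \<bar>h \<sigma>\<bar> \<le> B * exp (l * (\<sigma> - c))"
 shows "\<bar>integral {0..s} h\<bar> \<le> B * exp (l * (s - c)) / l"
proof (cases "s \<ge> 0")
 case True
 have I: "((\<lambda>\<sigma>. B * exp (l * (\<sigma> - c))) has_integral (B * exp (l * (s - c)) / l - B * exp (l * (0 - c)) / l)) {0..s}"
  using True l
  by (intro fundamental_theorem_of_calculus)
   (auto intro!: derivative_eq_intros simp: has_real_derivative_iff_has_vector_derivative[symmetric])
 have "\<bar>integral {0..s} h\<bar> \<le> integral {0..s} (\<lambda>\<sigma>. B * exp (l * (\<sigma> - c)))"
  using integral_norm_bound_integral[OF locbm_integrable[OF h] has_integral_integrable[OF I]] bd by auto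
 also have "\<dots> = B * exp (l * (s - c)) / l - B * exp (l * (0 - c)) / l" using I by (rule integral_unique)
 also have "\<dots> \<le> B * exp (l * (s - c)) / l" using B l by simp
 finally show ?thesis .
next
 case False
 then show ?thesis using B l by simp
qed

lemma integral0_cut:
 fixes h :: "real \<Rightarrow> real"
 assumes h: "locbm h" and T: "T \<ge> 0" and z: "\<And>\<sigma>. \<sigma> > T \<Longrightarrow> h \<sigma> = 0"
 shows "integral {0..s} h = integral {0..min s T} h"
proof (cases "s \<le> T")
 case False
 have "integral {T..s} h = integral {T..s} (\<lambda>_. 0)"
  by (rule integral_spike[of "{T}"]) (use z in auto)
 then show ?thesis
  using Henstock_Kurzweil_Integration.integral_combine[OF T _ locbm_integrable[OF h], of s] False
  by (simp add: min_def)
qed (simp add: min_def)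

text \<open>Banach's argument without a function space type: \<C> is any class closed under uniform
  limits, and distances are measured relative to the weight W. The upper bound M turns convergence
  relative to W into uniform convergence.\<close>

lemma picard_fixpoint:
 fixes \<Phi> :: "('y \<Rightarrow> real) \<Rightarrow> 'y \<Rightarrow> real" and W :: "'y \<Rightarrow> real"
 assumes W: "\<And>y. 0 < W y" "\<And>y. W y \<le> M"
  and inv: "\<And>U. \<C> U \<Longrightarrow> \<C> (\<Phi> U)"
  and contr: "\<And>U V B. \<C> U \<Longrightarrow> \<C> V \<Longrightarrow> 0 \<le> B \<Longrightarrow> (\<And>y. \<bar>U y - V y\<bar> \<le> B * W y) \<Longrightarrow>
   (\<And>y. \<bar>\<Phi> U y - \<Phi> V y\<bar> \<le> B / 2 * W y)"
  and Ua: "\<C> Ua" "\<And>y. \<bar>\<Phi> Ua y - Ua y\<bar> \<le> Ba * W y" "0 \<le> Ba"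
  and closed: "\<And>u U. (\<And>n. \<C> (u n)) \<Longrightarrow> uniform_limit UNIV u U sequentially \<Longrightarrow> \<C> U"
 shows "\<exists>U. \<C> U \<and> \<Phi> U = U"
proof -
 define u where "u n = (\<Phi> ^^ n) Ua" for n :: nat
 have u0: "u 0 = Ua" and us: "u (Suc n) = \<Phi> (u n)" for n by (simp_all add: u_def)
 have C: "\<C> (u n)" for n by (induction n) (auto simp: u0 us Ua inv)
 have step: "\<bar>u (Suc n) y - u n y\<bar> \<le> Ba / 2 ^ n * W y" for n y
 proof (induction n arbitrary: y)
  case 0 then show ?case using Ua(2) by (simp add: u0 us)
 next
  case (Suc n)
  have "\<bar>\<Phi> (u (Suc n)) y - \<Phi> (u n) y\<bar> \<le> Ba / 2 ^ n / 2 * W y"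
   by (rule contr[OF C C]) (use Suc Ua(3) in auto)
  then show ?case by (simp add: us)
 qed
 \<comment> \<open>The factor is the geometric sum 1 + 1/2 + ... with k terms; it stays below
   2.\<close>
 have far: "\<bar>u (n + k) y - u n y\<bar> \<le> (2 - 2 / 2 ^ k) * (Ba / 2 ^ n * W y)" for n k y
 proof (induction k)
  case (Suc k)
  have "\<bar>u (n + Suc k) y - u n y\<bar> \<le> \<bar>u (Suc (n + k)) y - u (n + k) y\<bar> + \<bar>u (n + k) y - u n y\<bar>" by simp
  also have "\<dots> \<le> Ba / 2 ^ (n + k) * W y + (2 - 2 / 2 ^ k) * (Ba / 2 ^ n * W y)"
   using step[of "n + k" y] Suc by linarith
  also have "\<dots> = (2 - 2 / 2 ^ Suc k) * (Ba / 2 ^ n * W y)" by (simp add: power_add field_simps)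
  finally show ?case .
 qed simp
 have far2: "\<bar>u m y - u n y\<bar> \<le> 2 * (Ba / 2 ^ n * W y)" if "n \<le> m" for n m y
 proof -
  have "(2 - 2 / 2 ^ (m - n)) * (Ba / 2 ^ n * W y) \<le> 2 * (Ba / 2 ^ n * W y)"
   using Ua(3) W(1)[of y] by (intro mult_right_mono) auto
  then show ?thesis using far[of n "m - n" y] that by simp
 qed
 have z: "(\<lambda>n. c / 2 ^ n) \<longlonglongrightarrow> 0" for c :: real
  using LIMSEQ_divide_realpow_zero[of 2 c] by simp
 have M: "2 * (Ba / 2 ^ n * W y) \<le> 2 * Ba * M / 2 ^ n" for n y
  using mult_left_mono[OF W(2)[of y] Ua(3)] by (simp add: field_simps)
 have "Cauchy (\<lambda>n. u n y)" for y
 proof (rule CauchyI')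
  fix e :: real assume "e > 0"
  then have "eventually (\<lambda>n. 2 * Ba * M / 2 ^ n < e) sequentially"
   using order_tendstoD(2)[OF z] by blast
  then obtain n where n: "\<And>m. m \<ge> n \<Longrightarrow> 2 * Ba * M / 2 ^ m < e" by (auto simp: eventually_sequentially)
  have "norm (u m y - u k y) < e" if "m \<ge> n" "k > m" for m k
   using far2[of m k y] that M[of m y] n[of m] by (simp add: abs_minus_commute)
  then show "\<exists>M. \<forall>m\<ge>M. \<forall>n>m. dist (u m y) (u n y) < e" by (auto simp: dist_norm)
 qed
 then have "\<forall>y. \<exists>L. (\<lambda>n. u n y) \<longlonglongrightarrow> L" by (simp add: Cauchy_convergent_iff convergent_def)
 then obtain U where U: "\<And>y. (\<lambda>n. u n y) \<longlonglongrightarrow> U y" by metis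
 have lim: "\<bar>U y - u n y\<bar> \<le> 2 * (Ba / 2 ^ n) * W y" for n y
 proof (rule tendsto_upperbound)
  show "(\<lambda>m. \<bar>u m y - u n y\<bar>) \<longlonglongrightarrow> \<bar>U y - u n y\<bar>" by (intro tendsto_intros U)
  show "\<forall>\<^sub>F m in sequentially. \<bar>u m y - u n y\<bar> \<le> 2 * (Ba / 2 ^ n) * W y"
   using far2[of n _ y] by (auto simp: eventually_sequentially mult.assoc)
 qed simp
 have "uniform_limit UNIV u U sequentially"
  unfolding uniform_limit_iff
 proof (intro allI impI)
  fix e :: real assume "e > 0"
  then have "eventually (\<lambda>n. 2 * Ba * M / 2 ^ n < e) sequentially"
   using order_tendstoD(2)[OF z] by blast
  then show "\<forall>\<^sub>F n in sequentially. \<forall>x\<in>UNIV. dist (u n x) (U x) < e"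
  proof (rule eventually_mono, intro ballI)
   fix n y assume "2 * Ba * M / 2 ^ n < e"
   then show "dist (u n y) (U y) < e"
    using lim[of y n] M[of n y] by (simp add: dist_real_def abs_minus_commute mult.assoc)
  qed
 qed
 then have CU: "\<C> U" using closed C by blast
 have "\<Phi> U y = U y" for y
 proof -
  have b: "\<bar>\<Phi> U y - U y\<bar> \<le> 2 * Ba * W y / 2 ^ n" for n
  proof -
   have "\<bar>\<Phi> U y - \<Phi> (u n) y\<bar> \<le> 2 * (Ba / 2 ^ n) / 2 * W y"
    by (rule contr[OF CU C]) (use Ua(3) lim in auto)
   then have "\<bar>\<Phi> U y - u (Suc n) y\<bar> \<le> Ba / 2 ^ n * W y" by (simp add: us)
   moreover have "\<bar>U y - u (Suc n) y\<bar> \<le> Ba / 2 ^ n * W y" using lim[of y "Suc n"] by simp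
   ultimately have "\<bar>\<Phi> U y - U y\<bar> \<le> Ba / 2 ^ n * W y + Ba / 2 ^ n * W y" by linarith
   then show ?thesis by simp
  qed
  have "\<bar>\<Phi> U y - U y\<bar> \<le> 0"
   by (rule tendsto_lowerbound[OF z[of "2 * Ba * W y"]]) (use b in auto)
  then show ?thesis by simp
 qed
 then show ?thesis using CU by auto
qed

section \<open>The characteristic system of one row\<close>

text \<open>Here f need only be extended on gaps inside (a, b]. For g this matters: the value of f
  reflected at y = L k is regular between points of S only where t \<le> T, because S is closed
  under the shift by 2 L k only up to T.\<close>

lemma pc_if_interval_ext:
 assumes f: "\<And>I. connected I \<Longrightarrow> bounded I \<Longrightarrow> I \<inter> S = {} \<Longrightarrow> I \<subseteq> {a<..b} \<Longrightarrow>
   \<exists>h. continuous_on UNIV h \<and> (\<forall>x\<in>I. f x = h x)"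
  and ab: "a \<in> S" "b \<in> S"
 shows "pc S (\<lambda>x. if a < x \<and> x \<le> b then f x else 0)"
proof (rule pcI_ext)
 fix I assume I: "connected I" "bounded I" "I \<inter> S = {}"
 have "I \<subseteq> {a<..b} \<or> (\<forall>x\<in>I. \<not> (a < x \<and> x \<le> b))"
 proof (rule ccontr)
  assume "\<not> ?thesis"
  then obtain x y where xy: "x \<in> I" "y \<in> I" "a < x \<and> x \<le> b" "y \<le> a \<or> b < y" by force
  then have "a \<in> I \<or> b \<in> I"
   using connected_contains_Icc[OF I(1) xy(1,2)] connected_contains_Icc[OF I(1) xy(2,1)] by fastforce
  then show False using I(3) ab by blast
 qed
 then show "\<exists>u. continuous_on UNIV u \<and> (\<forall>x\<in>I. (if a < x \<and> x \<le> b then f x else 0) = u x)"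
 proof
  assume s: "I \<subseteq> {a<..b}"
  then obtain h where "continuous_on UNIV h" "\<forall>x\<in>I. f x = h x" using f[OF I] by blast
  then show ?thesis using s by (intro exI[of _ h]) auto
 next
  assume "\<forall>x\<in>I. \<not> (a < x \<and> x \<le> b)"
  then show ?thesis by (intro exI[of _ "\<lambda>_. 0"]) auto
 qed
qed

text \<open>The constant B1 stands for a weight in the other variable: it does not gain 1/l and
  costs the length R. Integrals of \<open>hh\<close> contain one weight of each kind.\<close>

lemma integral_affine_exp_bound:
 fixes h :: "real \<Rightarrow> real"
 assumes h: "locbm h" and l: "l > 0" and B: "B1 \<ge> 0" "B2 \<ge> 0" and R: "0 \<le> R" "s \<le> R"
  and bd: "\<And>\<sigma>. 0 \<le> \<sigma> \<Longrightarrow> \<sigma> \<le> s \<Longrightarrow> \<bar>h \<sigma>\<bar> \<le> B1 + B2 * exp (l * (\<sigma> - c))"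
 shows "\<bar>integral {0..s} h\<bar> \<le> B1 * R + B2 * exp (l * (s - c)) / l"
proof (cases "s \<ge> 0")
 case True
 have I: "((\<lambda>\<sigma>. B1 + B2 * exp (l * (\<sigma> - c))) has_integral
   ((B1 * s + B2 * exp (l * (s - c)) / l) - (B1 * 0 + B2 * exp (l * (0 - c)) / l))) {0..s}"
  using True l
  by (intro fundamental_theorem_of_calculus)
   (auto intro!: derivative_eq_intros simp: has_real_derivative_iff_has_vector_derivative[symmetric])
 have "\<bar>integral {0..s} h\<bar> \<le> integral {0..s} (\<lambda>\<sigma>. B1 + B2 * exp (l * (\<sigma> - c)))"
  using integral_norm_bound_integral[OF locbm_integrable[OF h] has_integral_integrable[OF I]] bd by auto
 also have "\<dots> = (B1 * s + B2 * exp (l * (s - c)) / l) - (B1 * 0 + B2 * exp (l * (0 - c)) / l)"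
  using I by (rule integral_unique)
 also have "\<dots> \<le> B1 * s + B2 * exp (l * (s - c)) / l" using B l by simp
 also have "\<dots> \<le> B1 * R + B2 * exp (l * (s - c)) / l" using mult_left_mono[OF R(2) B(1)] by simp
 finally show ?thesis .
next
 case False
 then show ?thesis using B l R(1) by simp
qed

text \<open>Counterpart for the outgoing wave in a convolution, whose argument x - y decreases with
  the integration variable y.\<close>

lemma integral_exp_bound_decreasing:
 fixes h :: "real \<Rightarrow> real"
 assumes h: "locbm h" and l: "l > 0" and B: "B \<ge> 0" and s: "s \<ge> 0"
  and bd: "\<And>\<sigma>. 0 \<le> \<sigma> \<Longrightarrow> \<sigma> \<le> s \<Longrightarrow> \<bar>h \<sigma>\<bar> \<le> B * exp (l * (c - \<sigma>))"
 shows "\<bar>integral {0..s} h\<bar> \<le> B * exp (l * c) / l"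
proof -
 have I: "((\<lambda>\<sigma>. B * exp (l * (c - \<sigma>))) has_integral (- (B * exp (l * (c - s)) / l) - - (B * exp (l * (c - 0)) / l))) {0..s}"
  using s l
  by (intro fundamental_theorem_of_calculus)
   (auto intro!: derivative_eq_intros simp: has_real_derivative_iff_has_vector_derivative[symmetric])
 have "\<bar>integral {0..s} h\<bar> \<le> integral {0..s} (\<lambda>\<sigma>. B * exp (l * (c - \<sigma>)))"
  using integral_norm_bound_integral[OF locbm_integrable[OF h] has_integral_integrable[OF I]] bd by auto
 also have "\<dots> = - (B * exp (l * (c - s)) / l) - - (B * exp (l * (c - 0)) / l)" using I by (rule integral_unique)
 also have "\<dots> \<le> B * exp (l * c) / l" using B l by simp
 finally show ?thesis .
qed

lemma finite_type_bound:
 fixes f :: "'k::finite \<Rightarrow> 'x \<Rightarrow> real"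
 assumes "\<And>k. \<exists>B. \<forall>x. P k x \<longrightarrow> \<bar>f k x\<bar> \<le> B"
 obtains B where "B \<ge> 0" "\<And>k x. P k x \<Longrightarrow> \<bar>f k x\<bar> \<le> B"
proof -
 obtain b where b: "\<And>k x. P k x \<Longrightarrow> \<bar>f k x\<bar> \<le> b k" using assms by metis
 have "b k \<le> (\<Sum>k\<in>UNIV. \<bar>b k\<bar>)" for k
  using member_le_sum[of k UNIV "\<lambda>k. \<bar>b k\<bar>"] by fastforce
 then show ?thesis using that[of "\<Sum>k\<in>UNIV. \<bar>b k\<bar>"] b
  by (meson abs_ge_zero order_trans sum_nonneg)
qed

text \<open>The three families of unknowns, v and g in one variable and C in two, are packed into
  one function on a sum type, so that a fixed point theorem for a single real function covers the
  whole system.\<close>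

type_synonym 'k fld = "('k \<times> real) + (('k \<times> real) + ('k \<times> real \<times> real)) \<Rightarrow> real"

definition vU :: "'k fld \<Rightarrow> 'k \<Rightarrow> real \<Rightarrow> real" where "vU U k x = U (Inl (k, x))"
definition gU :: "'k fld \<Rightarrow> 'k \<Rightarrow> real \<Rightarrow> real" where "gU U k x = U (Inr (Inl (k, x)))"
definition CU :: "'k fld \<Rightarrow> 'k \<Rightarrow> real \<times> real \<Rightarrow> real" where "CU U k p = U (Inr (Inr (k, p)))"

text \<open>Kernel k of a row is \<open>ff k s + gg k t + CU k (s, t)\<close>, where \<open>vU\<close> and \<open>gU\<close> are the derivatives of ff and gg
  off their jumps \<open>fJ\<close> and \<open>gJ\<close>. The functions cs, ct and wx are the derivatives of C in s and in t and of the
  kernel in x. The first component of Phi is the condition at \<open>y = 0\<close>, the second the one at \<open>y = L k\<close>.\<close>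

locale row =
 fixes S :: "real set" and X T :: real and L :: "'k::finite \<Rightarrow> real"
  and m :: "'k \<Rightarrow> real \<times> real \<Rightarrow> real" and fJ gJ e :: "'k \<Rightarrow> real \<Rightarrow> real"
  and bet rb :: "'k \<Rightarrow> real" and a1 a2 a3 a4 :: "'k \<Rightarrow> 'k \<Rightarrow> real"
  and A A0 :: "'k \<Rightarrow> 'k \<Rightarrow> real \<Rightarrow> real"
 assumes finS: "finite S" and S0: "0 \<in> S" "X \<in> S" "T \<in> S" "\<And>k. 2 * L k \<in> S"
  and Sshift: "\<And>s k. s \<in> S \<Longrightarrow> s + 2 * L k \<le> T \<Longrightarrow> s + 2 * L k \<in> S"
  and XT: "0 < X" and L: "\<And>k. 0 < L k" "\<And>k. X + L k \<le> T"
  and m: "\<And>k. continuous_on UNIV (m k)"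
  and fJ: "\<And>k. pc S (fJ k)" "\<And>k x. x \<le> 0 \<Longrightarrow> fJ k x = 0"
  and gJ: "\<And>k. pc S (gJ k)" "\<And>k t. t \<le> 2 * L k \<Longrightarrow> gJ k t = 0"
  and e: "\<And>k. pc S (e k)"
  and A: "\<And>k k'. locbm (A k k')" and A0: "\<And>k k'. locbm (A0 k k')"
begin

lemma T0: "0 < T" "X < T" "L k < T" using XT L[of k] by linarith+

definition ff :: "'k fld \<Rightarrow> 'k \<Rightarrow> real \<Rightarrow> real" where
 "ff U k s = fJ k s + integral {0..s} (vU U k)"
definition gg :: "'k fld \<Rightarrow> 'k \<Rightarrow> real \<Rightarrow> real" where
 "gg U k t = gJ k t + integral {0..t} (gU U k)"
definition ww :: "'k fld \<Rightarrow> 'k \<Rightarrow> real \<times> real \<Rightarrow> real" where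
 "ww U k p = ff U k (fst p) + gg U k (snd p) + CU U k p"
text \<open>The square (0, T]^2 contains every point with s > 0 that the kernels use. Cutting off
  outside of it makes the double primitive of \<open>hh\<close> vanish for nonpositive arguments and
  stay constant beyond T.\<close>

definition hh :: "'k fld \<Rightarrow> 'k \<Rightarrow> real \<times> real \<Rightarrow> real" where
 "hh U k p = (if 0 < fst p \<and> fst p \<le> T then if 0 < snd p \<and> snd p \<le> T then m k p * ww U k p else 0 else 0)"
definition cs :: "'k fld \<Rightarrow> 'k \<Rightarrow> real \<times> real \<Rightarrow> real" where
 "cs U k p = integral {0..snd p} (\<lambda>\<tau>. hh U k (fst p, \<tau>))"
definition ct :: "'k fld \<Rightarrow> 'k \<Rightarrow> real \<times> real \<Rightarrow> real" where
 "ct U k p = integral {0..fst p} (\<lambda>\<sigma>. hh U k (\<sigma>, snd p))"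
definition wx :: "'k fld \<Rightarrow> 'k \<Rightarrow> real \<times> real \<Rightarrow> real" where
 "wx U k p = vU U k (fst p) + gU U k (snd p) + cs U k p + ct U k p"
definition conv :: "'k fld \<Rightarrow> 'k \<Rightarrow> 'k \<Rightarrow> real \<Rightarrow> real" where
 "conv U k k' x = integral {0..L k'} (\<lambda>y. A k k' y * wx U k' (x - y, x + y) + A0 k k' y * ww U k' (x - y, x + y))"

definition Phi :: "'k fld \<Rightarrow> 'k fld" where
 "Phi U = case_sum
  (\<lambda>(k, x). if 0 < x \<and> x \<le> X then e k x + (\<Sum>k'\<in>UNIV. a1 k k' * gU U k' x + a2 k k' * cs U k' (x, x)
    + a3 k k' * ct U k' (x, x) + a4 k k' * ww U k' (x, x) + conv U k k' x) else 0)
  (case_sum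
   (\<lambda>(k, t). if 2 * L k < t \<and> t \<le> T then bet k * (vU U k (t - 2 * L k) + cs U k (t - 2 * L k, t)
     - ct U k (t - 2 * L k, t) - rb k * ww U k (t - 2 * L k, t)) else 0)
   (\<lambda>(k, p). integral {0..fst p} (\<lambda>\<sigma>. cs U k (\<sigma>, snd p))))"

text \<open>The zero conditions express that nothing happens before the first signal: v starts at 0
  and the reflected g at 2 L k. The upper cut-offs at X and T are those of \<open>Phi\<close>; they
  keep the supports of v and g bounded.\<close>

definition good :: "'k fld \<Rightarrow> bool" where
 "good U \<longleftrightarrow> (\<forall>k. pc S (vU U k) \<and> (\<forall>x. x \<le> 0 \<or> X < x \<longrightarrow> vU U k x = 0) \<and>
  pc S (gU U k) \<and> (\<forall>t. t \<le> 2 * L k \<or> T < t \<longrightarrow> gU U k t = 0) \<and>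
  continuous_on UNIV (CU U k) \<and> (\<forall>p. fst p \<le> 0 \<or> snd p \<le> 0 \<longrightarrow> CU U k p = 0))"

context
 fixes U assumes U: "good U"
begin

lemma v_pc: "pc S (vU U k)" and v_0: "x \<le> 0 \<or> X < x \<Longrightarrow> vU U k x = 0"
 and g_pc: "pc S (gU U k)" and g_0: "t \<le> 2 * L k \<or> T < t \<Longrightarrow> gU U k t = 0"
 and C_cont: "continuous_on UNIV (CU U k)" and C_0: "fst p \<le> 0 \<or> snd p \<le> 0 \<Longrightarrow> CU U k p = 0"
 using U by (cases p, auto simp: good_def)+

lemma v_locbm: "locbm (vU U k)" and g_locbm: "locbm (gU U k)"
 using pc_locbm[OF v_pc finS] pc_locbm[OF g_pc finS] by auto

lemma ff_pc: "pc S (ff U k)"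
 unfolding ff_def by (intro pc_add fJ pc_continuous continuous_on_integral0 v_locbm)

lemma gg_pc: "pc S (gg U k)"
 unfolding gg_def by (intro pc_add gJ pc_continuous continuous_on_integral0 g_locbm)

lemma ff_0: "s \<le> 0 \<Longrightarrow> ff U k s = 0"
 unfolding ff_def using fJ(2) v_0 by (cases "s = 0") auto

lemma gg_0: assumes "t \<le> 2 * L k" shows "gg U k t = 0"
proof -
 have "integral {0..t} (gU U k) = integral {0..t} (\<lambda>_. 0)"
  by (rule integral_cong) (use g_0 assms in auto)
 then show ?thesis unfolding gg_def using gJ(2) assms by simp
qed

lemma ww_locbm: "locbm (ww U k)"
proof -
 have "locbm (\<lambda>p::real \<times> real. ff U k (fst p))" "locbm (\<lambda>p::real \<times> real. gg U k (snd p))"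
  by (rule locbm_compose[OF pc_locbm[OF ff_pc finS]] locbm_compose[OF pc_locbm[OF gg_pc finS]],
    intro continuous_intros)+
 then show ?thesis unfolding ww_def by (intro locbm_add locbm_continuous[OF C_cont]) auto
qed

lemma hh_locbm: "locbm (hh U k)"
proof -
 have [measurable]: "fst \<in> borel_measurable (borel :: (real \<times> real) measure)"
  "snd \<in> borel_measurable (borel :: (real \<times> real) measure)"
  by (auto intro!: borel_measurable_continuous_onI continuous_intros)
 have *: "{p. 0 < fst p \<and> fst p \<le> T} \<in> sets (borel :: (real \<times> real) measure)"
  "{p. 0 < snd p \<and> snd p \<le> T} \<in> sets (borel :: (real \<times> real) measure)"
  by measurable
 show ?thesis unfolding hh_def
  by (intro locbm_if * locbm_mult locbm_continuous[OF m] ww_locbm locbm_const)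
qed

lemma hh_sec: "locbm (\<lambda>\<tau>. hh U k (s, \<tau>))" "locbm (\<lambda>\<sigma>. hh U k (\<sigma>, t))"
 by (rule locbm_compose[OF hh_locbm], intro continuous_intros)+

lemma hh_0: "fst p \<le> 0 \<or> T < fst p \<or> snd p \<le> 0 \<or> T < snd p \<Longrightarrow> hh U k p = 0"
 by (auto simp: hh_def)

lemma cs_locbm: "locbm (cs U k)"
 unfolding cs_def using locbm_integral[OF hh_locbm] .

lemma ct_locbm: "locbm (ct U k)"
proof -
 have "locbm (\<lambda>p. hh U k (snd p, fst p))" by (rule locbm_compose[OF hh_locbm]) (intro continuous_intros)
 from locbm_compose[OF locbm_integral[OF this], of "\<lambda>p. (snd p, fst p)"]
 show ?thesis unfolding ct_def by (simp add: continuous_intros)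
qed

lemma wx_locbm: "locbm (wx U k)"
proof -
 have "locbm (\<lambda>p::real \<times> real. vU U k (fst p))" "locbm (\<lambda>p::real \<times> real. gU U k (snd p))"
  by (rule locbm_compose[OF v_locbm] locbm_compose[OF g_locbm], intro continuous_intros)+
 then show ?thesis unfolding wx_def by (intro locbm_add cs_locbm ct_locbm) auto
qed

lemma gap_in_out:
 assumes "connected I" "I \<inter> S = {}" shows "I \<subseteq> {0<..T} \<or> I \<inter> {0<..T} = {}"
proof (rule ccontr)
 assume "\<not> ?thesis"
 then obtain x y where xy: "x \<in> I" "y \<in> I" "0 < x \<and> x \<le> T" "y \<le> 0 \<or> T < y" by force
 then have "0 \<in> I \<or> T \<in> I"
  using connected_contains_Icc[OF assms(1) xy(1,2)] connected_contains_Icc[OF assms(1) xy(2,1)] by fastforce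
 then show False using assms(2) S0 by blast
qed

text \<open>In t the function is a primitive, but in s it inherits the jumps of f. On a gap in s, f
  is replaced by a continuous extension F; the integrand is then continuous in s for each \<tau>,
  and \<open>cs\<close> agrees, for all t at once, with a function continuous on the plane.\<close>

lemma cs_ext:
 assumes I: "connected I" "bounded I" "I \<inter> S = {}"
 obtains c where "continuous_on UNIV c" "\<And>s t. s \<in> I \<Longrightarrow> cs U k (s, t) = c (s, t)"
proof (cases "I \<inter> {0<..T} = {}")
 case True
 then have "hh U k (s, \<tau>) = 0" if "s \<in> I" for s \<tau>
  using that by (fastforce simp: hh_def)
 then have "cs U k (s, t) = 0" if "s \<in> I" for s t using that by (simp add: cs_def)
 then show ?thesis using that[of "\<lambda>_. 0"] by auto
next
 case False
 with gap_in_out[OF I(1,3)] have inI: "I \<subseteq> {0<..T}" by blast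
 obtain F where F: "continuous_on UNIV F" "\<And>s. s \<in> I \<Longrightarrow> ff U k s = F s"
  using pc_ext[OF ff_pc I] by metis
 define h where "h q = (if 0 < snd q \<and> snd q \<le> T then
   m k (fst (fst q), snd q) * (F (fst (fst q)) + gg U k (snd q) + CU U k (fst (fst q), snd q)) else 0)"
  for q :: "(real \<times> real) \<times> real"
 have h: "locbm h"
 proof -
  have [measurable]: "snd \<in> borel_measurable (borel :: ((real \<times> real) \<times> real) measure)"
   by (auto intro!: borel_measurable_continuous_onI continuous_intros)
  have *: "{p. 0 < snd p \<and> snd p \<le> T} \<in> sets (borel :: ((real \<times> real) \<times> real) measure)"
   by measurable
  show ?thesis unfolding h_def
   by (intro locbm_if * locbm_mult locbm_const locbm_add locbm_compose[OF pc_locbm[OF gg_pc finS]]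
     locbm_continuous continuous_on_compose2[OF m] continuous_on_compose2[OF F(1)]
     continuous_on_compose2[OF C_cont] continuous_intros subset_UNIV)
 qed
 define c where "c p = integral {0..snd p} (\<lambda>\<tau>. h (p, \<tau>))" for p
 have "isCont c p" for p
  unfolding c_def
 proof (rule isCont_param_integral[OF h, where N="{}"])
  show "isCont snd p" by simp
  show "isCont (\<lambda>q. h (q, \<tau>)) p" for \<tau>
  proof -
   have "continuous_on UNIV (\<lambda>q. h (q, \<tau>))"
    unfolding h_def fst_conv snd_conv
    by (cases "0 < \<tau> \<and> \<tau> \<le> T")
     (auto intro!: continuous_intros continuous_on_compose2[OF m] continuous_on_compose2[OF F(1)]
     continuous_on_compose2[OF C_cont])
   then show ?thesis using continuous_on_eq_continuous_at[OF open_UNIV] by blast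
  qed
 qed simp
 then have "continuous_on UNIV c" by (simp add: continuous_at_imp_continuous_on)
 moreover have "cs U k (s, t) = c (s, t)" if "s \<in> I" for s t
  unfolding cs_def c_def h_def hh_def ww_def using that inI F(2) by (intro integral_cong) auto
 ultimately show ?thesis using that by blast
qed

lemma ct_ext:
 assumes I: "connected I" "bounded I" "I \<inter> S = {}"
 obtains c where "continuous_on UNIV c" "\<And>s t. t \<in> I \<Longrightarrow> ct U k (s, t) = c (s, t)"
proof (cases "I \<inter> {0<..T} = {}")
 case True
 then have "hh U k (\<sigma>, t) = 0" if "t \<in> I" for \<sigma> t
  using that by (fastforce simp: hh_def)
 then have "ct U k (s, t) = 0" if "t \<in> I" for s t using that by (simp add: ct_def)
 then show ?thesis using that[of "\<lambda>_. 0"] by auto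
next
 case False
 with gap_in_out[OF I(1,3)] have inI: "I \<subseteq> {0<..T}" by blast
 obtain G where G: "continuous_on UNIV G" "\<And>s. s \<in> I \<Longrightarrow> gg U k s = G s"
  using pc_ext[OF gg_pc I] by metis
 define h where "h q = (if 0 < snd q \<and> snd q \<le> T then
   m k (snd q, snd (fst q)) * (ff U k (snd q) + G (snd (fst q)) + CU U k (snd q, snd (fst q))) else 0)"
  for q :: "(real \<times> real) \<times> real"
 have h: "locbm h"
 proof -
  have [measurable]: "snd \<in> borel_measurable (borel :: ((real \<times> real) \<times> real) measure)"
   by (auto intro!: borel_measurable_continuous_onI continuous_intros)
  have *: "{p. 0 < snd p \<and> snd p \<le> T} \<in> sets (borel :: ((real \<times> real) \<times> real) measure)"
   by measurable
  show ?thesis unfolding h_def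
   by (intro locbm_if * locbm_mult locbm_const locbm_add locbm_compose[OF pc_locbm[OF ff_pc finS]]
     locbm_continuous continuous_on_compose2[OF m] continuous_on_compose2[OF G(1)]
     continuous_on_compose2[OF C_cont] continuous_intros subset_UNIV)
 qed
 define c where "c p = integral {0..fst p} (\<lambda>\<tau>. h (p, \<tau>))" for p
 have "isCont c p" for p
  unfolding c_def
 proof (rule isCont_param_integral[OF h, where N="{}"])
  show "isCont fst p" by simp
  show "isCont (\<lambda>q. h (q, \<tau>)) p" for \<tau>
  proof -
   have "continuous_on UNIV (\<lambda>q. h (q, \<tau>))"
    unfolding h_def fst_conv snd_conv
    by (cases "0 < \<tau> \<and> \<tau> \<le> T")
     (auto intro!: continuous_intros continuous_on_compose2[OF m] continuous_on_compose2[OF G(1)]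
     continuous_on_compose2[OF C_cont])
   then show ?thesis using continuous_on_eq_continuous_at[OF open_UNIV] by blast
  qed
 qed simp
 then have "continuous_on UNIV c" by (simp add: continuous_at_imp_continuous_on)
 moreover have "ct U k (s, t) = c (s, t)" if "t \<in> I" for s t
  unfolding ct_def c_def h_def hh_def ww_def using that inI G(2) by (intro integral_cong) auto
 ultimately show ?thesis using that by blast
qed

lemma cs_isCont: assumes "fst p \<notin> S" shows "isCont (cs U k) p"
proof -
 let ?I = "cell S {s\<in>S. s < fst p} \<inter> {fst p - 1<..<fst p + 1}"
 have c: "connected ?I" unfolding connected_iff_interval using cell_convex[of _ S] by auto
 have b: "bounded ?I" by (rule bounded_subset[of "{fst p-1..fst p+1}"]) auto
 have d: "?I \<inter> S = {}" using cell_disjoint by blast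
 obtain c where c: "continuous_on UNIV c" "\<And>s t. s \<in> ?I \<Longrightarrow> cs U k (s, t) = c (s, t)"
  by (rule cs_ext[OF c b d, of k]) blast
 have o: "open ?I" "fst p \<in> ?I" using open_cell[OF finS] cell_self[OF assms] by auto
 have "continuous_on (?I \<times> UNIV) (cs U k)"
  using continuous_on_subset[OF c(1), of "?I \<times> UNIV"] c(2)
  by (subst continuous_on_cong[OF refl, where g=c]) auto
 moreover have op: "open (?I \<times> (UNIV::real set))" by (intro open_Times o(1) open_UNIV)
 moreover have "p \<in> ?I \<times> UNIV" using o(2) unfolding mem_Times_iff by blast
 ultimately show ?thesis by (simp only: continuous_on_eq_continuous_at)
qed

lemma ct_isCont: assumes "snd p \<notin> S" shows "isCont (ct U k) p"
proof -
 let ?I = "cell S {s\<in>S. s < snd p} \<inter> {snd p - 1<..<snd p + 1}"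
 have c: "connected ?I" unfolding connected_iff_interval using cell_convex[of _ S] by auto
 have b: "bounded ?I" by (rule bounded_subset[of "{snd p-1..snd p+1}"]) auto
 have d: "?I \<inter> S = {}" using cell_disjoint by blast
 obtain c where c: "continuous_on UNIV c" "\<And>s t. t \<in> ?I \<Longrightarrow> ct U k (s, t) = c (s, t)"
  by (rule ct_ext[OF c b d, of k]) blast
 have o: "open ?I" "snd p \<in> ?I" using open_cell[OF finS] cell_self[OF assms] by auto
 have "continuous_on (UNIV \<times> ?I) (ct U k)"
  using continuous_on_subset[OF c(1), of "UNIV \<times> ?I"] c(2)
  by (subst continuous_on_cong[OF refl, where g=c]) auto
 moreover have op: "open ((UNIV::real set) \<times> ?I)" by (intro open_Times o(1) open_UNIV)
 moreover have "p \<in> UNIV \<times> ?I" using o(2) unfolding mem_Times_iff by blast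
 ultimately show ?thesis by (simp only: continuous_on_eq_continuous_at)
qed

lemma ww_isCont: "fst p \<notin> S \<Longrightarrow> snd p \<notin> S \<Longrightarrow> isCont (ww U k) p"
 unfolding ww_def
 using isCont_o2[OF _ pc_isCont[OF ff_pc finS], of p fst k] isCont_o2[OF _ pc_isCont[OF gg_pc finS], of p snd k]
  continuous_on_eq_continuous_at[OF open_UNIV, THEN iffD1, OF C_cont[of k], THEN bspec, of p]
 by (intro continuous_intros) auto

lemma wx_isCont: "fst p \<notin> S \<Longrightarrow> snd p \<notin> S \<Longrightarrow> isCont (wx U k) p"
 unfolding wx_def
 using isCont_o2[OF _ pc_isCont[OF v_pc finS], of p fst k] isCont_o2[OF _ pc_isCont[OF g_pc finS], of p snd k]
  cs_isCont ct_isCont by (intro continuous_intros) auto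

text \<open>Convolving removes the jumps of \<open>wx\<close> and \<open>ww\<close>: for fixed x
  only the finitely many y with x - y or x + y in S are exceptional. So the convolution terms add
  nothing to the exceptional set.\<close>

lemma conv_continuous: "continuous_on UNIV (conv U k k')"
proof (rule continuous_at_imp_continuous_on, intro ballI)
 fix x :: real
 let ?h = "\<lambda>q::real \<times> real. A k k' (snd q) * wx U k' (fst q - snd q, fst q + snd q)
  + A0 k k' (snd q) * ww U k' (fst q - snd q, fst q + snd q)"
 have h: "locbm ?h"
  by (intro locbm_add locbm_mult locbm_compose[OF A] locbm_compose[OF A0] locbm_compose[OF wx_locbm]
    locbm_compose[OF ww_locbm] continuous_intros)
 have "isCont (\<lambda>q. integral {0..L k'} (\<lambda>\<tau>. ?h (q, \<tau>))) x"
 proof (rule isCont_param_integral[OF h, where t="\<lambda>_. L k'"])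
  show "finite ((\<lambda>s. x - s) ` S \<union> (\<lambda>s. s - x) ` S)" using finS by simp
  fix \<tau> assume t: "\<tau> \<notin> (\<lambda>s. x - s) ` S \<union> (\<lambda>s. s - x) ` S"
  have "x - \<tau> \<notin> S" "x + \<tau> \<notin> S"
   using t by (force simp: image_iff)+
  then have "isCont (\<lambda>q. wx U k' (q - \<tau>, q + \<tau>)) x" "isCont (\<lambda>q. ww U k' (q - \<tau>, q + \<tau>)) x"
   by (auto intro!: isCont_o2[OF _ wx_isCont, of x "\<lambda>q. (q - \<tau>, q + \<tau>)"]
     isCont_o2[OF _ ww_isCont, of x "\<lambda>q. (q - \<tau>, q + \<tau>)"] continuous_intros)
  then show "isCont (\<lambda>q. ?h (q, \<tau>)) x" by (auto intro!: continuous_intros)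
 qed simp
 then show "isCont (conv U k k') x" by (simp add: conv_def[abs_def])
qed

end
end

lemma abs_le_sum4: "\<bar>a\<bar> \<le> A \<Longrightarrow> \<bar>b\<bar> \<le> B \<Longrightarrow> \<bar>c\<bar> \<le> C \<Longrightarrow> \<bar>d\<bar> \<le> D \<Longrightarrow> \<bar>a + b - c - d\<bar> \<le> A + B + C + (D::real)"
 by linarith

section \<open>Invariance of the class of candidates under the iteration\<close>

context row
begin

lemma vU_Phi: "vU (Phi U) k x = (if 0 < x \<and> x \<le> X then e k x + (\<Sum>k'\<in>UNIV. a1 k k' * gU U k' x
    + a2 k k' * cs U k' (x, x) + a3 k k' * ct U k' (x, x) + a4 k k' * ww U k' (x, x) + conv U k k' x) else 0)"
 and gU_Phi: "gU (Phi U) k t = (if 2 * L k < t \<and> t \<le> T then bet k * (vU U k (t - 2 * L k) + cs U k (t - 2 * L k, t)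
     - ct U k (t - 2 * L k, t) - rb k * ww U k (t - 2 * L k, t)) else 0)"
 and CU_Phi: "CU (Phi U) k p = integral {0..fst p} (\<lambda>\<sigma>. cs U k (\<sigma>, snd p))"
 by (simp_all add: vU_def gU_def CU_def Phi_def split: prod.split)

lemma good_Phi:
 assumes U: "good U" shows "good (Phi U)"
 unfolding good_def
proof (intro allI conjI impI)
 fix k
 have d1: "pc S (\<lambda>x. cs U k' (x, x))" for k'
 proof (rule pcI_ext)
  fix I assume I: "connected I" "bounded I" "I \<inter> S = {}"
  obtain c where c: "continuous_on UNIV c" "\<And>s t. s \<in> I \<Longrightarrow> cs U k' (s, t) = c (s, t)"
   by (rule cs_ext[OF U I, of k']) blast
  then show "\<exists>h. continuous_on UNIV h \<and> (\<forall>x\<in>I. cs U k' (x, x) = h x)"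
   by (intro exI[of _ "\<lambda>x. c (x, x)"]) (auto intro!: continuous_on_compose2[OF c(1)] continuous_intros)
 qed
 have d2: "pc S (\<lambda>x. ct U k' (x, x))" for k'
 proof (rule pcI_ext)
  fix I assume I: "connected I" "bounded I" "I \<inter> S = {}"
  obtain c where c: "continuous_on UNIV c" "\<And>s t. t \<in> I \<Longrightarrow> ct U k' (s, t) = c (s, t)"
   by (rule ct_ext[OF U I, of k']) blast
  then show "\<exists>h. continuous_on UNIV h \<and> (\<forall>x\<in>I. ct U k' (x, x) = h x)"
   by (intro exI[of _ "\<lambda>x. c (x, x)"]) (auto intro!: continuous_on_compose2[OF c(1)] continuous_intros)
 qed
 have d3: "pc S (\<lambda>x. ww U k' (x, x))" for k'
  unfolding ww_def fst_conv snd_conv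
  by (intro pc_add ff_pc gg_pc U pc_continuous continuous_on_compose2[OF C_cont[OF U]] continuous_intros) auto
 show "pc S (vU (Phi U) k)"
  unfolding vU_Phi
  by (intro pc_if_interval pc_const pc_add pc_sum pc_cmult e d1 d2 d3 g_pc[OF U]
    pc_continuous[OF conv_continuous[OF U]] S0)
 show "vU (Phi U) k x = 0" if "x \<le> 0 \<or> X < x" for x using that by (auto simp: vU_Phi)
 show "gU (Phi U) k t = 0" if "t \<le> 2 * L k \<or> T < t" for t using that by (auto simp: gU_Phi)
 show "pc S (gU (Phi U) k)"
  unfolding gU_Phi
 proof (rule pc_if_interval_ext)
  fix I assume I: "connected I" "bounded I" "I \<inter> S = {}" and sub: "I \<subseteq> {2 * L k<..T}"
  let ?u = "\<lambda>t. t - 2 * L k"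
  have I': "connected (?u ` I)" "bounded (?u ` I)" "?u ` I \<inter> S = {}"
  proof -
   show "connected (?u ` I)" by (intro connected_continuous_image continuous_intros I)
   show "bounded (?u ` I)" using bounded_translation_minus[OF I(2), of "2 * L k"] by simp
   \<comment> \<open>If the gap moved back by \<open>2 * L k\<close> met S, shifting forward again
     would produce a point of S in the gap; the bound t \<le> T on the gap makes the closure
     property applicable.\<close>
   show "?u ` I \<inter> S = {}"
   proof (rule ccontr)
    assume "?u ` I \<inter> S \<noteq> {}"
    then obtain t where t: "t \<in> I" "t - 2 * L k \<in> S" by blast
    have "t \<in> S" using Sshift[OF t(2), of k] t(1) sub by auto
    then show False using t I(3) by blast
   qed
  qed
  obtain h1 where h1: "continuous_on UNIV h1" "\<And>s. s \<in> ?u ` I \<Longrightarrow> vU U k s = h1 s"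
   by (rule pc_ext[OF v_pc[OF U] I', of k]) blast
  obtain h2 where h2: "continuous_on UNIV h2" "\<And>s t. s \<in> ?u ` I \<Longrightarrow> cs U k (s, t) = h2 (s, t)"
   by (rule cs_ext[OF U I', of k]) blast
  obtain h3 where h3: "continuous_on UNIV h3" "\<And>s t. t \<in> I \<Longrightarrow> ct U k (s, t) = h3 (s, t)"
   by (rule ct_ext[OF U I, of k]) blast
  obtain h4 where h4: "continuous_on UNIV h4" "\<And>s. s \<in> ?u ` I \<Longrightarrow> ff U k s = h4 s"
   by (rule pc_ext[OF ff_pc[OF U] I', of k]) blast
  obtain h5 where h5: "continuous_on UNIV h5" "\<And>s. s \<in> I \<Longrightarrow> gg U k s = h5 s"
   by (rule pc_ext[OF gg_pc[OF U] I, of k]) blast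
  let ?h = "\<lambda>t. bet k * (h1 (?u t) + h2 (?u t, t) - h3 (?u t, t) - rb k * (h4 (?u t) + h5 t + CU U k (?u t, t)))"
  have "continuous_on UNIV ?h"
   by (intro continuous_intros continuous_on_compose2[OF h1(1)] continuous_on_compose2[OF h2(1)]
    continuous_on_compose2[OF h3(1)] continuous_on_compose2[OF h4(1)] continuous_on_compose2[OF h5(1)]
    continuous_on_compose2[OF C_cont[OF U]] subset_UNIV)
  moreover have "\<forall>x\<in>I. bet k * (vU U k (x - 2 * L k) + cs U k (x - 2 * L k, x)
     - ct U k (x - 2 * L k, x) - rb k * ww U k (x - 2 * L k, x)) = ?h x"
   using h1(2) h2(2) h3(2) h4(2) h5(2) by (auto simp: ww_def)
  ultimately show "\<exists>h. continuous_on UNIV h \<and> (\<forall>x\<in>I. bet k * (vU U k (x - 2 * L k) + cs U k (x - 2 * L k, x)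
     - ct U k (x - 2 * L k, x) - rb k * ww U k (x - 2 * L k, x)) = h x)"
   by blast
 qed (use S0 in auto)
 show "continuous_on UNIV (CU (Phi U) k)"
 proof (rule continuous_at_imp_continuous_on, intro ballI)
  fix p :: "real \<times> real"
  have h: "locbm (\<lambda>q::(real \<times> real) \<times> real. cs U k (snd q, snd (fst q)))"
   by (rule locbm_compose[OF cs_locbm[OF U]]) (intro continuous_intros)
  have "isCont (\<lambda>p. integral {0..fst p} (\<lambda>\<sigma>. (\<lambda>q. cs U k (snd q, snd (fst q))) (p, \<sigma>))) p"
  proof (rule isCont_param_integral[OF h _ finS])
   fix \<tau> assume "\<tau> \<notin> S"
   then show "isCont (\<lambda>q. cs U k (snd (q, \<tau>), snd (fst (q, \<tau>)))) p"
    by (auto intro!: isCont_o2[OF _ cs_isCont[OF U], of p "\<lambda>q. (\<tau>, snd q)"] continuous_intros)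
  qed simp
  then show "isCont (CU (Phi U) k) p" by (simp add: CU_Phi[abs_def])
 qed
 show "CU (Phi U) k p = 0" if "fst p \<le> 0 \<or> snd p \<le> 0" for p
 proof (cases "fst p \<le> 0")
  case True
  then show ?thesis by (cases "fst p = 0") (auto simp: CU_Phi)
 next
  case False
  then have "cs U k (\<sigma>, snd p) = 0" for \<sigma>
   using that by (cases "snd p = 0") (auto simp: cs_def)
  then show ?thesis by (simp add: CU_Phi)
 qed
qed

text \<open>As \<open>hh\<close> is cut off at T, C is determined by its values for arguments at
  most T. Bounds and difference estimates on that range therefore hold everywhere.\<close>

lemma CU_Phi_cut:
 assumes U: "good U" shows "CU (Phi U) k p = CU (Phi U) k (min (fst p) T, min (snd p) T)"
proof -
 have c: "cs U k (s, t) = cs U k (s, min t T)" for s t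
  unfolding cs_def fst_conv snd_conv
  by (rule integral0_cut[OF hh_sec(1)[OF U]]) (use T0 hh_0[OF U] in auto)
 have "locbm (\<lambda>\<sigma>. cs U k (\<sigma>, t))" for t
  by (rule locbm_compose[OF cs_locbm[OF U]]) (intro continuous_intros)
 then have "integral {0..s} (\<lambda>\<sigma>. cs U k (\<sigma>, t)) = integral {0..min s T} (\<lambda>\<sigma>. cs U k (\<sigma>, t))" for s t
  by (rule integral0_cut) (use T0 hh_0[OF U] in \<open>auto simp: cs_def\<close>)
 then show ?thesis unfolding CU_Phi fst_conv snd_conv using c by simp
qed

lemma good_uniform_limit:
 assumes u: "\<And>n. good (u n)" and lim: "uniform_limit UNIV u U sequentially"
 shows "good U"
 unfolding good_def
proof (intro allI conjI impI)
 fix k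
 have pt: "(\<lambda>n. u n y) \<longlonglongrightarrow> U y" for y using tendsto_uniform_limitI[OF lim] by simp
 have "uniform_limit UNIV (\<lambda>n. vU (u n) k) (vU U k) sequentially"
  using lim unfolding uniform_limit_iff vU_def by (auto elim!: eventually_mono)
 then show "pc S (vU U k)" by (rule pc_uniform_limit[OF v_pc[OF u]])
 have "uniform_limit UNIV (\<lambda>n. gU (u n) k) (gU U k) sequentially"
  using lim unfolding uniform_limit_iff gU_def by (auto elim!: eventually_mono)
 then show "pc S (gU U k)" by (rule pc_uniform_limit[OF g_pc[OF u]])
 have "uniform_limit UNIV (\<lambda>n. CU (u n) k) (CU U k) sequentially"
  using lim unfolding uniform_limit_iff CU_def by (auto elim!: eventually_mono)
 then show "continuous_on UNIV (CU U k)"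
  by (rule uniform_limit_theorem[rotated]) (auto intro!: always_eventually C_cont[OF u])
 show "vU U k x = 0" if "x \<le> 0 \<or> X < x" for x
  using pt[of "Inl (k, x)"] v_0[OF u that] unfolding vU_def by (simp add: LIMSEQ_const_iff)
 show "gU U k t = 0" if "t \<le> 2 * L k \<or> T < t" for t
  using pt[of "Inr (Inl (k, t))"] g_0[OF u that] unfolding gU_def by (simp add: LIMSEQ_const_iff)
 show "CU U k p = 0" if "fst p \<le> 0 \<or> snd p \<le> 0" for p
  using pt[of "Inr (Inr (k, p))"] C_0[OF u that] unfolding CU_def by (simp add: LIMSEQ_const_iff)
qed

lemma good_zero: "good (\<lambda>_. 0)"
 by (auto simp: good_def vU_def[abs_def] gU_def[abs_def] CU_def[abs_def] pc_const)

text \<open>Used for the first step of the iteration, which starts from the zero field.\<close>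

lemma Phi_bounded:
 assumes U: "good U" obtains B where "B \<ge> 0" "\<And>y. \<bar>Phi U y\<bar> \<le> B"
proof -
 note P = good_Phi[OF U]
 have "\<exists>B. \<forall>x. True \<longrightarrow> \<bar>vU (Phi U) k x\<bar> \<le> B" for k
 proof -
  obtain B where B: "B \<ge> 0" "\<And>x. norm x \<le> T \<Longrightarrow> \<bar>vU (Phi U) k x\<bar> \<le> B"
   using locbm_bound[OF v_locbm[OF P]] by metis
  have "\<bar>vU (Phi U) k x\<bar> \<le> B" for x
   using B v_0[OF P, of x k] T0 by (cases "x \<le> 0 \<or> X < x") auto
  then show ?thesis by blast
 qed
 then obtain B1 where B1: "B1 \<ge> 0" "\<And>k x. \<bar>vU (Phi U) k x\<bar> \<le> B1"
  using finite_type_bound[of "\<lambda>k x. True" "vU (Phi U)"] by metis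
 have "\<exists>B. \<forall>x. True \<longrightarrow> \<bar>gU (Phi U) k x\<bar> \<le> B" for k
 proof -
  obtain B where B: "B \<ge> 0" "\<And>x. norm x \<le> T \<Longrightarrow> \<bar>gU (Phi U) k x\<bar> \<le> B"
   using locbm_bound[OF g_locbm[OF P]] by metis
  have "\<bar>gU (Phi U) k x\<bar> \<le> B" for x
   using B g_0[OF P, of x k] L(1)[of k] by (cases "x \<le> 2 * L k \<or> T < x") auto
  then show ?thesis by blast
 qed
 then obtain B2 where B2: "B2 \<ge> 0" "\<And>k x. \<bar>gU (Phi U) k x\<bar> \<le> B2"
  using finite_type_bound[of "\<lambda>k x. True" "gU (Phi U)"] by metis
 have "\<exists>B. \<forall>x. True \<longrightarrow> \<bar>CU (Phi U) k x\<bar> \<le> B" for k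
 proof -
  obtain B where B: "B \<ge> 0" "\<And>x. norm x \<le> T + T \<Longrightarrow> \<bar>CU (Phi U) k x\<bar> \<le> B"
   using locbm_bound[OF locbm_continuous[OF C_cont[OF P]]] by metis
  have "\<bar>CU (Phi U) k p\<bar> \<le> B" for p
  proof (cases "fst p \<le> 0 \<or> snd p \<le> 0")
   case True then show ?thesis using C_0[OF P, of p k] B by simp
  next
   case False
   then have "norm (min (fst p) T, min (snd p) T) \<le> T + T"
    using T0 norm_Pair_le[of "min (fst p) T" "min (snd p) T"] by auto
   from B(2)[OF this] show ?thesis using CU_Phi_cut[OF U, of k p] by simp
  qed
  then show ?thesis by blast
 qed
 then obtain B3 where B3: "B3 \<ge> 0" "\<And>k x. \<bar>CU (Phi U) k x\<bar> \<le> B3"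
  using finite_type_bound[of "\<lambda>k x. True" "CU (Phi U)"] by metis
 have "\<bar>Phi U y\<bar> \<le> B1 + B2 + B3" for y
 proof -
  consider k x where "y = Inl (k, x)" | k x where "y = Inr (Inl (k, x))" | k p where "y = Inr (Inr (k, p))"
   by (metis sumE surj_pair)
  then show ?thesis
  proof cases
   case 1 then show ?thesis using B1(2)[of k x] B1(1) B2(1) B3(1) by (simp add: vU_def)
  next
   case 2 then show ?thesis using B2(2)[of k x] B1(1) B2(1) B3(1) by (simp add: gU_def)
  next
   case 3 then show ?thesis using B3(2)[of k p] B1(1) B2(1) B3(1) by (simp add: CU_def)
  qed
 qed
 then show ?thesis using that[of "B1 + B2 + B3"] B1(1) B2(1) B3(1) by simp
qed

section \<open>Contraction estimates in the weighted norm\<close>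

text \<open>The weights are exp (l x) for v, \<epsilon> exp (l (t - L k)) for g and \<epsilon>^2
  (exp (l s) + exp (l (t - L k))) for C. The derivative v contains g at the same argument, where the
  weight of g brings the small factor \<epsilon>. Conversely g contains v at t - 2 L k: half of the
  delay is absorbed by the shift in the weight of g, the other half leaves exp (- l L k) \<le>
  \<epsilon>^3. In the convolution g is evaluated at x + y with y \<le> L k, and the same shift
  keeps its weight below \<epsilon> exp (l x). Single integrals such as \<open>cs\<close> and
  \<open>ct\<close> have no small factor for one of the two weights; there the \<epsilon>^2 in the
  bound on w supplies it.\<close>

context
 fixes U V :: "'k fld" and B l \<epsilon> Z :: real
 assumes U: "good U" and V: "good V" and B: "0 \<le> B" and l: "l > 0" "1 / l \<le> \<epsilon> ^ 3" "\<And>k. exp (- l * L k) \<le> \<epsilon> ^ 3"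
  and eps: "0 < \<epsilon>" "\<epsilon> \<le> 1" and Z: "1 \<le> Z" "T \<le> Z"
  and Zm: "\<And>k p. fst p \<in> {0..T} \<Longrightarrow> snd p \<in> {0..T} \<Longrightarrow> \<bar>m k p\<bar> \<le> Z"
  and ZA: "\<And>k k' y. y \<in> {0..T} \<Longrightarrow> \<bar>A k k' y\<bar> \<le> Z" "\<And>k k' y. y \<in> {0..T} \<Longrightarrow> \<bar>A0 k k' y\<bar> \<le> Z"
  and Za: "\<And>k k'. \<bar>a1 k k'\<bar> \<le> Z" "\<And>k k'. \<bar>a2 k k'\<bar> \<le> Z" "\<And>k k'. \<bar>a3 k k'\<bar> \<le> Z" "\<And>k k'. \<bar>a4 k k'\<bar> \<le> Z"
  and Zb: "\<And>k. \<bar>bet k\<bar> \<le> Z" "\<And>k. \<bar>rb k\<bar> \<le> Z"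
  and small: "54 * real CARD('k) * Z ^ 4 * \<epsilon> \<le> 1"
  and dv: "\<And>k x. x \<le> T \<Longrightarrow> \<bar>vU U k x - vU V k x\<bar> \<le> B * exp (l * x)"
  and dg: "\<And>k t. t \<le> T \<Longrightarrow> \<bar>gU U k t - gU V k t\<bar> \<le> B * \<epsilon> * exp (l * (t - L k))"
  and dC: "\<And>k p. fst p \<le> T \<Longrightarrow> snd p \<le> T \<Longrightarrow>
   \<bar>CU U k p - CU V k p\<bar> \<le> B * \<epsilon>\<^sup>2 * (exp (l * fst p) + exp (l * (snd p - L k)))"
begin

lemma e32: "\<epsilon> ^ 3 \<le> \<epsilon>\<^sup>2" "\<epsilon>\<^sup>2 \<le> \<epsilon>" "\<epsilon> ^ 3 \<le> \<epsilon>" "0 < \<epsilon> ^ 3" "0 < \<epsilon>\<^sup>2"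
 using eps power_decreasing[of 2 3 \<epsilon>] power_decreasing[of 1 2 \<epsilon>] power_decreasing[of 1 3 \<epsilon>] by auto

lemma div_l: "0 \<le> c \<Longrightarrow> c / l \<le> c * \<epsilon> ^ 3"
 using mult_left_mono[OF l(2), of c] by simp

lemma d_ff: assumes "s \<le> T" shows "\<bar>ff U k s - ff V k s\<bar> \<le> B * \<epsilon> ^ 3 * exp (l * s)"
proof -
 have "ff U k s - ff V k s = integral {0..s} (\<lambda>x. vU U k x - vU V k x)"
  unfolding ff_def using integral_diff[OF locbm_integrable[OF v_locbm[OF U]] locbm_integrable[OF v_locbm[OF V]]]
  by simp
 also have "\<bar>\<dots>\<bar> \<le> B * exp (l * (s - 0)) / l"
  by (rule integral_exp_bound) (use assms dv l B in \<open>auto intro!: locbm_diff v_locbm U V\<close>)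
 also have "\<dots> \<le> B * \<epsilon> ^ 3 * exp (l * s)" using div_l[of "B * exp (l * s)"] B by (simp add: mult_ac)
 finally show ?thesis .
qed

lemma d_gg: assumes "t \<le> T" shows "\<bar>gg U k t - gg V k t\<bar> \<le> B * \<epsilon> ^ 3 * exp (l * (t - L k))"
proof -
 have "gg U k t - gg V k t = integral {0..t} (\<lambda>x. gU U k x - gU V k x)"
  unfolding gg_def using integral_diff[OF locbm_integrable[OF g_locbm[OF U]] locbm_integrable[OF g_locbm[OF V]]]
  by simp
 also have "\<bar>\<dots>\<bar> \<le> B * \<epsilon> * exp (l * (t - L k)) / l"
  by (rule integral_exp_bound) (use assms dg l B eps in \<open>auto intro!: locbm_diff g_locbm U V\<close>)
 also have "\<dots> \<le> B * \<epsilon> * exp (l * (t - L k)) * \<epsilon> ^ 3" using div_l[of "B * \<epsilon> * exp (l * (t - L k))"] B eps by simp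
 also have "\<dots> \<le> B * 1 * exp (l * (t - L k)) * \<epsilon> ^ 3"
  using B eps by (intro mult_right_mono mult_left_mono) auto
 finally show ?thesis by (simp add: mult_ac)
qed

lemma d_ww: assumes "fst p \<le> T" "snd p \<le> T"
 shows "\<bar>ww U k p - ww V k p\<bar> \<le> 2 * B * \<epsilon>\<^sup>2 * (exp (l * fst p) + exp (l * (snd p - L k)))"
proof -
 have q: "B * \<epsilon> ^ 3 * c \<le> B * \<epsilon>\<^sup>2 * c" if "0 \<le> c" for c
  using B e32 that by (intro mult_right_mono mult_left_mono) auto
 have "\<bar>ww U k p - ww V k p\<bar> \<le> \<bar>ff U k (fst p) - ff V k (fst p)\<bar> + \<bar>gg U k (snd p) - gg V k (snd p)\<bar> + \<bar>CU U k p - CU V k p\<bar>"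
  unfolding ww_def by linarith
 also have "\<dots> \<le> B * \<epsilon>\<^sup>2 * exp (l * fst p) + B * \<epsilon>\<^sup>2 * exp (l * (snd p - L k))
   + B * \<epsilon>\<^sup>2 * (exp (l * fst p) + exp (l * (snd p - L k)))"
  using d_ff[OF assms(1), of k] d_gg[OF assms(2), of k] dC[OF assms, of k] q[of "exp (l * fst p)"] q[of "exp (l * (snd p - L k))"]
  by simp
 finally show ?thesis by (simp add: algebra_simps)
qed

lemma d_hh: assumes "fst p \<le> T" "snd p \<le> T"
 shows "\<bar>hh U k p - hh V k p\<bar> \<le> 2 * Z * B * \<epsilon>\<^sup>2 * (exp (l * fst p) + exp (l * (snd p - L k)))"
proof (cases "0 < fst p \<and> 0 < snd p")
 case True
 then have "hh U k p - hh V k p = m k p * (ww U k p - ww V k p)" using assms by (simp add: hh_def algebra_simps)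
 also have "\<bar>\<dots>\<bar> \<le> Z * (2 * B * \<epsilon>\<^sup>2 * (exp (l * fst p) + exp (l * (snd p - L k))))"
  unfolding abs_mult using True assms d_ww[OF assms, of k] Zm[of p k] Z by (intro mult_mono) auto
 finally show ?thesis by (simp add: mult_ac)
next
 case False
 then have "hh U k p - hh V k p = 0" using hh_0[OF U, of p] hh_0[OF V, of p] by auto
 then show ?thesis using B Z by simp
qed

text \<open>Of the two weights in \<open>d_hh\<close> the one in s is constant under the integral in
  \<tau> and costs the length, whereas the one in t gains \<epsilon>^3. Keeping them apart is
  essential for \<open>d_CU\<close>, where the second integration acts on the other weight.\<close>

lemma d_cs: assumes "fst p \<le> T" "snd p \<le> T"
 shows "\<bar>cs U k p - cs V k p\<bar> \<le> 2 * Z * B * \<epsilon>\<^sup>2 * (Z * exp (l * fst p) + \<epsilon> ^ 3 * exp (l * (snd p - L k)))"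
proof -
 let ?q = "2 * Z * B * \<epsilon>\<^sup>2"
 have q: "0 \<le> ?q" using Z B by simp
 have "cs U k p - cs V k p = integral {0..snd p} (\<lambda>\<tau>. hh U k (fst p, \<tau>) - hh V k (fst p, \<tau>))"
  unfolding cs_def using integral_diff[OF locbm_integrable[OF hh_sec(1)[OF U]] locbm_integrable[OF hh_sec(1)[OF V]]]
  by simp
 also have "\<bar>\<dots>\<bar> \<le> ?q * exp (l * fst p) * T + ?q * exp (l * (snd p - L k)) / l"
 proof (rule integral_affine_exp_bound)
  show "locbm (\<lambda>\<tau>. hh U k (fst p, \<tau>) - hh V k (fst p, \<tau>))" by (intro locbm_diff hh_sec U V)
  fix \<sigma> assume "0 \<le> \<sigma>" "\<sigma> \<le> snd p"
  then show "\<bar>hh U k (fst p, \<sigma>) - hh V k (fst p, \<sigma>)\<bar> \<le> ?q * exp (l * fst p) + ?q * exp (l * (\<sigma> - L k))"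
   using d_hh[of "(fst p, \<sigma>)" k] assms by (simp add: algebra_simps)
 qed (use q l T0 assms in auto)
 also have "\<dots> \<le> ?q * exp (l * fst p) * Z + ?q * exp (l * (snd p - L k)) * \<epsilon> ^ 3"
  using q Z div_l[of "?q * exp (l * (snd p - L k))"] by (intro add_mono mult_left_mono) auto
 finally show ?thesis by (simp add: algebra_simps)
qed

lemma d_ct: assumes "fst p \<le> T" "snd p \<le> T"
 shows "\<bar>ct U k p - ct V k p\<bar> \<le> 2 * Z * B * \<epsilon>\<^sup>2 * (\<epsilon> ^ 3 * exp (l * fst p) + Z * exp (l * (snd p - L k)))"
proof -
 let ?q = "2 * Z * B * \<epsilon>\<^sup>2"
 have q: "0 \<le> ?q" using Z B by simp
 have "ct U k p - ct V k p = integral {0..fst p} (\<lambda>\<tau>. hh U k (\<tau>, snd p) - hh V k (\<tau>, snd p))"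
  unfolding ct_def using integral_diff[OF locbm_integrable[OF hh_sec(2)[OF U]] locbm_integrable[OF hh_sec(2)[OF V]]]
  by simp
 also have "\<bar>\<dots>\<bar> \<le> ?q * exp (l * (snd p - L k)) * T + ?q * exp (l * (fst p - 0)) / l"
 proof (rule integral_affine_exp_bound)
  show "locbm (\<lambda>\<tau>. hh U k (\<tau>, snd p) - hh V k (\<tau>, snd p))" by (intro locbm_diff hh_sec U V)
  fix \<sigma> assume "0 \<le> \<sigma>" "\<sigma> \<le> fst p"
  then show "\<bar>hh U k (\<sigma>, snd p) - hh V k (\<sigma>, snd p)\<bar> \<le> ?q * exp (l * (snd p - L k)) + ?q * exp (l * (\<sigma> - 0))"
   using d_hh[of "(\<sigma>, snd p)" k] assms by (simp add: algebra_simps)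
 qed (use q l T0 assms in auto)
 also have "\<dots> \<le> ?q * exp (l * (snd p - L k)) * Z + ?q * exp (l * (fst p - 0)) * \<epsilon> ^ 3"
  using q Z div_l[of "?q * exp (l * (fst p - 0))"] by (intro add_mono mult_left_mono) auto
 finally show ?thesis by (simp add: algebra_simps)
qed

text \<open>Coarse version for the equations of v and g, where \<epsilon>^2 is compared with the
  weights 1 and \<epsilon> and leaves a spare \<epsilon>.\<close>

lemma d_cst: assumes "fst p \<le> T" "snd p \<le> T"
 shows "\<bar>cs U k p - cs V k p\<bar> \<le> 2 * Z\<^sup>2 * B * \<epsilon>\<^sup>2 * (exp (l * fst p) + exp (l * (snd p - L k)))"
  "\<bar>ct U k p - ct V k p\<bar> \<le> 2 * Z\<^sup>2 * B * \<epsilon>\<^sup>2 * (exp (l * fst p) + exp (l * (snd p - L k)))"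
proof -
 have eZ: "\<epsilon> ^ 3 \<le> Z" using e32 eps Z by linarith
 have q: "0 \<le> 2 * Z * B * \<epsilon>\<^sup>2" using Z B by simp
 have "2 * Z * B * \<epsilon>\<^sup>2 * (Z * exp (l * fst p) + \<epsilon> ^ 3 * exp (l * (snd p - L k)))
   \<le> 2 * Z * B * \<epsilon>\<^sup>2 * (Z * exp (l * fst p) + Z * exp (l * (snd p - L k)))"
  using eZ by (intro mult_left_mono[OF _ q] add_mono mult_right_mono) auto
 also have "\<dots> = 2 * Z\<^sup>2 * B * \<epsilon>\<^sup>2 * (exp (l * fst p) + exp (l * (snd p - L k)))" by (simp add: algebra_simps power2_eq_square)
 finally show "\<bar>cs U k p - cs V k p\<bar> \<le> 2 * Z\<^sup>2 * B * \<epsilon>\<^sup>2 * (exp (l * fst p) + exp (l * (snd p - L k)))"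
  using d_cs[OF assms, of k] by linarith
 have "2 * Z * B * \<epsilon>\<^sup>2 * (\<epsilon> ^ 3 * exp (l * fst p) + Z * exp (l * (snd p - L k)))
   \<le> 2 * Z * B * \<epsilon>\<^sup>2 * (Z * exp (l * fst p) + Z * exp (l * (snd p - L k)))"
  using eZ by (intro mult_left_mono[OF _ q] add_mono mult_right_mono) auto
 also have "\<dots> = 2 * Z\<^sup>2 * B * \<epsilon>\<^sup>2 * (exp (l * fst p) + exp (l * (snd p - L k)))" by (simp add: algebra_simps power2_eq_square)
 finally show "\<bar>ct U k p - ct V k p\<bar> \<le> 2 * Z\<^sup>2 * B * \<epsilon>\<^sup>2 * (exp (l * fst p) + exp (l * (snd p - L k)))"
  using d_ct[OF assms, of k] by linarith
qed

text \<open>C has the same weight \<epsilon>^2 as the bound on w, so the ranking by powers of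
  \<epsilon> gives nothing here. The double integral does: each weight is integrated once in its own
  variable, which brings \<epsilon>^3 to both terms.\<close>

lemma d_CU: assumes "fst p \<le> T" "snd p \<le> T"
 shows "\<bar>CU (Phi U) k p - CU (Phi V) k p\<bar> \<le> B / 2 * (\<epsilon>\<^sup>2 * (exp (l * fst p) + exp (l * (snd p - L k))))"
proof -
 let ?q = "2 * Z * B * \<epsilon>\<^sup>2"
 have q: "0 \<le> ?q" "0 \<le> ?q * \<epsilon> ^ 3 * exp (l * (snd p - L k))" using Z B eps by simp_all
 have sec: "locbm (\<lambda>\<sigma>. cs W k (\<sigma>, t))" if "good W" for W t
  by (rule locbm_compose[OF cs_locbm[OF that]]) (intro continuous_intros)
 have "CU (Phi U) k p - CU (Phi V) k p = integral {0..fst p} (\<lambda>\<sigma>. cs U k (\<sigma>, snd p) - cs V k (\<sigma>, snd p))"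
  unfolding CU_Phi using integral_diff[OF locbm_integrable[OF sec[OF U]] locbm_integrable[OF sec[OF V]]]
  by simp
 also have "\<bar>\<dots>\<bar> \<le> ?q * \<epsilon> ^ 3 * exp (l * (snd p - L k)) * T + ?q * Z * exp (l * (fst p - 0)) / l"
 proof (rule integral_affine_exp_bound)
  show "locbm (\<lambda>\<sigma>. cs U k (\<sigma>, snd p) - cs V k (\<sigma>, snd p))" by (intro locbm_diff sec U V)
  fix \<sigma> assume "0 \<le> \<sigma>" "\<sigma> \<le> fst p"
  then show "\<bar>cs U k (\<sigma>, snd p) - cs V k (\<sigma>, snd p)\<bar> \<le> ?q * \<epsilon> ^ 3 * exp (l * (snd p - L k)) + ?q * Z * exp (l * (\<sigma> - 0))"
   using d_cs[of "(\<sigma>, snd p)" k] assms by (simp add: algebra_simps)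
 qed (use q l T0 assms Z B eps in auto)
 also have "\<dots> \<le> ?q * \<epsilon> ^ 3 * exp (l * (snd p - L k)) * Z + ?q * Z * exp (l * (fst p - 0)) * \<epsilon> ^ 3"
  using q Z B eps div_l[of "?q * Z * exp (l * (fst p - 0))"] by (intro add_mono mult_left_mono) auto
 also have "\<dots> = (4 * Z\<^sup>2 * \<epsilon> ^ 3) * (B / 2 * (\<epsilon>\<^sup>2 * (exp (l * fst p) + exp (l * (snd p - L k)))))"
  by (simp add: algebra_simps power2_eq_square)
 also have "\<dots> \<le> 1 * (B / 2 * (\<epsilon>\<^sup>2 * (exp (l * fst p) + exp (l * (snd p - L k)))))"
 proof (rule mult_right_mono)
  have "1 \<le> real CARD('k)" by (simp add: Suc_leI)
  then have "4 \<le> 54 * real CARD('k)" by linarith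
  then have "4 * Z\<^sup>2 * \<epsilon> ^ 3 \<le> 54 * real CARD('k) * Z ^ 4 * \<epsilon>"
   using Z e32 less_imp_le[OF eps(1)] power_increasing[of 2 4 Z]
   by (intro mult_mono) simp_all
  then show "4 * Z\<^sup>2 * \<epsilon> ^ 3 \<le> 1" using small by linarith
  show "0 \<le> B / 2 * (\<epsilon>\<^sup>2 * (exp (l * fst p) + exp (l * (snd p - L k))))" using B by simp
 qed
 finally show ?thesis by simp
qed

lemma d_gU: assumes "t \<le> T"
 shows "\<bar>gU (Phi U) k t - gU (Phi V) k t\<bar> \<le> B / 2 * (\<epsilon> * exp (l * (t - L k)))"
proof (cases "2 * L k < t")
 case True
 let ?p = "(t - 2 * L k, t)"
 define K where "K = B * exp (l * (t - L k))"
 have K: "0 \<le> K" using B by (simp add: K_def)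
 have p: "fst ?p \<le> T" "snd ?p \<le> T" using assms L(1)[of k] by auto
 have "exp (l * (t - 2 * L k)) = exp (- l * L k) * exp (l * (t - L k))"
  by (simp add: exp_add[symmetric] algebra_simps)
 then have 1: "\<bar>vU U k (t - 2 * L k) - vU V k (t - 2 * L k)\<bar> \<le> \<epsilon>\<^sup>2 * K"
  using dv[of "t - 2 * L k" k] p mult_right_mono[OF order_trans[OF l(3)[of k] e32(1)], of "K"] K
  by (simp add: K_def mult_ac)
 have le: "exp (l * fst ?p) \<le> exp (l * (t - L k))" using l(1) L(1)[of k] by simp
 have 2: "c * B * \<epsilon>\<^sup>2 * (exp (l * fst ?p) + exp (l * (snd ?p - L k))) \<le> 2 * c * \<epsilon>\<^sup>2 * K" if "0 \<le> c" for c
 proof -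
  have "c * B * \<epsilon>\<^sup>2 * (exp (l * fst ?p) + exp (l * (snd ?p - L k)))
   \<le> c * B * \<epsilon>\<^sup>2 * (exp (l * (t - L k)) + exp (l * (t - L k)))"
   using le that B by (intro mult_left_mono add_mono) auto
  then show ?thesis by (simp add: K_def algebra_simps)
 qed
 have 3: "\<bar>cs U k ?p - cs V k ?p\<bar> \<le> 4 * Z\<^sup>2 * \<epsilon>\<^sup>2 * K" "\<bar>ct U k ?p - ct V k ?p\<bar> \<le> 4 * Z\<^sup>2 * \<epsilon>\<^sup>2 * K"
  using order_trans[OF d_cst(1)[OF p, of k] 2[of "2 * Z\<^sup>2"]] order_trans[OF d_cst(2)[OF p, of k] 2[of "2 * Z\<^sup>2"]]
  by simp_all
 have 4: "\<bar>rb k * ww U k ?p - rb k * ww V k ?p\<bar> \<le> Z * (4 * \<epsilon>\<^sup>2 * K)"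
  unfolding right_diff_distrib[symmetric] abs_mult
  using order_trans[OF d_ww[OF p, of k] 2[of 2]] Zb(2)[of k] Z by (intro mult_mono) auto
 have eq: "gU (Phi U) k t - gU (Phi V) k t = bet k * ((vU U k (t - 2 * L k) - vU V k (t - 2 * L k))
  + (cs U k ?p - cs V k ?p) - (ct U k ?p - ct V k ?p) - (rb k * ww U k ?p - rb k * ww V k ?p))"
  using True assms by (simp add: gU_Phi algebra_simps)
 have "\<bar>gU (Phi U) k t - gU (Phi V) k t\<bar> \<le> Z * (\<epsilon>\<^sup>2 * K + 4 * Z\<^sup>2 * \<epsilon>\<^sup>2 * K + 4 * Z\<^sup>2 * \<epsilon>\<^sup>2 * K + Z * (4 * \<epsilon>\<^sup>2 * K))"
  unfolding eq abs_mult
  using Zb(1)[of k] Z by (intro mult_mono abs_le_sum4 1 3 4) auto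
 also have "\<dots> = (Z + 8 * Z ^ 3 + 4 * Z\<^sup>2) * (\<epsilon>\<^sup>2 * K)" by (simp add: algebra_simps power2_eq_square power3_eq_cube)
 also have "\<dots> \<le> (27 * real CARD('k) * Z ^ 4) * (\<epsilon>\<^sup>2 * K)"
 proof (rule mult_right_mono)
  have "Z \<le> Z ^ 4" "Z ^ 3 \<le> Z ^ 4" "Z\<^sup>2 \<le> Z ^ 4"
   using Z power_increasing[of 1 4 Z] power_increasing[of 3 4 Z] power_increasing[of 2 4 Z] by auto
  then have "Z + 8 * Z ^ 3 + 4 * Z\<^sup>2 \<le> 27 * Z ^ 4" using Z zero_le_power[of Z 4] by linarith
  also have "\<dots> \<le> 27 * real CARD('k) * Z ^ 4" using Z by (auto simp: Suc_leI)
  finally show "Z + 8 * Z ^ 3 + 4 * Z\<^sup>2 \<le> 27 * real CARD('k) * Z ^ 4" .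
 qed (use K in auto)
 also have "\<dots> = (54 * real CARD('k) * Z ^ 4 * \<epsilon>) * (\<epsilon> * K / 2)" by (simp add: power2_eq_square)
 also have "\<dots> \<le> 1 * (\<epsilon> * K / 2)" using small K eps by (intro mult_right_mono) auto
 finally show ?thesis by (simp add: K_def mult_ac)
next
 case False
 then have "gU (Phi U) k t - gU (Phi V) k t = 0" by (simp add: gU_Phi)
 then show ?thesis using B eps by simp
qed

text \<open>Split by arguments: the weight of v at x - y decreases in y and gains 1/l; the weight of
  g at x + y grows up to y = L k', where it reaches \<epsilon> exp (l x), and gains 1/l as well; the
  remaining terms carry \<epsilon>^2 and are bounded by the length.\<close>

lemma d_conv: assumes x: "0 < x" "x \<le> X"
 shows "\<bar>conv U k k' x - conv V k k' x\<bar> \<le> 14 * Z ^ 4 * (\<epsilon> * (B * exp (l * x)))"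
proof -
 define K where "K = B * exp (l * x)"
 have K: "0 \<le> K" using B by (simp add: K_def)
 let ?p = "\<lambda>y. (x - y, x + y)"
 let ?h1 = "\<lambda>y. A k k' y * (vU U k' (x - y) - vU V k' (x - y))"
 let ?h2 = "\<lambda>y. A k k' y * (gU U k' (x + y) - gU V k' (x + y))"
 let ?h3 = "\<lambda>y. A k k' y * ((cs U k' (?p y) - cs V k' (?p y)) + (ct U k' (?p y) - ct V k' (?p y)))
  + A0 k k' y * (ww U k' (?p y) - ww V k' (?p y))"
 have lb: "locbm (\<lambda>y. A k k' y * wx W k' (?p y) + A0 k k' y * ww W k' (?p y))" if "good W" for W
  by (intro locbm_add locbm_mult A A0 locbm_compose[OF wx_locbm[OF that]] locbm_compose[OF ww_locbm[OF that]] continuous_intros)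
 have lbs: "locbm (\<lambda>y. vU W k' (x - y))" "locbm (\<lambda>y. gU W k' (x + y))" "locbm (\<lambda>y. cs W k' (?p y))"
  "locbm (\<lambda>y. ct W k' (?p y))" "locbm (\<lambda>y. ww W k' (?p y))" if "good W" for W
  by (intro locbm_compose[OF v_locbm[OF that]] locbm_compose[OF g_locbm[OF that]] locbm_compose[OF cs_locbm[OF that]]
   locbm_compose[OF ct_locbm[OF that]] locbm_compose[OF ww_locbm[OF that]] continuous_intros)+
 have l1: "locbm ?h1" by (intro locbm_mult A locbm_diff lbs U V)
 have l2: "locbm ?h2" by (intro locbm_mult A locbm_diff lbs U V)
 have l3: "locbm ?h3" by (intro locbm_add locbm_mult A A0 locbm_diff lbs U V)
 have "conv U k k' x - conv V k k' x = integral {0..L k'} (\<lambda>y. (A k k' y * wx U k' (?p y) + A0 k k' y * ww U k' (?p y))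
  - (A k k' y * wx V k' (?p y) + A0 k k' y * ww V k' (?p y)))"
  unfolding conv_def using integral_diff[OF locbm_integrable[OF lb[OF U]] locbm_integrable[OF lb[OF V]]] by simp
 also have "\<dots> = integral {0..L k'} (\<lambda>y. ?h1 y + ?h2 y + ?h3 y)"
  by (rule integral_cong) (simp add: wx_def algebra_simps)
 also have "\<dots> = integral {0..L k'} ?h1 + integral {0..L k'} ?h2 + integral {0..L k'} ?h3"
  using l1 l2 l3 by (simp add: integral_add locbm_integrable integrable_add)
 finally have eq: "conv U k k' x - conv V k k' x = integral {0..L k'} ?h1 + integral {0..L k'} ?h2 + integral {0..L k'} ?h3" .
 have yT: "y \<in> {0..T}" "x - y \<le> T" "x + y \<le> T" if "0 \<le> y" "y \<le> L k'" for y
  using that x L(2)[of k'] T0 by auto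
 have 1: "\<bar>integral {0..L k'} ?h1\<bar> \<le> Z * \<epsilon> ^ 3 * K"
 proof -
  have "\<bar>integral {0..L k'} ?h1\<bar> \<le> Z * B * exp (l * x) / l"
  proof (rule integral_exp_bound_decreasing[OF l1 l(1)])
   fix y assume "0 \<le> y" "y \<le> L k'"
   then show "\<bar>?h1 y\<bar> \<le> Z * B * exp (l * (x - y))"
    unfolding abs_mult mult.assoc using yT[of y] ZA(1)[of y k k'] dv[of "x - y" k'] Z by (intro mult_mono) auto
  qed (use Z B L(1)[of k'] in auto)
  then show ?thesis using div_l[of "Z * B * exp (l * x)"] Z B by (simp add: K_def mult_ac)
 qed
 have 2: "\<bar>integral {0..L k'} ?h2\<bar> \<le> Z * \<epsilon> ^ 3 * K"
 proof -
  have "\<bar>integral {0..L k'} ?h2\<bar> \<le> Z * B * \<epsilon> * exp (l * (L k' - (L k' - x))) / l"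
  proof (rule integral_exp_bound[OF l2 l(1)])
   fix y assume "0 \<le> y" "y \<le> L k'"
   then show "\<bar>?h2 y\<bar> \<le> Z * B * \<epsilon> * exp (l * (y - (L k' - x)))"
    unfolding abs_mult mult.assoc using yT[of y] ZA(1)[of y k k'] dg[of "x + y" k'] Z
    by (intro mult_mono) (auto simp: algebra_simps)
  qed (use Z B eps in auto)
  also have "\<dots> = \<epsilon> * (Z * B * exp (l * x) / l)" by simp
  also have "\<dots> \<le> 1 * (Z * B * exp (l * x) / l)"
   using Z B eps l by (intro mult_right_mono) auto
  finally show ?thesis using div_l[of "Z * B * exp (l * x)"] Z B by (simp add: K_def mult_ac)
 qed
 have 3: "\<bar>integral {0..L k'} ?h3\<bar> \<le> 12 * Z ^ 4 * (\<epsilon>\<^sup>2 * K)"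
 proof -
  have "\<bar>integral {0..L k'} ?h3\<bar> \<le> (12 * Z ^ 3 * (\<epsilon>\<^sup>2 * K)) * \<bar>L k' - 0\<bar>"
  proof (rule integral_bound[OF l3])
   fix y assume "y \<in> {0..L k'}"
   then have y: "0 \<le> y" "y \<le> L k'" by auto
   have p: "fst (?p y) \<le> T" "snd (?p y) \<le> T" using yT[OF y] by auto
   have le: "exp (l * fst (?p y)) \<le> exp (l * x)" "exp (l * (snd (?p y) - L k')) \<le> exp (l * x)"
    using l(1) y by auto
   have E: "c * B * \<epsilon>\<^sup>2 * (exp (l * fst (?p y)) + exp (l * (snd (?p y) - L k'))) \<le> 2 * c * (\<epsilon>\<^sup>2 * K)" if "0 \<le> c" for c
   proof -
    have "c * B * \<epsilon>\<^sup>2 * (exp (l * fst (?p y)) + exp (l * (snd (?p y) - L k'))) \<le> c * B * \<epsilon>\<^sup>2 * (exp (l * x) + exp (l * x))"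
     using le that B by (intro mult_left_mono add_mono) auto
    then show ?thesis by (simp add: K_def algebra_simps)
   qed
   have "\<bar>cs U k' (?p y) - cs V k' (?p y)\<bar> \<le> 4 * Z\<^sup>2 * (\<epsilon>\<^sup>2 * K)" "\<bar>ct U k' (?p y) - ct V k' (?p y)\<bar> \<le> 4 * Z\<^sup>2 * (\<epsilon>\<^sup>2 * K)"
    using order_trans[OF d_cst(1)[OF p, of k'] E[of "2 * Z\<^sup>2"]] order_trans[OF d_cst(2)[OF p, of k'] E[of "2 * Z\<^sup>2"]]
    by simp_all
   then have u: "\<bar>A k k' y * ((cs U k' (?p y) - cs V k' (?p y)) + (ct U k' (?p y) - ct V k' (?p y)))\<bar> \<le> Z * (8 * Z\<^sup>2 * (\<epsilon>\<^sup>2 * K))"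
    unfolding abs_mult using ZA(1)[of y k k'] yT[OF y] Z by (intro mult_mono) auto
   have "\<bar>A0 k k' y * (ww U k' (?p y) - ww V k' (?p y))\<bar> \<le> Z * (4 * (\<epsilon>\<^sup>2 * K))"
    unfolding abs_mult using ZA(2)[of y k k'] yT[OF y] Z order_trans[OF d_ww[OF p, of k'] E[of 2]] by (intro mult_mono) auto
   then have "\<bar>?h3 y\<bar> \<le> Z * (8 * Z\<^sup>2 * (\<epsilon>\<^sup>2 * K)) + Z * (4 * (\<epsilon>\<^sup>2 * K))" using u by linarith
   also have "\<dots> = (8 * Z ^ 3 + 4 * Z) * (\<epsilon>\<^sup>2 * K)" by (simp add: algebra_simps power2_eq_square power3_eq_cube)
   also have "\<dots> \<le> 12 * Z ^ 3 * (\<epsilon>\<^sup>2 * K)"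
    using Z power_increasing[of 1 3 Z] K by (intro mult_right_mono) auto
   finally show "\<bar>?h3 y\<bar> \<le> 12 * Z ^ 3 * (\<epsilon>\<^sup>2 * K)" .
  qed (use Z K in auto)
  also have "\<dots> \<le> (12 * Z ^ 3 * (\<epsilon>\<^sup>2 * K)) * Z"
   using Z K L(1)[of k'] T0(3)[of k'] by (intro mult_left_mono) auto
  finally show ?thesis by (simp add: power3_eq_cube eval_nat_numeral mult_ac)
 qed
 have "\<bar>conv U k k' x - conv V k k' x\<bar> \<le> Z * \<epsilon> ^ 3 * K + Z * \<epsilon> ^ 3 * K + 12 * Z ^ 4 * (\<epsilon>\<^sup>2 * K)"
  unfolding eq using 1 2 3 by linarith
 also have "\<dots> \<le> Z ^ 4 * \<epsilon> * K + Z ^ 4 * \<epsilon> * K + 12 * Z ^ 4 * (\<epsilon> * K)"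
  using Z K e32 eps power_increasing[of 1 4 Z]
  by (intro add_mono mult_right_mono mult_mono mult_left_mono) auto
 also have "\<dots> = 14 * Z ^ 4 * (\<epsilon> * K)" by simp
 finally show ?thesis by (simp add: K_def)
qed

lemma d_vU: "\<bar>vU (Phi U) k x - vU (Phi V) k x\<bar> \<le> B / 2 * exp (l * x)"
proof (cases "0 < x \<and> x \<le> X")
 case True
 define K where "K = B * exp (l * x)"
 have K: "0 \<le> K" using B by (simp add: K_def)
 have p: "fst (x, x) \<le> T" "snd (x, x) \<le> T" using True T0 by auto
 have eK: "\<epsilon>\<^sup>2 * K \<le> \<epsilon> * K" using e32 K by (intro mult_right_mono) auto
 have each: "\<bar>(a1 k k' * gU U k' x + a2 k k' * cs U k' (x, x) + a3 k k' * ct U k' (x, x) + a4 k k' * ww U k' (x, x) + conv U k k' x)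
   - (a1 k k' * gU V k' x + a2 k k' * cs V k' (x, x) + a3 k k' * ct V k' (x, x) + a4 k k' * ww V k' (x, x) + conv V k k' x)\<bar>
   \<le> 27 * Z ^ 4 * (\<epsilon> * K)" (is "\<bar>?l\<bar> \<le> _") for k'
 proof -
  have le: "exp (l * (x - L k')) \<le> exp (l * x)" using l(1) L(1)[of k'] by simp
  have E: "c * B * \<epsilon>\<^sup>2 * (exp (l * fst (x, x)) + exp (l * (snd (x, x) - L k'))) \<le> 2 * c * (\<epsilon> * K)" if "0 \<le> c" for c
  proof -
   have "c * B * \<epsilon>\<^sup>2 * (exp (l * fst (x, x)) + exp (l * (snd (x, x) - L k'))) \<le> c * B * \<epsilon>\<^sup>2 * (exp (l * x) + exp (l * x))"
    using le that B by (intro mult_left_mono add_mono) auto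
   also have "\<dots> = 2 * c * (\<epsilon>\<^sup>2 * K)" by (simp add: K_def algebra_simps)
   also have "\<dots> \<le> 2 * c * (\<epsilon> * K)" using eK that by (intro mult_left_mono) auto
   finally show ?thesis .
  qed
  have "\<bar>gU U k' x - gU V k' x\<bar> \<le> \<epsilon> * K"
   using dg[of x k'] p mult_left_mono[OF le, of "B * \<epsilon>"] B eps by (simp add: K_def mult_ac)
  then have 1: "\<bar>a1 k k' * (gU U k' x - gU V k' x)\<bar> \<le> Z * (\<epsilon> * K)"
   unfolding abs_mult using Za(1)[of k k'] Z by (intro mult_mono) auto
  have 2: "\<bar>a2 k k' * (cs U k' (x, x) - cs V k' (x, x))\<bar> \<le> Z * (4 * Z\<^sup>2 * (\<epsilon> * K))"
   unfolding abs_mult using Za(2)[of k k'] Z order_trans[OF d_cst(1)[OF p, of k'] E[of "2 * Z\<^sup>2"]] by (intro mult_mono) auto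
  have 3: "\<bar>a3 k k' * (ct U k' (x, x) - ct V k' (x, x))\<bar> \<le> Z * (4 * Z\<^sup>2 * (\<epsilon> * K))"
   unfolding abs_mult using Za(3)[of k k'] Z order_trans[OF d_cst(2)[OF p, of k'] E[of "2 * Z\<^sup>2"]] by (intro mult_mono) auto
  have 4: "\<bar>a4 k k' * (ww U k' (x, x) - ww V k' (x, x))\<bar> \<le> Z * (4 * (\<epsilon> * K))"
   unfolding abs_mult using Za(4)[of k k'] Z order_trans[OF d_ww[OF p, of k'] E[of 2]] by (intro mult_mono) auto
  have 5: "\<bar>conv U k k' x - conv V k k' x\<bar> \<le> 14 * Z ^ 4 * (\<epsilon> * K)"
   unfolding K_def by (rule d_conv) (use True in auto)
  have eq: "?l = a1 k k' * (gU U k' x - gU V k' x) + a2 k k' * (cs U k' (x, x) - cs V k' (x, x))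
   + a3 k k' * (ct U k' (x, x) - ct V k' (x, x)) + a4 k k' * (ww U k' (x, x) - ww V k' (x, x))
   + (conv U k k' x - conv V k k' x)" by (simp add: algebra_simps)
  have "\<bar>?l\<bar> \<le> Z * (\<epsilon> * K) + Z * (4 * Z\<^sup>2 * (\<epsilon> * K)) + Z * (4 * Z\<^sup>2 * (\<epsilon> * K)) + Z * (4 * (\<epsilon> * K)) + 14 * Z ^ 4 * (\<epsilon> * K)"
   unfolding eq by (intro order_trans[OF abs_triangle_ineq] add_mono 1 2 3 4 5)
  also have "\<dots> = (5 * Z + 8 * Z ^ 3 + 14 * Z ^ 4) * (\<epsilon> * K)" by (simp add: algebra_simps power2_eq_square power3_eq_cube)
  \<comment> \<open>5 + 8 + 14 = 27, half of the 54 in \<open>small\<close>; this leaves the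
    contraction factor 1/2.\<close>
  also have "\<dots> \<le> 27 * Z ^ 4 * (\<epsilon> * K)"
   using Z power_increasing[of 1 4 Z] power_increasing[of 3 4 Z] K eps by (intro mult_right_mono) auto
  finally show ?thesis .
 qed
 have "\<bar>vU (Phi U) k x - vU (Phi V) k x\<bar> \<le> (\<Sum>k'\<in>(UNIV::'k set). 27 * Z ^ 4 * (\<epsilon> * K))"
  using True by (simp only: vU_Phi if_True simp_thms add_diff_cancel_left sum_subtractf[symmetric])
   (rule order_trans[OF sum_abs sum_mono[OF each]])
 also have "\<dots> = (54 * real CARD('k) * Z ^ 4 * \<epsilon>) * (K / 2)" by simp
 also have "\<dots> \<le> 1 * (K / 2)" using small K by (intro mult_right_mono) auto
 finally show ?thesis by (simp add: K_def)
next
 case False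
 then have "vU (Phi U) k x - vU (Phi V) k x = 0" by (auto simp: vU_Phi)
 then show ?thesis using B by simp
qed

end

lemma solution_exists: "\<exists>U. good U \<and> Phi U = U"
proof -
 have fb1: "\<exists>B\<ge>0. \<forall>k. \<bar>a k\<bar> \<le> B" for a :: "'x::finite \<Rightarrow> real"
 proof -
  obtain B where "B \<ge> 0" "\<And>k (x::unit). True \<Longrightarrow> \<bar>a k\<bar> \<le> B"
   using finite_type_bound[of "\<lambda>_ (_::unit). True" "\<lambda>p _. a p"] by blast
  then show ?thesis by blast
 qed
 have fb2: "\<exists>B\<ge>0. \<forall>k k'. \<bar>a k k'\<bar> \<le> B" for a :: "'k \<Rightarrow> 'k \<Rightarrow> real"
 proof -
  obtain B where B: "B \<ge> 0" "\<forall>p. \<bar>case_prod a p\<bar> \<le> B" using fb1[of "case_prod a"] by blast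
  have "\<bar>a k k'\<bar> \<le> B" for k k' using B(2)[rule_format, of "(k, k')"] by simp
  then show ?thesis using B(1) by blast
 qed
 have fbA: "\<exists>B\<ge>0. \<forall>k k'. \<forall>y\<in>{0..T}. \<bar>a k k' y\<bar> \<le> B" if a: "\<And>k k'. locbm (a k k')" for a :: "'k \<Rightarrow> 'k \<Rightarrow> real \<Rightarrow> real"
 proof -
  have "\<exists>B. \<forall>y\<in>{0..T}. \<bar>a k k' y\<bar> \<le> B" for k k'
  proof -
   obtain B where "\<And>x. norm x \<le> T \<Longrightarrow> \<bar>a k k' x\<bar> \<le> B" using locbm_bound[OF a] by metis
   then show ?thesis by (intro exI[of _ B]) auto
  qed
  then obtain b where b: "\<And>k k' y. y \<in> {0..T} \<Longrightarrow> \<bar>a k k' y\<bar> \<le> b k k'" by metis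
  obtain B where B: "B \<ge> 0" "\<forall>k k'. \<bar>b k k'\<bar> \<le> B" using fb2[of b] by blast
  have "\<bar>a k k' y\<bar> \<le> B" if "y \<in> {0..T}" for k k' y
   using b[OF that, of k k'] B(2)[rule_format, of k k'] by linarith
  then show ?thesis using B(1) by blast
 qed
 obtain Zm where Zm: "Zm \<ge> 0" "\<And>k p. fst p \<in> {0..T} \<and> snd p \<in> {0..T} \<Longrightarrow> \<bar>m k p\<bar> \<le> Zm"
 proof (rule finite_type_bound[of "\<lambda>k p. fst p \<in> {0..T} \<and> snd p \<in> {0..T}" m])
  fix k
  obtain B where B: "\<And>x. norm x \<le> T + T \<Longrightarrow> \<bar>m k x\<bar> \<le> B" using locbm_bound[OF locbm_continuous[OF m]] by metis
  have "\<bar>m k p\<bar> \<le> B" if "fst p \<in> {0..T} \<and> snd p \<in> {0..T}" for p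
   using that norm_Pair_le[of "fst p" "snd p"] by (intro B) auto
  then show "\<exists>B. \<forall>p. fst p \<in> {0..T} \<and> snd p \<in> {0..T} \<longrightarrow> \<bar>m k p\<bar> \<le> B" by blast
 qed blast
 obtain ZA where ZA: "ZA \<ge> 0" "\<forall>k k'. \<forall>y\<in>{0..T}. \<bar>A k k' y\<bar> \<le> ZA" using fbA[of A, OF A] by blast
 obtain ZA0 where ZA0: "ZA0 \<ge> 0" "\<forall>k k'. \<forall>y\<in>{0..T}. \<bar>A0 k k' y\<bar> \<le> ZA0" using fbA[of A0, OF A0] by blast
 obtain Z1 where Z1: "Z1 \<ge> 0" "\<forall>k k'. \<bar>a1 k k'\<bar> \<le> Z1" using fb2 by blast
 obtain Z2 where Z2: "Z2 \<ge> 0" "\<forall>k k'. \<bar>a2 k k'\<bar> \<le> Z2" using fb2 by blast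
 obtain Z3 where Z3: "Z3 \<ge> 0" "\<forall>k k'. \<bar>a3 k k'\<bar> \<le> Z3" using fb2 by blast
 obtain Z4 where Z4: "Z4 \<ge> 0" "\<forall>k k'. \<bar>a4 k k'\<bar> \<le> Z4" using fb2 by blast
 obtain Zb where Zb: "Zb \<ge> 0" "\<forall>k. \<bar>bet k\<bar> \<le> Zb" using fb1 by blast
 obtain Zr where Zr: "Zr \<ge> 0" "\<forall>k. \<bar>rb k\<bar> \<le> Zr" using fb1 by blast
 \<comment> \<open>One constant above all coefficient bounds and above 1, so that lower powers of Z
   may be replaced by Z^4.\<close>
 define Z where "Z = 1 + T + Zm + ZA + ZA0 + Z1 + Z2 + Z3 + Z4 + Zb + Zr"
 have Zle: "1 \<le> Z" "T \<le> Z" "Zm \<le> Z" "ZA \<le> Z" "ZA0 \<le> Z" "Z1 \<le> Z" "Z2 \<le> Z" "Z3 \<le> Z" "Z4 \<le> Z" "Zb \<le> Z" "Zr \<le> Z"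
  unfolding Z_def using T0(1) Zm(1) ZA(1) ZA0(1) Z1(1) Z2(1) Z3(1) Z4(1) Zb(1) Zr(1) by linarith+
 define D where "D = 54 * real CARD('k) * Z ^ 4"
 have D: "D \<ge> 1"
 proof -
  have "1 * 1 * 1 \<le> 54 * real CARD('k) * Z ^ 4"
   using Zle(1) by (intro mult_mono) (auto simp: Suc_leI)
  then show ?thesis by (simp add: D_def)
 qed
 \<comment> \<open>With this choice \<open>small\<close> holds with equality.\<close>
 define \<epsilon> where "\<epsilon> = 1 / D"
 have eps: "0 < \<epsilon>" "\<epsilon> \<le> 1" "D * \<epsilon> = 1" using D by (auto simp: \<epsilon>_def)
 define Lm where "Lm = Min (insert 1 (range L))"
 have Lm: "0 < Lm" "Lm \<le> 1" using L(1) by (auto simp: Lm_def)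
 have Lm3: "Lm \<le> L k" for k unfolding Lm_def by (intro Min_le) auto
 \<comment> \<open>Since Lm is at most 1 and at most every L k, one has 1/l = \<epsilon>^3 Lm \<le>
   \<epsilon>^3 and l L k \<ge> 1/\<epsilon>^3, whence exp (- l L k) \<le> \<epsilon>^3 by exp u
   \<ge> u.\<close>
 define l where "l = 1 / (\<epsilon> ^ 3 * Lm)"
 have l: "l > 0" using eps Lm by (simp add: l_def)
 have l1: "1 / l \<le> \<epsilon> ^ 3" using eps Lm by (simp add: l_def mult_left_le)
 have l2: "exp (- l * L k) \<le> \<epsilon> ^ 3" for k
 proof -
  have "1 / \<epsilon> ^ 3 \<le> l * L k" using eps Lm(1) Lm3[of k] by (simp add: l_def field_simps)
  also have "\<dots> \<le> exp (l * L k)" using exp_ge_add_one_self[of "l * L k"] by linarith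
  finally show ?thesis using eps by (simp add: exp_minus field_simps)
 qed
 \<comment> \<open>Clamping the arguments to [0, T] bounds the weights from above and away from 0 on
   the whole line; outside of this range the differences of images under \<open>Phi\<close> vanish
   or are constant.\<close>
 define cl where "cl x = max 0 (min x T)" for x
 have cl: "0 \<le> cl x" "cl x \<le> T" "0 \<le> x \<Longrightarrow> x \<le> T \<Longrightarrow> cl x = x" for x using T0 by (auto simp: cl_def)
 define W :: "'k fld" where "W = case_sum (\<lambda>(k, x). exp (l * cl x)) (case_sum (\<lambda>(k, t). \<epsilon> * exp (l * (cl t - L k)))
  (\<lambda>(k, p). \<epsilon>\<^sup>2 * (exp (l * cl (fst p)) + exp (l * (cl (snd p) - L k)))))"
 have W1: "W (Inl (k, x)) = exp (l * cl x)" and W2: "W (Inr (Inl (k, t))) = \<epsilon> * exp (l * (cl t - L k))"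
  and W3: "W (Inr (Inr (k, p))) = \<epsilon>\<^sup>2 * (exp (l * cl (fst p)) + exp (l * (cl (snd p) - L k)))" for k x t p
  by (simp_all add: W_def split: prod.split)
 have cases: "Q y" if "\<And>k x. Q (Inl (k, x))" "\<And>k t. Q (Inr (Inl (k, t)))" "\<And>k p. Q (Inr (Inr (k, p)))"
  for Q and y :: "('k \<times> real) + (('k \<times> real) + ('k \<times> real \<times> real))"
  using that by (metis sumE surj_pair)
 have e2: "\<epsilon>\<^sup>2 \<le> \<epsilon>" "\<epsilon>\<^sup>2 \<le> 1" "0 < \<epsilon>\<^sup>2" using eps power_decreasing[of 1 2 \<epsilon>] power_decreasing[of 0 2 \<epsilon>] by auto
 have ex: "exp (l * cl x) \<le> exp (l * T)" "exp (l * (cl x - L k)) \<le> exp (l * T)" for x k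
  using l cl(2)[of x] L(1)[of k] by auto
 have ex': "1 \<le> exp (l * cl x)" "exp (- l * T) \<le> exp (l * (cl x - L k))" for x k
 proof -
  show "1 \<le> exp (l * cl x)" using l cl(1)[of x] by simp
  have "l * (- T) \<le> l * (cl x - L k)" using l cl(1)[of x] T0(3)[of k] by (intro mult_left_mono) auto
  then show "exp (- l * T) \<le> exp (l * (cl x - L k))" by simp
 qed
 have Wlow: "\<epsilon>\<^sup>2 * exp (- l * T) \<le> W y" for y
 proof (rule cases[of "\<lambda>y. \<epsilon>\<^sup>2 * exp (- l * T) \<le> W y"])
  have E1: "exp (- l * T) \<le> 1" using l T0 by simp
  have "\<epsilon>\<^sup>2 * exp (- l * T) \<le> 1 * 1" using E1 e2 by (intro mult_mono) auto
  then show "\<epsilon>\<^sup>2 * exp (- l * T) \<le> W (Inl (k, x))" for k x unfolding W1 using ex'(1)[of x] by linarith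
  show "\<epsilon>\<^sup>2 * exp (- l * T) \<le> W (Inr (Inl (k, t)))" for k t
   unfolding W2 using ex'(2) e2 eps by (intro mult_mono) auto
  show "\<epsilon>\<^sup>2 * exp (- l * T) \<le> W (Inr (Inr (k, p)))" for k p
   unfolding W3 using ex'(2)[of "snd p" k] e2 by (intro mult_left_mono) (auto intro: order_trans add_increasing)
 qed
 have low: "0 < \<epsilon>\<^sup>2 * exp (- l * T)" using e2 by simp
 obtain B0 where B0: "B0 \<ge> 0" "\<And>y. \<bar>Phi (\<lambda>_. 0) y\<bar> \<le> B0" using Phi_bounded[OF good_zero] by blast
 show ?thesis
 proof (rule picard_fixpoint[where W=W and M="2 * exp (l * T)" and Ua="\<lambda>_. 0" and Ba="B0 / (\<epsilon>\<^sup>2 * exp (- l * T))"])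
  show "0 < W y" for y using Wlow[of y] low by linarith
  show "W y \<le> 2 * exp (l * T)" for y
  proof (rule cases[of "\<lambda>y. W y \<le> 2 * exp (l * T)"])
   show "W (Inl (k, x)) \<le> 2 * exp (l * T)" for k x
    unfolding W1 using ex(1)[of x] exp_gt_zero[of "l * T"] by linarith
   show "W (Inr (Inl (k, x))) \<le> 2 * exp (l * T)" for k x
    unfolding W2 using ex(2)[of x] eps by (intro mult_mono) auto
   show "W (Inr (Inr (k, p))) \<le> 2 * exp (l * T)" for k p
   proof -
    have "W (Inr (Inr (k, p))) \<le> 1 * (exp (l * T) + exp (l * T))"
     unfolding W3 using ex e2 by (intro mult_mono add_mono) auto
    then show ?thesis by simp
   qed
  qed
  show "good (Phi U)" if "good U" for U using good_Phi[OF that] .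
  show "good (\<lambda>_. 0)" by (rule good_zero)
  show "0 \<le> B0 / (\<epsilon>\<^sup>2 * exp (- l * T))" using B0(1) by simp
  show "\<bar>Phi (\<lambda>_. 0) y - 0\<bar> \<le> B0 / (\<epsilon>\<^sup>2 * exp (- l * T)) * W y" for y
  proof -
   have "B0 = B0 / (\<epsilon>\<^sup>2 * exp (- l * T)) * (\<epsilon>\<^sup>2 * exp (- l * T))" using eps(1) by simp
   also have "\<dots> \<le> B0 / (\<epsilon>\<^sup>2 * exp (- l * T)) * W y" using B0(1) low by (intro mult_left_mono Wlow) auto
   finally show ?thesis using B0(2)[of y] by simp
  qed
  show "good U" if "\<And>n. good (u n)" "uniform_limit UNIV u U sequentially" for u U
   using good_uniform_limit[OF that] .
  fix U V B y
  assume U: "good U" and V: "good V" and B: "0 \<le> B" and d: "\<And>y. \<bar>U y - V y\<bar> \<le> B * W y"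
  have dv: "\<bar>vU U k x - vU V k x\<bar> \<le> B * exp (l * x)" if "x \<le> T" for k x
   using d[of "Inl (k, x)"] cl(3)[OF _ that] v_0[OF U, of x k] v_0[OF V, of x k] B
   by (cases "x \<le> 0") (auto simp: W1 vU_def)
  have dg: "\<bar>gU U k t - gU V k t\<bar> \<le> B * \<epsilon> * exp (l * (t - L k))" if "t \<le> T" for k t
   using d[of "Inr (Inl (k, t))"] cl(3)[OF _ that] g_0[OF U, of t k] g_0[OF V, of t k] B eps L(1)[of k]
   by (cases "t \<le> 2 * L k") (auto simp: W2 gU_def mult.assoc)
  have dC: "\<bar>CU U k p - CU V k p\<bar> \<le> B * \<epsilon>\<^sup>2 * (exp (l * fst p) + exp (l * (snd p - L k)))"
   if "fst p \<le> T" "snd p \<le> T" for k p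
   using d[of "Inr (Inr (k, p))"] cl(3)[OF _ that(1)] cl(3)[OF _ that(2)] C_0[OF U, of p k] C_0[OF V, of p k] B e2
   by (cases "fst p \<le> 0 \<or> snd p \<le> 0") (auto simp: W3 CU_def mult.assoc)
  have le: "\<bar>c\<bar> \<le> Z" if "\<bar>c\<bar> \<le> Z'" "Z' \<le> Z" for c Z' using that by linarith
  have pZ: "\<bar>m k p\<bar> \<le> Z" if "fst p \<in> {0..T}" "snd p \<in> {0..T}" for k p
   by (rule le[OF _ Zle(3)]) (use Zm(2) that in blast)
  have pA: "\<bar>A k k' y\<bar> \<le> Z" "\<bar>A0 k k' y\<bar> \<le> Z" if "y \<in> {0..T}" for k k' y
   using that by (auto intro!: le[OF ZA(2)[rule_format] Zle(4)] le[OF ZA0(2)[rule_format] Zle(5)])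
  have pa: "\<bar>a1 k k'\<bar> \<le> Z" "\<bar>a2 k k'\<bar> \<le> Z" "\<bar>a3 k k'\<bar> \<le> Z" "\<bar>a4 k k'\<bar> \<le> Z" "\<bar>bet k\<bar> \<le> Z" "\<bar>rb k\<bar> \<le> Z" for k k'
   by (rule le[OF Z1(2)[rule_format] Zle(6)] le[OF Z2(2)[rule_format] Zle(7)] le[OF Z3(2)[rule_format] Zle(8)]
     le[OF Z4(2)[rule_format] Zle(9)] le[OF Zb(2)[rule_format] Zle(10)] le[OF Zr(2)[rule_format] Zle(11)])+
  have sm: "54 * real CARD('k) * Z ^ 4 * \<epsilon> \<le> 1" using eps(3) by (simp add: D_def)
  note pre = U V B l l1 l2 eps(1,2) Zle(1,2) pZ pA pa sm
  show "\<bar>Phi U y - Phi V y\<bar> \<le> B / 2 * W y"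
  proof (rule cases[of "\<lambda>y. \<bar>Phi U y - Phi V y\<bar> \<le> B / 2 * W y"])
   show "\<bar>Phi U (Inl (k, x)) - Phi V (Inl (k, x))\<bar> \<le> B / 2 * W (Inl (k, x))" for k x
   proof (cases "0 < x \<and> x \<le> X")
    case True
    have "\<bar>vU (Phi U) k x - vU (Phi V) k x\<bar> \<le> B / 2 * exp (l * x)"
     using pre dv dg dC by (rule d_vU)
    then show ?thesis using True cl(3)[of x] T0 by (simp add: W1 vU_def)
   next
    case False
    then have "vU (Phi U) k x - vU (Phi V) k x = 0" by (auto simp: vU_Phi)
    then show ?thesis using B by (simp add: W1 vU_def)
   qed
   show "\<bar>Phi U (Inr (Inl (k, t))) - Phi V (Inr (Inl (k, t)))\<bar> \<le> B / 2 * W (Inr (Inl (k, t)))" for k t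
   proof (cases "2 * L k < t \<and> t \<le> T")
    case True
    then have tT: "t \<le> T" by simp
    have "\<bar>gU (Phi U) k t - gU (Phi V) k t\<bar> \<le> B / 2 * (\<epsilon> * exp (l * (t - L k)))"
     using pre dv dg dC tT by (rule d_gU)
    then show ?thesis using True cl(3)[of t] L(1)[of k] by (simp add: W2 gU_def)
   next
    case False
    then have "gU (Phi U) k t - gU (Phi V) k t = 0" by (auto simp: gU_Phi)
    then show ?thesis using B eps by (simp add: W2 gU_def)
   qed
   show "\<bar>Phi U (Inr (Inr (k, p))) - Phi V (Inr (Inr (k, p)))\<bar> \<le> B / 2 * W (Inr (Inr (k, p)))" for k p
   proof (cases "fst p \<le> 0 \<or> snd p \<le> 0")
    case True
    then have "CU (Phi U) k p - CU (Phi V) k p = 0"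
     using C_0[OF good_Phi[OF U]] C_0[OF good_Phi[OF V]] by simp
    then show ?thesis using B e2 by (simp add: W3 CU_def)
   next
    case False
    let ?p = "(min (fst p) T, min (snd p) T)"
    have pT: "fst ?p \<le> T" "snd ?p \<le> T" by auto
    have "\<bar>CU (Phi U) k ?p - CU (Phi V) k ?p\<bar> \<le> B / 2 * (\<epsilon>\<^sup>2 * (exp (l * fst ?p) + exp (l * (snd ?p - L k))))"
     using pre dv dg dC pT by (rule d_CU)
    moreover have "cl (fst p) = fst ?p" "cl (snd p) = snd ?p" using False T0 by (auto simp: cl_def)
    ultimately show ?thesis
     using CU_Phi_cut[OF U, of k p] CU_Phi_cut[OF V, of k p]
     by (simp add: W3 CU_def)
   qed
  qed
 qed
qed

end

section \<open>Differentiability of the fixed point off the exceptional characteristics\<close>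

text \<open>Only one of the two partial derivatives has to be continuous, and only at the point; the
  other one enters on a single line. For C the continuous one is \<open>ct\<close>.\<close>

lemma has_derivative_from_partials:
 fixes f :: "real \<times> real \<Rightarrow> real"
 assumes fx: "((\<lambda>x. f (x, b)) has_real_derivative p) (at a)"
  and fy: "\<And>x y. y \<in> Y \<Longrightarrow> ((\<lambda>y. f (x, y)) has_real_derivative q (x, y)) (at y)"
  and Y: "open Y" "convex Y" "b \<in> Y" and c: "isCont q (a, b)"
 shows "(f has_derivative (\<lambda>d. p * fst d + q (a, b) * snd d)) (at (a, b))"
proof -
 have id: "blinfun_apply (c *\<^sub>R id_blinfun) = (*) c" for c :: real
  by (auto simp: scaleR_blinfun.rep_eq)
 have "((\<lambda>(x, y). f (x, y)) has_derivative (\<lambda>(tx, ty). p * tx + blinfun_apply (q (a, b) *\<^sub>R id_blinfun) ty))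
   (at (a, b) within UNIV \<times> Y)"
 proof (rule has_derivative_partialsI[where fy="\<lambda>x y. q (x, y) *\<^sub>R id_blinfun"])
  show "((\<lambda>x. f (x, b)) has_derivative (*) p) (at a)" using fx by (simp add: has_field_derivative_def)
  show "((\<lambda>y. f (x, y)) has_derivative blinfun_apply (q (x, y) *\<^sub>R id_blinfun)) (at y within Y)" if "y \<in> Y" for x y
   using has_field_derivative_at_within[OF fy[OF that], of x Y]
   by (simp add: has_field_derivative_def id)
  show "continuous (at (a, b) within UNIV \<times> Y) (\<lambda>(x, y). q (x, y) *\<^sub>R (id_blinfun :: real \<Rightarrow>\<^sub>L real))"
   using continuous_at_imp_continuous_at_within[OF c, of "UNIV \<times> Y"]
   by (simp add: case_prod_beta' continuous_intros)
 qed (use Y in auto)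
 moreover have "at (a, b) within UNIV \<times> Y = at (a, b)"
  by (rule at_within_open) (use Y in \<open>auto intro: open_Times\<close>)
 ultimately show ?thesis by (simp add: case_prod_beta' scaleR_blinfun.rep_eq)
qed

lemma gap_around:
 fixes S :: "real set"
 assumes "finite S" "x \<notin> S"
 obtains I where "open I" "convex I" "bounded I" "connected I" "x \<in> I" "I \<inter> S = {}"
proof -
 let ?I = "cell S {s\<in>S. s < x} \<inter> {x - 1<..<x + 1}"
 have c: "connected ?I" unfolding connected_iff_interval using cell_convex[of _ S] by auto
 then have "convex ?I" using is_interval_connected_1 is_interval_convex_1 by blast
 moreover have "bounded ?I" by (rule bounded_subset[of "{x-1..x+1}"]) auto
 moreover have "?I \<inter> S = {}" using cell_disjoint by blast
 moreover have "open ?I" "x \<in> ?I" using open_cell[OF assms(1)] cell_self[OF assms(2)] by auto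
 ultimately show ?thesis using that c by blast
qed

definition locally_const :: "real set \<Rightarrow> (real \<Rightarrow> real) \<Rightarrow> bool" where
 "locally_const S f \<longleftrightarrow> (\<forall>I x y. connected I \<and> I \<inter> S = {} \<and> x \<in> I \<and> y \<in> I \<longrightarrow> f x = f y)"

lemma locally_const_pc: "locally_const S f \<Longrightarrow> pc S f"
proof (rule pcI_ext)
 fix I assume f: "locally_const S f" and I: "connected I" "bounded I" "I \<inter> S = {}"
 show "\<exists>h. continuous_on UNIV h \<and> (\<forall>x\<in>I. f x = h x)"
 proof (cases "I = {}")
  case False
  then obtain a where "a \<in> I" by blast
  then have "\<forall>x\<in>I. f x = f a" using f I unfolding locally_const_def by blast
  then show ?thesis by (intro exI[of _ "\<lambda>_. f a"]) auto
 qed auto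
qed

lemma locally_const_deriv:
 assumes f: "locally_const S f" and S: "finite S" "x \<notin> S"
 shows "(f has_real_derivative 0) (at x)"
proof -
 obtain I where I: "open I" "connected I" "x \<in> I" "I \<inter> S = {}" using gap_around[OF S] by metis
 have "((\<lambda>_. f x) has_real_derivative 0) (at x)" by simp
 then show ?thesis
  by (rule has_field_derivative_transform_within_open[OF _ I(1,3)])
   (use f I in \<open>unfold locally_const_def, blast\<close>)
qed

text \<open>Local constancy of the jump parts makes \<open>vU\<close> and \<open>gU\<close> the
  derivatives of f and g off S.\<close>

locale row_sol = row +
 fixes U
 assumes U: "good U" and fixp: "Phi U = U"
  and fJc: "\<And>k. locally_const S (fJ k)" and gJc: "\<And>k. locally_const S (gJ k)"
begin

lemma CU_eq: "CU U k p = integral {0..fst p} (\<lambda>\<sigma>. cs U k (\<sigma>, snd p))"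
 using CU_Phi[of U k p] by (simp add: fixp)

text \<open>Fubini turns the primitive of \<open>cs\<close> in s into the primitive of
  \<open>ct\<close> in t; this form shows that the derivative of C in t is
  \<open>ct\<close>.\<close>

lemma CU_eq': "CU U k p = integral {0..snd p} (\<lambda>\<tau>. ct U k (fst p, \<tau>))"
 unfolding CU_eq cs_def ct_def fst_conv snd_conv by (rule integral_swap_locbm[OF hh_locbm[OF U]])

lemma vU_eq: "0 < x \<Longrightarrow> x \<le> X \<Longrightarrow> vU U k x = e k x + (\<Sum>k'\<in>UNIV. a1 k k' * gU U k' x
    + a2 k k' * cs U k' (x, x) + a3 k k' * ct U k' (x, x) + a4 k k' * ww U k' (x, x) + conv U k k' x)"
 using vU_Phi[of U k x] by (simp add: fixp)

lemma gU_eq: "2 * L k < t \<Longrightarrow> t \<le> T \<Longrightarrow> gU U k t = bet k * (vU U k (t - 2 * L k) + cs U k (t - 2 * L k, t)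
     - ct U k (t - 2 * L k, t) - rb k * ww U k (t - 2 * L k, t))"
 using gU_Phi[of U k t] by (simp add: fixp)

lemma cs_0: "fst p \<le> 0 \<or> snd p \<le> 0 \<Longrightarrow> cs U k p = 0"
 and ct_0: "fst p \<le> 0 \<or> snd p \<le> 0 \<Longrightarrow> ct U k p = 0"
 using hh_0[OF U] by (cases "fst p = 0"; cases "snd p = 0"; auto simp: cs_def ct_def)+

lemma ff_deriv: "s \<notin> S \<Longrightarrow> (ff U k has_real_derivative vU U k s) (at s)"
 unfolding ff_def
 using DERIV_add[OF locally_const_deriv[OF fJc finS] integral0_has_derivative[OF v_locbm[OF U] v_0[OF U] pc_isCont[OF v_pc[OF U] finS]]]
 by simp

lemma gg_deriv: "t \<notin> S \<Longrightarrow> (gg U k has_real_derivative gU U k t) (at t)"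
proof -
 assume t: "t \<notin> S"
 have "gU U k x = 0" if "x \<le> 0" for x using g_0[OF U] L(1)[of k] that by simp
 then show ?thesis unfolding gg_def
  using DERIV_add[OF locally_const_deriv[OF gJc finS t] integral0_has_derivative[OF g_locbm[OF U] _ pc_isCont[OF g_pc[OF U] finS t]]]
  by simp
qed

lemma CU_deriv:
 assumes cs: "isCont (cs U k) (s, t)" and t: "t \<notin> S"
 shows "(CU U k has_derivative (\<lambda>d. cs U k (s, t) * fst d + ct U k (s, t) * snd d)) (at (s, t))"
proof -
 obtain Y where Y: "open Y" "convex Y" "t \<in> Y" "Y \<inter> S = {}" using gap_around[OF finS t] by metis
 show ?thesis
 proof (rule has_derivative_from_partials[OF _ _ Y(1-3)])
  have "locbm (\<lambda>\<sigma>. cs U k (\<sigma>, t))" by (rule locbm_compose[OF cs_locbm[OF U]]) (intro continuous_intros)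
  moreover have "isCont (\<lambda>\<sigma>. cs U k (\<sigma>, t)) s"
   by (rule isCont_o2[of s "\<lambda>\<sigma>. (\<sigma>, t)" "cs U k"]) (use cs in \<open>auto intro!: continuous_intros\<close>)
  ultimately have "((\<lambda>s. integral {0..s} (\<lambda>\<sigma>. cs U k (\<sigma>, t))) has_real_derivative cs U k (s, t)) (at s)"
   by (intro integral0_has_derivative) (auto simp: cs_0)
  then show "((\<lambda>x. CU U k (x, t)) has_real_derivative cs U k (s, t)) (at s)" by (simp add: CU_eq)
  fix x y assume y: "y \<in> Y"
  have "locbm (\<lambda>\<tau>. ct U k (x, \<tau>))" by (rule locbm_compose[OF ct_locbm[OF U]]) (intro continuous_intros)
  moreover have "isCont (\<lambda>\<tau>. ct U k (x, \<tau>)) y"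
   by (rule isCont_o2[of y "\<lambda>\<tau>. (x, \<tau>)" "ct U k"])
    (use y Y(4) in \<open>auto intro!: continuous_intros ct_isCont[OF U]\<close>)
  ultimately have "((\<lambda>t. integral {0..t} (\<lambda>\<tau>. ct U k (x, \<tau>))) has_real_derivative ct U k (x, y)) (at y)"
   by (intro integral0_has_derivative) (auto simp: ct_0)
  then show "((\<lambda>y. CU U k (x, y)) has_real_derivative ct U k (x, y)) (at y)" by (simp add: CU_eq')
 qed (use t ct_isCont[OF U] in auto)
qed

text \<open>At s = 0 the cut-off switches \<open>hh\<close> on, but f and C vanish there; if f is
  continuous at 0 and g is absent, \<open>hh\<close> tends to 0 and is continuous across. The
  diagonal entries of Q need this, since their diagonal is s = 0.\<close>

lemma cs_isCont_0:
 assumes gg: "\<And>t. gg U k t = 0" and f: "isCont (ff U k) 0"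
 shows "isCont (cs U k) (0, t)"
proof -
 have "isCont (\<lambda>p. integral {0..snd p} (\<lambda>\<tau>. (\<lambda>q. hh U k (fst (fst q), snd q)) (p, \<tau>))) (0, t)"
 proof (rule isCont_param_integral[where N="{}"])
  show "locbm (\<lambda>q::(real \<times> real) \<times> real. hh U k (fst (fst q), snd q))"
   by (rule locbm_compose[OF hh_locbm[OF U]]) (intro continuous_intros)
  show "isCont (\<lambda>q. hh U k (fst (fst (q, \<tau>)), snd (q, \<tau>))) (0, t)" for \<tau>
  proof -
   let ?W = "\<lambda>s. m k (s, \<tau>) * (ff U k s + CU U k (s, \<tau>))"
   have W0: "?W 0 = 0" using ff_0[OF U, of 0] C_0[OF U, of "(0, \<tau>)"] by simp
   have "isCont ?W 0"
    using f continuous_on_eq_continuous_at[OF open_UNIV, THEN iffD1, OF C_cont[OF U, of k], THEN bspec, of "(0, \<tau>)"]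
     continuous_on_eq_continuous_at[OF open_UNIV, THEN iffD1, OF m[of k], THEN bspec, of "(0, \<tau>)"]
    by (intro continuous_intros isCont_o2[of 0 "\<lambda>s. (s, \<tau>)" "m k"] isCont_o2[of 0 "\<lambda>s. (s, \<tau>)" "CU U k"]) auto
   then have lim: "(?W \<longlongrightarrow> 0) (at 0)" using W0 unfolding isCont_def by simp
   have "\<bar>hh U k (s, \<tau>)\<bar> \<le> \<bar>?W s\<bar>" for s by (simp add: hh_def ww_def gg)
   then have "((\<lambda>s. hh U k (s, \<tau>)) \<longlongrightarrow> 0) (at 0)"
    by (intro Lim_null_comparison[OF _ tendsto_rabs_zero[OF lim]]) auto
   then have "isCont (\<lambda>s. hh U k (s, \<tau>)) 0" using hh_0[OF U, of "(0, \<tau>)"] by (simp add: isCont_def)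
   then show ?thesis by (auto intro!: isCont_o2[of "(0, t)" fst "\<lambda>s. hh U k (s, \<tau>)"])
  qed
 qed auto
 then show ?thesis by (simp add: cs_def[abs_def])
qed

text \<open>The kernel without its jump parts. It is continuous and is the primitive of
  \<open>wx\<close> along lines of constant y, which the kernel itself need not be.\<close>

definition wr :: "'a \<Rightarrow> real \<times> real \<Rightarrow> real" where
 "wr k p = integral {0..fst p} (vU U k) + integral {0..snd p} (gU U k) + CU U k p"

lemma ww_wr: "ww U k p = fJ k (fst p) + gJ k (snd p) + wr k p"
 by (simp add: ww_def ff_def gg_def wr_def)

lemma wr_cont: "continuous_on UNIV (wr k)"
 unfolding wr_def
 by (intro continuous_intros C_cont[OF U] continuous_on_compose2[OF continuous_on_integral0[OF v_locbm[OF U]]]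
  continuous_on_compose2[OF continuous_on_integral0[OF g_locbm[OF U]]]) auto

text \<open>The fundamental theorem on a line of constant y, for a continuous function
  differentiable off a finite set. At \<xi> = 0 the point is (- y, y): there the parts from f and C
  vanish because - y \<le> 0, and the part from g because y \<le> 2 L k.\<close>

lemma wr_line:
 assumes y: "0 \<le> y" "y \<le> L k" and x: "0 \<le> x"
 shows "integral {0..x} (\<lambda>\<xi>. wx U k (\<xi> - y, \<xi> + y)) = wr k (x - y, x + y)"
proof -
 let ?N = "(\<lambda>s. s + y) ` S \<union> (\<lambda>s. s - y) ` S"
 have "((\<lambda>\<xi>. wx U k (\<xi> - y, \<xi> + y)) has_integral (wr k (x - y, x + y) - wr k (0 - y, 0 + y))) {0..x}"
 proof (rule fundamental_theorem_of_calculus_strong[of ?N])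
  show "finite ?N" using finS by simp
  show "continuous_on {0..x} (\<lambda>\<xi>. wr k (\<xi> - y, \<xi> + y))"
   by (intro continuous_on_compose2[OF wr_cont] continuous_intros) auto
  fix \<xi> assume "\<xi> \<in> {0..x} - ?N"
  then have n: "\<xi> - y \<notin> S" "\<xi> + y \<notin> S" by (auto simp: image_iff)
  let ?f = "\<lambda>s. integral {0..s} (vU U k)" and ?g = "\<lambda>s. integral {0..s} (gU U k)"
  have gz: "gU U k x = 0" if "x \<le> 0" for x using g_0[OF U] L(1)[of k] that by simp
  have f: "(?f has_real_derivative vU U k (\<xi> - y)) (at (\<xi> - y))"
   by (rule integral0_has_derivative[OF v_locbm[OF U] v_0[OF U] pc_isCont[OF v_pc[OF U] finS n(1)]]) auto
  have g: "(?g has_real_derivative gU U k (\<xi> + y)) (at (\<xi> + y))"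
   by (rule integral0_has_derivative[OF g_locbm[OF U] gz pc_isCont[OF g_pc[OF U] finS n(2)]]) auto
  have f': "((\<lambda>\<xi>. ?f (\<xi> - y)) has_real_derivative vU U k (\<xi> - y)) (at \<xi>)"
   using f DERIV_shift[of ?f "vU U k (\<xi> - y)" \<xi> "- y"] by simp
  have g': "((\<lambda>\<xi>. ?g (\<xi> + y)) has_real_derivative gU U k (\<xi> + y)) (at \<xi>)"
   using g DERIV_shift[of ?g "gU U k (\<xi> + y)" \<xi> y] by simp
  have C: "(CU U k has_derivative (\<lambda>d. cs U k (\<xi> - y, \<xi> + y) * fst d + ct U k (\<xi> - y, \<xi> + y) * snd d)) (at (\<xi> - y, \<xi> + y))"
   by (rule CU_deriv) (use n cs_isCont[OF U] in auto)
  have l: "((\<lambda>\<xi>. (\<xi> - y, \<xi> + y)) has_derivative (\<lambda>h. (h, h))) (at \<xi>)"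
   by (auto intro!: derivative_eq_intros)
  have "((\<lambda>\<xi>. CU U k (\<xi> - y, \<xi> + y)) has_derivative (\<lambda>h. cs U k (\<xi> - y, \<xi> + y) * h + ct U k (\<xi> - y, \<xi> + y) * h)) (at \<xi>)"
   using has_derivative_compose[OF l C] by simp
  then have C': "((\<lambda>\<xi>. CU U k (\<xi> - y, \<xi> + y)) has_real_derivative (cs U k (\<xi> - y, \<xi> + y) + ct U k (\<xi> - y, \<xi> + y))) (at \<xi>)"
   unfolding has_field_derivative_def by (rule has_derivative_eq_rhs) (simp add: fun_eq_iff distrib_right)
  have "((\<lambda>\<xi>. wr k (\<xi> - y, \<xi> + y)) has_real_derivative wx U k (\<xi> - y, \<xi> + y)) (at \<xi>)"
   using DERIV_add[OF DERIV_add[OF f' g'] C'] by (simp add: wr_def wx_def add.assoc)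
  then show "((\<lambda>\<xi>. wr k (\<xi> - y, \<xi> + y)) has_vector_derivative wx U k (\<xi> - y, \<xi> + y)) (at \<xi>)"
   by (simp add: has_real_derivative_iff_has_vector_derivative)
 qed (use x in auto)
 moreover have "wr k (0 - y, 0 + y) = 0"
 proof -
  have "integral {0..y} (gU U k) = integral {0..y} (\<lambda>_. 0)"
   by (rule integral_cong) (use g_0[OF U] y L(1)[of k] in auto)
  moreover have "integral {0..-y} (vU U k) = 0" using y by (cases "y = 0") auto
  ultimately show ?thesis using C_0[OF U, of "(- y, y)"] y by (simp add: wr_def)
 qed
 ultimately show ?thesis by (simp add: integral_unique)
qed

text \<open>Integrating the differentiated convolution in x gives back the convolution of the
  continuous part: Fubini, then \<open>wr_line\<close> for each y. The jump parts are restored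
  separately.\<close>

lemma conv_line:
 assumes B: "locbm B" and x: "0 \<le> x"
 shows "integral {0..x} (\<lambda>\<xi>. integral {0..L k} (\<lambda>y. B y * wx U k (\<xi> - y, \<xi> + y)))
   = integral {0..L k} (\<lambda>y. B y * wr k (x - y, x + y))"
proof -
 let ?h = "\<lambda>q::real \<times> real. B (snd q) * wx U k (fst q - snd q, fst q + snd q)"
 have h: "locbm ?h"
  by (intro locbm_mult locbm_compose[OF B] locbm_compose[OF wx_locbm[OF U]] continuous_intros)
 have "integral {0..x} (\<lambda>\<xi>. integral {0..L k} (\<lambda>y. ?h (\<xi>, y))) = integral {0..L k} (\<lambda>y. integral {0..x} (\<lambda>\<xi>. ?h (\<xi>, y)))"
  by (rule integral_swap_locbm[OF h])
 also have "\<dots> = integral {0..L k} (\<lambda>y. B y * wr k (x - y, x + y))"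
  by (rule integral_cong) (use wr_line x in auto)
 finally show ?thesis by simp
qed

lemma conv_locbm:
 assumes B: "locbm B"
 shows "locbm (\<lambda>x. integral {0..L k} (\<lambda>y. B y * wx U k (x - y, x + y)))"
proof -
 have "locbm (\<lambda>q::real \<times> real. B (snd q) * wx U k (fst q - snd q, fst q + snd q))"
  by (intro locbm_mult locbm_compose[OF B] locbm_compose[OF wx_locbm[OF U]] continuous_intros)
 from locbm_compose[OF locbm_integral[OF this], of "\<lambda>x. (x, L k)"]
 show ?thesis by (simp add: continuous_intros)
qed

lemma ww_deriv:
 assumes "s \<notin> S" "t \<notin> S"
 shows "(ww U k has_derivative (\<lambda>d. (vU U k s + cs U k (s, t)) * fst d + (gU U k t + ct U k (s, t)) * snd d)) (at (s, t))"
proof -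
 have f: "((\<lambda>p. ff U k (fst p)) has_derivative (\<lambda>d. vU U k s * fst d)) (at (s, t))"
  using has_derivative_compose[of fst fst "(s, t)" UNIV "ff U k" "(*) (vU U k s)"] ff_deriv[OF assms(1), of k]
  by (simp add: has_field_derivative_def has_derivative_fst)
 have g: "((\<lambda>p. gg U k (snd p)) has_derivative (\<lambda>d. gU U k t * snd d)) (at (s, t))"
  using has_derivative_compose[of snd snd "(s, t)" UNIV "gg U k" "(*) (gU U k t)"] gg_deriv[OF assms(2), of k]
  by (simp add: has_field_derivative_def has_derivative_snd)
 have C: "(CU U k has_derivative (\<lambda>d. cs U k (s, t) * fst d + ct U k (s, t) * snd d)) (at (s, t))"
  by (rule CU_deriv) (use assms cs_isCont[OF U] in auto)
 show ?thesis unfolding ww_def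
  by (rule has_derivative_eq_rhs[OF has_derivative_add[OF has_derivative_add[OF f g] C]]) (simp add: algebra_simps fun_eq_iff)
qed

end

section \<open>Weak solutions of the wave equation\<close>

lemma locbm_support_integrable:
 fixes G :: "'a::euclidean_space \<Rightarrow> real"
 assumes G: "locbm G" and z: "\<And>p. norm p > R \<Longrightarrow> G p = 0"
 shows "integrable lborel G"
proof -
 have "set_integrable lborel (cball 0 R) G" by (rule locbm_set_integrable[OF G]) auto
 moreover have "(\<lambda>x. indicator (cball 0 R) x *\<^sub>R G x) = G"
  using z by (auto simp: indicator_def fun_eq_iff)
 ultimately show ?thesis by (simp add: set_integrable_def)
qed

lemma locbm_fubini:
 fixes G :: "real \<times> real \<Rightarrow> real"
 assumes G: "locbm G" and z: "\<And>p. norm p > R \<Longrightarrow> G p = 0"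
 shows "(\<integral>p. G p \<partial>lborel) = (\<integral>y. \<integral>x. G (x, y) \<partial>lborel \<partial>lborel)"
  and "(\<integral>p. G p \<partial>lborel) = (\<integral>x. \<integral>y. G (x, y) \<partial>lborel \<partial>lborel)"
proof -
 have "integrable (lborel \<Otimes>\<^sub>M lborel) (\<lambda>(x, y). G (x, y))"
  using locbm_support_integrable[OF G z] by (simp add: lborel_prod case_prod_beta')
 from lborel_pair.integral_snd[OF this] lborel_pair.integral_fst'[of "\<lambda>(x, y). G (x, y)"] this
 show "(\<integral>p. G p \<partial>lborel) = (\<integral>y. \<integral>x. G (x, y) \<partial>lborel \<partial>lborel)"
  "(\<integral>p. G p \<partial>lborel) = (\<integral>x. \<integral>y. G (x, y) \<partial>lborel \<partial>lborel)"
  by (simp_all add: lborel_prod case_prod_beta')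
qed

lemma locbm_support_integral_eq:
 fixes f :: "real \<Rightarrow> real"
 assumes f: "locbm f" and z: "\<And>x. x < a \<or> b < x \<Longrightarrow> f x = 0"
 shows "(\<integral>x. f x \<partial>lborel) = integral {a..b} f"
 unfolding locbm_integral_eq[OF f] set_lebesgue_integral_def
proof (rule Bochner_Integration.integral_cong[OF refl])
 fix x show "f x = indicator {a..b} x *\<^sub>R f x"
  using z[of x] by (cases "x \<in> {a..b}") auto
qed

text \<open>After the substitution x = s + kk y the combination kk \<Theta>x + \<Theta>y is the
  derivative of \<Theta> along the line s = const, so this is one-dimensional integration by parts
  on each line, with Fubini. The support of \<Theta> removes the boundary terms. Continuity of a is
  asked along these lines; a may jump across them.\<close>

lemma shear_integration_by_parts:
 fixes a b \<Theta> \<Theta>x \<Theta>y :: "real \<times> real \<Rightarrow> real" and kk :: real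
 assumes a: "locbm a" and b: "locbm b"
  and cont: "\<And>s. continuous_on UNIV (\<lambda>y. a (s, y))"
  and der: "\<And>s. \<exists>N. finite N \<and> (\<forall>y. y \<notin> N \<longrightarrow> ((\<lambda>y. a (s, y)) has_real_derivative b (s, y)) (at y))"
  and \<Theta>: "\<And>p. (\<Theta> has_derivative (\<lambda>d. \<Theta>x p * fst d + \<Theta>y p * snd d)) (at p)"
  and \<Theta>c: "continuous_on UNIV \<Theta>x" "continuous_on UNIV \<Theta>y"
  and z: "\<And>p. norm p > R \<Longrightarrow> \<Theta> p = 0" "\<And>p. norm p > R \<Longrightarrow> \<Theta>x p = 0" "\<And>p. norm p > R \<Longrightarrow> \<Theta>y p = 0"
 shows "(\<integral>p. a (fst p - kk * snd p, snd p) * (kk * \<Theta>x p + \<Theta>y p) \<partial>lborel)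
   = - (\<integral>p. b (fst p - kk * snd p, snd p) * \<Theta> p \<partial>lborel)"
proof -
 have \<Theta>cont: "continuous_on UNIV \<Theta>"
  using \<Theta> by (auto intro!: continuous_at_imp_continuous_on has_derivative_continuous)
 let ?A = "\<lambda>p. a (fst p - kk * snd p, snd p) * (kk * \<Theta>x p + \<Theta>y p)"
 let ?B = "\<lambda>p. b (fst p - kk * snd p, snd p) * \<Theta> p"
 have lA: "locbm ?A" and lB: "locbm ?B"
  by (intro locbm_mult locbm_compose[OF a] locbm_compose[OF b] locbm_continuous continuous_intros \<Theta>cont \<Theta>c)+
 define G where "G p = ?A p + ?B p" for p
 have G: "locbm G" unfolding G_def by (intro locbm_add lA lB)
 have Gz: "norm p > R \<Longrightarrow> G p = 0" for p using z by (simp add: G_def)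
 have "(\<integral>p. G p \<partial>lborel) = 0"
 proof -
  define H where "H q = G (fst q + kk * snd q, snd q)" for q
  have H: "locbm H" unfolding H_def by (rule locbm_compose[OF G]) (intro continuous_intros)
  define R' where "R' = (1 + \<bar>kk\<bar>) * \<bar>R\<bar> + \<bar>R\<bar>"
  have nb: "norm (s, y) \<le> R'" if "norm (s + kk * y, y) \<le> R" for s y :: real
  proof -
   have "\<bar>s + kk * y\<bar> \<le> R" "\<bar>y\<bar> \<le> R"
    using that norm_fst_le[of "s + kk * y" y] norm_snd_le[of y "s + kk * y"] by auto
   moreover have "\<bar>kk * y\<bar> \<le> \<bar>kk\<bar> * R" using \<open>\<bar>y\<bar> \<le> R\<close> by (simp add: abs_mult mult_left_mono)
   ultimately show ?thesis using norm_Pair_le[of s y] by (auto simp: R'_def algebra_simps)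
  qed
  have Hz: "norm q > R' \<Longrightarrow> H q = 0" for q
   using nb[of "fst q" "snd q"] Gz by (force simp: H_def not_le[symmetric])
  have inner: "(\<integral>y. H (s, y) \<partial>lborel) = 0" for s
  proof -
   have Hs: "locbm (\<lambda>y. H (s, y))" by (rule locbm_compose[OF H]) (intro continuous_intros)
   have R': "0 \<le> R'" by (simp add: R'_def)
   let ?b = "R' + 1"
   have zs: "H (s, y) = 0" if "y < - ?b \<or> ?b < y" for y
    using Hz[of "(s, y)"] norm_snd_le[of y s] that by force
   have \<Theta>s: "\<Theta> (s + kk * y, y) = 0" if "\<bar>y\<bar> = ?b" for y
    using nb[of s y] z(1)[of "(s + kk * y, y)"] norm_snd_le[of y s] that by force
   obtain N where N: "finite N" "\<And>y. y \<notin> N \<Longrightarrow> ((\<lambda>y. a (s, y)) has_real_derivative b (s, y)) (at y)"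
    using der[of s] by blast
   have "((\<lambda>y. H (s, y)) has_integral
     (a (s, ?b) * \<Theta> (s + kk * ?b, ?b) - a (s, - ?b) * \<Theta> (s + kk * (- ?b), - ?b))) {- ?b..?b}"
   proof (rule fundamental_theorem_of_calculus_strong[OF N(1)])
    show "continuous_on {- ?b..?b} (\<lambda>y. a (s, y) * \<Theta> (s + kk * y, y))"
     by (intro continuous_intros continuous_on_subset[OF cont] continuous_on_compose2[OF \<Theta>cont]) auto
    fix y assume "y \<in> {- ?b..?b} - N"
    then have d1: "((\<lambda>y. a (s, y)) has_real_derivative b (s, y)) (at y)" using N(2) by blast
    have l: "((\<lambda>y. (s + kk * y, y)) has_derivative (\<lambda>h. (kk * h, h))) (at y)"
     by (auto intro!: derivative_eq_intros)
    have "((\<lambda>y. \<Theta> (s + kk * y, y)) has_derivative (\<lambda>h. \<Theta>x (s + kk * y, y) * (kk * h) + \<Theta>y (s + kk * y, y) * h)) (at y)"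
     using has_derivative_compose[OF l \<Theta>] by simp
    then have d2: "((\<lambda>y. \<Theta> (s + kk * y, y)) has_real_derivative (kk * \<Theta>x (s + kk * y, y) + \<Theta>y (s + kk * y, y))) (at y)"
     unfolding has_field_derivative_def by (rule has_derivative_eq_rhs) (simp add: fun_eq_iff algebra_simps)
    show "((\<lambda>y. a (s, y) * \<Theta> (s + kk * y, y)) has_vector_derivative H (s, y)) (at y)"
     using DERIV_mult[OF d1 d2]
     by (simp add: H_def G_def has_real_derivative_iff_has_vector_derivative[symmetric] algebra_simps)
   qed (use R' in auto)
   then have "integral {- ?b..?b} (\<lambda>y. H (s, y)) = 0"
    using \<Theta>s[of ?b] \<Theta>s[of "- ?b"] R' by (simp add: integral_unique)
   then show ?thesis using locbm_support_integral_eq[OF Hs zs] by simp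
  qed
  have shift: "(\<integral>x. G (x, y) \<partial>lborel) = (\<integral>s. H (s, y) \<partial>lborel)" for y
   using lborel_integral_real_affine[of 1 "\<lambda>x. G (x, y)" "kk * y"] by (simp add: H_def add.commute)
  have "(\<integral>p. G p \<partial>lborel) = (\<integral>y. \<integral>s. H (s, y) \<partial>lborel \<partial>lborel)"
   using locbm_fubini(1)[OF G Gz] by (simp add: shift)
  also have "\<dots> = (\<integral>s. \<integral>y. H (s, y) \<partial>lborel \<partial>lborel)"
   using locbm_fubini[OF H Hz] by simp
  also have "\<dots> = 0" by (simp add: inner)
  finally show ?thesis .
 qed
 moreover have "(\<integral>p. G p \<partial>lborel) = (\<integral>p. ?A p \<partial>lborel) + (\<integral>p. ?B p \<partial>lborel)"
  unfolding G_def using z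
  by (intro Bochner_Integration.integral_add locbm_support_integrable[OF lA, of R] locbm_support_integrable[OF lB, of R]) auto
 ultimately show ?thesis by simp
qed

text \<open>With s = x - y and t = x + y, \<Psi>xx - \<Psi>yy is the derivative of \<Psi>x - \<Psi>y
  along the lines s = const and, up to sign, that of \<Psi>x + \<Psi>y along t = const. On these
  lines f(s), respectively g(t), is constant, so arbitrary jumps of f and g are harmless. For C one
  integration along t = const produces - 2 cs and one along s = const produces 2 H, hence the factor
  4.\<close>

lemma weak_wave_equation:
 fixes f g :: "real \<Rightarrow> real" and C cs H :: "real \<times> real \<Rightarrow> real"
  and \<Psi> \<Psi>x \<Psi>y \<Psi>xx \<Psi>xy \<Psi>yy :: "real \<times> real \<Rightarrow> real"
 assumes f: "locbm f" and g: "locbm g" and C: "continuous_on UNIV C" and cs: "locbm cs" and H: "locbm H"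
  and dC: "\<And>t. \<exists>N. finite N \<and> (\<forall>s. s \<notin> N \<longrightarrow> ((\<lambda>s. C (s, t)) has_real_derivative cs (s, t)) (at s))"
  and ccs: "\<And>s. continuous_on UNIV (\<lambda>t. cs (s, t))"
  and dcs: "\<And>s. \<exists>N. finite N \<and> (\<forall>t. t \<notin> N \<longrightarrow> ((\<lambda>t. cs (s, t)) has_real_derivative H (s, t)) (at t))"
  and \<Psi>: "\<And>p. (\<Psi> has_derivative (\<lambda>d. \<Psi>x p * fst d + \<Psi>y p * snd d)) (at p)"
  and \<Psi>x: "\<And>p. (\<Psi>x has_derivative (\<lambda>d. \<Psi>xx p * fst d + \<Psi>xy p * snd d)) (at p)"
  and \<Psi>y: "\<And>p. (\<Psi>y has_derivative (\<lambda>d. \<Psi>xy p * fst d + \<Psi>yy p * snd d)) (at p)"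
  and cont: "continuous_on UNIV \<Psi>xx" "continuous_on UNIV \<Psi>xy" "continuous_on UNIV \<Psi>yy"
  and z: "\<And>p. norm p > R \<Longrightarrow> \<Psi> p = 0 \<and> \<Psi>x p = 0 \<and> \<Psi>y p = 0 \<and> \<Psi>xx p = 0 \<and> \<Psi>xy p = 0 \<and> \<Psi>yy p = 0"
 shows "(\<integral>p. (f (fst p - snd p) + g (fst p + snd p) + C (fst p - snd p, fst p + snd p)) * (\<Psi>xx p - \<Psi>yy p) \<partial>lborel)
  = (\<integral>p. 4 * H (fst p - snd p, fst p + snd p) * \<Psi> p \<partial>lborel)"
proof -
 have c1: "continuous_on UNIV \<Psi>" "continuous_on UNIV \<Psi>x" "continuous_on UNIV \<Psi>y"
  using \<Psi> \<Psi>x \<Psi>y by (auto intro!: continuous_at_imp_continuous_on has_derivative_continuous)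
 have dsum: "((\<lambda>p. \<Psi>x p + \<Psi>y p) has_derivative (\<lambda>d. (\<Psi>xx p + \<Psi>xy p) * fst d + (\<Psi>xy p + \<Psi>yy p) * snd d)) (at p)" for p
  by (rule has_derivative_eq_rhs[OF has_derivative_add[OF \<Psi>x \<Psi>y]]) (simp add: algebra_simps fun_eq_iff)
 have ddiff: "((\<lambda>p. \<Psi>x p - \<Psi>y p) has_derivative (\<lambda>d. (\<Psi>xx p - \<Psi>xy p) * fst d + (\<Psi>xy p - \<Psi>yy p) * snd d)) (at p)" for p
  by (rule has_derivative_eq_rhs[OF has_derivative_diff[OF \<Psi>x \<Psi>y]]) (simp add: algebra_simps fun_eq_iff)
 have lD: "locbm (\<lambda>p. \<Psi>xx p - \<Psi>yy p)" by (intro locbm_diff locbm_continuous cont)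
 have lf: "locbm (\<lambda>p::real \<times> real. f (fst p - snd p))" "locbm (\<lambda>p::real \<times> real. g (fst p + snd p))"
  "locbm (\<lambda>p. C (fst p - snd p, fst p + snd p))"
  by (intro locbm_compose[OF f] locbm_compose[OF g] locbm_compose[OF locbm_continuous[OF C]] continuous_intros)+
 have If: "(\<integral>p. f (fst p - snd p) * (\<Psi>xx p - \<Psi>yy p) \<partial>lborel) = 0"
 proof -
  have "(\<integral>p. (\<lambda>q. f (fst q)) (fst p - 1 * snd p, snd p) * (1 * (\<Psi>xx p - \<Psi>xy p) + (\<Psi>xy p - \<Psi>yy p)) \<partial>lborel)
   = - (\<integral>p. (\<lambda>q::real \<times> real. 0) (fst p - 1 * snd p, snd p) * (\<Psi>x p - \<Psi>y p) \<partial>lborel)"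
   by (rule shear_integration_by_parts[OF _ locbm_const _ _ ddiff, where R=R])
    (use z cont in \<open>auto intro!: locbm_compose[OF f] continuous_intros\<close>)
  then show ?thesis by (simp add: algebra_simps)
 qed
 have Ig: "(\<integral>p. g (fst p + snd p) * (\<Psi>xx p - \<Psi>yy p) \<partial>lborel) = 0"
 proof -
  have "(\<integral>p. (\<lambda>q. g (fst q)) (fst p - (-1) * snd p, snd p) * ((-1) * (\<Psi>xx p + \<Psi>xy p) + (\<Psi>xy p + \<Psi>yy p)) \<partial>lborel)
   = - (\<integral>p. (\<lambda>q::real \<times> real. 0) (fst p - (-1) * snd p, snd p) * (\<Psi>x p + \<Psi>y p) \<partial>lborel)"
   by (rule shear_integration_by_parts[OF _ locbm_const _ _ dsum, where R=R])
    (use z cont in \<open>auto intro!: locbm_compose[OF g] continuous_intros\<close>)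
  then have "(\<integral>p. - (g (fst p + snd p) * (\<Psi>xx p - \<Psi>yy p)) \<partial>lborel) = 0" by (simp add: algebra_simps)
  then show ?thesis by simp
 qed
 have IC: "(\<integral>p. C (fst p - snd p, fst p + snd p) * (\<Psi>xx p - \<Psi>yy p) \<partial>lborel)
   = - 2 * (\<integral>p. cs (fst p - snd p, fst p + snd p) * (\<Psi>x p + \<Psi>y p) \<partial>lborel)"
 proof -
  let ?a = "\<lambda>q. C (fst q - 2 * snd q, fst q)" and ?b = "\<lambda>q. - 2 * cs (fst q - 2 * snd q, fst q)"
  have "(\<integral>p. ?a (fst p - (-1) * snd p, snd p) * ((-1) * (\<Psi>xx p + \<Psi>xy p) + (\<Psi>xy p + \<Psi>yy p)) \<partial>lborel)
   = - (\<integral>p. ?b (fst p - (-1) * snd p, snd p) * (\<Psi>x p + \<Psi>y p) \<partial>lborel)"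
  proof (rule shear_integration_by_parts[OF _ _ _ _ dsum, where R=R])
   show "locbm ?a" by (intro locbm_compose[OF locbm_continuous[OF C]] continuous_intros)
   show "locbm ?b" by (intro locbm_mult locbm_const locbm_compose[OF cs] continuous_intros)
   show "continuous_on UNIV (\<lambda>y. ?a (s, y))" for s
    by (intro continuous_on_compose2[OF C] continuous_intros) auto
   show "\<exists>N. finite N \<and> (\<forall>y. y \<notin> N \<longrightarrow> ((\<lambda>y. ?a (s, y)) has_real_derivative ?b (s, y)) (at y))" for s
   proof -
    obtain N where N: "finite N" "\<And>u. u \<notin> N \<Longrightarrow> ((\<lambda>u. C (u, s)) has_real_derivative cs (u, s)) (at u)"
     using dC[of s] by blast
    have "((\<lambda>y. ?a (s, y)) has_real_derivative ?b (s, y)) (at y)" if "y \<notin> (\<lambda>u. (s - u) / 2) ` N" for y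
    proof -
     have "s - 2 * y \<notin> N" using that by (force simp: image_iff)
     have "((\<lambda>y. C (s - 2 * y, s)) has_real_derivative cs (s - 2 * y, s) * (- 2)) (at y)"
      by (rule DERIV_chain2[where f="\<lambda>u. C (u, s)" and g="\<lambda>y. s - 2 * y", OF N(2)[OF \<open>s - 2 * y \<notin> N\<close>]])
       (auto intro!: derivative_eq_intros)
     then show ?thesis by (simp add: mult.commute)
    qed
    then show ?thesis using N(1) by (intro exI[of _ "(\<lambda>u. (s - u) / 2) ` N"]) auto
   qed
  qed (use z cont in \<open>auto intro!: continuous_intros\<close>)
  then have "(\<integral>p. - (C (fst p - snd p, fst p + snd p) * (\<Psi>xx p - \<Psi>yy p)) \<partial>lborel)
    = - (\<integral>p. - 2 * (cs (fst p - snd p, fst p + snd p) * (\<Psi>x p + \<Psi>y p)) \<partial>lborel)"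
   by (simp add: algebra_simps)
  then show ?thesis by simp
 qed
 have Ics: "(\<integral>p. cs (fst p - snd p, fst p + snd p) * (\<Psi>x p + \<Psi>y p) \<partial>lborel)
   = - 2 * (\<integral>p. H (fst p - snd p, fst p + snd p) * \<Psi> p \<partial>lborel)"
 proof -
  let ?a = "\<lambda>q. cs (fst q, fst q + 2 * snd q)" and ?b = "\<lambda>q. 2 * H (fst q, fst q + 2 * snd q)"
  have "(\<integral>p. ?a (fst p - 1 * snd p, snd p) * (1 * \<Psi>x p + \<Psi>y p) \<partial>lborel)
   = - (\<integral>p. ?b (fst p - 1 * snd p, snd p) * \<Psi> p \<partial>lborel)"
  proof (rule shear_integration_by_parts[OF _ _ _ _ \<Psi>, where R=R])
   show "locbm ?a" by (intro locbm_compose[OF cs] continuous_intros)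
   show "locbm ?b" by (intro locbm_mult locbm_const locbm_compose[OF H] continuous_intros)
   show "continuous_on UNIV (\<lambda>y. ?a (s, y))" for s
    by (simp, rule continuous_on_compose2[OF ccs[of s]]) (auto intro!: continuous_intros)
   show "\<exists>N. finite N \<and> (\<forall>y. y \<notin> N \<longrightarrow> ((\<lambda>y. ?a (s, y)) has_real_derivative ?b (s, y)) (at y))" for s
   proof -
    obtain N where N: "finite N" "\<And>u. u \<notin> N \<Longrightarrow> ((\<lambda>u. cs (s, u)) has_real_derivative H (s, u)) (at u)"
     using dcs[of s] by blast
    have "((\<lambda>y. ?a (s, y)) has_real_derivative ?b (s, y)) (at y)" if "y \<notin> (\<lambda>u. (u - s) / 2) ` N" for y
    proof -
     have "s + 2 * y \<notin> N" using that by (force simp: image_iff)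
     have "((\<lambda>y. cs (s, s + 2 * y)) has_real_derivative H (s, s + 2 * y) * 2) (at y)"
      by (rule DERIV_chain2[where f="\<lambda>u. cs (s, u)" and g="\<lambda>y. s + 2 * y", OF N(2)[OF \<open>s + 2 * y \<notin> N\<close>]])
       (auto intro!: derivative_eq_intros)
     then show ?thesis by (simp add: mult.commute)
    qed
    then show ?thesis using N(1) by (intro exI[of _ "(\<lambda>u. (u - s) / 2) ` N"]) auto
   qed
  qed (use z c1 in auto)
  then have "(\<integral>p. cs (fst p - snd p, fst p + snd p) * (\<Psi>x p + \<Psi>y p) \<partial>lborel)
   = - (\<integral>p. 2 * (H (fst p - snd p, fst p + snd p) * \<Psi> p) \<partial>lborel)"
   by (simp add: mult.assoc add.commute)
  then show ?thesis by simp
 qed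
 have int: "integrable lborel (\<lambda>p. u p * (\<Psi>xx p - \<Psi>yy p))" if "locbm u" for u
  by (rule locbm_support_integrable[OF locbm_mult[OF that lD], of R]) (use z in auto)
 have "(\<integral>p. (f (fst p - snd p) + g (fst p + snd p) + C (fst p - snd p, fst p + snd p)) * (\<Psi>xx p - \<Psi>yy p) \<partial>lborel)
  = (\<integral>p. f (fst p - snd p) * (\<Psi>xx p - \<Psi>yy p) \<partial>lborel) + (\<integral>p. g (fst p + snd p) * (\<Psi>xx p - \<Psi>yy p) \<partial>lborel)
   + (\<integral>p. C (fst p - snd p, fst p + snd p) * (\<Psi>xx p - \<Psi>yy p) \<partial>lborel)"
  unfolding distrib_right using int[OF lf(1)] int[OF lf(2)] int[OF lf(3)] by simp
 also have "\<dots> = 4 * (\<integral>p. H (fst p - snd p, fst p + snd p) * \<Psi> p \<partial>lborel)"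
  unfolding If Ig IC Ics by simp
 finally show ?thesis by (simp add: mult.assoc)
qed

section \<open>Changes of variables\<close>

lemma lborel_substitution:
 fixes \<phi> \<phi>' g :: "real \<Rightarrow> real"
 assumes g: "locbm g" and z: "\<And>x. R < \<bar>x\<bar> \<Longrightarrow> g x = 0"
  and \<phi>: "\<And>x. (\<phi> has_real_derivative \<phi>' x) (at x)" "continuous_on UNIV \<phi>'" "\<And>x. 0 < \<phi>' x" "surj \<phi>"
 shows "(\<integral>x. g (\<phi> x) * \<phi>' x \<partial>lborel) = (\<integral>x. g x \<partial>lborel)"
proof -
 have mono: "x < y \<Longrightarrow> \<phi> x < \<phi> y" for x y using DERIV_pos_imp_increasing[of x y \<phi>] \<phi>(1,3) by blast
 obtain a b where ab: "\<phi> a = - \<bar>R\<bar> - 1" "\<phi> b = \<bar>R\<bar> + 1" using \<phi>(4) by (metis surj_def)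
 then have "a < b" using mono[of b a] by (cases a b rule: linorder_cases) auto
 have "set_integrable lborel {\<phi> a..\<phi> b} g" by (rule locbm_set_integrable[OF g]) auto
 then have "(\<integral>x. g x * indicator {\<phi> a..\<phi> b} x \<partial>lborel) = (\<integral>x. g (\<phi> x) * \<phi>' x * indicator {a..b} x \<partial>lborel)"
  by (rule integral_substitution(2)) (use \<open>a < b\<close> \<phi> in \<open>auto intro: less_imp_le continuous_on_subset\<close>)
 moreover have "g x * indicator {\<phi> a..\<phi> b} x = g x" for x
  using z[of x] ab by (cases "x \<in> {\<phi> a..\<phi> b}") auto
 moreover have "g (\<phi> x) * \<phi>' x * indicator {a..b} x = g (\<phi> x) * \<phi>' x" for x
 proof (cases "x \<in> {a..b}")
  case False
  then have "\<bar>\<phi> x\<bar> > R" using mono[of x a] mono[of b x] ab by auto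
  then show ?thesis using z by simp
 qed simp
 ultimately show ?thesis by simp
qed

text \<open>One variable at a time, by Fubini: for fixed second variable the inner integral is
  substituted, then the outer one.\<close>

lemma lborel_substitution2:
 fixes \<phi> \<phi>' \<theta> \<theta>' :: "real \<Rightarrow> real" and G :: "real \<times> real \<Rightarrow> real"
 assumes G: "locbm G" and z: "\<And>p. norm p > R \<Longrightarrow> G p = 0"
  and \<phi>: "\<And>x. (\<phi> has_real_derivative \<phi>' x) (at x)" "continuous_on UNIV \<phi>'" "\<And>x. 0 < \<phi>' x" "surj \<phi>"
  and \<theta>: "\<And>x. (\<theta> has_real_derivative \<theta>' x) (at x)" "continuous_on UNIV \<theta>'" "\<And>x. 0 < \<theta>' x" "surj \<theta>"
  and z': "\<And>p. norm p > R \<Longrightarrow> G (\<phi> (fst p), \<theta> (snd p)) = 0"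
 shows "(\<integral>p. G (\<phi> (fst p), \<theta> (snd p)) * (\<phi>' (fst p) * \<theta>' (snd p)) \<partial>lborel) = (\<integral>p. G p \<partial>lborel)"
proof -
 have c: "continuous_on UNIV \<phi>" "continuous_on UNIV \<theta>"
  using \<phi>(1) \<theta>(1) by (meson DERIV_isCont continuous_at_imp_continuous_on)+
 have cp: "continuous_on UNIV (\<lambda>p. (\<phi> (fst p), \<theta> (snd p)))"
  by (intro continuous_intros continuous_on_compose2[OF c(1)] continuous_on_compose2[OF c(2)]) auto
 let ?H = "\<lambda>p. G (\<phi> (fst p), \<theta> (snd p)) * (\<phi>' (fst p) * \<theta>' (snd p))"
 have H: "locbm ?H"
  by (intro locbm_mult locbm_compose[OF G cp] locbm_continuous continuous_on_compose2[OF \<phi>(2)]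
    continuous_on_compose2[OF \<theta>(2)] continuous_intros) auto
 have Hz: "norm p > R \<Longrightarrow> ?H p = 0" for p using z' by simp
 have sec: "locbm (\<lambda>x. G (x, y))" "locbm (\<lambda>y. G (x, y))" for x y
  by (rule locbm_compose[OF G], intro continuous_intros)+
 have zs: "R < \<bar>x\<bar> \<Longrightarrow> G (x, y) = 0" "R < \<bar>y\<bar> \<Longrightarrow> G (x, y) = 0" for x y
  using z[of "(x, y)"] norm_fst_le[of x y] norm_snd_le[of y x] by force+
 have "(\<integral>p. ?H p \<partial>lborel) = (\<integral>y. \<integral>x. ?H (x, y) \<partial>lborel \<partial>lborel)" by (rule locbm_fubini(1)[OF H Hz])
 also have "\<dots> = (\<integral>y. (\<integral>x. G (\<phi> x, \<theta> y) * \<phi>' x \<partial>lborel) * \<theta>' y \<partial>lborel)"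
  by (simp add: mult.assoc[symmetric])
 also have "\<dots> = (\<integral>y. (\<integral>x. G (x, \<theta> y) \<partial>lborel) * \<theta>' y \<partial>lborel)"
  by (subst lborel_substitution[OF sec(1) zs(1) \<phi>]) auto
 also have "\<dots> = (\<integral>y. \<integral>x. G (x, y) \<partial>lborel \<partial>lborel)"
 proof (rule lborel_substitution[OF _ _ \<theta>, where R="R"])
  \<comment> \<open>As an integral over a bounded interval with a parameter, the partial integral is
    seen to be measurable and locally bounded; the shift by \<open>\<bar>R\<bar>\<close> makes the
    interval start at 0.\<close>
  have e: "(\<integral>x. G (x, y) \<partial>lborel) = integral {0..2*\<bar>R\<bar>} (\<lambda>x. G (x - \<bar>R\<bar>, y))" for y
  proof -
   have "(\<integral>x. G (x, y) \<partial>lborel) = (\<integral>x. G (x - \<bar>R\<bar>, y) \<partial>lborel)"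
    using lborel_integral_real_affine[of 1 "\<lambda>x. G (x, y)" "- \<bar>R\<bar>"] by simp
   also have "\<dots> = integral {0..2*\<bar>R\<bar>} (\<lambda>x. G (x - \<bar>R\<bar>, y))"
    by (rule locbm_support_integral_eq) (use zs(1) in \<open>auto intro!: locbm_compose[OF G] continuous_intros\<close>)
   finally show ?thesis .
  qed
  have "locbm (\<lambda>q. G (snd q - \<bar>R\<bar>, fst q))" by (rule locbm_compose[OF G]) (intro continuous_intros)
  from locbm_compose[OF locbm_integral[OF this], of "\<lambda>y. (y, 2 * \<bar>R\<bar>)"]
  show "locbm (\<lambda>y. \<integral>x. G (x, y) \<partial>lborel)" unfolding e by (simp add: continuous_intros)
  show "R < \<bar>y\<bar> \<Longrightarrow> (\<integral>x. G (x, y) \<partial>lborel) = 0" for y using zs(2) by simp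
 qed
 also have "\<dots> = (\<integral>p. G p \<partial>lborel)" using locbm_fubini(1)[OF G z] by simp
 finally show ?thesis .
qed

section \<open>Travel time coordinates\<close>

lemma DERIV_zero_open:
 fixes f :: "real \<Rightarrow> real"
 assumes Y: "open Y" "a \<in> Y" and f: "\<And>x. x \<in> Y \<Longrightarrow> f x = 0"
 shows "(f has_real_derivative 0) (at a)"
proof -
 have "((\<lambda>_. 0 :: real) has_real_derivative 0) (at a)" by simp
 from has_field_derivative_transform_within_open[OF this Y] show ?thesis using f by simp
qed

lemma C1_planeD:
 assumes "C1_plane f"
 shows "((\<lambda>x. f x b) has_real_derivative Dz f a b) (at a)"
  and "((\<lambda>y. f a y) has_real_derivative Dzeta f a b) (at b)"
  and "continuous_on UNIV (\<lambda>p. Dz f (fst p) (snd p))"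
  and "continuous_on UNIV (\<lambda>p. Dzeta f (fst p) (snd p))"
 using assms unfolding C1_plane_def Dz_def Dzeta_def
 by (auto simp: case_prod_beta' DERIV_deriv_iff_real_differentiable)

lemma C1_plane_has_derivative:
 assumes "C1_plane f"
 shows "((\<lambda>p. f (fst p) (snd p)) has_derivative (\<lambda>d. Dz f (fst p) (snd p) * fst d + Dzeta f (fst p) (snd p) * snd d)) (at p)"
proof -
 obtain a b where p: "p = (a, b)" by force
 have "((\<lambda>p. f (fst p) (snd p)) has_derivative (\<lambda>d. Dz f a b * fst d + (\<lambda>p. Dzeta f (fst p) (snd p)) (a, b) * snd d)) (at (a, b))"
 proof (rule has_derivative_from_partials[where Y=UNIV])
  show "isCont (\<lambda>p. Dzeta f (fst p) (snd p)) (a, b)"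
   using C1_planeD(4)[OF assms] continuous_on_eq_continuous_at[OF open_UNIV] by blast
 qed (use C1_planeD[OF assms] in auto)
 then show ?thesis by (simp add: p)
qed

lemma C1_plane_continuous:
 assumes "C1_plane f" shows "continuous_on UNIV (\<lambda>p. f (fst p) (snd p))"
 using C1_plane_has_derivative[OF assms]
 by (auto intro!: continuous_at_imp_continuous_on has_derivative_continuous)

text \<open>Integrating \<open>Dz (Dzeta f)\<close> in the second variable and differentiating under
  the integral sign expresses \<open>Dz f\<close> through it; differentiating the result in the
  second variable exchanges the order. The definition of test functions provides the two mixed
  derivatives as separate objects.\<close>

lemma mixed_partials_commute:
 assumes f: "C1_plane f" and fx: "C1_plane (Dz f)" and fy: "C1_plane (Dzeta f)"
 shows "Dz (Dzeta f) a b = Dzeta (Dz f) a b"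
proof -
 have eq: "Dz f a y - Dz f a (b - 1) = integral {b - 1..y} (\<lambda>\<eta>. Dz (Dzeta f) a \<eta>)" if y: "b - 1 \<le> y" for y
 proof -
  have I: "integral {b - 1..y} (\<lambda>\<eta>. Dzeta f x \<eta>) = f x y - f x (b - 1)" for x
   by (rule integral_unique, rule fundamental_theorem_of_calculus[OF y])
    (use C1_planeD(2)[OF f] in \<open>auto simp: has_real_derivative_iff_has_vector_derivative[symmetric] intro: has_field_derivative_at_within\<close>)
  have "((\<lambda>x. integral (cbox (b - 1) y) (\<lambda>\<eta>. Dzeta f x \<eta>)) has_field_derivative
    integral (cbox (b - 1) y) (\<lambda>\<eta>. Dz (Dzeta f) a \<eta>)) (at a within UNIV)"
  proof (rule leibniz_rule_field_derivative)
   show "((\<lambda>x. Dzeta f x t) has_real_derivative Dz (Dzeta f) x t) (at x within UNIV)" for x t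
    using C1_planeD(1)[OF fy] by simp
   show "(\<lambda>\<eta>. Dzeta f x \<eta>) integrable_on cbox (b - 1) y" for x
    by (intro integrable_continuous continuous_on_compose2[OF C1_plane_continuous[OF fy], of _ "\<lambda>\<eta>. (x, \<eta>)", simplified])
     (auto intro!: continuous_intros)
   show "continuous_on (UNIV \<times> cbox (b - 1) y) (\<lambda>(x, t). Dz (Dzeta f) x t)"
    using C1_planeD(3)[OF fy] by (auto simp: case_prod_beta' intro: continuous_on_subset)
  qed auto
  then have "((\<lambda>x. f x y - f x (b - 1)) has_real_derivative integral {b - 1..y} (\<lambda>\<eta>. Dz (Dzeta f) a \<eta>)) (at a)"
   by (simp add: I)
  moreover have "((\<lambda>x. f x y - f x (b - 1)) has_real_derivative Dz f a y - Dz f a (b - 1)) (at a)"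
   by (intro derivative_intros C1_planeD(1)[OF f])
  ultimately show ?thesis using DERIV_unique by blast
 qed
 have c: "continuous_on UNIV (\<lambda>\<eta>. Dz (Dzeta f) a \<eta>)"
  using continuous_on_compose2[OF C1_planeD(3)[OF fy], of UNIV "\<lambda>\<eta>. (a, \<eta>)"] by (simp add: continuous_intros)
 have "((\<lambda>y. integral {b - 1..y} (\<lambda>\<eta>. Dz (Dzeta f) a \<eta>)) has_real_derivative Dz (Dzeta f) a b) (at b within {b - 1..b + 1})"
  by (rule integral_has_real_derivative[OF continuous_on_subset[OF c]]) auto
 then have "((\<lambda>y. integral {b - 1..y} (\<lambda>\<eta>. Dz (Dzeta f) a \<eta>)) has_real_derivative Dz (Dzeta f) a b) (at b)"
  using at_within_Icc_at[of "b - 1" b "b + 1"] by simp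
 then have "((\<lambda>y. Dz f a y - Dz f a (b - 1)) has_real_derivative Dz (Dzeta f) a b) (at b)"
  by (rule has_field_derivative_transform_within_open[of _ _ _ "{b - 1<..}"]) (use eq in auto)
 moreover have "((\<lambda>y. Dz f a y - Dz f a (b - 1)) has_real_derivative Dzeta (Dz f) a b - 0) (at b)"
  by (intro derivative_intros C1_planeD(2)[OF fx])
 ultimately show ?thesis using DERIV_unique by force
qed

text \<open>The travel time \<open>\<phi>\<close> of a coefficient \<open>p\<^sup>4\<close>, and its inverse \<open>\<xi>\<close>.\<close>

locale chart =
 fixes p p1 p2 \<phi> \<xi> :: "real \<Rightarrow> real"
 assumes pc: "continuous_on UNIV p" "continuous_on UNIV p1" "continuous_on UNIV p2"
  and pos: "\<And>z. 0 < p z"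
  and dp: "\<And>z. z \<in> {0..1} \<Longrightarrow> (p has_real_derivative p1 z) (at z within {0..1})"
  and dp1: "\<And>z. z \<in> {0..1} \<Longrightarrow> (p1 has_real_derivative p2 z) (at z within {0..1})"
  and d\<phi>: "\<And>z. (\<phi> has_real_derivative 1 / (p z)\<^sup>2) (at z)"
  and \<phi>0: "\<phi> 0 = 0"
  and inv: "\<And>x. \<phi> (\<xi> x) = x" "\<And>z. \<xi> (\<phi> z) = z"
  and d\<xi>: "\<And>x. (\<xi> has_real_derivative (p (\<xi> x))\<^sup>2) (at x)"
begin

lemma dp_at: "z \<in> {0<..<1} \<Longrightarrow> (p has_real_derivative p1 z) (at z)"
 "z \<in> {0<..<1} \<Longrightarrow> (p1 has_real_derivative p2 z) (at z)"
 using dp[of z] dp1[of z] at_within_Icc_at[of 0 z 1] by auto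

lemma \<phi>_mono: "x < y \<Longrightarrow> \<phi> x < \<phi> y"
 using DERIV_pos_imp_increasing[of x y \<phi>] d\<phi> pos by (metis zero_less_divide_1_iff zero_less_power)

lemma \<phi>_less_iff: "\<phi> x < \<phi> y \<longleftrightarrow> x < y"
 using \<phi>_mono[of x y] \<phi>_mono[of y x] by (cases x y rule: linorder_cases) auto

lemma \<phi>_le_iff: "\<phi> x \<le> \<phi> y \<longleftrightarrow> x \<le> y"
 using \<phi>_less_iff[of y x] by linarith

lemma \<phi>_eq_iff: "\<phi> x = \<phi> y \<longleftrightarrow> x = y"
 using inv(2) by metis

lemma \<phi>_cont: "continuous_on A \<phi>" and \<xi>_cont: "continuous_on A \<xi>"
 using d\<phi> d\<xi> by (meson DERIV_isCont continuous_at_imp_continuous_on)+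

lemma surj_\<phi>: "surj \<phi>" using inv(1) by (metis surjI)

lemma cont1: "continuous_on A f \<Longrightarrow> continuous_on A (\<lambda>x. p (f x))"
 "continuous_on A f \<Longrightarrow> continuous_on A (\<lambda>x. p1 (f x))"
 "continuous_on A f \<Longrightarrow> continuous_on A (\<lambda>x. p2 (f x))"
 "continuous_on A f \<Longrightarrow> continuous_on A (\<lambda>x. \<phi> (f x))"
 "continuous_on A f \<Longrightarrow> continuous_on A (\<lambda>x. \<xi> (f x))"
 by (erule continuous_on_compose2[OF pc(1) _ subset_UNIV] continuous_on_compose2[OF pc(2) _ subset_UNIV]
  continuous_on_compose2[OF pc(3) _ subset_UNIV] continuous_on_compose2[OF \<phi>_cont _ subset_UNIV]
  continuous_on_compose2[OF \<xi>_cont _ subset_UNIV])+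

end

locale chart2 = r: chart p p1 p2 \<phi> \<xi> + c: chart q q1 q2 \<theta> \<nu>
 for p p1 p2 \<phi> \<xi> q q1 q2 \<theta> \<nu>
begin

text \<open>The derivative formulas are known on the open square, and off the support Z everything
  vanishes; together they give the formulas on the plane. The factors are the derivatives p^2 of
  \<xi> and q^2 of \<nu>.\<close>

lemma lift_derivative:
 fixes F Fz Fy :: "real \<times> real \<Rightarrow> real"
 assumes Z: "closed Z" "Z \<subseteq> {0<..<1} \<times> {0<..<1}"
  and z: "\<And>a. a \<notin> Z \<Longrightarrow> F a = 0" "\<And>a. a \<notin> Z \<Longrightarrow> Fz a = 0" "\<And>a. a \<notin> Z \<Longrightarrow> Fy a = 0"
  and d1: "\<And>a b. a \<in> {0<..<1} \<Longrightarrow> b \<in> {0<..<1} \<Longrightarrow> ((\<lambda>x. F (x, b)) has_real_derivative Fz (a, b)) (at a)"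
  and d2: "\<And>a b. a \<in> {0<..<1} \<Longrightarrow> b \<in> {0<..<1} \<Longrightarrow> ((\<lambda>y. F (a, y)) has_real_derivative Fy (a, b)) (at b)"
  and c: "continuous_on UNIV Fy"
 shows "((\<lambda>s. F (\<xi> (fst s), \<nu> (snd s))) has_derivative
  (\<lambda>d. ((p (\<xi> (fst s)))\<^sup>2 * Fz (\<xi> (fst s), \<nu> (snd s))) * fst d + ((q (\<nu> (snd s)))\<^sup>2 * Fy (\<xi> (fst s), \<nu> (snd s))) * snd d)) (at s)"
proof -
 have o: "open (- Z)" using Z(1) by auto
 have D1: "((\<lambda>x. F (x, b)) has_real_derivative Fz (a, b)) (at a)" for a b
 proof (cases "(a, b) \<in> Z")
  case True then show ?thesis using d1 Z(2) by blast
 next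
  case False
  have op: "open ((\<lambda>x. (x, b)) -` (- Z))" by (rule open_vimage[OF o]) (intro continuous_intros)
  have "((\<lambda>x. F (x, b)) has_real_derivative 0) (at a)"
   by (rule DERIV_zero_open[OF op]) (use False z(1) in simp_all)
  then show ?thesis using z(2)[OF False] by simp
 qed
 have D2: "((\<lambda>y. F (a, y)) has_real_derivative Fy (a, b)) (at b)" for a b
 proof (cases "(a, b) \<in> Z")
  case True then show ?thesis using d2 Z(2) by blast
 next
  case False
  have op: "open ((\<lambda>x. (a, x)) -` (- Z))" by (rule open_vimage[OF o]) (intro continuous_intros)
  have "((\<lambda>x. F (a, x)) has_real_derivative 0) (at b)"
   by (rule DERIV_zero_open[OF op]) (use False z(1) in simp_all)
  then show ?thesis using z(3)[OF False] by simp
 qed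
 obtain x y where s: "s = (x, y)" by force
 have cc: "continuous_on UNIV (\<lambda>s. (q (\<nu> (snd s)))\<^sup>2 * Fy (\<xi> (fst s), \<nu> (snd s)))"
  by (intro continuous_intros c.cont1 r.cont1 continuous_on_compose2[OF c]) auto
 have "((\<lambda>s. F (\<xi> (fst s), \<nu> (snd s))) has_derivative
  (\<lambda>d. ((p (\<xi> x))\<^sup>2 * Fz (\<xi> x, \<nu> y)) * fst d + (\<lambda>s. (q (\<nu> (snd s)))\<^sup>2 * Fy (\<xi> (fst s), \<nu> (snd s))) (x, y) * snd d)) (at (x, y))"
 proof (rule has_derivative_from_partials[where Y=UNIV])
  show "((\<lambda>x. F (\<xi> (fst (x, y)), \<nu> (snd (x, y)))) has_real_derivative (p (\<xi> x))\<^sup>2 * Fz (\<xi> x, \<nu> y)) (at x)"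
   using DERIV_chain2[where f="\<lambda>u. F (u, \<nu> y)" and g=\<xi>, OF D1 r.d\<xi>] by (simp add: mult.commute)
  show "((\<lambda>y. F (\<xi> (fst (x, y)), \<nu> (snd (x, y)))) has_real_derivative
   (q (\<nu> (snd (x, y))))\<^sup>2 * Fy (\<xi> (fst (x, y)), \<nu> (snd (x, y)))) (at y)" for x y
   using DERIV_chain2[where f="\<lambda>u. F (\<xi> x, u)" and g=\<nu>, OF D2 c.d\<xi>] by (simp add: mult.commute)
  show "isCont (\<lambda>s. (q (\<nu> (snd s)))\<^sup>2 * Fy (\<xi> (fst s), \<nu> (snd s))) (x, y)"
   using cc continuous_on_eq_continuous_at[OF open_UNIV] by blast
 qed auto
 then show ?thesis by (simp add: s)
qed

text \<open>In the coordinates x, y the kernel equation becomes a wave equation with a potential. For the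
  test function this means multiplying it by \<open>p\<^sup>3/q\<close>.\<close>

lemma weak_kernel_component:
 fixes f g :: "real \<Rightarrow> real" and C cs H m :: "real \<times> real \<Rightarrow> real" and K \<psi> :: "real \<Rightarrow> real \<Rightarrow> real"
  and a b :: "real \<Rightarrow> real"
 assumes f: "locbm f" and g: "locbm g" and C: "continuous_on UNIV C" and cs: "locbm cs" and H: "locbm H"
  and dC: "\<And>t. \<exists>N. finite N \<and> (\<forall>s. s \<notin> N \<longrightarrow> ((\<lambda>s. C (s, t)) has_real_derivative cs (s, t)) (at s))"
  and ccs: "\<And>s. continuous_on UNIV (\<lambda>t. cs (s, t))"
  and dcs: "\<And>s. \<exists>N. finite N \<and> (\<forall>t. t \<notin> N \<longrightarrow> ((\<lambda>t. cs (s, t)) has_real_derivative H (s, t)) (at t))"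
  and m: "\<And>x y. 4 * m (x - y, x + y) = (q (\<nu> y)) ^ 3 * q2 (\<nu> y) - (p (\<xi> x)) ^ 3 * p2 (\<xi> x)"
  and HM: "\<And>z \<zeta>. (z, \<zeta>) \<in> interior D \<Longrightarrow> H (\<phi> z - \<theta> \<zeta>, \<phi> z + \<theta> \<zeta>) = m (\<phi> z - \<theta> \<zeta>, \<phi> z + \<theta> \<zeta>) *
    (f (\<phi> z - \<theta> \<zeta>) + g (\<phi> z + \<theta> \<zeta>) + C (\<phi> z - \<theta> \<zeta>, \<phi> z + \<theta> \<zeta>))"
  and K: "\<And>z \<zeta>. (z, \<zeta>) \<in> interior D \<Longrightarrow> K z \<zeta> = p z / (q \<zeta>) ^ 3 *
    (f (\<phi> z - \<theta> \<zeta>) + g (\<phi> z + \<theta> \<zeta>) + C (\<phi> z - \<theta> \<zeta>, \<phi> z + \<theta> \<zeta>))"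
  and ab: "\<And>z. z \<in> {0..1} \<Longrightarrow> a z = (p z) ^ 4" "\<And>z. z \<in> {0..1} \<Longrightarrow> b z = (q z) ^ 4"
  and D: "D \<subseteq> {0..1} \<times> {0..1}" and test: "test_function D \<psi>"
 shows "integral D (\<lambda>(z, \<zeta>). K z \<zeta> * Dz (Dz (\<lambda>z \<zeta>. a z * \<psi> z \<zeta>)) z \<zeta> - K z \<zeta> * b \<zeta> * Dzeta (Dzeta \<psi>) z \<zeta>) = 0"
proof -
 obtain Z where Z: "compact Z" "Z \<subseteq> interior D" "\<And>z \<zeta>. (z, \<zeta>) \<notin> Z \<Longrightarrow> \<psi> z \<zeta> = 0"
  and C1: "C1_plane \<psi>" "C1_plane (Dz \<psi>)" "C1_plane (Dzeta \<psi>)"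
  using test unfolding test_function_def by blast
 have ZO: "Z \<subseteq> {0<..<1} \<times> {0<..<1}"
  using Z(2) interior_mono[OF D] by (simp add: interior_Times)
 have cZ: "closed Z" using Z(1) compact_imp_closed by blast
 have Dz0: "Dz h z \<zeta> = 0" if h: "\<And>z \<zeta>. (z, \<zeta>) \<notin> Z \<Longrightarrow> h z \<zeta> = 0" and n: "(z, \<zeta>) \<notin> Z" for h z \<zeta>
 proof -
  have op: "open ((\<lambda>x. (x, \<zeta>)) -` (- Z))" by (rule open_vimage) (use cZ in \<open>auto intro!: continuous_intros\<close>)
  have "((\<lambda>x. h x \<zeta>) has_real_derivative 0) (at z)"
   by (rule DERIV_zero_open[OF op]) (use n h in simp_all)
  then show ?thesis unfolding Dz_def by (rule DERIV_imp_deriv)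
 qed
 have Dy0: "Dzeta h z \<zeta> = 0" if h: "\<And>z \<zeta>. (z, \<zeta>) \<notin> Z \<Longrightarrow> h z \<zeta> = 0" and n: "(z, \<zeta>) \<notin> Z" for h z \<zeta>
 proof -
  have op: "open ((\<lambda>y. (z, y)) -` (- Z))" by (rule open_vimage) (use cZ in \<open>auto intro!: continuous_intros\<close>)
  have "((\<lambda>y. h z y) has_real_derivative 0) (at \<zeta>)"
   by (rule DERIV_zero_open[OF op]) (use n h in simp_all)
  then show ?thesis unfolding Dzeta_def by (rule DERIV_imp_deriv)
 qed
 define u where "u s = \<psi> (fst s) (snd s)" for s
 define uz where "uz s = Dz \<psi> (fst s) (snd s)" for s
 define uy where "uy s = Dzeta \<psi> (fst s) (snd s)" for s
 define uzz where "uzz s = Dz (Dz \<psi>) (fst s) (snd s)" for s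
 define uzy where "uzy s = Dzeta (Dz \<psi>) (fst s) (snd s)" for s
 define uyy where "uyy s = Dzeta (Dzeta \<psi>) (fst s) (snd s)" for s
 have uyz: "Dz (Dzeta \<psi>) x y = uzy (x, y)" for x y
  using mixed_partials_commute[OF C1] by (simp add: uzy_def)
 have u0: "s \<notin> Z \<Longrightarrow> u s = 0 \<and> uz s = 0 \<and> uy s = 0 \<and> uzz s = 0 \<and> uzy s = 0 \<and> uyy s = 0" for s
  unfolding u_def uz_def uy_def uzz_def uzy_def uyy_def using Z(3) Dz0 Dy0 by (cases s) (simp add: Dz0 Dy0)
 have uc: "continuous_on UNIV u" "continuous_on UNIV uz" "continuous_on UNIV uy" "continuous_on UNIV uzz"
  "continuous_on UNIV uzy" "continuous_on UNIV uyy"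
  unfolding u_def uz_def uy_def uzz_def uzy_def uyy_def
  using C1_plane_continuous[OF C1(1)] C1_planeD(3,4)[OF C1(1)] C1_planeD(3,4)[OF C1(2)] C1_planeD(4)[OF C1(3)] by auto
 have ud: "((\<lambda>x. u (x, y)) has_real_derivative uz (x, y)) (at x)" "((\<lambda>y. u (x, y)) has_real_derivative uy (x, y)) (at y)"
  "((\<lambda>x. uz (x, y)) has_real_derivative uzz (x, y)) (at x)" "((\<lambda>y. uz (x, y)) has_real_derivative uzy (x, y)) (at y)"
  "((\<lambda>x. uy (x, y)) has_real_derivative uzy (x, y)) (at x)" "((\<lambda>y. uy (x, y)) has_real_derivative uyy (x, y)) (at y)" for x y
  using C1_planeD(1,2)[OF C1(1), of y x] C1_planeD(1,2)[OF C1(1), of x y] C1_planeD(1,2)[OF C1(2)] C1_planeD(1,2)[OF C1(3)] uyz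
  by (auto simp: u_def uz_def uy_def uzz_def uzy_def uyy_def)
 let ?p = "\<lambda>s::real\<times>real. p (fst s)" and ?p1 = "\<lambda>s::real\<times>real. p1 (fst s)" and ?p2 = "\<lambda>s::real\<times>real. p2 (fst s)"
 let ?q = "\<lambda>s::real\<times>real. q (snd s)" and ?q1 = "\<lambda>s::real\<times>real. q1 (snd s)" and ?q2 = "\<lambda>s::real\<times>real. q2 (snd s)"
 \<comment> \<open>F is the test function of the wave equation. \<open>F1\<close> and
   \<open>F2\<close> are its derivatives in x and y, as p^2 and q^2 are the derivatives of z and
   \<zeta> with respect to x and y; a final z or y in a name marks a partial derivative in the
   original variables.\<close>
 define F where "F s = ?p s ^ 3 * u s / ?q s" for s
 define Fz where "Fz s = (3 * ?p s ^ 2 * ?p1 s * u s + ?p s ^ 3 * uz s) / ?q s" for s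
 define Fy where "Fy s = ?p s ^ 3 * (?q s * uy s - ?q1 s * u s) / ?q s ^ 2" for s
 define F1 where "F1 s = ?p s ^ 2 * Fz s" for s
 define F2 where "F2 s = ?q s ^ 2 * Fy s" for s
 define F1z where "F1z s = ((12 * ?p s ^ 3 * ?p1 s ^ 2 + 3 * ?p s ^ 4 * ?p2 s) * u s + 8 * ?p s ^ 4 * ?p1 s * uz s + ?p s ^ 5 * uzz s) / ?q s" for s
 define F1y where "F1y s = (3 * ?p s ^ 4 * ?p1 s * (?q s * uy s - ?q1 s * u s) + ?p s ^ 5 * (?q s * uzy s - ?q1 s * uz s)) / ?q s ^ 2" for s
 define F2z where "F2z s = 3 * ?p s ^ 2 * ?p1 s * (?q s * uy s - ?q1 s * u s) + ?p s ^ 3 * (?q s * uzy s - ?q1 s * uz s)" for s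
 define F2y where "F2y s = ?p s ^ 3 * (?q s * uyy s - ?q2 s * u s)" for s
 have qn: "q y \<noteq> 0" "p y \<noteq> 0" for y using c.pos[of y] r.pos[of y] by auto
 have F1': "F1 s = (3 * ?p s ^ 4 * ?p1 s * u s + ?p s ^ 5 * uz s) / ?q s" for s
  by (simp add: F1_def Fz_def field_simps eval_nat_numeral)
 have F2': "F2 s = ?p s ^ 3 * (?q s * uy s - ?q1 s * u s)" for s
  using qn by (simp add: F2_def Fy_def)
 have cont: "continuous_on UNIV Fy" "continuous_on UNIV F1y" "continuous_on UNIV F2y" "continuous_on UNIV F1z" "continuous_on UNIV F"
  unfolding Fy_def F1y_def F2y_def F1z_def F_def
  by (intro continuous_intros r.cont1 c.cont1 uc ballI; simp add: qn)+
 have Lq: "((\<lambda>s. G (\<xi> (fst s), \<nu> (snd s))) has_derivative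
  (\<lambda>d. ((p (\<xi> (fst s)))\<^sup>2 * Gz (\<xi> (fst s), \<nu> (snd s))) * fst d + ((q (\<nu> (snd s)))\<^sup>2 * Gy (\<xi> (fst s), \<nu> (snd s))) * snd d)) (at s)"
  if "\<And>a. a \<notin> Z \<Longrightarrow> G a = 0" "\<And>a. a \<notin> Z \<Longrightarrow> Gz a = 0" "\<And>a. a \<notin> Z \<Longrightarrow> Gy a = 0"
   "\<And>a b. a \<in> {0<..<1} \<Longrightarrow> b \<in> {0<..<1} \<Longrightarrow> ((\<lambda>x. G (x, b)) has_real_derivative Gz (a, b)) (at a)"
   "\<And>a b. a \<in> {0<..<1} \<Longrightarrow> b \<in> {0<..<1} \<Longrightarrow> ((\<lambda>y. G (a, y)) has_real_derivative Gy (a, b)) (at b)"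
   "continuous_on UNIV Gy" for G Gz Gy :: "real \<times> real \<Rightarrow> real" and s
  using lift_derivative[OF cZ ZO that] .
 note dd = r.dp_at c.dp_at ud
 have L0: "((\<lambda>s. F (\<xi> (fst s), \<nu> (snd s))) has_derivative
  (\<lambda>d. F1 (\<xi> (fst s), \<nu> (snd s)) * fst d + F2 (\<xi> (fst s), \<nu> (snd s)) * snd d)) (at s)" for s
 proof -
  have "((\<lambda>x. F (x, y)) has_real_derivative Fz (x, y)) (at x)" if "x \<in> {0<..<1}" "y \<in> {0<..<1}" for x y
   unfolding F_def Fz_def fst_conv snd_conv using that qn
   by (auto intro!: derivative_eq_intros dd simp: field_simps power2_eq_square)
  moreover have "((\<lambda>y. F (x, y)) has_real_derivative Fy (x, y)) (at y)" if "x \<in> {0<..<1}" "y \<in> {0<..<1}" for x y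
   unfolding F_def Fy_def fst_conv snd_conv using that qn
   by (auto intro!: derivative_eq_intros dd simp: field_simps power2_eq_square)
  ultimately show ?thesis
   using Lq[of F Fz Fy s] cont u0 by (simp add: F1_def F2_def F_def Fz_def Fy_def)
 qed
 have L1: "((\<lambda>s. F1 (\<xi> (fst s), \<nu> (snd s))) has_derivative
  (\<lambda>d. (p (\<xi> (fst s)) ^ 2 * F1z (\<xi> (fst s), \<nu> (snd s))) * fst d + (q (\<nu> (snd s)) ^ 2 * F1y (\<xi> (fst s), \<nu> (snd s))) * snd d)) (at s)" for s
 proof (rule Lq)
  show "((\<lambda>x. F1 (x, y)) has_real_derivative F1z (x, y)) (at x)" if "x \<in> {0<..<1}" "y \<in> {0<..<1}" for x y
   unfolding F1' F1z_def fst_conv snd_conv using that qn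
   by (auto intro!: derivative_eq_intros dd simp: field_simps eval_nat_numeral)
  show "((\<lambda>y. F1 (x, y)) has_real_derivative F1y (x, y)) (at y)" if "x \<in> {0<..<1}" "y \<in> {0<..<1}" for x y
   unfolding F1' F1y_def fst_conv snd_conv using that qn
   by (auto intro!: derivative_eq_intros dd simp: field_simps power2_eq_square)
 qed (use u0 cont in \<open>auto simp: F1' F1z_def F1y_def\<close>)
 have L2: "((\<lambda>s. F2 (\<xi> (fst s), \<nu> (snd s))) has_derivative
  (\<lambda>d. (p (\<xi> (fst s)) ^ 2 * F2z (\<xi> (fst s), \<nu> (snd s))) * fst d + (q (\<nu> (snd s)) ^ 2 * F2y (\<xi> (fst s), \<nu> (snd s))) * snd d)) (at s)" for s
 proof (rule Lq)
  show "((\<lambda>x. F2 (x, y)) has_real_derivative F2z (x, y)) (at x)" if "x \<in> {0<..<1}" "y \<in> {0<..<1}" for x y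
   unfolding F2' F2z_def fst_conv snd_conv using that qn
   by (auto intro!: derivative_eq_intros dd simp: field_simps eval_nat_numeral)
  show "((\<lambda>y. F2 (x, y)) has_real_derivative F2y (x, y)) (at y)" if "x \<in> {0<..<1}" "y \<in> {0<..<1}" for x y
   unfolding F2' F2y_def fst_conv snd_conv using that qn
   by (auto intro!: derivative_eq_intros dd simp: field_simps power2_eq_square)
 qed (use u0 cont in \<open>auto simp: F2' F2z_def F2y_def\<close>)
 \<comment> \<open>The mixed second derivative in x and y computed in either order;
   \<open>weak_wave_equation\<close> takes a single function for both.\<close>
 have mix: "p x ^ 2 * F2z (x, y) = q y ^ 2 * F1y (x, y)" for x y
  using qn by (simp add: F2z_def F1y_def field_simps eval_nat_numeral)
 define T where "T s = (\<xi> (fst s), \<nu> (snd s))" for s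
 have Tc: "continuous_on UNIV T" unfolding T_def by (intro continuous_intros r.cont1 c.cont1)
 define Ti where "Ti s = (\<phi> (fst s), \<theta> (snd s))" for s
 have Tic: "continuous_on UNIV Ti" unfolding Ti_def by (intro continuous_intros r.cont1 c.cont1)
 have TTi: "T (Ti s) = s" "Ti (T s) = s" for s by (simp_all add: T_def Ti_def r.inv c.inv)
 have "compact (Ti ` Z)" by (intro compact_continuous_image Z continuous_on_subset[OF Tic]) auto
 then have "bounded (Ti ` Z \<union> Z)" using Z(1) by (simp add: compact_imp_bounded)
 then obtain R where R: "\<And>s. s \<in> Ti ` Z \<union> Z \<Longrightarrow> norm s \<le> R" by (auto simp: bounded_iff)
 have out: "T s \<notin> Z" if "norm s > R" for s
  using R[of s] that TTi(2)[of s] by (metis UnI1 image_eqI not_le)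
 have out': "s \<notin> Z" if "norm s > R" for s using R[of s] that by auto
 let ?w = "\<lambda>s. f (fst s - snd s) + g (fst s + snd s) + C (fst s - snd s, fst s + snd s)"
 define Pxx where "Pxx s = p (\<xi> (fst s)) ^ 2 * F1z (T s)" for s
 define Pyy where "Pyy s = q (\<nu> (snd s)) ^ 2 * F2y (T s)" for s
 define Pxy where "Pxy s = q (\<nu> (snd s)) ^ 2 * F1y (T s)" for s
 have Pc: "continuous_on UNIV Pxx" "continuous_on UNIV Pyy" "continuous_on UNIV Pxy"
  unfolding Pxx_def Pyy_def Pxy_def
  by (intro continuous_intros r.cont1 c.cont1 continuous_on_compose2[OF cont(2) Tc]
   continuous_on_compose2[OF cont(3) Tc] continuous_on_compose2[OF cont(4) Tc]; simp)+
 have W: "(\<integral>s. ?w s * (Pxx s - Pyy s) \<partial>lborel) = (\<integral>s. 4 * H (fst s - snd s, fst s + snd s) * F (T s) \<partial>lborel)"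
 proof (rule weak_wave_equation[OF f g C cs H dC ccs dcs, where \<Psi>x="\<lambda>s. F1 (T s)" and \<Psi>y="\<lambda>s. F2 (T s)" and \<Psi>xy=Pxy and R=R])
  show "((\<lambda>s. F (T s)) has_derivative (\<lambda>d. F1 (T s) * fst d + F2 (T s) * snd d)) (at s)" for s
   using L0[of s] by (simp add: T_def)
  show "((\<lambda>s. F1 (T s)) has_derivative (\<lambda>d. Pxx s * fst d + Pxy s * snd d)) (at s)" for s
   using L1[of s] by (simp add: T_def Pxx_def Pxy_def)
  show "((\<lambda>s. F2 (T s)) has_derivative (\<lambda>d. Pxy s * fst d + Pyy s * snd d)) (at s)" for s
   using L2[of s] mix[of "\<xi> (fst s)" "\<nu> (snd s)"] by (simp add: T_def Pyy_def Pxy_def)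
  show "F (T s) = 0 \<and> F1 (T s) = 0 \<and> F2 (T s) = 0 \<and> Pxx s = 0 \<and> Pxy s = 0 \<and> Pyy s = 0" if "R < norm s" for s
   using u0[OF out[OF that]] by (simp add: F_def F1' F2' Pxx_def Pxy_def Pyy_def F1z_def F1y_def F2y_def)
 qed (use Pc in auto)
 have lw: "locbm ?w"
  by (intro locbm_add locbm_compose[OF f] locbm_compose[OF g] locbm_compose[OF locbm_continuous[OF C]] continuous_intros)
 have lH: "locbm (\<lambda>s. 4 * H (fst s - snd s, fst s + snd s) * F (T s))"
  by (intro locbm_mult locbm_const locbm_compose[OF H] locbm_compose[OF locbm_continuous[OF cont(5)] Tc] continuous_intros)
 have lP: "locbm (\<lambda>s. ?w s * (Pxx s - Pyy s))" by (intro locbm_mult lw locbm_diff locbm_continuous Pc)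
 \<comment> \<open>The wave equation says that G has integral 0; it remains to return to (z,
   \<zeta>), with Jacobian 1 / (p^2 q^2).\<close>
 define G where "G s = ?w s * (Pxx s - Pyy s) - 4 * H (fst s - snd s, fst s + snd s) * F (T s)" for s
 have lG: "locbm G" unfolding G_def by (intro locbm_diff lP lH)
 have z1: "F (T s) = 0 \<and> Pxx s = 0 \<and> Pyy s = 0" if "R < norm s" for s
  using u0[OF out[OF that]] by (simp add: F_def Pxx_def Pyy_def F1z_def F2y_def)
 have Gz: "G s = 0" if "R < norm s" for s using z1[OF that] by (simp add: G_def)
 have G0: "(\<integral>s. G s \<partial>lborel) = 0"
  unfolding G_def
  by (subst Bochner_Integration.integral_diff[OF locbm_support_integrable[OF lP, of R] locbm_support_integrable[OF lH, of R]])
   (use z1 W in auto)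
 let ?I = "\<lambda>s. G (\<phi> (fst s), \<theta> (snd s)) * (1 / (p (fst s))\<^sup>2 * (1 / (q (snd s))\<^sup>2))"
 have GTi: "G (\<phi> (fst s), \<theta> (snd s)) = 0" if "s \<notin> Z" for s
  using u0[OF that] TTi(1)[of s] by (simp add: G_def Pxx_def Pyy_def F_def F1z_def F2y_def Ti_def)
 have S: "(\<integral>s. ?I s \<partial>lborel) = (\<integral>s. G s \<partial>lborel)"
 proof (rule lborel_substitution2[OF lG Gz r.d\<phi> _ _ r.surj_\<phi> c.d\<phi> _ _ c.surj_\<phi>])
  show "continuous_on UNIV (\<lambda>x. 1 / (p x)\<^sup>2)" "continuous_on UNIV (\<lambda>x. 1 / (q x)\<^sup>2)"
   using qn by (auto intro!: continuous_intros r.pc c.pc)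
  show "R < norm s \<Longrightarrow> G (\<phi> (fst s), \<theta> (snd s)) = 0" for s using GTi[OF out'] .
 qed (simp_all add: r.pos c.pos qn)
 let ?J = "\<lambda>s. K (fst s) (snd s) * Dz (Dz (\<lambda>z \<zeta>. a z * \<psi> z \<zeta>)) (fst s) (snd s) - K (fst s) (snd s) * b (snd s) * Dzeta (Dzeta \<psi>) (fst s) (snd s)"
 have J0: "?J s = 0" if "s \<notin> Z" for s
 proof -
  obtain z \<zeta> where s: "s = (z, \<zeta>)" by force
  have n: "(z, \<zeta>) \<notin> Z" using that s by simp
  have "Dz (Dz (\<lambda>z \<zeta>. a z * \<psi> z \<zeta>)) z \<zeta> = 0" by (rule Dz0[OF Dz0 n]) (use Z(3) in auto)
  moreover have "Dzeta (Dzeta \<psi>) z \<zeta> = 0" by (rule Dy0[OF Dy0 n]) (use Z(3) in auto)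
  ultimately show ?thesis by (simp add: s)
 qed
 have IJ: "?J s = ?I s" for s
 proof (cases "s \<in> Z")
  case False
  then show ?thesis using J0 GTi by simp
 next
  case True
  obtain z \<zeta> where s: "s = (z, \<zeta>)" by force
  have zO: "z \<in> {0<..<1}" "\<zeta> \<in> {0<..<1}" and iD: "(z, \<zeta>) \<in> interior D" using True s ZO Z(2) by auto
  have d1: "Dz (\<lambda>z \<zeta>. a z * \<psi> z \<zeta>) x \<zeta> = 4 * p x ^ 3 * p1 x * u (x, \<zeta>) + p x ^ 4 * uz (x, \<zeta>)" if "x \<in> {0<..<1}" for x
  proof -
   have "((\<lambda>x. p x ^ 4 * u (x, \<zeta>)) has_real_derivative 4 * p x ^ 3 * p1 x * u (x, \<zeta>) + p x ^ 4 * uz (x, \<zeta>)) (at x)"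
    using that by (auto intro!: derivative_eq_intros dd)
   then have "((\<lambda>x. a x * \<psi> x \<zeta>) has_real_derivative 4 * p x ^ 3 * p1 x * u (x, \<zeta>) + p x ^ 4 * uz (x, \<zeta>)) (at x)"
    by (rule has_field_derivative_transform_within_open[of _ _ _ "{0<..<1}"]) (use that ab in \<open>auto simp: u_def\<close>)
   then show ?thesis unfolding Dz_def by (rule DERIV_imp_deriv)
  qed
  have "((\<lambda>x. 4 * p x ^ 3 * p1 x * u (x, \<zeta>) + p x ^ 4 * uz (x, \<zeta>)) has_real_derivative
   (12 * p z ^ 2 * p1 z ^ 2 + 4 * p z ^ 3 * p2 z) * u (z, \<zeta>) + 8 * p z ^ 3 * p1 z * uz (z, \<zeta>) + p z ^ 4 * uzz (z, \<zeta>)) (at z)"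
   using zO by (auto intro!: derivative_eq_intros dd simp: algebra_simps eval_nat_numeral)
  then have "((\<lambda>x. Dz (\<lambda>z \<zeta>. a z * \<psi> z \<zeta>) x \<zeta>) has_real_derivative
   (12 * p z ^ 2 * p1 z ^ 2 + 4 * p z ^ 3 * p2 z) * u (z, \<zeta>) + 8 * p z ^ 3 * p1 z * uz (z, \<zeta>) + p z ^ 4 * uzz (z, \<zeta>)) (at z)"
   by (rule has_field_derivative_transform_within_open[of _ _ _ "{0<..<1}"]) (use zO d1 in auto)
  then have d2: "Dz (Dz (\<lambda>z \<zeta>. a z * \<psi> z \<zeta>)) z \<zeta> =
   (12 * p z ^ 2 * p1 z ^ 2 + 4 * p z ^ 3 * p2 z) * u (z, \<zeta>) + 8 * p z ^ 3 * p1 z * uz (z, \<zeta>) + p z ^ 4 * uzz (z, \<zeta>)"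
   unfolding Dz_def[of "Dz (\<lambda>z \<zeta>. a z * \<psi> z \<zeta>)"] by (rule DERIV_imp_deriv)
  define w where "w = f (\<phi> z - \<theta> \<zeta>) + g (\<phi> z + \<theta> \<zeta>) + C (\<phi> z - \<theta> \<zeta>, \<phi> z + \<theta> \<zeta>)"
  have Kw: "K z \<zeta> = p z / q \<zeta> ^ 3 * w" using K[OF iD] by (simp add: w_def)
  have Hw: "4 * H (\<phi> z - \<theta> \<zeta>, \<phi> z + \<theta> \<zeta>) = (q \<zeta> ^ 3 * q2 \<zeta> - p z ^ 3 * p2 z) * w"
   using HM[OF iD] m[of "\<phi> z" "\<theta> \<zeta>"] by (simp add: w_def r.inv c.inv)
  have J: "?J s = p z / q \<zeta> ^ 3 * w * ((12 * p z ^ 2 * p1 z ^ 2 + 4 * p z ^ 3 * p2 z) * u (z, \<zeta>) + 8 * p z ^ 3 * p1 z * uz (z, \<zeta>) + p z ^ 4 * uzz (z, \<zeta>))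
   - p z / q \<zeta> ^ 3 * w * q \<zeta> ^ 4 * uyy (z, \<zeta>)"
   using zO ab(2)[of \<zeta>] by (simp add: s d2 Kw uyy_def)
  have I: "?I s = (w * (p z ^ 2 * F1z (z, \<zeta>) - q \<zeta> ^ 2 * F2y (z, \<zeta>)) - (q \<zeta> ^ 3 * q2 \<zeta> - p z ^ 3 * p2 z) * w * F (z, \<zeta>))
   * (1 / (p z)\<^sup>2 * (1 / (q \<zeta>)\<^sup>2))"
   by (simp add: s G_def Pxx_def Pyy_def T_def r.inv c.inv Hw w_def[symmetric])
  \<comment> \<open>The part of the potential with p2 raises the coefficient 3 of p^4 p2 in
    \<open>F1z\<close> to the 4 that comes from the second derivative of p^4, and the part with q2
    cancels the one in \<open>F2y\<close>.\<close>
  show ?thesis unfolding J I F1z_def F2y_def F_def using qn by (simp add: field_simps eval_nat_numeral)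
 qed
 have lI: "locbm ?I"
  by (intro locbm_mult locbm_compose[OF lG] locbm_continuous continuous_intros r.cont1 c.cont1 ballI) (auto simp: qn)
 have "integrable lborel ?I"
  by (rule locbm_support_integrable[OF lI, of R]) (use GTi[OF out'] in auto)
 then have "(?I has_integral 0) UNIV"
  using has_integral_integral_lborel[of ?I] S G0 by simp
 then have "integral UNIV ?J = 0" using IJ by (simp add: integral_unique)
 moreover have "integral D ?J = integral UNIV ?J"
 proof -
  have ZD: "Z \<subseteq> D" using Z(2) interior_subset by blast
  have "(if s \<in> D then ?J s else 0) = ?J s" for s
  proof (cases "s \<in> D")
   case False
   then have "s \<notin> Z" using ZD by blast
   then show ?thesis using J0 False by simp
  qed simp
  then show ?thesis using integral_restrict_UNIV[of D ?J] by presburger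
 qed
 ultimately show ?thesis by (simp add: case_prod_beta')
qed

end

section \<open>Piecewise regular kernels and their partial derivatives\<close>

lemma at_within_slice_has_derivative:
 assumes f: "((\<lambda>(x, y). f x y) has_derivative f') (at (a, b) within D)"
 shows "((\<lambda>x. f x b) has_vector_derivative f' (1, 0)) (at a within {x. (x, b) \<in> D})"
  and "((\<lambda>y. f a y) has_vector_derivative f' (0, 1)) (at b within {y. (a, y) \<in> D})"
proof -
 interpret f': bounded_linear f' using f by (rule has_derivative_bounded_linear)
 have "((\<lambda>x. (x, b)) has_derivative (\<lambda>h. (h, 0))) (at a within {x. (x, b) \<in> D})"
  by (auto intro!: derivative_eq_intros)
 moreover have "((\<lambda>(x, y). f x y) has_derivative f') (at (a, b) within (\<lambda>x. (x, b)) ` {x. (x, b) \<in> D})"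
  by (rule has_derivative_subset[OF f]) auto
 ultimately have "((\<lambda>x. (\<lambda>(x, y). f x y) (x, b)) has_derivative (\<lambda>h. f' (h, 0))) (at a within {x. (x, b) \<in> D})"
  by (rule has_derivative_in_compose)
 then have "((\<lambda>x. f x b) has_derivative (\<lambda>h. f' (h, 0))) (at a within {x. (x, b) \<in> D})" by (simp only: prod.case)
 moreover have "(\<lambda>h. f' (h, 0)) = (\<lambda>h. h *\<^sub>R f' (1, 0))"
 proof
  fix h show "f' (h, 0) = h *\<^sub>R f' (1, 0)" using f'.scaleR[of h "(1, 0)"] by simp
 qed
 ultimately show "((\<lambda>x. f x b) has_vector_derivative f' (1, 0)) (at a within {x. (x, b) \<in> D})"
  by (simp only: has_vector_derivative_def)
 have "((\<lambda>y. (a, y)) has_derivative (\<lambda>h. (0, h))) (at b within {y. (a, y) \<in> D})"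
  by (auto intro!: derivative_eq_intros)
 moreover have "((\<lambda>(x, y). f x y) has_derivative f') (at (a, b) within (\<lambda>y. (a, y)) ` {y. (a, y) \<in> D})"
  by (rule has_derivative_subset[OF f]) auto
 ultimately have "((\<lambda>y. (\<lambda>(x, y). f x y) (a, y)) has_derivative (\<lambda>h. f' (0, h))) (at b within {y. (a, y) \<in> D})"
  by (rule has_derivative_in_compose)
 then have "((\<lambda>y. f a y) has_derivative (\<lambda>h. f' (0, h))) (at b within {y. (a, y) \<in> D})" by (simp only: prod.case)
 moreover have "(\<lambda>h. f' (0, h)) = (\<lambda>h. h *\<^sub>R f' (0, 1))"
 proof
  fix h show "f' (0, h) = h *\<^sub>R f' (0, 1)" using f'.scaleR[of h "(0, 1)"] by simp
 qed
 ultimately show "((\<lambda>y. f a y) has_vector_derivative f' (0, 1)) (at b within {y. (a, y) \<in> D})"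
  by (simp only: has_vector_derivative_def)
qed

text \<open>Both slices of D through the point accumulate at it. This makes derivatives along the
  slices unique, so that \<open>pd_z\<close> and \<open>pd_zeta\<close> are determined by the total
  derivative.\<close>

definition thick :: "(real \<times> real) set \<Rightarrow> real \<times> real \<Rightarrow> bool" where
 "thick D p \<longleftrightarrow> at (fst p) within {x. (x, snd p) \<in> D} \<noteq> bot \<and> at (snd p) within {y. (fst p, y) \<in> D} \<noteq> bot"

lemma pd_eq:
 assumes f: "((\<lambda>(x, y). f x y) has_derivative f') (at (a, b) within D)" and t: "thick D (a, b)"
 shows "pd_z D f a b = f' (1, 0)" "pd_zeta D f a b = f' (0, 1)"
 using at_within_slice_has_derivative[OF f] t
 unfolding pd_z_def pd_zeta_def thick_def by (auto intro: vector_derivative_within)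

text \<open>\<open>pw_C1\<close> with thick pieces. With unique partial derivatives the property
  passes to sums and to images under bounded linear maps, which allows passing from entries to
  matrices.\<close>

definition pwc :: "(real \<times> real) set \<Rightarrow> (real \<Rightarrow> real \<Rightarrow> 'a::real_normed_vector) \<Rightarrow> bool" where
 "pwc D f \<longleftrightarrow> (\<exists>\<U> \<Gamma>. finite \<U> \<and> finite \<Gamma> \<and> (\<forall>\<gamma>\<in>\<Gamma>. valid_path \<gamma>) \<and>
  D \<subseteq> \<Union>\<U> \<union> (\<Union>\<gamma>\<in>\<Gamma>. path_image \<gamma>) \<and> finite (frontier D - \<Union>\<U>) \<and>
  (\<forall>U\<in>\<U>. openin (top_of_set D) U \<and> (\<forall>p\<in>U. thick D p) \<and>
    (\<forall>p\<in>U. (\<lambda>(z, \<zeta>). f z \<zeta>) differentiable (at p within D)) \<and>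
    uniformly_continuous_on U (\<lambda>(z, \<zeta>). f z \<zeta>) \<and>
    uniformly_continuous_on U (\<lambda>(z, \<zeta>). pd_z D f z \<zeta>) \<and>
    uniformly_continuous_on U (\<lambda>(z, \<zeta>). pd_zeta D f z \<zeta>)))"

lemma pwc_imp_pw_C1: "pwc D f \<Longrightarrow> pw_C1 D f"
 unfolding pwc_def pw_C1_def
 by (elim exE conjE, intro exI conjI, assumption+) (rule ballI, drule (1) bspec, simp)

lemma uniformly_continuous_on_subset':
 fixes f :: "'a::metric_space \<Rightarrow> 'b::metric_space"
 shows "uniformly_continuous_on A f \<Longrightarrow> B \<subseteq> A \<Longrightarrow> uniformly_continuous_on B f"
 unfolding uniformly_continuous_on_def by (meson subsetD)

lemma uniformly_continuous_on_eq:
 fixes f :: "'a::metric_space \<Rightarrow> 'b::metric_space"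
 shows "uniformly_continuous_on A f \<Longrightarrow> (\<And>x. x \<in> A \<Longrightarrow> f x = g x) \<Longrightarrow> uniformly_continuous_on A g"
 unfolding uniformly_continuous_on_def by simp

text \<open>Common refinement: the pieces are the pairwise intersections, the curves are
  united.\<close>

lemma pwc_add:
 assumes "pwc D f" "pwc D g" shows "pwc D (\<lambda>z \<zeta>. f z \<zeta> + g z \<zeta>)"
proof -
 obtain \<U> \<Gamma> where f: "finite \<U>" "finite \<Gamma>" "\<forall>\<gamma>\<in>\<Gamma>. valid_path \<gamma>" "D \<subseteq> \<Union>\<U> \<union> (\<Union>\<gamma>\<in>\<Gamma>. path_image \<gamma>)" "finite (frontier D - \<Union>\<U>)"
  "\<forall>U\<in>\<U>. openin (top_of_set D) U \<and> (\<forall>p\<in>U. thick D p) \<and> (\<forall>p\<in>U. (\<lambda>(z, \<zeta>). f z \<zeta>) differentiable (at p within D)) \<and>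
    uniformly_continuous_on U (\<lambda>(z, \<zeta>). f z \<zeta>) \<and> uniformly_continuous_on U (\<lambda>(z, \<zeta>). pd_z D f z \<zeta>) \<and>
    uniformly_continuous_on U (\<lambda>(z, \<zeta>). pd_zeta D f z \<zeta>)"
  using assms(1) unfolding pwc_def by blast
 obtain \<V> \<Delta> where g: "finite \<V>" "finite \<Delta>" "\<forall>\<gamma>\<in>\<Delta>. valid_path \<gamma>" "D \<subseteq> \<Union>\<V> \<union> (\<Union>\<gamma>\<in>\<Delta>. path_image \<gamma>)" "finite (frontier D - \<Union>\<V>)"
  "\<forall>U\<in>\<V>. openin (top_of_set D) U \<and> (\<forall>p\<in>U. thick D p) \<and> (\<forall>p\<in>U. (\<lambda>(z, \<zeta>). g z \<zeta>) differentiable (at p within D)) \<and>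
    uniformly_continuous_on U (\<lambda>(z, \<zeta>). g z \<zeta>) \<and> uniformly_continuous_on U (\<lambda>(z, \<zeta>). pd_z D g z \<zeta>) \<and>
    uniformly_continuous_on U (\<lambda>(z, \<zeta>). pd_zeta D g z \<zeta>)"
  using assms(2) unfolding pwc_def by blast
 let ?W = "(\<lambda>(U, V). U \<inter> V) ` (\<U> \<times> \<V>)"
 have un: "\<Union>?W = \<Union>\<U> \<inter> \<Union>\<V>" by auto
 show ?thesis unfolding pwc_def
 proof (intro exI[of _ ?W] exI[of _ "\<Gamma> \<union> \<Delta>"] conjI)
  show "finite ?W" "finite (\<Gamma> \<union> \<Delta>)" using f(1,2) g(1,2) by auto
  show "\<forall>\<gamma>\<in>\<Gamma> \<union> \<Delta>. valid_path \<gamma>" using f(3) g(3) by blast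
  show "D \<subseteq> \<Union>?W \<union> (\<Union>\<gamma>\<in>\<Gamma> \<union> \<Delta>. path_image \<gamma>)" using f(4) g(4) unfolding un by blast
  show "finite (frontier D - \<Union>?W)" using finite_UnI[OF f(5) g(5)] unfolding un by (simp add: Diff_Int)
  show "\<forall>U\<in>?W. openin (top_of_set D) U \<and> (\<forall>p\<in>U. thick D p) \<and>
    (\<forall>p\<in>U. (\<lambda>(z, \<zeta>). f z \<zeta> + g z \<zeta>) differentiable (at p within D)) \<and>
    uniformly_continuous_on U (\<lambda>(z, \<zeta>). f z \<zeta> + g z \<zeta>) \<and>
    uniformly_continuous_on U (\<lambda>(z, \<zeta>). pd_z D (\<lambda>z \<zeta>. f z \<zeta> + g z \<zeta>) z \<zeta>) \<and>
    uniformly_continuous_on U (\<lambda>(z, \<zeta>). pd_zeta D (\<lambda>z \<zeta>. f z \<zeta> + g z \<zeta>) z \<zeta>)"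
  proof (rule ballI, elim imageE, clarify)
   fix U V assume UV: "U \<in> \<U>" "V \<in> \<V>"
   have fU: "openin (top_of_set D) U" "\<And>p. p \<in> U \<Longrightarrow> thick D p" "\<And>p. p \<in> U \<Longrightarrow> (\<lambda>(z, \<zeta>). f z \<zeta>) differentiable (at p within D)"
    "uniformly_continuous_on U (\<lambda>(z, \<zeta>). f z \<zeta>)" "uniformly_continuous_on U (\<lambda>(z, \<zeta>). pd_z D f z \<zeta>)"
    "uniformly_continuous_on U (\<lambda>(z, \<zeta>). pd_zeta D f z \<zeta>)"
    using f(6)[rule_format, OF UV(1)] by simp_all
   have gV: "openin (top_of_set D) V" "\<And>p. p \<in> V \<Longrightarrow> (\<lambda>(z, \<zeta>). g z \<zeta>) differentiable (at p within D)"
    "uniformly_continuous_on V (\<lambda>(z, \<zeta>). g z \<zeta>)" "uniformly_continuous_on V (\<lambda>(z, \<zeta>). pd_z D g z \<zeta>)"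
    "uniformly_continuous_on V (\<lambda>(z, \<zeta>). pd_zeta D g z \<zeta>)"
    using g(6)[rule_format, OF UV(2)] by simp_all
   let ?UV = "U \<inter> V"
   have d: "\<exists>f' g'. ((\<lambda>(z, \<zeta>). f z \<zeta>) has_derivative f') (at (a, b) within D) \<and> ((\<lambda>(z, \<zeta>). g z \<zeta>) has_derivative g') (at (a, b) within D)
     \<and> ((\<lambda>(z, \<zeta>). f z \<zeta> + g z \<zeta>) has_derivative (\<lambda>d. f' d + g' d)) (at (a, b) within D) \<and> thick D (a, b)" if "(a, b) \<in> ?UV" for a b
   proof -
    have "(a, b) \<in> U" "(a, b) \<in> V" using that by auto
    then obtain f' g' where fg: "((\<lambda>(z, \<zeta>). f z \<zeta>) has_derivative f') (at (a, b) within D)" "((\<lambda>(z, \<zeta>). g z \<zeta>) has_derivative g') (at (a, b) within D)"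
     using fU(3) gV(2) unfolding differentiable_def by metis
    from has_derivative_add[OF fg] have "((\<lambda>(z, \<zeta>). f z \<zeta> + g z \<zeta>) has_derivative (\<lambda>d. f' d + g' d)) (at (a, b) within D)"
     by (simp add: case_prod_beta')
    then show ?thesis using fg fU(2)[OF \<open>(a, b) \<in> U\<close>] by blast
   qed
   have pd: "pd_z D f a b + pd_z D g a b = pd_z D (\<lambda>z \<zeta>. f z \<zeta> + g z \<zeta>) a b"
     "pd_zeta D f a b + pd_zeta D g a b = pd_zeta D (\<lambda>z \<zeta>. f z \<zeta> + g z \<zeta>) a b"
    if "(a, b) \<in> ?UV" for a b
    using d[OF that] by (auto simp: pd_eq)
   show "openin (top_of_set D) ?UV \<and> (\<forall>p\<in>?UV. thick D p) \<and>
    (\<forall>p\<in>?UV. (\<lambda>(z, \<zeta>). f z \<zeta> + g z \<zeta>) differentiable (at p within D)) \<and>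
    uniformly_continuous_on ?UV (\<lambda>(z, \<zeta>). f z \<zeta> + g z \<zeta>) \<and>
    uniformly_continuous_on ?UV (\<lambda>(z, \<zeta>). pd_z D (\<lambda>z \<zeta>. f z \<zeta> + g z \<zeta>) z \<zeta>) \<and>
    uniformly_continuous_on ?UV (\<lambda>(z, \<zeta>). pd_zeta D (\<lambda>z \<zeta>. f z \<zeta> + g z \<zeta>) z \<zeta>)"
   proof (intro conjI)
    show "openin (top_of_set D) ?UV" using fU(1) gV(1) by (rule openin_Int)
    show "\<forall>p\<in>?UV. thick D p" using fU(2) by simp
    show "\<forall>p\<in>?UV. (\<lambda>(z, \<zeta>). f z \<zeta> + g z \<zeta>) differentiable (at p within D)"
    proof
     fix p assume p: "p \<in> ?UV"
     obtain a b where ab: "p = (a, b)" by force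
     show "(\<lambda>(z, \<zeta>). f z \<zeta> + g z \<zeta>) differentiable (at p within D)"
      using d[of a b] p unfolding ab differentiable_def by blast
    qed
    have sub: "?UV \<subseteq> U" "?UV \<subseteq> V" by auto
    have u: "uniformly_continuous_on ?UV (\<lambda>x. h x + k x)" if "uniformly_continuous_on U h" "uniformly_continuous_on V k" for h k :: "real \<times> real \<Rightarrow> 'a"
     by (intro uniformly_continuous_on_add uniformly_continuous_on_subset'[OF that(1) sub(1)] uniformly_continuous_on_subset'[OF that(2) sub(2)])
    show "uniformly_continuous_on ?UV (\<lambda>(z, \<zeta>). f z \<zeta> + g z \<zeta>)"
     by (rule uniformly_continuous_on_eq[OF u[OF fU(4) gV(3)]]) auto
    show "uniformly_continuous_on ?UV (\<lambda>(z, \<zeta>). pd_z D (\<lambda>z \<zeta>. f z \<zeta> + g z \<zeta>) z \<zeta>)"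
     by (rule uniformly_continuous_on_eq[OF u[OF fU(5) gV(4)]]) (use pd in auto)
    show "uniformly_continuous_on ?UV (\<lambda>(z, \<zeta>). pd_zeta D (\<lambda>z \<zeta>. f z \<zeta> + g z \<zeta>) z \<zeta>)"
     by (rule uniformly_continuous_on_eq[OF u[OF fU(6) gV(5)]]) (use pd in auto)
   qed
  qed
 qed
qed

lemma pwc_linear:
 assumes f: "pwc D f" and L: "bounded_linear l" shows "pwc D (\<lambda>z \<zeta>. l (f z \<zeta>))"
proof -
 obtain \<U> \<Gamma> where f: "finite \<U>" "finite \<Gamma>" "\<forall>\<gamma>\<in>\<Gamma>. valid_path \<gamma>" "D \<subseteq> \<Union>\<U> \<union> (\<Union>\<gamma>\<in>\<Gamma>. path_image \<gamma>)" "finite (frontier D - \<Union>\<U>)"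
  "\<forall>U\<in>\<U>. openin (top_of_set D) U \<and> (\<forall>p\<in>U. thick D p) \<and> (\<forall>p\<in>U. (\<lambda>(z, \<zeta>). f z \<zeta>) differentiable (at p within D)) \<and>
    uniformly_continuous_on U (\<lambda>(z, \<zeta>). f z \<zeta>) \<and> uniformly_continuous_on U (\<lambda>(z, \<zeta>). pd_z D f z \<zeta>) \<and>
    uniformly_continuous_on U (\<lambda>(z, \<zeta>). pd_zeta D f z \<zeta>)"
  using assms(1) unfolding pwc_def by blast
 show ?thesis unfolding pwc_def
 proof (intro exI[of _ \<U>] exI[of _ \<Gamma>] conjI f(1-5) ballI)
  fix U assume U: "U \<in> \<U>"
  have fU: "openin (top_of_set D) U" "\<And>p. p \<in> U \<Longrightarrow> thick D p" "\<And>p. p \<in> U \<Longrightarrow> (\<lambda>(z, \<zeta>). f z \<zeta>) differentiable (at p within D)"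
    "uniformly_continuous_on U (\<lambda>(z, \<zeta>). f z \<zeta>)" "uniformly_continuous_on U (\<lambda>(z, \<zeta>). pd_z D f z \<zeta>)"
    "uniformly_continuous_on U (\<lambda>(z, \<zeta>). pd_zeta D f z \<zeta>)"
    using f(6)[rule_format, OF U] by simp_all
  have d: "\<exists>f'. ((\<lambda>(z, \<zeta>). f z \<zeta>) has_derivative f') (at (a, b) within D)
    \<and> ((\<lambda>(z, \<zeta>). l (f z \<zeta>)) has_derivative (\<lambda>d. l (f' d))) (at (a, b) within D) \<and> thick D (a, b)" if ab: "(a, b) \<in> U" for a b
  proof -
   obtain f' where f': "((\<lambda>(z, \<zeta>). f z \<zeta>) has_derivative f') (at (a, b) within D)"
    using fU(3)[OF ab] unfolding differentiable_def by blast
   from bounded_linear.has_derivative[OF L f'] have "((\<lambda>(z, \<zeta>). l (f z \<zeta>)) has_derivative (\<lambda>d. l (f' d))) (at (a, b) within D)"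
    by (simp add: case_prod_beta')
   then show ?thesis using f' fU(2)[OF ab] by blast
  qed
  have pd: "l (pd_z D f a b) = pd_z D (\<lambda>z \<zeta>. l (f z \<zeta>)) a b"
    "l (pd_zeta D f a b) = pd_zeta D (\<lambda>z \<zeta>. l (f z \<zeta>)) a b" if "(a, b) \<in> U" for a b
   using d[OF that] by (auto simp: pd_eq)
  show "openin (top_of_set D) U" "\<And>p. p \<in> U \<Longrightarrow> thick D p" using fU(1,2) by auto
  show "(\<lambda>(z, \<zeta>). l (f z \<zeta>)) differentiable (at p within D)" if "p \<in> U" for p
   using d that unfolding differentiable_def by (cases p) blast
  show "uniformly_continuous_on U (\<lambda>(z, \<zeta>). l (f z \<zeta>))"
   by (rule uniformly_continuous_on_eq[OF bounded_linear.uniformly_continuous_on[OF L fU(4)]]) auto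
  show "uniformly_continuous_on U (\<lambda>(z, \<zeta>). pd_z D (\<lambda>z \<zeta>. l (f z \<zeta>)) z \<zeta>)"
   by (rule uniformly_continuous_on_eq[OF bounded_linear.uniformly_continuous_on[OF L fU(5)]]) (use pd in auto)
  show "uniformly_continuous_on U (\<lambda>(z, \<zeta>). pd_zeta D (\<lambda>z \<zeta>. l (f z \<zeta>)) z \<zeta>)"
   by (rule uniformly_continuous_on_eq[OF bounded_linear.uniformly_continuous_on[OF L fU(6)]]) (use pd in auto)
 qed
qed

lemma valid_path_const: "valid_path (\<lambda>_. p :: real \<times> real)"
proof -
 have "(\<lambda>_. p) C1_differentiable_on {0..1::real}"
  unfolding C1_differentiable_on_def by (rule exI[of _ "\<lambda>_. 0"]) simp
 then show ?thesis unfolding valid_path_def by (rule C1_differentiable_imp_piecewise)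
qed

lemma path_image_const: "path_image (\<lambda>_. p) = {p}"
 by (auto simp: path_image_def image_constant_conv)

lemma pwc_zero:
 assumes E: "finite E" "\<And>p. p \<in> D - E \<Longrightarrow> thick D p" and D: "closed D"
 shows "pwc D (\<lambda>z \<zeta>. 0 :: 'a::real_normed_vector)"
 unfolding pwc_def
proof (intro exI[of _ "{D - E}"] exI[of _ "(\<lambda>p _. p) ` E"] conjI ballI)
 show "finite {D - E}" "finite ((\<lambda>p _. p) ` E)" using E(1) by auto
 show "valid_path \<gamma>" if "\<gamma> \<in> (\<lambda>p _. p) ` E" for \<gamma> :: "real \<Rightarrow> real \<times> real" using that valid_path_const by auto
 show "D \<subseteq> \<Union> {D - E} \<union> (\<Union>\<gamma>\<in>(\<lambda>p _. p) ` E. path_image \<gamma>)" by (auto simp: path_image_const)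
 have "frontier D - \<Union> {D - E} \<subseteq> E" using D by (auto simp: frontier_def)
 then show "finite (frontier D - \<Union> {D - E})" using E(1) finite_subset by blast
 fix U assume U: "U \<in> {D - E}"
 then show "openin (top_of_set D) U"
  using finite_imp_closed[OF E(1)] by (auto simp: openin_open intro!: exI[of _ "- E"])
 show "thick D p" if "p \<in> U" for p using E(2) that U by blast
 have d: "((\<lambda>(z, \<zeta>). 0 :: 'a) has_derivative (\<lambda>_. 0)) (at p within D)" for p
  by (simp add: case_prod_beta')
 show "(\<lambda>(z, \<zeta>). 0 :: 'a) differentiable (at p within D)" for p using d unfolding differentiable_def by blast
 have pd: "pd_z D (\<lambda>z \<zeta>. 0 :: 'a) a b = 0" "pd_zeta D (\<lambda>z \<zeta>. 0 :: 'a) a b = 0" if "(a, b) \<in> U" for a b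
  using pd_eq[OF d[of "(a, b)"]] E(2)[of "(a, b)"] that U by auto
 show "uniformly_continuous_on U (\<lambda>(z, \<zeta>). 0 :: 'a)" by (simp add: case_prod_beta' uniformly_continuous_on_const)
 show "uniformly_continuous_on U (\<lambda>(z, \<zeta>). pd_z D (\<lambda>z \<zeta>. 0 :: 'a) z \<zeta>)"
  by (rule uniformly_continuous_on_eq[OF uniformly_continuous_on_const[of _ 0]]) (use pd in auto)
 show "uniformly_continuous_on U (\<lambda>(z, \<zeta>). pd_zeta D (\<lambda>z \<zeta>. 0 :: 'a) z \<zeta>)"
  by (rule uniformly_continuous_on_eq[OF uniformly_continuous_on_const[of _ 0]]) (use pd in auto)
qed

lemma pwc_matrix:
 fixes K :: "real \<Rightarrow> real \<Rightarrow> real^'c^'r"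
 assumes K: "\<And>i j. pwc D (\<lambda>z \<zeta>. K z \<zeta> $ i $ j)"
  and E: "finite E" "\<And>p. p \<in> D - E \<Longrightarrow> thick D p" and D: "closed D"
 shows "pwc D K"
proof -
 have s: "pwc D (\<lambda>z \<zeta>. \<Sum>x\<in>A. g x z \<zeta>)" if "finite A" "\<And>x. x \<in> A \<Longrightarrow> pwc D (g x)" for A :: "'x set" and g :: "'x \<Rightarrow> real \<Rightarrow> real \<Rightarrow> real^'c^'r"
  using that by (induction A rule: finite_induct) (auto intro: pwc_add pwc_zero[OF E D])
 define B :: "'r \<Rightarrow> 'c \<Rightarrow> real^'c^'r" where "B i j = (\<chi> k l. if k = i \<and> l = j then 1 else 0)" for i j
 have c: "(if k = i \<and> l = j then c else 0) = (if j = l then if i = k then c else 0 else 0)" for i j k l and c :: real by auto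
 have eq: "K z \<zeta> = (\<Sum>i\<in>UNIV. \<Sum>j\<in>UNIV. K z \<zeta> $ i $ j *\<^sub>R B i j)" for z \<zeta>
  by (simp add: vec_eq_iff B_def if_distrib[of "\<lambda>x. _ * x"] c cong: if_cong)
 have "pwc D (\<lambda>z \<zeta>. \<Sum>i\<in>UNIV. \<Sum>j\<in>UNIV. K z \<zeta> $ i $ j *\<^sub>R B i j)"
  by (intro s pwc_linear[OF K]) (auto intro: bounded_linear_scaleR_left)
 then show ?thesis using eq by simp
qed

context chart2
begin

text \<open>The characteristics as graphs over z: \<sigma> = 1 gives s = - c and \<sigma> = - 1
  gives t = c. Since \<nu> is defined on the whole line, the path may leave the domain of the
  kernel.\<close>

lemma valid_path_char:
 assumes "\<sigma> = 1 \<or> \<sigma> = (-1)"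
 shows "valid_path (\<lambda>z. (z, \<nu> (\<sigma> * \<phi> z + c)))"
proof -
 let ?D = "\<lambda>z. (1, (q (\<nu> (\<sigma> * \<phi> z + c)))\<^sup>2 * (\<sigma> * (1 / (p z)\<^sup>2)))"
 have "((\<lambda>z. (z, \<nu> (\<sigma> * \<phi> z + c))) has_vector_derivative ?D z) (at z)" for z
 proof -
  have 1: "((\<lambda>z. \<sigma> * \<phi> z + c) has_real_derivative \<sigma> * (1 / (p z)\<^sup>2)) (at z)"
   using DERIV_add[OF DERIV_cmult[OF r.d\<phi>[of z], of \<sigma>] DERIV_const[of c]] by simp
  have "((\<lambda>z. \<nu> (\<sigma> * \<phi> z + c)) has_real_derivative (q (\<nu> (\<sigma> * \<phi> z + c)))\<^sup>2 * (\<sigma> * (1 / (p z)\<^sup>2))) (at z)"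
   using DERIV_chain2[OF c.d\<xi> 1] .
  then show ?thesis
   by (intro has_vector_derivative_Pair has_vector_derivative_id) (simp add: has_real_derivative_iff_has_vector_derivative)
 qed
 moreover have "continuous_on {0..1} ?D"
  using r.pos by (intro continuous_intros c.cont1 r.cont1) (auto simp: less_imp_neq[symmetric])
 ultimately have "(\<lambda>z. (z, \<nu> (\<sigma> * \<phi> z + c))) C1_differentiable_on {0..1}"
  unfolding C1_differentiable_on_def by (intro exI[of _ ?D]) blast
 then show ?thesis unfolding valid_path_def by (rule C1_differentiable_imp_piecewise)
qed

lemma kernel_has_derivative:
 fixes V :: "real \<times> real \<Rightarrow> real"
 assumes D: "D \<subseteq> {0..1} \<times> {0..1}" and ab: "(a, b) \<in> D"
  and dV: "(V has_derivative (\<lambda>d. vs * fst d + vt * snd d)) (at (\<phi> a - \<theta> b, \<phi> a + \<theta> b))"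
 shows "((\<lambda>u. p (fst u) / q (snd u) ^ 3 * V (\<phi> (fst u) - \<theta> (snd u), \<phi> (fst u) + \<theta> (snd u))) has_derivative
  (\<lambda>d. (p1 a / q b ^ 3 * V (\<phi> a - \<theta> b, \<phi> a + \<theta> b) + p a / q b ^ 3 * ((vs + vt) / (p a)\<^sup>2)) * fst d
   + (- 3 * p a * q1 b / q b ^ 4 * V (\<phi> a - \<theta> b, \<phi> a + \<theta> b) + p a / q b ^ 3 * ((vt - vs) / (q b)\<^sup>2)) * snd d))
  (at (a, b) within D)"
proof -
 let ?st = "\<lambda>u. (\<phi> (fst u) - \<theta> (snd u), \<phi> (fst u) + \<theta> (snd u))"
 have qn: "q y \<noteq> 0" "p y \<noteq> 0" for y using c.pos[of y] r.pos[of y] by auto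
 have ab01: "a \<in> {0..1}" "b \<in> {0..1}" using D ab by auto
 have d\<phi>: "((\<lambda>u. \<phi> (fst u)) has_derivative (\<lambda>d. fst d / (p a)\<^sup>2)) (at (a, b) within D)"
  using has_derivative_compose[of fst fst "(a, b)" D \<phi> "(*) (1 / (p a)\<^sup>2)"] r.d\<phi>[of a]
  by (simp add: has_field_derivative_def has_derivative_fst)
 have d\<theta>: "((\<lambda>u. \<theta> (snd u)) has_derivative (\<lambda>d. snd d / (q b)\<^sup>2)) (at (a, b) within D)"
  using has_derivative_compose[of snd snd "(a, b)" D \<theta> "(*) (1 / (q b)\<^sup>2)"] c.d\<phi>[of b]
  by (simp add: has_field_derivative_def has_derivative_snd)
 have dp: "((\<lambda>u. p (fst u)) has_derivative (\<lambda>d. p1 a * fst d)) (at (a, b) within D)"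
 proof -
  have "(p has_derivative (*) (p1 a)) (at (fst (a, b)) within fst ` D)"
   using r.dp[OF ab01(1)] unfolding has_field_derivative_def
   by (simp, rule has_derivative_subset) (use D in auto)
  from has_derivative_in_compose[of fst fst "(a, b)" D, OF _ this] show ?thesis by (simp add: has_derivative_fst)
 qed
 have dq: "((\<lambda>u. q (snd u)) has_derivative (\<lambda>d. q1 b * snd d)) (at (a, b) within D)"
 proof -
  have "(q has_derivative (*) (q1 b)) (at (snd (a, b)) within snd ` D)"
   using c.dp[OF ab01(2)] unfolding has_field_derivative_def
   by (simp, rule has_derivative_subset) (use D in auto)
  from has_derivative_in_compose[of snd snd "(a, b)" D, OF _ this] show ?thesis by (simp add: has_derivative_snd)
 qed
 have dst: "(?st has_derivative (\<lambda>d. (fst d / (p a)\<^sup>2 - snd d / (q b)\<^sup>2, fst d / (p a)\<^sup>2 + snd d / (q b)\<^sup>2))) (at (a, b) within D)"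
  by (intro has_derivative_Pair has_derivative_diff has_derivative_add d\<phi> d\<theta>)
 have dVst: "((\<lambda>u. V (?st u)) has_derivative (\<lambda>d. vs * (fst d / (p a)\<^sup>2 - snd d / (q b)\<^sup>2)
  + vt * (fst d / (p a)\<^sup>2 + snd d / (q b)\<^sup>2))) (at (a, b) within D)"
 proof -
  have dV': "(V has_derivative (\<lambda>d. vs * fst d + vt * snd d)) (at (?st (a, b)))" using dV by simp
  show ?thesis using has_derivative_compose[OF dst dV'] by simp
 qed
 show ?thesis
  by (rule has_derivative_eq_rhs, rule has_derivative_mult[OF has_derivative_divide[OF dp has_derivative_power[OF dq, of 3]] dVst])
   (use qn in \<open>auto simp: fun_eq_iff field_simps eval_nat_numeral\<close>)
qed

text \<open>The pieces are the parts of D on which s lies in one gap of Sa and t in one gap of Sb,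
  without the points of E; the curves are characteristics. Because \<open>loc\<close> provides
  functions continuous on the plane, uniform continuity on a piece follows from compactness of D. Sa
  and Sb are kept apart for the entries whose domain has s = 0 on its boundary.\<close>

lemma pwc_component:
 fixes W :: "real \<times> real \<Rightarrow> real" and K :: "real \<Rightarrow> real \<Rightarrow> real"
 assumes D: "compact D" "D \<subseteq> {0..1} \<times> {0..1}" and E: "finite E" "\<And>p. p \<in> D - E \<Longrightarrow> thick D p"
  and S: "finite Sa" "finite Sb"
  and fr: "finite {(z, \<zeta>) \<in> frontier D. \<phi> z - \<theta> \<zeta> \<in> Sa \<or> \<phi> z + \<theta> \<zeta> \<in> Sb}"
  and K: "\<And>z \<zeta>. (z, \<zeta>) \<in> D \<Longrightarrow> K z \<zeta> = p z / q \<zeta> ^ 3 * W (\<phi> z - \<theta> \<zeta>, \<phi> z + \<theta> \<zeta>)"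
  and loc: "\<And>A B. \<exists>V Vs Vt. continuous_on UNIV V \<and> continuous_on UNIV Vs \<and> continuous_on UNIV Vt \<and>
   (\<forall>(z, \<zeta>)\<in>D. \<phi> z - \<theta> \<zeta> \<in> cell Sa A \<and> \<phi> z + \<theta> \<zeta> \<in> cell Sb B \<longrightarrow>
     W (\<phi> z - \<theta> \<zeta>, \<phi> z + \<theta> \<zeta>) = V (\<phi> z - \<theta> \<zeta>, \<phi> z + \<theta> \<zeta>) \<and>
     (V has_derivative (\<lambda>d. Vs (\<phi> z - \<theta> \<zeta>, \<phi> z + \<theta> \<zeta>) * fst d + Vt (\<phi> z - \<theta> \<zeta>, \<phi> z + \<theta> \<zeta>) * snd d))
      (at (\<phi> z - \<theta> \<zeta>, \<phi> z + \<theta> \<zeta>)))"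
 shows "pwc D K"
proof -
 let ?s = "\<lambda>u. \<phi> (fst u) - \<theta> (snd u)" and ?t = "\<lambda>u. \<phi> (fst u) + \<theta> (snd u)"
 have sc: "continuous_on UNIV ?s" "continuous_on UNIV ?t"
  by (intro continuous_intros r.cont1 c.cont1)+
 define Ucell where "Ucell A B = {u \<in> D. ?s u \<in> cell Sa A \<and> ?t u \<in> cell Sb B} - E" for A B
 define \<U> where "\<U> = (\<lambda>(A, B). Ucell A B) ` (Pow Sa \<times> Pow Sb)"
 define \<Gamma> where "\<Gamma> = (\<lambda>e z. (z, \<nu> (1 * \<phi> z + (- e)))) ` Sa \<union> (\<lambda>e z. (z, \<nu> ((-1) * \<phi> z + e))) ` Sb \<union> (\<lambda>u (_::real). u) ` E"
 have inU: "u \<in> \<Union>\<U>" if u: "u \<in> D" "u \<notin> E" "?s u \<notin> Sa" "?t u \<notin> Sb" for u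
 proof -
  have "u \<in> Ucell {e \<in> Sa. e < ?s u} {e \<in> Sb. e < ?t u}"
   using u cell_self[OF u(3)] cell_self[OF u(4)] by (simp add: Ucell_def)
  moreover have "Ucell {e \<in> Sa. e < ?s u} {e \<in> Sb. e < ?t u} \<in> \<U>"
   unfolding \<U>_def by (rule image_eqI[of _ _ "({e \<in> Sa. e < ?s u}, {e \<in> Sb. e < ?t u})"]) auto
  ultimately show ?thesis by (rule UnionI[rotated])
 qed
 show ?thesis unfolding pwc_def
 proof (intro exI[of _ \<U>] exI[of _ \<Gamma>] conjI)
  show "finite \<U>" "finite \<Gamma>" using S E(1) by (auto simp: \<U>_def \<Gamma>_def)
  show "\<forall>\<gamma>\<in>\<Gamma>. valid_path \<gamma>"
  proof -
   have "valid_path (\<lambda>z. (z, \<nu> (1 * \<phi> z + (- e))))" "valid_path (\<lambda>z. (z, \<nu> ((-1) * \<phi> z + e)))" for e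
    by (intro valid_path_char disjI1 refl, intro valid_path_char disjI2 refl)
   then show ?thesis using valid_path_const unfolding \<Gamma>_def by blast
  qed
  show "D \<subseteq> \<Union>\<U> \<union> (\<Union>\<gamma>\<in>\<Gamma>. path_image \<gamma>)"
  proof
   fix u assume u: "u \<in> D"
   then have u01: "fst u \<in> {0..1}" using D(2) by auto
   consider "u \<in> E" | "?s u \<in> Sa" | "?t u \<in> Sb" | "u \<in> \<Union>\<U>" using inU[OF u] by blast
   then show "u \<in> \<Union>\<U> \<union> (\<Union>\<gamma>\<in>\<Gamma>. path_image \<gamma>)"
   proof cases
    case 1
    then have "u \<in> path_image (\<lambda>_. u)" "(\<lambda>_. u) \<in> \<Gamma>" by (auto simp: path_image_const \<Gamma>_def)
    then show ?thesis by blast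
   next
    case 2
    let ?g = "\<lambda>z. (z, \<nu> (1 * \<phi> z + (- ?s u)))"
    have "?g (fst u) = u" using c.inv by (cases u) simp
    then have "u \<in> path_image ?g" unfolding path_image_def using u01 by (intro image_eqI[of u _ "fst u"]) simp_all
    moreover have "?g \<in> \<Gamma>" using 2 unfolding \<Gamma>_def by blast
    ultimately show ?thesis by blast
   next
    case 3
    let ?g = "\<lambda>z. (z, \<nu> ((-1) * \<phi> z + ?t u))"
    have "?g (fst u) = u" using c.inv by (cases u) simp
    then have "u \<in> path_image ?g" unfolding path_image_def using u01 by (intro image_eqI[of u _ "fst u"]) simp_all
    moreover have "?g \<in> \<Gamma>" using 3 unfolding \<Gamma>_def by blast
    ultimately show ?thesis by blast
   qed blast
  qed
  have "frontier D \<subseteq> D" using D(1) compact_imp_closed frontier_subset_closed by blast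
  then have "frontier D - \<Union>\<U> \<subseteq> E \<union> {(z, \<zeta>) \<in> frontier D. \<phi> z - \<theta> \<zeta> \<in> Sa \<or> \<phi> z + \<theta> \<zeta> \<in> Sb}"
   using inU by fastforce
  then show "finite (frontier D - \<Union>\<U>)" using fr E(1) finite_subset by blast
  show "\<forall>U\<in>\<U>. openin (top_of_set D) U \<and> (\<forall>p\<in>U. thick D p) \<and>
    (\<forall>p\<in>U. (\<lambda>(z, \<zeta>). K z \<zeta>) differentiable (at p within D)) \<and>
    uniformly_continuous_on U (\<lambda>(z, \<zeta>). K z \<zeta>) \<and>
    uniformly_continuous_on U (\<lambda>(z, \<zeta>). pd_z D K z \<zeta>) \<and>
    uniformly_continuous_on U (\<lambda>(z, \<zeta>). pd_zeta D K z \<zeta>)"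
  proof
   fix U assume "U \<in> \<U>"
   then obtain A B where U: "U = Ucell A B" by (auto simp: \<U>_def)
   obtain V Vs Vt where Vc: "continuous_on UNIV V" "continuous_on UNIV Vs" "continuous_on UNIV Vt"
    and V: "\<And>z \<zeta>. (z, \<zeta>) \<in> D \<Longrightarrow> \<phi> z - \<theta> \<zeta> \<in> cell Sa A \<Longrightarrow> \<phi> z + \<theta> \<zeta> \<in> cell Sb B \<Longrightarrow>
     W (\<phi> z - \<theta> \<zeta>, \<phi> z + \<theta> \<zeta>) = V (\<phi> z - \<theta> \<zeta>, \<phi> z + \<theta> \<zeta>) \<and>
     (V has_derivative (\<lambda>d. Vs (\<phi> z - \<theta> \<zeta>, \<phi> z + \<theta> \<zeta>) * fst d + Vt (\<phi> z - \<theta> \<zeta>, \<phi> z + \<theta> \<zeta>) * snd d))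
      (at (\<phi> z - \<theta> \<zeta>, \<phi> z + \<theta> \<zeta>))"
    using loc[of A B] by fast
   let ?st = "\<lambda>u. (?s u, ?t u)"
   have stc: "continuous_on UNIV ?st" by (intro continuous_intros sc)
   have openU: "openin (top_of_set D) U"
   proof -
    have "open (?s -` cell Sa A \<inter> ?t -` cell Sb B - E)"
     using open_vimage[OF open_cell[OF S(1)] sc(1)] open_vimage[OF open_cell[OF S(2)] sc(2)] E(1)
     by (intro open_Diff open_Int finite_imp_closed) auto
    moreover have "U = D \<inter> (?s -` cell Sa A \<inter> ?t -` cell Sb B - E)" by (auto simp: U Ucell_def)
    ultimately show ?thesis by (auto simp: openin_open)
   qed
   define Kt where "Kt u = p (fst u) / q (snd u) ^ 3 * V (?st u)" for u
   define Kz where "Kz u = p1 (fst u) / q (snd u) ^ 3 * V (?st u)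
     + p (fst u) / q (snd u) ^ 3 * ((Vs (?st u) + Vt (?st u)) / (p (fst u))\<^sup>2)" for u
   define Ky where "Ky u = - 3 * p (fst u) * q1 (snd u) / q (snd u) ^ 4 * V (?st u)
     + p (fst u) / q (snd u) ^ 3 * ((Vt (?st u) - Vs (?st u)) / (q (snd u))\<^sup>2)" for u
   have qn: "q y \<noteq> 0" "p y \<noteq> 0" for y using c.pos[of y] r.pos[of y] by auto
   have cts: "continuous_on UNIV Kt" "continuous_on UNIV Kz" "continuous_on UNIV Ky"
    unfolding Kt_def Kz_def Ky_def
    by (intro continuous_intros r.cont1 c.cont1 continuous_on_compose2[OF Vc(1) stc] continuous_on_compose2[OF Vc(2) stc]
      continuous_on_compose2[OF Vc(3) stc]; simp add: qn)+
   have KU: "K z \<zeta> = Kt (z, \<zeta>)" if "(z, \<zeta>) \<in> U" for z \<zeta>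
    using that K V by (auto simp: U Ucell_def Kt_def)
   have dK: "((\<lambda>(z, \<zeta>). K z \<zeta>) has_derivative (\<lambda>d. Kz (a, b) * fst d + Ky (a, b) * snd d)) (at (a, b) within D)"
    if ab: "(a, b) \<in> U" for a b
   proof -
    have abD: "(a, b) \<in> D" using ab by (auto simp: U Ucell_def)
    then have ab01: "a \<in> {0..1}" "b \<in> {0..1}" using D(2) by auto
    have dV: "(V has_derivative (\<lambda>d. Vs (?st (a, b)) * fst d + Vt (?st (a, b)) * snd d)) (at (?st (a, b)))"
     using V[of a b] ab by (auto simp: U Ucell_def)
    have dKt: "(Kt has_derivative (\<lambda>d. Kz (a, b) * fst d + Ky (a, b) * snd d)) (at (a, b) within D)"
     using kernel_has_derivative[OF D(2) abD dV[unfolded fst_conv snd_conv]]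
     by (simp add: Kt_def[abs_def] Kz_def Ky_def)
    obtain O' where O': "open O'" "U = D \<inter> O'" using openU by (auto simp: openin_open)
    show ?thesis
    proof (rule has_derivative_transform_eventually[OF dKt])
     have "\<forall>\<^sub>F u in at (a, b) within D. u \<in> O' \<and> u \<in> D"
      using ab O' by (auto simp: eventually_at_topological)
     then show "\<forall>\<^sub>F u in at (a, b) within D. Kt u = (case u of (z, \<zeta>) \<Rightarrow> K z \<zeta>)"
      by (rule eventually_mono) (use KU O' in auto)
    qed (use KU ab abD in auto)
   qed
   have thk: "thick D u" if "u \<in> U" for u using that E(2) by (auto simp: U Ucell_def)
   have pd: "pd_z D K a b = Kz (a, b)" "pd_zeta D K a b = Ky (a, b)" if "(a, b) \<in> U" for a b
    using pd_eq[OF dK[OF that] thk[OF that]] by auto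
   have UD: "U \<subseteq> D" by (auto simp: U Ucell_def)
   have uc: "uniformly_continuous_on U h" if "continuous_on UNIV h" for h :: "real \<times> real \<Rightarrow> real"
    by (rule uniformly_continuous_on_subset'[OF compact_uniformly_continuous[OF continuous_on_subset[OF that] D(1)] UD]) auto
   show "openin (top_of_set D) U \<and> (\<forall>p\<in>U. thick D p) \<and>
    (\<forall>p\<in>U. (\<lambda>(z, \<zeta>). K z \<zeta>) differentiable (at p within D)) \<and>
    uniformly_continuous_on U (\<lambda>(z, \<zeta>). K z \<zeta>) \<and>
    uniformly_continuous_on U (\<lambda>(z, \<zeta>). pd_z D K z \<zeta>) \<and>
    uniformly_continuous_on U (\<lambda>(z, \<zeta>). pd_zeta D K z \<zeta>)"
   proof (intro conjI openU ballI thk)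
    show "(\<lambda>(z, \<zeta>). K z \<zeta>) differentiable (at u within D)" if "u \<in> U" for u
     using dK that unfolding differentiable_def by (cases u) blast
    show "uniformly_continuous_on U (\<lambda>(z, \<zeta>). K z \<zeta>)"
     by (rule uniformly_continuous_on_eq[OF uc[OF cts(1)]]) (use KU in auto)
    show "uniformly_continuous_on U (\<lambda>(z, \<zeta>). pd_z D K z \<zeta>)"
     by (rule uniformly_continuous_on_eq[OF uc[OF cts(2)]]) (use pd in auto)
    show "uniformly_continuous_on U (\<lambda>(z, \<zeta>). pd_zeta D K z \<zeta>)"
     by (rule uniformly_continuous_on_eq[OF uc[OF cts(3)]]) (use pd in auto)
   qed
  qed
 qed
qed

end

section \<open>Jumps and the coupling condition\<close>

lemma locally_const_mono: "locally_const S f \<Longrightarrow> S \<subseteq> S' \<Longrightarrow> locally_const S' f"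
 unfolding locally_const_def by blast

text \<open>Shifts are added one at a time: for a new l all multiples up to N l are taken, where N
  carries every point beyond T. The shifts treated before remain possible because they commute with
  adding a multiple of l.\<close>

lemma shift_closure:
 fixes S0 \<Lambda> :: "real set"
 assumes "finite \<Lambda>" "finite S0" "\<And>l. l \<in> \<Lambda> \<Longrightarrow> 0 < l"
 shows "\<exists>S. finite S \<and> S0 \<subseteq> S \<and> (\<forall>s\<in>S. \<forall>l\<in>\<Lambda>. s + l \<le> T \<longrightarrow> s + l \<in> S) \<and> (\<forall>s\<in>S. \<exists>s0\<in>S0. s0 \<le> s)"
 using assms
proof (induction \<Lambda> arbitrary: S0 rule: finite_induct)
 case empty
 then show ?case by (intro exI[of _ S0]) auto
next
 case (insert l \<Lambda>)
 obtain S where S: "finite S" "S0 \<subseteq> S" "\<And>s l. s \<in> S \<Longrightarrow> l \<in> \<Lambda> \<Longrightarrow> s + l \<le> T \<Longrightarrow> s + l \<in> S" "\<And>s. s \<in> S \<Longrightarrow> \<exists>s0\<in>S0. s0 \<le> s"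
  using insert.IH[of S0] insert.prems by (metis insertCI)
 have l: "0 < l" using insert.prems by blast
 define b where "b = Min (insert T S)"
 have b: "\<And>s. s \<in> S \<Longrightarrow> b \<le> s" using S(1) by (auto simp: b_def)
 obtain N :: nat where N: "(T - b) / l < real N" using reals_Archimedean2 by blast
 define S' where "S' = (\<lambda>(s, n). s + real n * l) ` (S \<times> {..N})"
 show ?case
 proof (intro exI[of _ S'] conjI ballI impI)
  show "finite S'" using S(1) by (simp add: S'_def)
  show "S0 \<subseteq> S'"
  proof
   fix s assume "s \<in> S0"
   then show "s \<in> S'" using S(2) unfolding S'_def by (intro image_eqI[of _ _ "(s, 0)"]) auto
  qed
  fix s' assume "s' \<in> S'"
  then obtain s n where s: "s' = s + real n * l" "s \<in> S" "n \<le> N" by (auto simp: S'_def)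
  obtain s0 where "s0 \<in> S0" "s0 \<le> s" using S(4)[OF s(2)] by blast
  then show "\<exists>s0\<in>S0. s0 \<le> s'" using s(1) l by (intro bexI[of _ s0]) (auto intro: order_trans)
  fix l' assume l': "l' \<in> insert l \<Lambda>" and le: "s' + l' \<le> T"
  show "s' + l' \<in> S'"
  proof (cases "l' = l")
   case True
   have "b + real (Suc n) * l \<le> T" using b[OF s(2)] le s(1) True by (simp add: algebra_simps)
   then have "real (Suc n) \<le> (T - b) / l" using l by (simp add: field_simps)
   then have "Suc n \<le> N" using N by linarith
   moreover have "s' + l' = s + real (Suc n) * l" using s(1) True by (simp add: algebra_simps)
   ultimately show ?thesis using s(2) unfolding S'_def by (intro image_eqI[of _ _ "(s, Suc n)"]) auto
  next
   case False
   then have "l' \<in> \<Lambda>" using l' by blast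
   moreover have "0 \<le> real n * l" using l by simp
   ultimately have "s + l' \<in> S" using S(3)[OF s(2)] le s(1) by auto
   moreover have "s' + l' = (s + l') + real n * l" using s(1) by simp
   ultimately show ?thesis using s(3) unfolding S'_def by (intro image_eqI[of _ _ "(s + l', n)"]) auto
  qed
 qed
qed

text \<open>Induction on the largest point c: continuing the value left of c beyond c removes c from
  the set, and the coefficient at c is the jump there. Vanishing far to the left excludes an
  additive constant.\<close>

lemma step_representation:
 fixes S :: "real set"
 assumes "finite S" "locally_const S f" "\<And>x. x < b \<Longrightarrow> f x = 0"
 shows "\<exists>\<delta>. \<forall>x. x \<notin> S \<longrightarrow> f x = (\<Sum>a\<in>S. \<delta> a * (if a < x then 1 else 0 :: real))"
 using assms
proof (induction S arbitrary: f rule: finite_linorder_max_induct)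
 case empty
 have "f x = f (b - 1)" for x using empty.prems(1) unfolding locally_const_def by (metis UNIV_I connected_UNIV inf_bot_right)
 then show ?case using empty.prems(2)[of "b - 1"] by simp
next
 case (insert c A)
 \<comment> \<open>A point below c and above all of A, hence in the gap just left of c.\<close>
 obtain x0 where x0: "x0 < c" "\<forall>a\<in>A. a < x0"
 proof -
  define M where "M = Max (insert (c - 1) A)"
  have "M < c" using insert.hyps by (auto simp: M_def)
  moreover have "\<forall>a\<in>A. a \<le> M" using insert.hyps by (auto simp: M_def)
  ultimately show ?thesis using that[of "(M + c) / 2"] by fastforce
 qed
 have seg: "f x = f y" if "x < c" "y < c" "\<And>a. a \<in> A \<Longrightarrow> min x y \<le> a \<Longrightarrow> a \<le> max x y \<Longrightarrow> False" for x y
  using insert.prems(1)[unfolded locally_const_def, rule_format, of "{min x y..max x y}" x y] that by force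
 define f' where "f' x = (if x < c then f x else f x0)" for x
 have lc: "locally_const A f'"
  unfolding locally_const_def
 proof (intro allI impI)
  fix I x y assume I: "connected I \<and> I \<inter> A = {} \<and> x \<in> I \<and> y \<in> I"
  have nA: "\<not> (x' \<le> a \<and> a \<le> y')" if "x' \<in> I" "y' \<in> I" "a \<in> A" for x' y' a
   using connected_contains_Icc[of I x' y'] I that by (metis IntI atLeastAtMost_iff empty_iff subsetD)
  have key: "f x' = f x0" if "x' \<in> I" "y' \<in> I" "x' < c" "c \<le> y'" for x' y'
  proof (rule seg[OF that(3) x0(1)])
   fix a assume a: "a \<in> A" "min x' x0 \<le> a" "a \<le> max x' x0"
   have "a < x'" using nA[OF that(1,2) a(1)] insert.hyps(2) a(1) that(4) by force
   then show False using a x0(2) by force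
  qed
  show "f' x = f' y"
  proof (cases "x < c"; cases "y < c")
   assume xy: "x < c" "y < c"
   have "f x = f y"
    by (rule seg[OF xy]) (use nA I in \<open>metis max_def min_def\<close>)
   then show ?thesis using xy by (simp add: f'_def)
  qed (use key I in \<open>auto simp: f'_def not_less\<close>)
 qed
 have z: "f' x = 0" if "x < min b (min x0 c)" for x using that insert.prems(2) by (simp add: f'_def)
 have "f' x = 0" if "x < b" for x
 proof (cases "x < c")
  case True then show ?thesis using that insert.prems(2) by (simp add: f'_def)
 next
  case False
  then have "x0 < b" using x0(1) that by linarith
  then show ?thesis using False insert.prems(2) by (simp add: f'_def)
 qed
 from insert.IH[OF lc this] obtain \<delta> where \<delta>: "\<And>x. x \<notin> A \<Longrightarrow> f' x = (\<Sum>a\<in>A. \<delta> a * (if a < x then 1 else 0))"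
  by blast
 have cA: "c \<notin> A" using insert.hyps(2) by blast
 show ?case
 proof (intro exI[of _ "\<delta>(c := f (c + 1) - f x0)"] allI impI)
  fix x assume x: "x \<notin> insert c A"
  have "(\<Sum>a\<in>insert c A. (\<delta>(c := f (c + 1) - f x0)) a * (if a < x then 1 else 0))
    = (f (c + 1) - f x0) * (if c < x then 1 else 0) + (\<Sum>a\<in>A. \<delta> a * (if a < x then 1 else 0))"
   using insert.hyps(1) cA by (simp add: sum.insert) (intro sum.cong refl; auto)
  also have "\<dots> = (f (c + 1) - f x0) * (if c < x then 1 else 0) + f' x" using \<delta> x by simp
  also have "\<dots> = f x"
  proof (cases "x < c")
   case False
   then have "c < x" using x by simp
   moreover have "f x = f (c + 1)"
    using insert.prems(1)[unfolded locally_const_def, rule_format, of "{c<..}" x "c + 1"] \<open>c < x\<close> insert.hyps(2) by force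
   ultimately show ?thesis by (simp add: f'_def)
  qed (simp add: f'_def)
  finally show "f x = (\<Sum>a\<in>insert c A. (\<delta>(c := f (c + 1) - f x0)) a * (if a < x then 1 else 0))" by simp
 qed
qed

text \<open>Convolving a step with A gives a primitive of translates of A, for a wave moving to the right
  and for its reflection at \<open>y = L\<close>.\<close>

lemma step_convolution:
 fixes A :: "real \<Rightarrow> real"
 assumes A: "locbm A" and z: "\<And>y. y < 0 \<or> L < y \<Longrightarrow> A y = 0" and a: "0 \<le> a" and L: "0 < L"
 shows "integral {0..L} (\<lambda>y. A y * (if a < x - y then 1 else 0)) = integral {0..x} (\<lambda>\<xi>. A (\<xi> - a))"
  and "integral {0..L} (\<lambda>y. A y * (if a < x + y - 2 * L then 1 else 0)) = integral {0..x} (\<lambda>\<xi>. A (2 * L + a - \<xi>))"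
proof -
 have lA: "locbm (\<lambda>\<xi>. A (\<xi> - a))" "locbm (\<lambda>\<xi>. A (2 * L + a - \<xi>))"
  by (rule locbm_compose[OF A], intro continuous_intros)+
 have lI: "locbm (\<lambda>y. A y * (if P y then 1 else 0))" if "{y. P y} \<in> sets borel" for P
  using that by (intro locbm_mult A locbm_if locbm_const)
 have e: "{y. a < x - y} \<in> sets borel" "{y. a < x + y - 2 * L} \<in> sets borel" by measurable
 have "integral {0..x} (\<lambda>\<xi>. A (\<xi> - a)) = (\<integral>\<xi>. indicator {0..x} \<xi> * A (\<xi> - a) \<partial>lborel)"
  unfolding locbm_integral_eq[OF lA(1)] set_lebesgue_integral_def by simp
 also have "\<dots> = (\<integral>y. indicator {0..x} (a + y) * A y \<partial>lborel)"
  using lborel_integral_real_affine[of 1 "\<lambda>\<xi>. indicator {0..x} \<xi> * A (\<xi> - a)" a] by simp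
 also have "\<dots> = (\<integral>y. indicator {0..L} y * (A y * (if a < x - y then 1 else 0)) \<partial>lborel)"
 proof (rule integral_cong_AE)
  show "AE y in lborel. indicator {0..x} (a + y) * A y = indicator {0..L} y * (A y * (if a < x - y then 1 else 0))"
  proof (rule AE_I'[of "{x - a}"])
   show "{x - a} \<in> null_sets lborel" by (rule finite_imp_null_set_lborel) simp
   have "indicator {0..x} (a + y) * A y = indicator {0..L} y * (A y * (if a < x - y then 1 else 0))" if "y \<noteq> x - a" for y
    using z[of y] a that by (cases "y \<in> {0..L}") (auto simp: indicator_def)
   then show "{y \<in> space lborel. indicator {0..x} (a + y) * A y \<noteq> indicator {0..L} y * (A y * (if a < x - y then 1 else 0))} \<subseteq> {x - a}"
    by blast
  qed
 qed (use locbm_measurable[OF A] in measurable)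
 also have "\<dots> = integral {0..L} (\<lambda>y. A y * (if a < x - y then 1 else 0))"
  unfolding locbm_integral_eq[OF lI[OF e(1)]] set_lebesgue_integral_def by simp
 finally show "integral {0..L} (\<lambda>y. A y * (if a < x - y then 1 else 0)) = integral {0..x} (\<lambda>\<xi>. A (\<xi> - a))" by simp
 have "integral {0..x} (\<lambda>\<xi>. A (2 * L + a - \<xi>)) = (\<integral>\<xi>. indicator {0..x} \<xi> * A (2 * L + a - \<xi>) \<partial>lborel)"
  unfolding locbm_integral_eq[OF lA(2)] set_lebesgue_integral_def by simp
 also have "\<dots> = (\<integral>y. indicator {0..x} (2 * L + a - y) * A y \<partial>lborel)"
  using lborel_integral_real_affine[of "-1" "\<lambda>\<xi>. indicator {0..x} \<xi> * A (2 * L + a - \<xi>)" "2 * L + a"] by simp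
 also have "\<dots> = (\<integral>y. indicator {0..L} y * (A y * (if a < x + y - 2 * L then 1 else 0)) \<partial>lborel)"
 proof (rule integral_cong_AE)
  show "AE y in lborel. indicator {0..x} (2 * L + a - y) * A y = indicator {0..L} y * (A y * (if a < x + y - 2 * L then 1 else 0))"
  proof (rule AE_I'[of "{2 * L + a - x}"])
   show "{2 * L + a - x} \<in> null_sets lborel" by (rule finite_imp_null_set_lborel) simp
   have "indicator {0..x} (2 * L + a - y) * A y = indicator {0..L} y * (A y * (if a < x + y - 2 * L then 1 else 0))"
    if "y \<noteq> 2 * L + a - x" for y
    using z[of y] a that L by (cases "y \<in> {0..L}") (auto simp: indicator_def)
   then show "{y \<in> space lborel. indicator {0..x} (2 * L + a - y) * A y \<noteq> indicator {0..L} y * (A y * (if a < x + y - 2 * L then 1 else 0))} \<subseteq> {2 * L + a - x}"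
    by blast
  qed
 qed (use locbm_measurable[OF A] in measurable)
 also have "\<dots> = integral {0..L} (\<lambda>y. A y * (if a < x + y - 2 * L then 1 else 0))"
  unfolding locbm_integral_eq[OF lI[OF e(2)]] set_lebesgue_integral_def by simp
 finally show "integral {0..L} (\<lambda>y. A y * (if a < x + y - 2 * L then 1 else 0)) = integral {0..x} (\<lambda>\<xi>. A (2 * L + a - \<xi>))" by simp
qed

text \<open>The jumps f of a wave that is reflected at \<open>y = L\<close> without change of sign, so that the boundary
  value at \<open>y = 0\<close>, which is the sum of the outgoing and the incoming wave, is the given step function.\<close>

lemma reflected_steps:
 assumes S: "finite S" "T \<in> S" "\<And>s. s \<in> S \<Longrightarrow> s + l \<le> T \<Longrightarrow> s + l \<in> S" and l: "0 < l"
  and d: "locally_const S d" "\<And>x. x \<le> 0 \<Longrightarrow> d x = 0"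
 obtains f where "locally_const S f" "\<And>x. x \<le> 0 \<Longrightarrow> f x = (0::real)" "\<And>x. x \<le> T \<Longrightarrow> f x + f (x - l) = d x"
proof -
 obtain M :: nat where M: "T / l < real M" using reals_Archimedean2 by blast
 define f where "f x = (if x \<le> T then \<Sum>n<M. (-1) ^ n * d (x - real n * l) else 0)" for x
 have tel: "(\<Sum>n<N. (-1) ^ n * d (x - real n * l)) + (\<Sum>n<N. (-1) ^ n * d (x - l - real n * l))
   = d x - (-1) ^ N * d (x - real N * l)" for N x
 proof (induction N)
  case (Suc N)
  have "x - l - real N * l = x - real (Suc N) * l" by (simp add: algebra_simps)
  then show ?case using Suc by (simp add: algebra_simps)
 qed simp
 show ?thesis
 proof (rule that[of f])
  show "f x = 0" if "x \<le> 0" for x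
  proof -
   have "x - real n * l \<le> 0" for n using that l by (simp add: order_trans[of x 0])
   then show ?thesis using d(2) by (simp add: f_def)
  qed
  show "f x + f (x - l) = d x" if x: "x \<le> T" for x
  proof -
   have "T < real M * l" using M l by (simp add: field_simps)
   then have "d (x - real M * l) = 0" using x by (intro d(2)) linarith
   then show ?thesis using tel[of x M] x l by (simp add: f_def)
  qed
  show "locally_const S f" unfolding locally_const_def
  proof (intro allI impI)
   fix I x y assume I: "connected I \<and> I \<inter> S = {} \<and> x \<in> I \<and> y \<in> I"
   have side: "(\<forall>u\<in>I. u \<le> T) \<or> (\<forall>u\<in>I. T < u)"
   proof (rule ccontr)
    assume "\<not> ?thesis"
    then obtain u v where "u \<in> I" "v \<in> I" "T < u" "v \<le> T" by force
    then have "T \<in> I" using connected_contains_Icc[of I v u] I by auto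
    then show False using I S(2) by blast
   qed
   show "f x = f y"
   proof (cases "\<forall>u\<in>I. u \<le> T")
    case True
    have "d (x - real n * l) = d (y - real n * l)" for n
    proof -
     have up: "s + real n * l \<in> S" if "s \<in> S" "s + real n * l \<le> T" for s n
      using that
     proof (induction n)
      case (Suc n)
      have "s + real n * l \<in> S" using Suc l by (auto simp: algebra_simps)
      from S(3)[OF this] show ?case using Suc.prems(2) by (simp add: algebra_simps)
     qed simp
     let ?u = "\<lambda>u. u - real n * l"
     have "connected (?u ` I)" using I by (intro connected_continuous_image continuous_intros) auto
     moreover have "?u ` I \<inter> S = {}"
     proof (rule ccontr)
      assume "?u ` I \<inter> S \<noteq> {}"
      then obtain u where "u \<in> I" "u - real n * l \<in> S" by blast
      then have "u \<in> S" using up[of "u - real n * l" n] True by simp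
      then show False using I \<open>u \<in> I\<close> by blast
     qed
     ultimately show ?thesis using d(1) I unfolding locally_const_def by (meson imageI)
    qed
    then show ?thesis using True I by (simp add: f_def)
   next
    case False
    then have "T < x" "T < y" using side I by auto
    then show ?thesis by (simp add: f_def)
   qed
  qed
 qed
qed

text \<open>On a gap inside (0, X) both d and the integral of dd have derivative dd, so their
  difference is constant; 0 and X belong to S, so no gap crosses the cut-offs.\<close>

lemma jump_part:
 assumes S: "finite S" "0 \<in> S" "X \<in> S" and dd: "pc S dd"
  and der: "\<And>x. 0 < x \<Longrightarrow> x < X \<Longrightarrow> x \<notin> S \<Longrightarrow> (d has_real_derivative dd x) (at x)"
 shows "locally_const S (\<lambda>x. if 0 < x \<and> x \<le> X then d x - integral {0..x} dd else 0)"
 unfolding locally_const_def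
proof (intro allI impI)
 fix I x y assume I: "connected I \<and> I \<inter> S = {} \<and> x \<in> I \<and> y \<in> I"
 let ?J = "\<lambda>x. if 0 < x \<and> x \<le> X then d x - integral {0..x} dd else (0::real)"
 let ?c = "\<lambda>x. if 0 < x \<and> x \<le> X then dd x else 0"
 have cpc: "pc S ?c" by (rule pc_if_interval[OF dd pc_const S(2,3)])
 have ieq: "integral {0..x} dd = integral {0..x} ?c" if "x \<le> X" for x
  by (rule integral_spike[of "{0}"]) (use that in auto)
 have sub: "u \<in> I" if "v \<in> I" "w \<in> I" "v \<le> u" "u \<le> w" for u v w
  using connected_contains_Icc[of I v w] I that by auto
 have "?J x = ?J y" if xy: "x \<in> I" "y \<in> I" "x < y" for x y
 proof (cases "0 < x \<and> y \<le> X")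
  case True
  have n: "u \<notin> S" if "x \<le> u" "u \<le> y" for u using sub[OF xy(1,2) that] I by blast
  have yX: "y < X" using True n[of y] S(3) xy(3) by (cases "y = X") auto
  have D: "((\<lambda>x. d x - integral {0..x} ?c) has_real_derivative 0) (at u)" if u: "x \<le> u" "u \<le> y" for u
  proof -
   have "((\<lambda>x. integral {0..x} ?c) has_real_derivative ?c u) (at u)"
    by (rule integral0_has_derivative[OF pc_locbm[OF cpc S(1)] _ pc_isCont[OF cpc S(1) n[OF u]]]) auto
   then show ?thesis using DERIV_diff[OF der[of u]] u True yX n[OF u] by fastforce
  qed
  have "d y - integral {0..y} ?c = d x - integral {0..x} ?c"
   using DERIV_isconst_end[of x y "\<lambda>x. d x - integral {0..x} ?c"] xy(3) D
   by (metis (no_types, lifting) DERIV_isCont continuous_at_imp_continuous_on atLeastAtMost_iff less_imp_le)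
  then show ?thesis using True xy(3) ieq[of x] ieq[of y] by simp
 next
  case False
  show ?thesis
  proof (cases "y \<le> 0 \<or> X < x")
   case F: False
   have "x \<noteq> 0" "y \<noteq> X" using xy I S by auto
   then have "(x < 0 \<and> 0 < y) \<or> (x < X \<and> X < y) \<or> x = X" using False F by linarith
   then have "0 \<in> I \<or> X \<in> I" using sub[OF xy(1,2)] xy(1) by (metis less_imp_le)
   then show ?thesis using I S by blast
  qed (use xy(3) in auto)
 qed
 then show "?J x = ?J y" using I by (cases x y rule: linorder_cases) metis+
qed

text \<open>The column index of an entry: \<open>Inl j\<close> and \<open>Inr j\<close>, the entries
  of P and Q in column j, share the two coupling conditions of that column.\<close>

definition ix :: "'n + 'n \<Rightarrow> 'n" where "ix k = (case k of Inl j \<Rightarrow> j | Inr j \<Rightarrow> j)"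

lemma ix_simps [simp]: "ix (Inl j) = j" "ix (Inr j) = j"
 by (simp_all add: ix_def)

lemma sum_ix: "(\<Sum>k\<in>(UNIV :: ('n::finite + 'n) set). if ix k = j then F k else 0) = F (Inl j) + (F (Inr j) :: real)"
proof -
 have "ix k = j \<longleftrightarrow> k = Inl j \<or> k = Inr j" for k by (cases k) auto
 then have "{k \<in> UNIV. ix k = j} = {Inl j, Inr j}" by auto
 then show ?thesis using sum.inter_filter[of UNIV F "\<lambda>k. ix k = j"] by simp
qed

lemma sum_UNIV_Plus: "(\<Sum>k\<in>(UNIV :: ('n::finite + 'n) set). F k) = (\<Sum>j\<in>UNIV. F (Inl j)) + (\<Sum>j\<in>UNIV. F (Inr j) :: real)"
 unfolding UNIV_Plus_UNIV[symmetric] by (subst sum.Plus) (simp_all add: comp_def)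

lemma locally_const_cut: "T \<in> S \<Longrightarrow> locally_const S f \<Longrightarrow> locally_const S (\<lambda>x. if x \<le> T then f x else (0::real))"
 unfolding locally_const_def
proof (intro allI impI)
 fix I x y assume T: "T \<in> S" and f: "\<forall>I x y. connected I \<and> I \<inter> S = {} \<and> x \<in> I \<and> y \<in> I \<longrightarrow> f x = f y"
  and I: "connected I \<and> I \<inter> S = {} \<and> x \<in> I \<and> y \<in> I"
 have "x \<le> T \<longleftrightarrow> y \<le> T"
 proof (rule ccontr)
  assume "\<not> ?thesis"
  then have "T \<in> I" using connected_contains_Icc[of I x y] connected_contains_Icc[of I y x] I by (auto simp: not_le)
  then show False using I T by blast
 qed
 then show "(if x \<le> T then f x else 0) = (if y \<le> T then f y else 0)" using f I by auto
qed

lemma locally_const_diff: "locally_const S f \<Longrightarrow> locally_const S g \<Longrightarrow> locally_const S (\<lambda>x. f x - g x)"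
 unfolding locally_const_def by metis

lemma locally_const_divide: "locally_const S f \<Longrightarrow> locally_const S (\<lambda>x. f x / c)"
 unfolding locally_const_def by metis

lemma integral_sum_locbm:
 fixes f :: "'x \<Rightarrow> real \<Rightarrow> real"
 assumes "finite I" "\<And>i. i \<in> I \<Longrightarrow> locbm (f i)"
 shows "integral {a..b} (\<lambda>x. \<Sum>i\<in>I. f i x) = (\<Sum>i\<in>I. integral {a..b} (f i))"
 by (rule integral_sum) (use assms locbm_integrable in auto)

section \<open>Solution of the coupling conditions of one row\<close>

text \<open>For each column j, c weighs the kernels in the first condition and d their y-derivatives
  in the second. The data of the first condition are split into a step function, met by the jumps of
  P and their reflections alone, and an absolutely continuous part, for which the condition is
  differentiated. The opposite signs of c and the equal signs of d make the resulting 2 by 2 systems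
  regular.\<close>

lemma coupled_solution:
 fixes X T :: real and L :: "'n::finite + 'n \<Rightarrow> real" and m :: "'n + 'n \<Rightarrow> real \<times> real \<Rightarrow> real"
  and c d zc :: "'n + 'n \<Rightarrow> real" and r :: "'n \<Rightarrow> real" and A1 A0 :: "'n + 'n \<Rightarrow> 'n \<Rightarrow> real \<Rightarrow> real"
  and dat dd E :: "'n \<Rightarrow> real \<Rightarrow> real"
 assumes X: "0 < X" and L: "\<And>k. 0 < L k" "\<And>k. X + L k \<le> T" and m: "\<And>k. continuous_on UNIV (m k)"
  and c: "\<And>j. 0 < c (Inl j)" "\<And>j. c (Inr j) < 0" and d: "\<And>k. 0 < d k"
  and SA: "finite SA" "\<And>k j. pc SA (A1 k j)" "\<And>k j y. y < 0 \<or> L k < y \<Longrightarrow> A1 k j y = 0"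
  and lA0: "\<And>k j. locbm (A0 k j)"
  and SD: "finite SD" "\<And>s. s \<in> SD \<Longrightarrow> 0 \<le> s" "\<And>j. pc SD (dd j)" "\<And>j. pc SD (E j)"
  and dat: "\<And>j x. 0 < x \<Longrightarrow> x < X \<Longrightarrow> x \<notin> SD \<Longrightarrow> (dat j has_real_derivative dd j x) (at x)"
 obtains S fJ gJ e bet rb a1 a2 a3 a4 B B0 U where
  "row_sol S X T L m fJ gJ e bet rb a1 a2 a3 a4 B B0 U"
  "\<And>j x. fJ (Inr j) x = 0" "\<And>j x. gJ (Inr j) x = 0" "\<And>j. bet (Inr j) = 0" "\<And>j. bet (Inl j) = 1" "\<And>j. rb (Inl j) = r j"
  "\<And>j x. 0 < x \<Longrightarrow> x \<le> X \<Longrightarrow> c (Inl j) * row.ww fJ gJ U (Inl j) (x, x) + c (Inr j) * row.ww fJ gJ U (Inr j) (x, x)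
    = dat j x - (\<Sum>k\<in>UNIV. integral {0..L k} (\<lambda>y. A1 k j y * row.ww fJ gJ U k (x - y, x + y)))"
  "\<And>j x. 0 < x \<Longrightarrow> x \<le> X \<Longrightarrow>
    d (Inl j) * (- vU U (Inl j) x - row.cs T m fJ gJ U (Inl j) (x, x) + gU U (Inl j) x + row.ct T m fJ gJ U (Inl j) (x, x))
     + zc (Inl j) * row.ww fJ gJ U (Inl j) (x, x)
    + (d (Inr j) * (- vU U (Inr j) x - row.cs T m fJ gJ U (Inr j) (x, x) + gU U (Inr j) x + row.ct T m fJ gJ U (Inr j) (x, x))
     + zc (Inr j) * row.ww fJ gJ U (Inr j) (x, x))
    = E j x + (\<Sum>k\<in>UNIV. integral {0..L k} (\<lambda>y. A0 k j y * row.ww fJ gJ U k (x - y, x + y)))"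
proof -
 have T: "0 < T" "X < T" using X L(1)[of "Inl undefined"] L(2)[of "Inl undefined"] by auto
 have lA1: "locbm (A1 k j)" for k j using pc_locbm[OF SA(2,1)] .
 let ?\<Lambda> = "range (\<lambda>k. 2 * L k)"
 have \<Lambda>: "finite ?\<Lambda>" "\<And>l. l \<in> ?\<Lambda> \<Longrightarrow> 0 < l" using L(1) by auto
 obtain SJ where SJ: "finite SJ" "{0, X, T} \<union> SD \<subseteq> SJ" "\<And>s k. s \<in> SJ \<Longrightarrow> s + 2 * L k \<le> T \<Longrightarrow> s + 2 * L k \<in> SJ"
  and SJ0: "\<And>s. s \<in> SJ \<Longrightarrow> 0 \<le> s"
 proof -
  obtain SJ where SJ: "finite SJ" "{0, X, T} \<union> SD \<subseteq> SJ" "\<forall>s\<in>SJ. \<forall>l\<in>?\<Lambda>. s + l \<le> T \<longrightarrow> s + l \<in> SJ"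
   "\<forall>s\<in>SJ. \<exists>s0\<in>{0, X, T} \<union> SD. s0 \<le> s"
   using shift_closure[OF \<Lambda>(1) _ \<Lambda>(2), of "{0, X, T} \<union> SD" T] SD(1) by auto
  have "0 \<le> s" if "s \<in> SJ" for s using SJ(4) that SD(2) X T by (fastforce intro: order_trans)
  then show ?thesis using that[of SJ] SJ(1-3) by blast
 qed
 \<comment> \<open>The step part of the data, divided by the weight of P, as P carries all
   jumps.\<close>
 define dJ where "dJ j x = (if 0 < x \<and> x \<le> X then dat j x - integral {0..x} (dd j) else 0) / c (Inl j)" for j x
 have dJ: "locally_const SJ (dJ j)" for j
  unfolding dJ_def
 proof (intro locally_const_divide jump_part SJ(1))
  show "0 \<in> SJ" "X \<in> SJ" "pc SJ (dd j)" using SJ(2) pc_mono[OF SD(3)] by auto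
  show "(dat j has_real_derivative dd j x) (at x)" if "0 < x" "x < X" "x \<notin> SJ" for x
   by (rule dat) (use that SJ(2) in auto)
 qed
 have "\<exists>f. locally_const SJ f \<and> (\<forall>x\<le>0. f x = 0) \<and> (\<forall>x\<le>T. f x + f (x - 2 * L (Inl j)) = dJ j x)" for j
  by (rule reflected_steps[OF SJ(1) _ SJ(3)[of _ "Inl j"] _ dJ[of j]])
   (use SJ(2) L(1)[of "Inl j"] in \<open>auto simp: dJ_def\<close>)
 then obtain f0 where f0: "\<And>j. locally_const SJ (f0 j)" "\<And>j x. x \<le> 0 \<Longrightarrow> f0 j x = 0"
  "\<And>j x. x \<le> T \<Longrightarrow> f0 j x + f0 j (x - 2 * L (Inl j)) = dJ j x" by metis
 define fJ where "fJ k x = (case k of Inl j \<Rightarrow> f0 j x | Inr j \<Rightarrow> 0)" for k :: "'n + 'n" and x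
 define gJ where "gJ k t = (case k of Inl j \<Rightarrow> (if t \<le> T then dJ j t - f0 j t else 0) | Inr j \<Rightarrow> 0)" for k :: "'n + 'n" and t
 have fJs: "fJ (Inl j) = f0 j" "fJ (Inr j) = (\<lambda>_. 0)" for j by (auto simp: fJ_def)
 have gJs: "gJ (Inl j) = (\<lambda>t. if t \<le> T then dJ j t - f0 j t else 0)" "gJ (Inr j) = (\<lambda>_. 0)" for j by (auto simp: gJ_def)
 \<comment> \<open>\<open>gJ\<close> is the reflection of \<open>f0\<close>; written as the
   remainder of \<open>dJ\<close> it is visibly locally constant, although \<open>SJ\<close> is
   closed under the reflection only up to T.\<close>
 have gJf: "gJ (Inl j) t = f0 j (t - 2 * L (Inl j))" if "t \<le> T" for j t using f0(3)[OF that, of j] that by (simp add: gJs)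
 have lcz: "locally_const SJ (\<lambda>_. 0)" by (simp add: locally_const_def)
 have fJ1: "locally_const SJ (fJ k)" for k using f0(1) lcz by (cases k) (simp_all add: fJs)
 have gJ1: "locally_const SJ (gJ k)" for k
  using locally_const_cut[OF _ locally_const_diff[OF dJ f0(1)]] SJ(2) lcz by (cases k) (simp_all add: gJs)
 have fJ0: "fJ k x = 0" if "x \<le> 0" for k x using f0(2)[OF that] by (cases k) (simp_all add: fJs)
 have gJ0: "gJ k t = 0" if "t \<le> 2 * L k" for k t
 proof (cases k)
  case (Inl j)
  have "2 * L k \<le> T \<or> T < 2 * L k" by linarith
  then show ?thesis using gJf[of t j] f0(2)[of "t - 2 * L k" j] that Inl by (cases "t \<le> T") (auto simp: gJs)
 qed (simp add: gJs)
 have "\<exists>\<delta>. \<forall>x. x \<notin> SJ \<longrightarrow> f0 j x = (\<Sum>a\<in>SJ. \<delta> a * (if a < x then 1 else 0))" for j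
  by (rule step_representation[OF SJ(1) f0(1), of 0]) (use f0(2) in auto)
 then obtain \<delta> where \<delta>: "\<And>j x. x \<notin> SJ \<Longrightarrow> f0 j x = (\<Sum>a\<in>SJ. \<delta> j a * (if a < x then 1 else 0))" by metis
 \<comment> \<open>The derivative in x of the convolutions of the jump parts: a jump at a
   contributes two translates of the coefficient, one for the outgoing wave and one for its
   reflection.\<close>
 define n where "n j x = (\<Sum>j'\<in>UNIV. \<Sum>a\<in>SJ. \<delta> j' a * (A1 (Inl j') j (x - a) + A1 (Inl j') j (2 * L (Inl j') + a - x)))" for j x
 define Sn where "Sn = (\<Union>a\<in>SJ. \<Union>j'\<in>(UNIV::'n set). (\<lambda>s. s + a) ` SA \<union> (\<lambda>s. 2 * L (Inl j') + a - s) ` SA)"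
 have Sn: "finite Sn" using SJ(1) SA(1) by (auto simp: Sn_def)
 have n_pc: "pc Sn (n j)" for j
  unfolding n_def
 proof (intro pc_sum pc_cmult pc_add)
  fix j' a assume a: "a \<in> SJ"
  show "pc Sn (\<lambda>x. A1 (Inl j') j (x - a))"
  proof (rule pc_compose[OF SA(2)])
   fix x assume "x - a \<in> SA"
   then have "x \<in> (\<lambda>s. s + a) ` SA" by (intro image_eqI[of _ _ "x - a"]) auto
   then show "x \<in> Sn" using a by (auto simp: Sn_def)
  qed (intro continuous_intros)
  show "pc Sn (\<lambda>x. A1 (Inl j') j (2 * L (Inl j') + a - x))"
  proof (rule pc_compose[OF SA(2)])
   fix x assume "2 * L (Inl j') + a - x \<in> SA"
   then have "x \<in> (\<lambda>s. 2 * L (Inl j') + a - s) ` SA" by (intro image_eqI[of _ _ "2 * L (Inl j') + a - x"]) auto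
   then show "x \<in> Sn" using a unfolding Sn_def by blast
  qed (intro continuous_intros)
 qed
 have NJ: "(\<Sum>k\<in>UNIV. integral {0..L k} (\<lambda>y. A1 k j y * (fJ k (x - y) + gJ k (x + y)))) = integral {0..x} (n j)"
  if x: "0 \<le> x" "x \<le> X" for j x
 proof -
  have lH: "locbm (\<lambda>y. \<delta> j' a * (A1 (Inl j') j y * (if a < x - y then 1 else 0)))"
   "locbm (\<lambda>y. \<delta> j' a * (A1 (Inl j') j y * (if a < x + y - 2 * L (Inl j') then 1 else 0)))" for j' a
  proof -
   have b: "{y. a < x - y} \<in> sets borel" "{y. a < x + y - 2 * L (Inl j')} \<in> sets borel" by measurable
   show "locbm (\<lambda>y. \<delta> j' a * (A1 (Inl j') j y * (if a < x - y then 1 else 0)))"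
    "locbm (\<lambda>y. \<delta> j' a * (A1 (Inl j') j y * (if a < x + y - 2 * L (Inl j') then 1 else 0)))"
    by (rule locbm_mult[OF locbm_const locbm_mult[OF lA1 locbm_if[OF b(1) locbm_const locbm_const]]]
      locbm_mult[OF locbm_const locbm_mult[OF lA1 locbm_if[OF b(2) locbm_const locbm_const]]])+
  qed
  have lS: "locbm (\<lambda>\<xi>. A1 (Inl j') j (\<xi> - a))" "locbm (\<lambda>\<xi>. A1 (Inl j') j (2 * L (Inl j') + a - \<xi>))" for j' a
   by (rule locbm_compose[OF lA1], intro continuous_intros)+
  have one: "integral {0..L (Inl j')} (\<lambda>y. A1 (Inl j') j y * (fJ (Inl j') (x - y) + gJ (Inl j') (x + y)))
    = integral {0..x} (\<lambda>x. \<Sum>a\<in>SJ. \<delta> j' a * (A1 (Inl j') j (x - a) + A1 (Inl j') j (2 * L (Inl j') + a - x)))" for j'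
  proof -
   let ?l = "Inl j' :: 'n + 'n"
   let ?N = "(\<lambda>s. x - s) ` SJ \<union> (\<lambda>s. s - x + 2 * L ?l) ` SJ"
   have "integral {0..L ?l} (\<lambda>y. A1 ?l j y * (fJ ?l (x - y) + gJ ?l (x + y)))
    = integral {0..L ?l} (\<lambda>y. \<Sum>a\<in>SJ. \<delta> j' a * (A1 ?l j y * (if a < x - y then 1 else 0))
       + \<delta> j' a * (A1 ?l j y * (if a < x + y - 2 * L ?l then 1 else 0)))"
   proof (rule integral_spike[of ?N])
    show "negligible ?N" using SJ(1) by (intro negligible_finite) auto
    fix y assume y: "y \<in> {0..L ?l} - ?N"
    have "x - y \<notin> SJ"
    proof
     assume "x - y \<in> SJ"
     then have "y \<in> (\<lambda>s. x - s) ` SJ" by (intro image_eqI[of _ _ "x - y"]) auto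
     then show False using y by blast
    qed
    moreover have "x + y - 2 * L ?l \<notin> SJ"
    proof
     assume "x + y - 2 * L ?l \<in> SJ"
     then have "y \<in> (\<lambda>s. s - x + 2 * L ?l) ` SJ" by (intro image_eqI[of _ _ "x + y - 2 * L ?l"]) auto
     then show False using y by blast
    qed
    moreover have "x + y \<le> T" using y x L(2)[of ?l] by auto
    ultimately have "fJ ?l (x - y) + gJ ?l (x + y) = (\<Sum>a\<in>SJ. \<delta> j' a * (if a < x - y then 1 else 0))
      + (\<Sum>a\<in>SJ. \<delta> j' a * (if a < x + y - 2 * L ?l then 1 else 0))"
     using \<delta>[of "x - y" j'] \<delta>[of "x + y - 2 * L ?l" j'] gJf[of "x + y" j'] by (simp add: fJs)
    then have "A1 ?l j y * (fJ ?l (x - y) + gJ ?l (x + y)) = (\<Sum>a\<in>SJ. A1 ?l j y * (\<delta> j' a * (if a < x - y then 1 else 0)))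
      + (\<Sum>a\<in>SJ. A1 ?l j y * (\<delta> j' a * (if a < x + y - 2 * L ?l then 1 else 0)))"
     by (simp only: distrib_left sum_distrib_left)
    then show "(\<Sum>a\<in>SJ. \<delta> j' a * (A1 ?l j y * (if a < x - y then 1 else 0))
       + \<delta> j' a * (A1 ?l j y * (if a < x + y - 2 * L ?l then 1 else 0))) = A1 ?l j y * (fJ ?l (x - y) + gJ ?l (x + y))"
     by (simp only: sum.distrib mult.left_commute)
   qed
   also have "\<dots> = (\<Sum>a\<in>SJ. integral {0..L ?l} (\<lambda>y. \<delta> j' a * (A1 ?l j y * (if a < x - y then 1 else 0))
       + \<delta> j' a * (A1 ?l j y * (if a < x + y - 2 * L ?l then 1 else 0))))"
    by (rule integral_sum_locbm[OF SJ(1)]) (intro locbm_add lH)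
   also have "\<dots> = (\<Sum>a\<in>SJ. integral {0..x} (\<lambda>\<xi>. \<delta> j' a * (A1 ?l j (\<xi> - a) + A1 ?l j (2 * L ?l + a - \<xi>))))"
   proof (rule sum.cong[OF refl])
    fix a assume "a \<in> SJ"
    then have a0: "0 \<le> a" using SJ0 by blast
    have "integral {0..L ?l} (\<lambda>y. \<delta> j' a * (A1 ?l j y * (if a < x - y then 1 else 0))
       + \<delta> j' a * (A1 ?l j y * (if a < x + y - 2 * L ?l then 1 else 0)))
     = \<delta> j' a * integral {0..L ?l} (\<lambda>y. A1 ?l j y * (if a < x - y then 1 else 0))
      + \<delta> j' a * integral {0..L ?l} (\<lambda>y. A1 ?l j y * (if a < x + y - 2 * L ?l then 1 else 0))"
     using integral_add[OF locbm_integrable[OF lH(1)] locbm_integrable[OF lH(2)]] by (simp only: integral_mult_right)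
    also have "\<dots> = \<delta> j' a * (integral {0..x} (\<lambda>\<xi>. A1 ?l j (\<xi> - a)) + integral {0..x} (\<lambda>\<xi>. A1 ?l j (2 * L ?l + a - \<xi>)))"
     using step_convolution[OF lA1[of ?l j] SA(3)[of _ ?l j] a0 L(1)[of ?l]] by (simp add: distrib_left)
    also have "\<dots> = integral {0..x} (\<lambda>\<xi>. \<delta> j' a * (A1 ?l j (\<xi> - a) + A1 ?l j (2 * L ?l + a - \<xi>)))"
     using integral_add[OF locbm_integrable[OF lS(1)] locbm_integrable[OF lS(2)]] by (simp only: integral_mult_right)
    finally show "integral {0..L ?l} (\<lambda>y. \<delta> j' a * (A1 ?l j y * (if a < x - y then 1 else 0))
       + \<delta> j' a * (A1 ?l j y * (if a < x + y - 2 * L ?l then 1 else 0)))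
     = integral {0..x} (\<lambda>\<xi>. \<delta> j' a * (A1 ?l j (\<xi> - a) + A1 ?l j (2 * L ?l + a - \<xi>)))" .
   qed
   also have "\<dots> = integral {0..x} (\<lambda>x. \<Sum>a\<in>SJ. \<delta> j' a * (A1 ?l j (x - a) + A1 ?l j (2 * L ?l + a - x)))"
    by (rule integral_sum_locbm[OF SJ(1), symmetric]) (intro locbm_mult locbm_const locbm_add lS)
   finally show ?thesis .
  qed
  have "(\<Sum>k\<in>UNIV. integral {0..L k} (\<lambda>y. A1 k j y * (fJ k (x - y) + gJ k (x + y))))
    = (\<Sum>j'\<in>UNIV. integral {0..x} (\<lambda>x. \<Sum>a\<in>SJ. \<delta> j' a * (A1 (Inl j') j (x - a) + A1 (Inl j') j (2 * L (Inl j') + a - x))))"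
   unfolding sum_UNIV_Plus one by (simp add: fJs gJs)
  also have "\<dots> = integral {0..x} (n j)"
   unfolding n_def by (rule integral_sum_locbm[symmetric]) (auto intro!: locbm_sum locbm_mult locbm_const locbm_add lS)
  finally show ?thesis .
 qed
 \<comment> \<open>The exceptional set of the fixed point also has to contain the points where the
   translated coefficients jump, and must again be closed under the reflections.\<close>
 obtain S where S: "finite S" "{0, X, T} \<union> range (\<lambda>k. 2 * L k) \<union> SJ \<union> Sn \<union> SD \<subseteq> S"
  "\<forall>s\<in>S. \<forall>l\<in>?\<Lambda>. s + l \<le> T \<longrightarrow> s + l \<in> S"
  using shift_closure[OF \<Lambda>(1) _ \<Lambda>(2), of "{0, X, T} \<union> range (\<lambda>k. 2 * L k) \<union> SJ \<union> Sn \<union> SD" T] SD(1) SJ(1) Sn by auto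
 \<comment> \<open>Minus the determinant of the system in \<open>lin\<close>; both products
   contribute positively.\<close>
 define D where "D j = c (Inl j) * d (Inr j) - c (Inr j) * d (Inl j)" for j
 have D: "D j > 0" for j
  using mult_pos_pos[OF c(1) d, of j "Inr j"] mult_neg_pos[OF c(2) d, of j "Inl j"] by (simp add: D_def)
 \<comment> \<open>\<open>pk\<close> and \<open>qk\<close> are the entries of the inverse of the
   system in \<open>lin\<close>: v is \<open>pk\<close> times R1 plus \<open>qk\<close> times
   R2.\<close>
 define pk where "pk k = (case k of Inl j \<Rightarrow> d (Inr j) | Inr j \<Rightarrow> - d (Inl j)) / D (ix k)" for k
 define qk where "qk k = (case k of Inl j \<Rightarrow> c (Inr j) | Inr j \<Rightarrow> - c (Inl j)) / D (ix k)" for k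
 define e where "e k x = pk k * (dd (ix k) x - n (ix k) x) + qk k * E (ix k) x" for k x
 define a1 where "a1 k k' = (if ix k' = ix k then - pk k * c k' - qk k * d k' else 0)" for k k'
 define a2 where "a2 k k' = (if ix k' = ix k then - pk k * c k' + qk k * d k' else 0)" for k k'
 define a4 where "a4 k k' = (if ix k' = ix k then - qk k * zc k' else 0)" for k k'
 define B where "B k k' y = - pk k * A1 k' (ix k) y" for k k' y
 define B0 where "B0 k k' y = qk k * A0 k' (ix k) y" for k k' y
 define bet where "bet k = (case k of Inl j \<Rightarrow> 1 :: real | Inr j \<Rightarrow> 0)" for k :: "'n + 'n"
 define rb where "rb k = (case k of Inl j \<Rightarrow> r j | Inr j \<Rightarrow> 0)" for k :: "'n + 'n"
 have row: "row S X T L m fJ gJ e B B0"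
 proof
  show "finite S" "0 \<in> S" "X \<in> S" "T \<in> S" "\<And>k. 2 * L k \<in> S" using S by auto
  show "s + 2 * L k \<in> S" if "s \<in> S" "s + 2 * L k \<le> T" for s k using S(3) that by blast
  show "pc S (fJ k)" "pc S (gJ k)" for k
   using locally_const_pc locally_const_mono[OF fJ1] locally_const_mono[OF gJ1] S(2) by auto
  show "pc S (e k)" for k
   unfolding e_def by (intro pc_add pc_cmult pc_diff pc_mono[OF SD(3)] pc_mono[OF SD(4)] pc_mono[OF n_pc]) (use S(2) in auto)
  show "locbm (B k k')" "locbm (B0 k k')" for k k'
   unfolding B_def B0_def by (intro locbm_mult locbm_const lA1 lA0)+
 qed (use X L m fJ0 gJ0 in auto)
 \<comment> \<open>g and \<open>ct\<close> enter either condition with equal signs and weights, so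
   the same \<open>a1\<close> is the coefficient of both.\<close>
 interpret row S X T L m fJ gJ e bet rb a1 a2 a1 a4 B B0 by (rule row)
 obtain U where U: "good U" "Phi U = U" using solution_exists by blast
 have rs: "row_sol S X T L m fJ gJ e bet rb a1 a2 a1 a4 B B0 U"
 proof
  show "locally_const S (fJ k)" "locally_const S (gJ k)" for k
   using locally_const_mono[OF fJ1] locally_const_mono[OF gJ1] S(2) by auto
 qed (use U in auto)
 then interpret row_sol S X T L m fJ gJ e bet rb a1 a2 a1 a4 B B0 U .
 define I1 where "I1 j k x = integral {0..L k} (\<lambda>y. A1 k j y * wx U k (x - y, x + y))" for j k x
 define I0 where "I0 j k x = integral {0..L k} (\<lambda>y. A0 k j y * ww U k (x - y, x + y))" for j k x
 \<comment> \<open>Right sides of the two conditions after everything except v has been moved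
   there.\<close>
 define R1 where "R1 j x = dd j x - n j x - (\<Sum>k\<in>UNIV. if ix k = j then c k * (gU U k x + cs U k (x, x) + ct U k (x, x)) else 0)
   - (\<Sum>k\<in>UNIV. I1 j k x)" for j x
 define R2 where "R2 j x = E j x - (\<Sum>k\<in>UNIV. if ix k = j then d k * (gU U k x - cs U k (x, x) + ct U k (x, x)) + zc k * ww U k (x, x) else 0)
   + (\<Sum>k\<in>UNIV. I0 j k x)" for j x
 have vR: "vU U k x = pk k * R1 (ix k) x + qk k * R2 (ix k) x" if x: "0 < x" "x \<le> X" for k x
 proof -
  have cv: "conv U k k' x = - pk k * I1 (ix k) k' x + qk k * I0 (ix k) k' x" for k'
  proof -
   have l1: "locbm (\<lambda>y. - pk k * (A1 k' (ix k) y * wx U k' (x - y, x + y)))"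
    by (intro locbm_mult locbm_const lA1 locbm_compose[OF wx_locbm[OF U(1)]] continuous_intros)
   have l0: "locbm (\<lambda>y. qk k * (A0 k' (ix k) y * ww U k' (x - y, x + y)))"
    by (intro locbm_mult locbm_const lA0 locbm_compose[OF ww_locbm[OF U(1)]] continuous_intros)
   have "conv U k k' x = integral {0..L k'} (\<lambda>y. - pk k * (A1 k' (ix k) y * wx U k' (x - y, x + y))
     + qk k * (A0 k' (ix k) y * ww U k' (x - y, x + y)))"
    unfolding conv_def B_def B0_def by (simp only: mult.assoc)
   also have "\<dots> = integral {0..L k'} (\<lambda>y. - pk k * (A1 k' (ix k) y * wx U k' (x - y, x + y)))
     + integral {0..L k'} (\<lambda>y. qk k * (A0 k' (ix k) y * ww U k' (x - y, x + y)))"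
    by (rule integral_add) (intro locbm_integrable l1 l0)+
   also have "\<dots> = - pk k * I1 (ix k) k' x + qk k * I0 (ix k) k' x"
    unfolding I1_def I0_def by (simp only: integral_mult_right)
   finally show ?thesis .
  qed
  have summand: "a1 k k' * gU U k' x + a2 k k' * cs U k' (x, x) + a1 k k' * ct U k' (x, x) + a4 k k' * ww U k' (x, x) + conv U k k' x
   = pk k * (- (if ix k' = ix k then c k' * (gU U k' x + cs U k' (x, x) + ct U k' (x, x)) else 0) - I1 (ix k) k' x)
   + qk k * (- (if ix k' = ix k then d k' * (gU U k' x - cs U k' (x, x) + ct U k' (x, x)) + zc k' * ww U k' (x, x) else 0) + I0 (ix k) k' x)" for k'
   unfolding cv a1_def a2_def a4_def by (simp add: algebra_simps)
  show ?thesis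
   unfolding vU_eq[OF x] summand R1_def R2_def e_def
   by (simp only: sum.distrib sum_subtractf sum_negf sum_distrib_left[symmetric]) (simp add: algebra_simps)
 qed
 have lin: "c (Inl j) * vU U (Inl j) x + c (Inr j) * vU U (Inr j) x = R1 j x"
  "- d (Inl j) * vU U (Inl j) x - d (Inr j) * vU U (Inr j) x = R2 j x" if x: "0 < x" "x \<le> X" for j x
 proof -
  have "c (Inl j) * vU U (Inl j) x + c (Inr j) * vU U (Inr j) x
   = (c (Inl j) * d (Inr j) - c (Inr j) * d (Inl j)) * R1 j x / D j"
   unfolding vR[OF x] pk_def qk_def using D[of j] by (simp add: field_simps)
  then show "c (Inl j) * vU U (Inl j) x + c (Inr j) * vU U (Inr j) x = R1 j x" using D[of j] unfolding D_def by simp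
  have "- d (Inl j) * vU U (Inl j) x - d (Inr j) * vU U (Inr j) x
   = (c (Inl j) * d (Inr j) - c (Inr j) * d (Inl j)) * R2 j x / D j"
   unfolding vR[OF x] pk_def qk_def using D[of j] by (simp add: field_simps)
  then show "- d (Inl j) * vU U (Inl j) x - d (Inr j) * vU U (Inr j) x = R2 j x" using D[of j] unfolding D_def by simp
 qed
 \<comment> \<open>The differentiated condition is integrated from 0, where the continuous parts
   vanish, and the step part is added.\<close>
 have eqI: "c (Inl j) * ww U (Inl j) (x, x) + c (Inr j) * ww U (Inr j) (x, x)
    = dat j x - (\<Sum>k\<in>UNIV. integral {0..L k} (\<lambda>y. A1 k j y * ww U k (x - y, x + y)))"
  if x: "0 < x" "x \<le> X" for j x
 proof -
  have pw: "c (Inl j) * wx U (Inl j) (\<xi>, \<xi>) + c (Inr j) * wx U (Inr j) (\<xi>, \<xi>) = dd j \<xi> - n j \<xi> - (\<Sum>k\<in>UNIV. I1 j k \<xi>)"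
   if "\<xi> \<in> {0..x} - {0}" for \<xi>
   using lin(1)[of \<xi> j] that x unfolding R1_def sum_ix by (simp add: wx_def algebra_simps)
  have lw: "locbm (\<lambda>\<xi>. wx U k (\<xi>, \<xi>))" for k by (rule locbm_compose[OF wx_locbm[OF U(1)]]) (intro continuous_intros)
  have ldd: "locbm (dd j)" and ln: "locbm (n j)" using pc_locbm[OF SD(3,1)] pc_locbm[OF n_pc Sn] by auto
  have lI: "locbm (I1 j k)" for k unfolding I1_def[abs_def] by (rule conv_locbm[OF lA1])
  have wl: "integral {0..x} (\<lambda>\<xi>. wx U k (\<xi>, \<xi>)) = wr k (x, x)" for k
   using wr_line[of 0 k x] L(1)[of k] x by simp
  have "c (Inl j) * wr (Inl j) (x, x) + c (Inr j) * wr (Inr j) (x, x)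
   = integral {0..x} (\<lambda>\<xi>. c (Inl j) * wx U (Inl j) (\<xi>, \<xi>) + c (Inr j) * wx U (Inr j) (\<xi>, \<xi>))"
   using integral_add[OF locbm_integrable[OF locbm_mult[OF locbm_const lw]] locbm_integrable[OF locbm_mult[OF locbm_const lw]],
     of 0 x "c (Inl j)" "Inl j" "c (Inr j)" "Inr j"] by (simp add: wl)
  also have "\<dots> = integral {0..x} (\<lambda>\<xi>. dd j \<xi> - n j \<xi> - (\<Sum>k\<in>UNIV. I1 j k \<xi>))"
   by (rule integral_spike[of "{0}"]) (use pw in auto)
  also have "\<dots> = integral {0..x} (dd j) - integral {0..x} (n j) - (\<Sum>k\<in>UNIV. integral {0..x} (I1 j k))"
   using integral_sum_locbm[of UNIV "I1 j" 0 x] lI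
   by (simp add: integral_diff locbm_integrable ldd ln locbm_sum locbm_diff)
  also have "(\<Sum>k\<in>UNIV. integral {0..x} (I1 j k)) = (\<Sum>k\<in>UNIV. integral {0..L k} (\<lambda>y. A1 k j y * wr k (x - y, x + y)))"
   unfolding I1_def[abs_def] using conv_line[OF lA1] x by simp
  also have "integral {0..x} (n j) = (\<Sum>k\<in>UNIV. integral {0..L k} (\<lambda>y. A1 k j y * (fJ k (x - y) + gJ k (x + y))))"
   using NJ[of x j] x by simp
  finally have reg: "c (Inl j) * wr (Inl j) (x, x) + c (Inr j) * wr (Inr j) (x, x) = integral {0..x} (dd j)
   - ((\<Sum>k\<in>UNIV. integral {0..L k} (\<lambda>y. A1 k j y * (fJ k (x - y) + gJ k (x + y))))
    + (\<Sum>k\<in>UNIV. integral {0..L k} (\<lambda>y. A1 k j y * wr k (x - y, x + y))))" by simp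
  have comb: "integral {0..L k} (\<lambda>y. A1 k j y * (fJ k (x - y) + gJ k (x + y))) + integral {0..L k} (\<lambda>y. A1 k j y * wr k (x - y, x + y))
    = integral {0..L k} (\<lambda>y. A1 k j y * ww U k (x - y, x + y))" for k
  proof -
   have "locbm (\<lambda>y. A1 k j y * (fJ k (x - y) + gJ k (x + y)))"
    using locally_const_pc[OF fJ1] locally_const_pc[OF gJ1] SJ(1)
    by (intro locbm_mult lA1 locbm_add locbm_compose[OF pc_locbm[OF locally_const_pc[OF fJ1] SJ(1)]]
     locbm_compose[OF pc_locbm[OF locally_const_pc[OF gJ1] SJ(1)]] continuous_intros)
   moreover have "locbm (\<lambda>y. A1 k j y * wr k (x - y, x + y))"
    by (intro locbm_mult lA1 locbm_compose[OF locbm_continuous[OF wr_cont]] continuous_intros)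
   ultimately show ?thesis
    using integral_add[OF locbm_integrable locbm_integrable, of "\<lambda>y. A1 k j y * (fJ k (x - y) + gJ k (x + y))" "\<lambda>y. A1 k j y * wr k (x - y, x + y)" 0 "L k"]
    by (simp add: ww_wr distrib_left add.assoc)
  qed
  have jump: "c (Inl j) * (fJ (Inl j) x + gJ (Inl j) x) = dat j x - integral {0..x} (dd j)"
   using x T c(1)[of j] by (simp add: fJs gJs dJ_def)
  have "c (Inl j) * ww U (Inl j) (x, x) + c (Inr j) * ww U (Inr j) (x, x)
   = c (Inl j) * (fJ (Inl j) x + gJ (Inl j) x) + (c (Inl j) * wr (Inl j) (x, x) + c (Inr j) * wr (Inr j) (x, x))"
   by (simp add: ww_wr fJs(2) gJs(2) algebra_simps)
  also have "\<dots> = dat j x - (\<Sum>k\<in>UNIV. integral {0..L k} (\<lambda>y. A1 k j y * ww U k (x - y, x + y)))"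
   unfolding jump reg by (simp add: comb sum.distrib[symmetric])
  finally show ?thesis .
 qed
 have eqII: "d (Inl j) * (- vU U (Inl j) x - cs U (Inl j) (x, x) + gU U (Inl j) x + ct U (Inl j) (x, x)) + zc (Inl j) * ww U (Inl j) (x, x)
    + (d (Inr j) * (- vU U (Inr j) x - cs U (Inr j) (x, x) + gU U (Inr j) x + ct U (Inr j) (x, x)) + zc (Inr j) * ww U (Inr j) (x, x))
    = E j x + (\<Sum>k\<in>UNIV. integral {0..L k} (\<lambda>y. A0 k j y * ww U k (x - y, x + y)))"
  if x: "0 < x" "x \<le> X" for j x
  using lin(2)[OF x, of j] unfolding R2_def sum_ix I0_def by (simp add: algebra_simps)
 show ?thesis
  by (rule that[OF rs _ _ _ _ _ eqI eqII]) (simp_all add: fJs gJs bet_def rb_def)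
qed

section \<open>The kernels in the original coordinates\<close>

lemma at_within_Icc_nontrivial: "a < b \<Longrightarrow> x \<in> {a..b} \<Longrightarrow> at x within {a..b} \<noteq> bot" for a b x :: real
 using islimpt_Icc[of a b x] trivial_limit_within[of x "{a..b}"] by (auto simp: trivial_limit_def)

lemma compact_square: "compact square" and square_sub: "square \<subseteq> {0..1} \<times> {0..1}"
 unfolding square_def by (auto intro: compact_Times)

lemma thick_square: "p \<in> square \<Longrightarrow> thick square p"
proof -
 assume p: "p \<in> square"
 then have "{x. (x, snd p) \<in> square} = {0..1}" "{y. (fst p, y) \<in> square} = {0..1}" by (auto simp: square_def)
 then show ?thesis using p at_within_Icc_nontrivial[of 0 1 "fst p"] at_within_Icc_nontrivial[of 0 1 "snd p"]
  unfolding thick_def by (auto simp: square_def mem_Times_iff)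
qed

lemma triangle_sub: "triangle \<subseteq> {0..1} \<times> {0..1}" by (auto simp: triangle_def)

lemma compact_triangle: "compact triangle"
proof -
 have "triangle = ({0..1} \<times> {0..1}) \<inter> {u. snd u \<le> fst u}" by (auto simp: triangle_def)
 moreover have "closed {u::real \<times> real. snd u \<le> fst u}" by (intro closed_Collect_le continuous_intros)
 ultimately show ?thesis by (metis compact_Int_closed compact_Times compact_Icc)
qed

text \<open>At (0, 0) the slice in \<zeta> and at (1, 1) the slice in z shrink to a point;
  everywhere else both are nondegenerate intervals.\<close>

lemma thick_triangle: "p \<in> triangle - {(0, 0), (1, 1)} \<Longrightarrow> thick triangle p"
proof -
 assume p: "p \<in> triangle - {(0, 0), (1, 1)}"
 then have e: "{x. (x, snd p) \<in> triangle} = {snd p..1}" "{y. (fst p, y) \<in> triangle} = {0..fst p}" by (auto simp: triangle_def)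
 have "snd p < 1" "0 < fst p" using p by (auto simp: triangle_def intro: antisym)
 moreover have "fst p \<in> {snd p..1}" "snd p \<in> {0..fst p}" using p by (auto simp: triangle_def)
 ultimately show ?thesis unfolding thick_def e by (intro conjI at_within_Icc_nontrivial)
qed

lemma frontier_square: "frontier square \<subseteq> {u. fst u \<in> {0, 1} \<or> snd u \<in> {0, 1}}"
proof -
 have "{0<..<1} \<times> {0<..<1} \<subseteq> interior square" unfolding square_def by (rule interior_maximal) (auto intro: open_Times)
 moreover have "closure square = square" using compact_square compact_imp_closed closure_closed by blast
 ultimately have "frontier square \<subseteq> square - {0<..<1} \<times> {0<..<1}" unfolding frontier_def by blast
 moreover have "u \<in> square - {0<..<1} \<times> {0<..<1} \<Longrightarrow> fst u \<in> {0, 1} \<or> snd u \<in> {0, 1}" for u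
  by (cases u) (auto simp: square_def)
 ultimately show ?thesis by blast
qed

lemma frontier_triangle: "frontier triangle \<subseteq> {u. (snd u = 0 \<or> fst u = 1) \<or> fst u \<in> {0..1} \<and> snd u = fst u}"
proof -
 have "open {u::real \<times> real. 0 < snd u \<and> snd u < fst u \<and> fst u < 1}"
  by (intro open_Collect_conj open_Collect_less continuous_intros)
 then have "{u. 0 < snd u \<and> snd u < fst u \<and> fst u < 1} \<subseteq> interior triangle"
  by (intro interior_maximal) (auto simp: triangle_def)
 moreover have "closure triangle = triangle" using compact_triangle compact_imp_closed closure_closed by blast
 ultimately have "frontier triangle \<subseteq> triangle - {u. 0 < snd u \<and> snd u < fst u \<and> fst u < 1}" unfolding frontier_def by blast
 moreover have "(snd u = 0 \<or> fst u = 1) \<or> fst u \<in> {0..1} \<and> snd u = fst u"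
  if "u \<in> triangle - {u. 0 < snd u \<and> snd u < fst u \<and> fst u < 1}" for u
  using that by (cases u) (auto simp: triangle_def)
 ultimately show ?thesis by blast
qed

context chart2
begin

text \<open>With one coordinate fixed, s and t are injective in the other, so each characteristic
  meets an edge line once.\<close>

lemma finite_char_edge:
 assumes "finite Sa" "finite Sb"
 shows "finite {u. (fst u \<in> {0, 1} \<or> snd u \<in> {0, 1}) \<and> (\<phi> (fst u) - \<theta> (snd u) \<in> Sa \<or> \<phi> (fst u) + \<theta> (snd u) \<in> Sb)}"
proof -
 let ?F = "\<Union>c\<in>{0, 1}. (\<lambda>e. (c, \<nu> (\<phi> c - e))) ` Sa \<union> (\<lambda>e. (c, \<nu> (e - \<phi> c))) ` Sb
  \<union> (\<lambda>e. (\<xi> (e + \<theta> c), c)) ` Sa \<union> (\<lambda>e. (\<xi> (e - \<theta> c), c)) ` Sb"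
 have "u \<in> ?F" if u: "fst u \<in> {0, 1} \<or> snd u \<in> {0, 1}" "\<phi> (fst u) - \<theta> (snd u) \<in> Sa \<or> \<phi> (fst u) + \<theta> (snd u) \<in> Sb" for u
 proof -
  have e: "u = (fst u, \<nu> (\<phi> (fst u) - (\<phi> (fst u) - \<theta> (snd u))))" "u = (fst u, \<nu> (\<phi> (fst u) + \<theta> (snd u) - \<phi> (fst u)))"
   "u = (\<xi> (\<phi> (fst u) - \<theta> (snd u) + \<theta> (snd u)), snd u)" "u = (\<xi> (\<phi> (fst u) + \<theta> (snd u) - \<theta> (snd u)), snd u)"
   by (simp_all add: c.inv r.inv)
  show ?thesis using u(1)
  proof
   assume "fst u \<in> {0, 1}" then show ?thesis using u(2) e(1,2) by (intro UN_I[of "fst u"]) blast+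
  next
   assume "snd u \<in> {0, 1}" then show ?thesis using u(2) e(3,4) by (intro UN_I[of "snd u"]) blast+
  qed
 qed
 moreover have "finite ?F" using assms by simp
 ultimately show ?thesis by (elim finite_subset[rotated]) blast
qed

lemma finite_char_diag:
 assumes "finite Sb" shows "finite {z. \<phi> z + \<theta> z \<in> Sb}"
proof -
 have "inj (\<lambda>z. \<phi> z + \<theta> z)"
  by (rule linorder_injI) (use r.\<phi>_mono c.\<phi>_mono in \<open>metis add_strict_mono less_irrefl\<close>)
 from finite_vimageI[OF assms this] show ?thesis by (simp add: vimage_def)
qed

text \<open>Where the column coefficient is smaller, its travel time grows faster than that of the
  row. Starting from 0, the diagonal therefore runs in s < 0, where the kernel vanishes, and a
  characteristic s = const meets it at most once.\<close>

lemma char_decreasing: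
 assumes qp: "\<And>z. z \<in> {0..1} \<Longrightarrow> q z < p z" and ab: "0 \<le> a" "a < b" "b \<le> 1"
 shows "\<phi> b - \<theta> b < \<phi> a - \<theta> a"
proof (rule DERIV_neg_imp_decreasing[OF ab(2)])
 fix x assume x: "a \<le> x" "x \<le> b"
 have "q x < p x" using qp x ab by simp
 then have "1 / (p x)\<^sup>2 < 1 / (q x)\<^sup>2"
  using c.pos[of x] by (intro divide_strict_left_mono power_strict_mono mult_pos_pos zero_less_power) (auto simp: r.pos)
 then show "\<exists>y. ((\<lambda>z. \<phi> z - \<theta> z) has_real_derivative y) (at x) \<and> y < 0"
  using DERIV_diff[OF r.d\<phi> c.d\<phi>, of x] by (intro exI[of _ "1 / (p x)\<^sup>2 - 1 / (q x)\<^sup>2"]) auto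
qed

lemma finite_char_diag_diff:
 assumes qp: "\<And>z. z \<in> {0..1} \<Longrightarrow> q z < p z" and S: "finite Sa"
 shows "finite {z \<in> {0..1}. \<phi> z - \<theta> z \<in> Sa}"
proof -
 have "inj_on (\<lambda>z. \<phi> z - \<theta> z) {0..1}"
  by (rule linorder_inj_onI) (use char_decreasing[OF qp] in force)+
 from finite_vimage_IntI[OF S this] show ?thesis by (rule finite_subset[rotated]) auto
qed

end

text \<open>The entry kk of the row seen in (z, \<zeta>): p belongs to the row, q to the column; X
  and \<open>L kk\<close> are the travel times across [0, 1].\<close>

locale row_kernel = row_sol S X T L m fJ gJ e bet rb a1 a2 a3 a4 A A0 U + chart2 p p1 p2 \<phi> \<xi> q q1 q2 \<theta> \<nu>
 for S X T and L :: "'k::finite \<Rightarrow> real" and m fJ gJ e bet rb a1 a2 a3 a4 A A0 U p p1 p2 \<phi> \<xi> q q1 q2 \<theta> \<nu> +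
 fixes kk :: 'k
 assumes X\<phi>: "X = \<phi> 1" and L\<theta>: "L kk = \<theta> 1"
  and mkk: "\<And>x y. 4 * m kk (x - y, x + y) = (q (\<nu> y)) ^ 3 * q2 (\<nu> y) - (p (\<xi> x)) ^ 3 * p2 (\<xi> x)"
begin

abbreviation sc :: "real \<Rightarrow> real \<Rightarrow> real" where "sc z \<zeta> \<equiv> \<phi> z - \<theta> \<zeta>"
abbreviation tc :: "real \<Rightarrow> real \<Rightarrow> real" where "tc z \<zeta> \<equiv> \<phi> z + \<theta> \<zeta>"

definition Kf :: "real \<Rightarrow> real \<Rightarrow> real" where
 "Kf z \<zeta> = p z / q \<zeta> ^ 3 * ww U kk (sc z \<zeta>, tc z \<zeta>)"

lemma ranges:
 assumes "z \<in> {0..1}" "\<zeta> \<in> {0..1}"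
 shows "0 \<le> \<phi> z" "\<phi> z \<le> X" "0 \<le> \<theta> \<zeta>" "\<theta> \<zeta> \<le> L kk" "tc z \<zeta> \<le> T" "sc z \<zeta> \<le> X"
proof -
 show 1: "0 \<le> \<phi> z" "\<phi> z \<le> X" "0 \<le> \<theta> \<zeta>" "\<theta> \<zeta> \<le> L kk"
  using assms r.\<phi>_le_iff[of 0 z] r.\<phi>_le_iff[of z 1] c.\<phi>_le_iff[of 0 \<zeta>] c.\<phi>_le_iff[of \<zeta> 1]
  by (auto simp: X\<phi> L\<theta> r.\<phi>0 c.\<phi>0)
 then show "tc z \<zeta> \<le> T" "sc z \<zeta> \<le> X" using L(2)[of kk] by linarith+
qed

lemma ww_zero: "s \<le> 0 \<Longrightarrow> t \<le> 2 * L k \<Longrightarrow> ww U k (s, t) = 0"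
 using ff_0[OF U, of s k] gg_0[OF U, of t k] C_0[OF U, of "(s, t)" k] by (simp add: ww_def)

lemma Kf_zero: "z \<in> {0..1} \<Longrightarrow> \<zeta> \<in> {0..1} \<Longrightarrow> \<phi> z \<le> \<theta> \<zeta> \<Longrightarrow> Kf z \<zeta> = 0"
 using ranges[of z \<zeta>] ww_zero[of "sc z \<zeta>" "tc z \<zeta>" kk] by (simp add: Kf_def)

text \<open>The cut-off in \<open>hh\<close> is invisible in D: s and t are at most T there, and
  where s \<le> 0 the kernel itself vanishes.\<close>

lemma Kf_weak:
 assumes ab: "\<And>z. z \<in> {0..1} \<Longrightarrow> a z = (p z) ^ 4" "\<And>z. z \<in> {0..1} \<Longrightarrow> b z = (q z) ^ 4"
  and D: "D \<subseteq> {0..1} \<times> {0..1}" and test: "test_function D \<psi>"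
 shows "integral D (\<lambda>(z, \<zeta>). Kf z \<zeta> * Dz (Dz (\<lambda>z \<zeta>. a z * \<psi> z \<zeta>)) z \<zeta> - Kf z \<zeta> * b \<zeta> * Dzeta (Dzeta \<psi>) z \<zeta>) = 0"
proof (rule weak_kernel_component[where f="ff U kk" and g="gg U kk" and C="CU U kk" and cs="cs U kk" and H="hh U kk" and m="m kk",
   OF pc_locbm[OF ff_pc[OF U] finS] pc_locbm[OF gg_pc[OF U] finS] C_cont[OF U] cs_locbm[OF U] hh_locbm[OF U] _ _ _ mkk _ _ ab D test])
 show "\<exists>N. finite N \<and> (\<forall>s. s \<notin> N \<longrightarrow> ((\<lambda>s. CU U kk (s, t)) has_real_derivative cs U kk (s, t)) (at s))" for t
 proof (intro exI[of _ S] conjI finS allI impI)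
  fix s assume s: "s \<notin> S"
  have "locbm (\<lambda>\<sigma>. cs U kk (\<sigma>, t))" by (rule locbm_compose[OF cs_locbm[OF U]]) (intro continuous_intros)
  moreover have "isCont (\<lambda>\<sigma>. cs U kk (\<sigma>, t)) s"
   by (rule isCont_o2[of s "\<lambda>\<sigma>. (\<sigma>, t)" "cs U kk"]) (use s in \<open>auto intro!: continuous_intros cs_isCont[OF U]\<close>)
  ultimately have "((\<lambda>s. integral {0..s} (\<lambda>\<sigma>. cs U kk (\<sigma>, t))) has_real_derivative cs U kk (s, t)) (at s)"
   by (intro integral0_has_derivative) (auto simp: cs_0)
  then show "((\<lambda>s. CU U kk (s, t)) has_real_derivative cs U kk (s, t)) (at s)" by (simp add: CU_eq)
 qed
 show "continuous_on UNIV (\<lambda>t. cs U kk (s, t))" for s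
  unfolding cs_def fst_conv snd_conv by (rule continuous_on_integral0[OF hh_sec(1)[OF U]])
 show "\<exists>N. finite N \<and> (\<forall>t. t \<notin> N \<longrightarrow> ((\<lambda>t. cs U kk (s, t)) has_real_derivative hh U kk (s, t)) (at t))" for s
 proof (intro exI[of _ S] conjI finS allI impI)
  fix t assume t: "t \<notin> S"
  have P: "pc S (\<lambda>\<tau>. if 0 < \<tau> \<and> \<tau> \<le> T then m kk (s, \<tau>) * (ff U kk s + gg U kk \<tau> + CU U kk (s, \<tau>)) else 0)"
   using S0 by (intro pc_if_interval pc_mult pc_add pc_const gg_pc[OF U] pc_continuous
     continuous_on_compose2[OF m] continuous_on_compose2[OF C_cont[OF U]] continuous_intros) auto
  have "(\<lambda>\<tau>. hh U kk (s, \<tau>)) = (\<lambda>\<tau>. (if 0 < s \<and> s \<le> T then 1 else 0) *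
    (if 0 < \<tau> \<and> \<tau> \<le> T then m kk (s, \<tau>) * (ff U kk s + gg U kk \<tau> + CU U kk (s, \<tau>)) else 0))"
   by (auto simp: hh_def ww_def)
  then have "pc S (\<lambda>\<tau>. hh U kk (s, \<tau>))" using pc_cmult[OF P] by simp
  from pc_isCont[OF this finS t]
  show "((\<lambda>t. cs U kk (s, t)) has_real_derivative hh U kk (s, t)) (at t)"
   unfolding cs_def fst_conv snd_conv by (intro integral0_has_derivative hh_sec(1)[OF U]) (auto simp: hh_0[OF U])
 qed
 fix z \<zeta> assume "(z, \<zeta>) \<in> interior D"
 then have zz: "z \<in> {0..1}" "\<zeta> \<in> {0..1}" using D interior_subset by blast+
 note R = ranges[OF zz]
 show "Kf z \<zeta> = p z / q \<zeta> ^ 3 * (ff U kk (sc z \<zeta>) + gg U kk (tc z \<zeta>) + CU U kk (sc z \<zeta>, tc z \<zeta>))"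
  by (simp add: Kf_def ww_def)
 have "hh U kk (sc z \<zeta>, tc z \<zeta>) = m kk (sc z \<zeta>, tc z \<zeta>) * ww U kk (sc z \<zeta>, tc z \<zeta>)"
 proof (cases "sc z \<zeta> \<le> 0")
  case True
  then show ?thesis using R ww_zero[of "sc z \<zeta>" "tc z \<zeta>" kk] by (simp add: hh_def)
 next
  case False
  then show ?thesis using R T0 by (simp add: hh_def)
 qed
 then show "hh U kk (sc z \<zeta>, tc z \<zeta>) = m kk (sc z \<zeta>, tc z \<zeta>) * (ff U kk (sc z \<zeta>) + gg U kk (tc z \<zeta>) + CU U kk (sc z \<zeta>, tc z \<zeta>))"
  by (simp add: ww_def)
qed

text \<open>The left side of the third formula is the \<zeta>-derivative of K q^4, the combination
  that occurs in the boundary conditions at \<zeta> = 0 and \<zeta> = 1.\<close>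

lemma Kf_deriv:
 assumes D: "D \<subseteq> {0..1} \<times> {0..1}" "(z, \<zeta>) \<in> D" "thick D (z, \<zeta>)" and S: "sc z \<zeta> \<notin> S" "tc z \<zeta> \<notin> S"
 defines "w \<equiv> ww U kk (sc z \<zeta>, tc z \<zeta>)" and "ws \<equiv> vU U kk (sc z \<zeta>) + cs U kk (sc z \<zeta>, tc z \<zeta>)"
  and "wt \<equiv> gU U kk (tc z \<zeta>) + ct U kk (sc z \<zeta>, tc z \<zeta>)"
 shows "pd_z D Kf z \<zeta> = p1 z / q \<zeta> ^ 3 * w + p z / q \<zeta> ^ 3 * ((ws + wt) / (p z)\<^sup>2)"
  and "pd_zeta D Kf z \<zeta> = - 3 * p z * q1 \<zeta> / q \<zeta> ^ 4 * w + p z / q \<zeta> ^ 3 * ((wt - ws) / (q \<zeta>)\<^sup>2)"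
  and "pd_zeta D Kf z \<zeta> * q \<zeta> ^ 4 + Kf z \<zeta> * (4 * q \<zeta> ^ 3 * q1 \<zeta>) = p z * (q1 \<zeta> * w + (wt - ws) / q \<zeta>)"
proof -
 have "((\<lambda>(z, \<zeta>). Kf z \<zeta>) has_derivative (\<lambda>d. (p1 z / q \<zeta> ^ 3 * w + p z / q \<zeta> ^ 3 * ((ws + wt) / (p z)\<^sup>2)) * fst d
   + (- 3 * p z * q1 \<zeta> / q \<zeta> ^ 4 * w + p z / q \<zeta> ^ 3 * ((wt - ws) / (q \<zeta>)\<^sup>2)) * snd d)) (at (z, \<zeta>) within D)"
  using kernel_has_derivative[OF D(1,2) ww_deriv[OF S]]
  by (simp add: Kf_def case_prod_beta' w_def ws_def wt_def)
 from pd_eq[OF this D(3)]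
 show 1: "pd_z D Kf z \<zeta> = p1 z / q \<zeta> ^ 3 * w + p z / q \<zeta> ^ 3 * ((ws + wt) / (p z)\<^sup>2)"
  and 2: "pd_zeta D Kf z \<zeta> = - 3 * p z * q1 \<zeta> / q \<zeta> ^ 4 * w + p z / q \<zeta> ^ 3 * ((wt - ws) / (q \<zeta>)\<^sup>2)" by simp_all
 have K: "Kf z \<zeta> = p z / q \<zeta> ^ 3 * w" by (simp add: Kf_def w_def)
 show "pd_zeta D Kf z \<zeta> * q \<zeta> ^ 4 + Kf z \<zeta> * (4 * q \<zeta> ^ 3 * q1 \<zeta>) = p z * (q1 \<zeta> * w + (wt - ws) / q \<zeta>)"
  unfolding 2 K using c.pos[of \<zeta>] by (simp add: field_simps eval_nat_numeral)
qed

lemma Kf_deriv_zero: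
 assumes D: "D \<subseteq> {0..1} \<times> {0..1}" "(z, \<zeta>) \<in> D" "thick D (z, \<zeta>)" and S: "sc z \<zeta> \<notin> S" "tc z \<zeta> \<notin> S"
  and s: "sc z \<zeta> \<le> 0"
 shows "pd_z D Kf z \<zeta> = 0" "pd_zeta D Kf z \<zeta> = 0"
proof -
 have zz: "z \<in> {0..1}" "\<zeta> \<in> {0..1}" using D by auto
 note R = ranges[OF zz]
 have t: "tc z \<zeta> \<le> 2 * L kk" using R s by linarith
 have "ww U kk (sc z \<zeta>, tc z \<zeta>) = 0" "vU U kk (sc z \<zeta>) = 0" "cs U kk (sc z \<zeta>, tc z \<zeta>) = 0"
  "gU U kk (tc z \<zeta>) = 0" "ct U kk (sc z \<zeta>, tc z \<zeta>) = 0"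
  using ww_zero[OF s t] v_0[OF U, of "sc z \<zeta>" kk] cs_0[of "(sc z \<zeta>, tc z \<zeta>)" kk] ct_0[of "(sc z \<zeta>, tc z \<zeta>)" kk] g_0[OF U, of "tc z \<zeta>" kk] s t
  by auto
 then show "pd_z D Kf z \<zeta> = 0" "pd_zeta D Kf z \<zeta> = 0" using Kf_deriv(1,2)[OF D S] by simp_all
qed

text \<open>At \<zeta> = 1 one has t - 2 L = s, so the fixed point equation for g is this condition,
  with \<open>rb\<close> accounting for the derivative of the factor in front of w. For s \<le> 0 no
  wave has arrived yet.\<close>

lemma Kf_reflection:
 assumes z: "z \<in> {0..1}" and S: "sc z 1 \<notin> S" "tc z 1 \<notin> S" and b: "bet kk = 1" "rb kk = q1 1 * q 1"
 shows "pd_zeta square Kf z 1 * q 1 ^ 4 + Kf z 1 * (4 * q 1 ^ 3 * q1 1) = 0"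
proof -
 have D: "(z, 1) \<in> square" "thick square (z, 1)" using z thick_square[of "(z, 1)"] by (auto simp: square_def)
 note R = ranges[OF z, of 1]
 show ?thesis
 proof (cases "sc z 1 \<le> 0")
  case True
  then show ?thesis using Kf_deriv_zero(2)[OF square_sub D S] Kf_zero[OF z, of 1] by simp
 next
  case False
  have e: "tc z 1 - 2 * L kk = sc z 1" by (simp add: L\<theta>)
  have "2 * L kk < tc z 1" "tc z 1 \<le> T" using False R by (auto simp: L\<theta>)
  from gU_eq[OF this] have "gU U kk (tc z 1) + ct U kk (sc z 1, tc z 1) - (vU U kk (sc z 1) + cs U kk (sc z 1, tc z 1))
    = - (q1 1 * q 1) * ww U kk (sc z 1, tc z 1)"
   unfolding e b by (simp add: algebra_simps)
  with Kf_deriv(3)[OF square_sub D S] show ?thesis using c.pos[of 1] by simp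
 qed
qed

text \<open>Substitution y = \<theta>(\<zeta>): the factor q in front of B and the q^2 from d\<zeta>
  = q^2 dy cancel the denominator q^3 of the kernel.\<close>

lemma Kf_integral:
 assumes B: "locbm B" "\<And>y. y \<notin> {0..L kk} \<Longrightarrow> B y = 0" and z: "z \<in> {0..1}"
 shows "((\<lambda>\<zeta>. Kf z \<zeta> * (q \<zeta> * B (\<theta> \<zeta>))) has_integral
  p z * integral {0..L kk} (\<lambda>y. B y * ww U kk (\<phi> z - y, \<phi> z + y))) {0..1}"
proof -
 let ?g = "\<lambda>y. B y * ww U kk (\<phi> z - y, \<phi> z + y)"
 have g: "locbm ?g" by (intro locbm_mult B(1) locbm_compose[OF ww_locbm[OF U]] continuous_intros)
 have gz: "?g y = 0" if "L kk < \<bar>y\<bar>" for y using B(2)[of y] that by (cases "y < 0") auto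
 have qn: "q x \<noteq> 0" for x using c.pos[of x] by simp
 have cq: "continuous_on UNIV (\<lambda>x. 1 / (q x)\<^sup>2)"
  by (intro continuous_intros c.cont1) (auto simp: qn)
 have sub: "(\<integral>x. ?g (\<theta> x) * (1 / (q x)\<^sup>2) \<partial>lborel) = (\<integral>x. ?g x \<partial>lborel)"
  by (rule lborel_substitution[where R="L kk", OF g gz c.d\<phi> cq _ c.surj_\<phi>]) (use qn in auto)
 have s1: "(\<integral>x. ?g x \<partial>lborel) = integral {0..L kk} ?g"
  by (rule locbm_support_integral_eq[OF g]) (use B(2) in auto)
 have g2: "locbm (\<lambda>x. ?g (\<theta> x) * (1 / (q x)\<^sup>2))"
  using locbm_mult[OF locbm_compose[OF g c.\<phi>_cont] locbm_continuous[OF cq]] .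
 have s2: "(\<integral>x. ?g (\<theta> x) * (1 / (q x)\<^sup>2) \<partial>lborel) = integral {0..1} (\<lambda>x. ?g (\<theta> x) * (1 / (q x)\<^sup>2))"
 proof (rule locbm_support_integral_eq[OF g2])
  show "?g (\<theta> x) * (1 / (q x)\<^sup>2) = 0" if "x < 0 \<or> 1 < x" for x
   using B(2)[of "\<theta> x"] that c.\<phi>_le_iff[of 0 x] c.\<phi>_le_iff[of x 1] by (auto simp: c.\<phi>0 L\<theta>)
 qed
 have "((\<lambda>x. ?g (\<theta> x) * (1 / (q x)\<^sup>2)) has_integral integral {0..L kk} ?g) {0..1}"
  using integrable_integral[OF locbm_integrable[OF g2, of 0 1]] sub s1 s2 by simp
 from has_integral_mult_right[OF this, of "p z"] show ?thesis
  by (rule has_integral_eq[rotated]) (use qn in \<open>auto simp: Kf_def field_simps eval_nat_numeral\<close>)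
qed

end

lemma connected_cell_Ioo: "connected (cell S A \<inter> {a<..<b})"
 unfolding connected_iff_interval using cell_convex[of _ S A] by auto

lemma cell_window:
 assumes "finite S"
 shows "connected (cell S A \<inter> {a<..<b})" "bounded (cell S A \<inter> {a<..<b})"
  "cell S A \<inter> {a<..<b} \<inter> S = {}" "open (cell S A \<inter> {a<..<b})"
proof -
 show "bounded (cell S A \<inter> {a<..<b})" by (rule bounded_subset[of "{a..b}"]) auto
 show "cell S A \<inter> {a<..<b} \<inter> S = {}" using cell_disjoint by blast
qed (use connected_cell_Ioo open_cell[OF assms] in auto)

context row_kernel
begin

lemma CU_V:
 assumes "continuous_on UNIV fe" "continuous_on UNIV ge"
 shows "continuous_on UNIV (\<lambda>u. fe (fst u) + ge (snd u) + CU U kk u)"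
 by (intro continuous_intros C_cont[OF U] continuous_on_compose2[OF assms(1)] continuous_on_compose2[OF assms(2)]) auto

lemma coordinate_bound:
 assumes "z \<in> {0..1}" "\<zeta> \<in> {0..1}" shows "\<bar>sc z \<zeta>\<bar> < T + 1" "\<bar>tc z \<zeta>\<bar> < T + 1"
 using ranges[OF assms] T0(1) L(2)[of kk] XT L(1)[of kk] by linarith+

lemma Kf_pwc:
 assumes D: "compact D" "D \<subseteq> {0..1} \<times> {0..1}" and E: "finite E" "\<And>p. p \<in> D - E \<Longrightarrow> thick D p"
  and fr: "finite {(z, \<zeta>) \<in> frontier D. sc z \<zeta> \<in> S \<or> tc z \<zeta> \<in> S}"
 shows "pwc D Kf"
proof (rule pwc_component[OF D E finS finS fr, where W="ww U kk"])
 show "Kf z \<zeta> = p z / q \<zeta> ^ 3 * ww U kk (sc z \<zeta>, tc z \<zeta>)" for z \<zeta> by (rule Kf_def)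
 fix A B
 let ?I = "cell S A \<inter> {- (T + 1)<..<T + 1}" and ?J = "cell S B \<inter> {- (T + 1)<..<T + 1}"
 have I: "connected ?I" "bounded ?I" "?I \<inter> S = {}" "open ?I"
  by (rule cell_window[OF finS])+
 have J: "connected ?J" "bounded ?J" "?J \<inter> S = {}" "open ?J"
  by (rule cell_window[OF finS])+
 obtain fe where fe: "continuous_on UNIV fe" "\<And>x. x \<in> ?I \<Longrightarrow> ff U kk x = fe x" using pc_ext[OF ff_pc[OF U] I(1-3)] by metis
 obtain ve where ve: "continuous_on UNIV ve" "\<And>x. x \<in> ?I \<Longrightarrow> vU U kk x = ve x" using pc_ext[OF v_pc[OF U] I(1-3)] by metis
 obtain ge where ge: "continuous_on UNIV ge" "\<And>x. x \<in> ?J \<Longrightarrow> gg U kk x = ge x" using pc_ext[OF gg_pc[OF U] J(1-3)] by metis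
 obtain ue where ue: "continuous_on UNIV ue" "\<And>x. x \<in> ?J \<Longrightarrow> gU U kk x = ue x" using pc_ext[OF g_pc[OF U] J(1-3)] by metis
 obtain c where c: "continuous_on UNIV c" "\<And>s t. s \<in> ?I \<Longrightarrow> cs U kk (s, t) = c (s, t)" using cs_ext[OF U I(1-3)] by metis
 obtain d where d: "continuous_on UNIV d" "\<And>s t. t \<in> ?J \<Longrightarrow> ct U kk (s, t) = d (s, t)" using ct_ext[OF U J(1-3)] by metis
 let ?V = "\<lambda>u. fe (fst u) + ge (snd u) + CU U kk u" and ?Vs = "\<lambda>u. ve (fst u) + c u" and ?Vt = "\<lambda>u. ue (snd u) + d u"
 show "\<exists>V Vs Vt. continuous_on UNIV V \<and> continuous_on UNIV Vs \<and> continuous_on UNIV Vt \<and>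
   (\<forall>(z, \<zeta>)\<in>D. sc z \<zeta> \<in> cell S A \<and> tc z \<zeta> \<in> cell S B \<longrightarrow>
     ww U kk (sc z \<zeta>, tc z \<zeta>) = V (sc z \<zeta>, tc z \<zeta>) \<and>
     (V has_derivative (\<lambda>d. Vs (sc z \<zeta>, tc z \<zeta>) * fst d + Vt (sc z \<zeta>, tc z \<zeta>) * snd d)) (at (sc z \<zeta>, tc z \<zeta>)))"
 proof (rule exI[of _ ?V], rule exI[of _ ?Vs], rule exI[of _ ?Vt], intro conjI, goal_cases)
  case 1 show ?case by (rule CU_V[OF fe(1) ge(1)])
  case 2 show ?case by (intro continuous_intros c(1) continuous_on_compose2[OF ve(1)]) auto
  case 3 show ?case by (intro continuous_intros d(1) continuous_on_compose2[OF ue(1)]) auto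
  case 4
  show ?case
  proof (clarify, intro conjI)
   fix z \<zeta> assume zz: "(z, \<zeta>) \<in> D" and "sc z \<zeta> \<in> cell S A" "tc z \<zeta> \<in> cell S B"
   then have s: "sc z \<zeta> \<in> ?I" and t: "tc z \<zeta> \<in> ?J" using coordinate_bound[of z \<zeta>] D(2) by (auto simp: abs_less_iff)
   have eq: "ww U kk u = ?V u" if "u \<in> ?I \<times> ?J" for u
    using that fe(2) ge(2) by (auto simp: ww_def)
   show "ww U kk (sc z \<zeta>, tc z \<zeta>) = ?V (sc z \<zeta>, tc z \<zeta>)" using eq[of "(sc z \<zeta>, tc z \<zeta>)"] s t by blast
   have "sc z \<zeta> \<notin> S" "tc z \<zeta> \<notin> S" using s t I(3) J(3) by blast+
   note wd = ww_deriv[OF this, of kk]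
   have op: "open (?I \<times> ?J)" using I(4) J(4) by (rule open_Times)
   have mem: "(sc z \<zeta>, tc z \<zeta>) \<in> ?I \<times> ?J" using s t by blast
   have "(?V has_derivative (\<lambda>d. (vU U kk (sc z \<zeta>) + cs U kk (sc z \<zeta>, tc z \<zeta>)) * fst d
     + (gU U kk (tc z \<zeta>) + ct U kk (sc z \<zeta>, tc z \<zeta>)) * snd d)) (at (sc z \<zeta>, tc z \<zeta>))"
    by (rule has_derivative_transform_within_open[OF wd op mem]) (rule eq)
   then show "(?V has_derivative (\<lambda>d. ?Vs (sc z \<zeta>, tc z \<zeta>) * fst d + ?Vt (sc z \<zeta>, tc z \<zeta>) * snd d)) (at (sc z \<zeta>, tc z \<zeta>))"
    unfolding fst_conv snd_conv ve(2)[OF s] ue(2)[OF t] c(2)[OF s] d(2)[OF t] .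
  qed
 qed
qed

lemma Kf_pwc_square: "pwc square Kf"
proof (rule Kf_pwc[OF compact_square square_sub, where E="{}"])
 show "finite {(z, \<zeta>) \<in> frontier square. sc z \<zeta> \<in> S \<or> tc z \<zeta> \<in> S}"
  by (rule finite_subset[OF _ finite_char_edge[OF finS finS]]) (use frontier_square in auto)
qed (use thick_square in auto)

text \<open>By \<open>qp\<close> both s and t are strictly monotone along the diagonal, so it
  carries only finitely many points of exceptional characteristics.\<close>

lemma Kf_pwc_triangle:
 assumes qp: "\<And>z. z \<in> {0..1} \<Longrightarrow> q z < p z"
 shows "pwc triangle Kf"
proof (rule Kf_pwc[OF compact_triangle triangle_sub, where E="{(0,0),(1,1)}"])
 have f: "finite ((\<lambda>z. (z, z)) ` ({z \<in> {0..1}. \<phi> z - \<theta> z \<in> S} \<union> {z. \<phi> z + \<theta> z \<in> S}))"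
  using finite_char_diag_diff[OF qp finS] finite_char_diag[OF finS] by simp
 show "finite {(z, \<zeta>) \<in> frontier triangle. sc z \<zeta> \<in> S \<or> tc z \<zeta> \<in> S}"
 proof (rule finite_subset[OF _ finite_UnI[OF finite_char_edge[OF finS finS] f]], rule subsetI, elim CollectE)
  fix u assume "case u of (z, \<zeta>) \<Rightarrow> (z, \<zeta>) \<in> frontier triangle \<and> (sc z \<zeta> \<in> S \<or> tc z \<zeta> \<in> S)"
  then have u: "u \<in> frontier triangle" "sc (fst u) (snd u) \<in> S \<or> tc (fst u) (snd u) \<in> S" by (auto simp: case_prod_beta')
  from u(1) frontier_triangle consider "snd u = 0 \<or> fst u = 1" | "fst u \<in> {0..1}" "snd u = fst u" by blast
  then show "u \<in> {u. (fst u \<in> {0, 1} \<or> snd u \<in> {0, 1}) \<and> (sc (fst u) (snd u) \<in> S \<or> tc (fst u) (snd u) \<in> S)}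
    \<union> (\<lambda>z. (z, z)) ` ({z \<in> {0..1}. \<phi> z - \<theta> z \<in> S} \<union> {z. \<phi> z + \<theta> z \<in> S})"
  proof cases
   case 1 then show ?thesis using u(2) by auto
  next
   case 2
   then have "u = (fst u, fst u)" "fst u \<in> {z \<in> {0..1}. \<phi> z - \<theta> z \<in> S} \<union> {z. \<phi> z + \<theta> z \<in> S}"
    using u(2) by (auto simp: prod_eq_iff)
   then show ?thesis by blast
  qed
 qed
qed (use thick_triangle in auto)

end

text \<open>The kernel with equal row and column: no characteristic other than the diagonal starts
  in the corner, and the one-sided limits on the diagonal have to be used there.\<close>

locale diag_row_kernel = row_kernel +
 assumes same: "q = p" "q1 = p1" "\<theta> = \<phi>"
  and no_g: "\<And>t. gg U kk t = 0" "\<And>t. gU U kk t = 0" and no_f: "\<And>t. fJ kk t = 0"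
begin

text \<open>For gaps of S - {0} a piece may reach s = 0. On s \<ge> 0 the kernel agrees with V,
  which is continued to s < 0 through an antiderivative of the extension of v. So V is
  differentiable at s = 0 as well, whereas the kernel itself, being 0 for s < 0, may have a kink
  there.\<close>

lemma one_sided_extension:
 obtains V Vs Vt where "continuous_on UNIV V" "continuous_on UNIV Vs" "continuous_on UNIV Vt"
  "\<And>s t. 0 \<le> s \<Longrightarrow> s \<in> cell (S - {0}) P \<Longrightarrow> s < T + 1 \<Longrightarrow> t \<in> cell S R \<Longrightarrow> t < T + 1 \<Longrightarrow> - (T + 1) < t \<Longrightarrow> ww U kk (s, t) = V (s, t)"
  "\<And>s t. 0 \<le> s \<Longrightarrow> s \<in> cell (S - {0}) P \<Longrightarrow> s < T + 1 \<Longrightarrow> t \<in> cell S R \<Longrightarrow> t < T + 1 \<Longrightarrow> - (T + 1) < t \<Longrightarrow>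
   (V has_derivative (\<lambda>d. Vs (s, t) * fst d + Vt (s, t) * snd d)) (at (s, t))"
  "\<And>t. 0 \<in> cell (S - {0}) P \<Longrightarrow> t \<in> cell S R \<Longrightarrow> t < T + 1 \<Longrightarrow> - (T + 1) < t \<Longrightarrow> Vt (0, t) = 0"
proof -
 let ?I = "cell (S - {0}) P \<inter> {0<..<T + 1}" and ?J = "cell S R \<inter> {- (T + 1)<..<T + 1}"
 have "finite (S - {0})" using finS by simp
 note W = cell_window[OF this, where A=P and a=0 and b="T + 1"]
 have I: "connected ?I" "bounded ?I" "?I \<inter> S = {}"
  using W(1,2) by simp_all (use W(3) in force)
 have J: "connected ?J" "bounded ?J" "?J \<inter> S = {}" "open ?J"
  by (rule cell_window[OF finS])+
 obtain ve where ve: "continuous_on UNIV ve" "\<And>x. x \<in> ?I \<Longrightarrow> vU U kk x = ve x" using pc_ext[OF v_pc[OF U] I(1-3)] by metis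
 obtain c where c: "continuous_on UNIV c" "\<And>s t. s \<in> ?I \<Longrightarrow> cs U kk (s, t) = c (s, t)" using cs_ext[OF U I(1-3)] by metis
 obtain d where d: "continuous_on UNIV d" "\<And>s t. t \<in> ?J \<Longrightarrow> ct U kk (s, t) = d (s, t)" using ct_ext[OF U J(1-3)] by metis
 have "\<exists>F. \<forall>x. - \<infinity> < ereal x \<longrightarrow> ereal x < \<infinity> \<longrightarrow> (F has_vector_derivative ve x) (at x)"
  by (rule einterval_antiderivative) (use ve(1) in \<open>auto simp: continuous_on_eq_continuous_at\<close>)
 then obtain F where F: "\<And>x. (F has_real_derivative ve x) (at x)"
  by (auto simp: has_real_derivative_iff_has_vector_derivative)
 have ff: "ff U kk s = integral {0..s} (vU U kk)" for s by (simp add: ff_def no_f)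
 have fc: "continuous_on UNIV (ff U kk)" unfolding ff by (rule continuous_on_integral0[OF v_locbm[OF U]])
 have Fc: "continuous_on UNIV F" using F DERIV_isCont continuous_at_imp_continuous_on by blast
 let ?Q = "cell (S - {0}) P \<inter> {0..<T + 1}"
 have lt: "ff U kk s - F s = ff U kk r - F r" if rs: "s \<in> ?Q" "r \<in> ?Q" "r < s" for r s
 proof -
  have "(\<lambda>x. ff U kk x - F x) s = (\<lambda>x. ff U kk x - F x) r"
  proof (rule DERIV_isconst_end[OF rs(3)])
   show "continuous_on {r..s} (\<lambda>x. ff U kk x - F x)"
    by (intro continuous_intros continuous_on_subset[OF fc] continuous_on_subset[OF Fc]) auto
   fix x assume x: "r < x" "x < s"
   then have "x \<in> ?I" using rs cell_convex[of r "S - {0}" P s x] by auto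
   then have xS: "x \<notin> S" "vU U kk x = ve x" using I(3) ve(2) by blast+
   show "((\<lambda>x. ff U kk x - F x) has_real_derivative 0) (at x)"
    using DERIV_diff[OF ff_deriv[OF xS(1), of kk] F[of x]] xS(2) by simp
  qed
  then show ?thesis by simp
 qed
 have "ff U kk s - F s = ff U kk r - F r" if "s \<in> ?Q" "r \<in> ?Q" for r s
  using lt[OF that] lt[OF that(2,1)] by (cases r s rule: linorder_cases) simp_all
 then obtain b where b: "\<And>s. s \<in> ?Q \<Longrightarrow> ff U kk s = b + F s" by (metis diff_add_cancel)
 \<comment> \<open>The extension of \<open>cs\<close> from s > 0 takes at s = 0 the value of
   \<open>cs\<close> there, namely 0, because \<open>cs\<close> is continuous across that
   line.\<close>
 have z: "c (0, t) = 0" if "0 \<in> ?Q" for t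
 proof -
  have e: "\<forall>\<^sub>F s in at_right 0. s \<in> ?I"
  proof -
   have "open (cell (S - {0}) P)" using open_cell finS by blast
   then have "\<forall>\<^sub>F s in nhds 0. s \<in> cell (S - {0}) P" using that by (auto intro: eventually_nhds_in_open)
   then have "\<forall>\<^sub>F s in at_right 0. s \<in> cell (S - {0}) P" by (simp add: eventually_at_filter eventually_mono)
   moreover have "\<forall>\<^sub>F s in at_right 0. s \<in> {0<..<T + 1}" using T0(1) by (auto intro!: eventually_at_rightI[of 0 "T+1"])
   ultimately show ?thesis by eventually_elim blast
  qed
  have l: "((\<lambda>s. (s, t)) \<longlongrightarrow> (0, t)) (at_right (0::real))"
   by (intro tendsto_intros)
  have "isCont (cs U kk) (0, t)"
   by (rule cs_isCont_0[OF no_g(1)]) (use fc in \<open>simp add: continuous_on_eq_continuous_at\<close>)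
  from isCont_tendsto_compose[OF this l] have "((\<lambda>s. cs U kk (s, t)) \<longlongrightarrow> 0) (at_right 0)" by (simp add: cs_0)
  then have 1: "((\<lambda>s. c (s, t)) \<longlongrightarrow> 0) (at_right 0)"
   by (rule Lim_transform_eventually) (use e c(2) in \<open>auto elim: eventually_mono\<close>)
  have "isCont c (0, t)" using c(1) by (simp add: continuous_on_eq_continuous_at)
  from isCont_tendsto_compose[OF this l] show "c (0, t) = 0"
   using 1 by (intro tendsto_unique[OF trivial_limit_at_right_real]) auto
 qed
 let ?V = "\<lambda>u. b + F (fst u) + CU U kk u" and ?Vs = "\<lambda>u. ve (fst u) + c u"
 show ?thesis
 proof (rule that[of ?V ?Vs d])
  show "continuous_on UNIV ?V"
   by (intro continuous_intros C_cont[OF U] continuous_on_compose2[OF Fc]) auto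
  show "continuous_on UNIV ?Vs" by (intro continuous_intros c(1) continuous_on_compose2[OF ve(1)]) auto
  show "continuous_on UNIV d" by fact
  fix s t assume st: "0 \<le> s" "s \<in> cell (S - {0}) P" "s < T + 1" "t \<in> cell S R" "t < T + 1" "- (T + 1) < t"
  then have s: "s \<in> ?Q" and t: "t \<in> ?J" by auto
  show "ww U kk (s, t) = ?V (s, t)" using b[OF s] by (simp add: ww_def no_g)
  have tS: "t \<notin> S" using t J(3) by blast
  have "isCont (cs U kk) (s, t) \<and> cs U kk (s, t) = c (s, t)"
  proof (cases "s = 0")
   case True
   then show ?thesis using z[of t] s fc by (auto simp: cs_0 continuous_on_eq_continuous_at intro!: cs_isCont_0[OF no_g(1)])
  next
   case False
   then have "s \<in> ?I" using s by auto
   then have "s \<notin> S" "cs U kk (s, t) = c (s, t)" using I(3) c(2) by blast+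
   then show ?thesis using cs_isCont[OF U, of "(s, t)" kk] by simp
  qed
  note cd = conjunct1[OF this] conjunct2[OF this]
  have 1: "((\<lambda>u. b + F (fst u)) has_derivative (\<lambda>d. ve s * fst d)) (at (s, t))"
   using has_derivative_add[OF has_derivative_const has_derivative_compose[of fst fst "(s, t)" UNIV F "(*) (ve s)"]] F[of s]
   by (simp add: has_field_derivative_def has_derivative_fst)
  show "(?V has_derivative (\<lambda>e. ?Vs (s, t) * fst e + d (s, t) * snd e)) (at (s, t))"
   by (rule has_derivative_eq_rhs[OF has_derivative_add[OF 1 CU_deriv[OF cd(1) tS]]])
    (use d(2)[OF t] cd(2) in \<open>simp add: algebra_simps fun_eq_iff\<close>)
 next
  fix t assume "0 \<in> cell (S - {0}) P" "t \<in> cell S R" "t < T + 1" "- (T + 1) < t"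
  then show "d (0, t) = 0" using d(2)[of t 0] ct_0[of "(0, t)" kk] by auto
 qed
qed

lemma sc_nonneg: "(z, \<zeta>) \<in> triangle \<Longrightarrow> 0 \<le> sc z \<zeta>"
 using r.\<phi>_le_iff[of \<zeta> z] by (auto simp: triangle_def same)

lemma Kf_pwc_row: "pwc triangle Kf"
proof (rule pwc_component[OF compact_triangle triangle_sub _ _ _ finS, where W="ww U kk" and E="{(0,0),(1,1)}" and Sa="S - {0}"])
 show "finite (S - {0})" using finS by simp
 show "Kf z \<zeta> = p z / q \<zeta> ^ 3 * ww U kk (sc z \<zeta>, tc z \<zeta>)" for z \<zeta> by (rule Kf_def)
 have f: "finite ((\<lambda>z. (z, z)) ` {z. \<phi> z + \<theta> z \<in> S})" using finite_char_diag[OF finS] by simp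
 show "finite {(z, \<zeta>) \<in> frontier triangle. sc z \<zeta> \<in> S - {0} \<or> tc z \<zeta> \<in> S}"
 proof (rule finite_subset[OF _ finite_UnI[OF finite_char_edge[OF finS finS] f]], rule subsetI, elim CollectE)
  fix u assume "case u of (z, \<zeta>) \<Rightarrow> (z, \<zeta>) \<in> frontier triangle \<and> (sc z \<zeta> \<in> S - {0} \<or> tc z \<zeta> \<in> S)"
  then have u: "u \<in> frontier triangle" "sc (fst u) (snd u) \<in> S - {0} \<or> tc (fst u) (snd u) \<in> S" by (auto simp: case_prod_beta')
  from u(1) frontier_triangle consider "snd u = 0 \<or> fst u = 1" | "fst u \<in> {0..1}" "snd u = fst u" by blast
  then show "u \<in> {u. (fst u \<in> {0, 1} \<or> snd u \<in> {0, 1}) \<and> (sc (fst u) (snd u) \<in> S \<or> tc (fst u) (snd u) \<in> S)}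
    \<union> (\<lambda>z. (z, z)) ` {z. \<phi> z + \<theta> z \<in> S}"
  proof cases
   case 1 then show ?thesis using u(2) by auto
  next
   case 2
   then have "u = (fst u, fst u)" "fst u \<in> {z. \<phi> z + \<theta> z \<in> S}"
    using u(2) by (auto simp: prod_eq_iff same)
   then show ?thesis by blast
  qed
 qed
 fix A B
 obtain V Vs Vt where V: "continuous_on UNIV V" "continuous_on UNIV Vs" "continuous_on UNIV Vt"
  "\<And>s t. 0 \<le> s \<Longrightarrow> s \<in> cell (S - {0}) A \<Longrightarrow> s < T + 1 \<Longrightarrow> t \<in> cell S B \<Longrightarrow> t < T + 1 \<Longrightarrow> - (T + 1) < t \<Longrightarrow> ww U kk (s, t) = V (s, t)"
  "\<And>s t. 0 \<le> s \<Longrightarrow> s \<in> cell (S - {0}) A \<Longrightarrow> s < T + 1 \<Longrightarrow> t \<in> cell S B \<Longrightarrow> t < T + 1 \<Longrightarrow> - (T + 1) < t \<Longrightarrow>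
   (V has_derivative (\<lambda>d. Vs (s, t) * fst d + Vt (s, t) * snd d)) (at (s, t))"
  by (rule one_sided_extension[of A B]) blast
 have "\<forall>(z, \<zeta>)\<in>triangle. sc z \<zeta> \<in> cell (S - {0}) A \<and> tc z \<zeta> \<in> cell S B \<longrightarrow>
     ww U kk (sc z \<zeta>, tc z \<zeta>) = V (sc z \<zeta>, tc z \<zeta>) \<and>
     (V has_derivative (\<lambda>d. Vs (sc z \<zeta>, tc z \<zeta>) * fst d + Vt (sc z \<zeta>, tc z \<zeta>) * snd d)) (at (sc z \<zeta>, tc z \<zeta>))"
 proof clarify
  fix z \<zeta> assume zz: "(z, \<zeta>) \<in> triangle" and st: "sc z \<zeta> \<in> cell (S - {0}) A" "tc z \<zeta> \<in> cell S B"
  have "\<bar>sc z \<zeta>\<bar> < T + 1" "\<bar>tc z \<zeta>\<bar> < T + 1" using coordinate_bound[of z \<zeta>] zz triangle_sub by auto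
  then show "ww U kk (sc z \<zeta>, tc z \<zeta>) = V (sc z \<zeta>, tc z \<zeta>) \<and>
     (V has_derivative (\<lambda>d. Vs (sc z \<zeta>, tc z \<zeta>) * fst d + Vt (sc z \<zeta>, tc z \<zeta>) * snd d)) (at (sc z \<zeta>, tc z \<zeta>))"
   using V(4,5)[OF sc_nonneg[OF zz] st(1) _ st(2)] by (simp add: abs_less_iff)
 qed
 then show "\<exists>V Vs Vt. continuous_on UNIV V \<and> continuous_on UNIV Vs \<and> continuous_on UNIV Vt \<and>
   (\<forall>(z, \<zeta>)\<in>triangle. sc z \<zeta> \<in> cell (S - {0}) A \<and> tc z \<zeta> \<in> cell S B \<longrightarrow>
     ww U kk (sc z \<zeta>, tc z \<zeta>) = V (sc z \<zeta>, tc z \<zeta>) \<and>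
     (V has_derivative (\<lambda>d. Vs (sc z \<zeta>, tc z \<zeta>) * fst d + Vt (sc z \<zeta>, tc z \<zeta>) * snd d)) (at (sc z \<zeta>, tc z \<zeta>)))"
  using V(1-3) by blast
qed (use thick_triangle in auto)

text \<open>On the diagonal w and its t-derivative vanish, only the derivative in s = \<phi>(z) -
  \<phi>(\<zeta>) remains, and with p = q the two partial derivatives are opposite.\<close>

lemma Kf_deriv_diag:
 assumes z: "0 < z" "z < 1" and t: "tc z z \<notin> S"
 shows "pd_zeta triangle Kf z z = - pd_z triangle Kf z z"
proof -
 let ?A = "{e \<in> S - {0}. e < 0}" and ?B = "{e \<in> S. e < tc z z}"
 obtain V Vs Vt where V: 
  "\<And>s t. 0 \<le> s \<Longrightarrow> s \<in> cell (S - {0}) ?A \<Longrightarrow> s < T + 1 \<Longrightarrow> t \<in> cell S ?B \<Longrightarrow> t < T + 1 \<Longrightarrow> - (T + 1) < t \<Longrightarrow> ww U kk (s, t) = V (s, t)"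
  "\<And>s t. 0 \<le> s \<Longrightarrow> s \<in> cell (S - {0}) ?A \<Longrightarrow> s < T + 1 \<Longrightarrow> t \<in> cell S ?B \<Longrightarrow> t < T + 1 \<Longrightarrow> - (T + 1) < t \<Longrightarrow>
   (V has_derivative (\<lambda>d. Vs (s, t) * fst d + Vt (s, t) * snd d)) (at (s, t))"
  "\<And>t. 0 \<in> cell (S - {0}) ?A \<Longrightarrow> t \<in> cell S ?B \<Longrightarrow> t < T + 1 \<Longrightarrow> - (T + 1) < t \<Longrightarrow> Vt (0, t) = 0"
  by (rule one_sided_extension[of ?A ?B]) blast
 have c: "0 \<in> cell (S - {0}) ?A" "tc z z \<in> cell S ?B" by (rule cell_self, simp, rule cell_self[OF t])
 have zD: "(z, z) \<in> triangle" and th: "thick triangle (z, z)" using z thick_triangle[of "(z, z)"] by (auto simp: triangle_def)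
 have tb: "tc z z < T + 1" "- (T + 1) < tc z z" using coordinate_bound[of z z] z by (auto simp: abs_less_iff)
 have s0: "sc z z = 0" by (simp add: same)
 have T1: "0 < T + 1" using T0(1) by simp
 have dV: "(V has_derivative (\<lambda>d. Vs (0, tc z z) * fst d + 0 * snd d)) (at (sc z z, tc z z))"
  using V(2)[OF order_refl c(1) T1 c(2) tb] V(3)[OF c tb] s0 by simp
 have w0: "V (0, tc z z) = 0"
  using V(1)[OF order_refl c(1) T1 c(2) tb] ww_zero[of 0 "tc z z" kk] ranges[of z z] z s0 by simp
 let ?K = "\<lambda>u. p (fst u) / q (snd u) ^ 3 * V (sc (fst u) (snd u), tc (fst u) (snd u))"
 have dK: "(?K has_derivative (\<lambda>d. (p z / q z ^ 3 * (Vs (0, tc z z) / (p z)\<^sup>2)) * fst d - (p z / q z ^ 3 * (Vs (0, tc z z) / (p z)\<^sup>2)) * snd d))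
  (at (z, z) within triangle)"
  using kernel_has_derivative[OF triangle_sub zD dV] unfolding s0 w0 by (simp add: same)
 have "((\<lambda>(z, \<zeta>). Kf z \<zeta>) has_derivative (\<lambda>d. (p z / q z ^ 3 * (Vs (0, tc z z) / (p z)\<^sup>2)) * fst d - (p z / q z ^ 3 * (Vs (0, tc z z) / (p z)\<^sup>2)) * snd d))
  (at (z, z) within triangle)"
 proof (rule has_derivative_transform_eventually[OF dK])
  have eq: "?K u = (case u of (z, \<zeta>) \<Rightarrow> Kf z \<zeta>)"
   if "u \<in> triangle" "sc (fst u) (snd u) \<in> cell (S - {0}) ?A" "tc (fst u) (snd u) \<in> cell S ?B" for u
  proof -
   have "fst u \<in> {0..1}" "snd u \<in> {0..1}" using subsetD[OF triangle_sub that(1)] by (simp_all add: mem_Times_iff)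
   then have "\<bar>sc (fst u) (snd u)\<bar> < T + 1" "\<bar>tc (fst u) (snd u)\<bar> < T + 1" by (rule coordinate_bound)+
   then have "ww U kk (sc (fst u) (snd u), tc (fst u) (snd u)) = V (sc (fst u) (snd u), tc (fst u) (snd u))"
    using sc_nonneg[of "fst u" "snd u"] that by (intro V(1)) (auto simp: abs_less_iff)
   then show ?thesis by (simp add: Kf_def case_prod_beta')
  qed
  have sco: "continuous_on UNIV (\<lambda>u. sc (fst u) (snd u))" "continuous_on UNIV (\<lambda>u. tc (fst u) (snd u))"
   by (intro continuous_intros continuous_on_compose2[OF r.\<phi>_cont] continuous_on_compose2[OF c.\<phi>_cont]; auto)+
  have "open {u. sc (fst u) (snd u) \<in> cell (S - {0}) ?A \<and> tc (fst u) (snd u) \<in> cell S ?B}"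
   using open_Int[OF open_vimage[OF open_cell[of "S - {0}" ?A] sco(1)] open_vimage[OF open_cell[OF finS, of ?B] sco(2)]] finS
   by (simp add: vimage_def Collect_conj_eq)
  then have "\<forall>\<^sub>F u in at (z, z) within triangle. u \<in> triangle \<and> sc (fst u) (snd u) \<in> cell (S - {0}) ?A \<and> tc (fst u) (snd u) \<in> cell S ?B"
   unfolding eventually_at_topological by (intro exI conjI, assumption) (use c s0 in auto)
  then show "\<forall>\<^sub>F u in at (z, z) within triangle. ?K u = (case u of (z, \<zeta>) \<Rightarrow> Kf z \<zeta>)"
   by (rule eventually_mono) (use eq in blast)
  show "?K (z, z) = (case (z, z) of (z, \<zeta>) \<Rightarrow> Kf z \<zeta>)" by (rule eq) (use c zD s0 in simp_all)
  show "(z, z) \<in> triangle" by fact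
 qed
 from pd_eq[OF this th] show ?thesis by simp
qed

end

section \<open>Data of the kernel equations\<close>

lemma fin01: "finite {0, 1::real}" by simp

definition cut01 :: "(real \<Rightarrow> real) \<Rightarrow> real \<Rightarrow> real" where
 "cut01 f z = (if z \<in> {0..1} then f z else 0)"

definition pc01 :: "(real \<Rightarrow> real) \<Rightarrow> bool" where
 "pc01 f \<longleftrightarrow> (\<exists>S. finite S \<and> S \<subseteq> {0..1} \<and> pc S (cut01 f))"

text \<open>A gap that avoids 0 and 1 lies inside or outside the interval, so it is enough to
  examine gaps in the open interval.\<close>

lemma pc01I:
 assumes N: "finite N"
  and f: "\<And>I. connected I \<Longrightarrow> bounded I \<Longrightarrow> I \<subseteq> {0<..<1} - N \<Longrightarrow> I \<noteq> {} \<Longrightarrow> uniformly_continuous_on I f"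
 shows "pc01 f"
 unfolding pc01_def
proof (intro exI[of _ "N \<inter> {0..1} \<union> {0, 1}"] conjI)
 show "pc (N \<inter> {0..1} \<union> {0, 1}) (cut01 f)"
  unfolding pc_def
 proof (intro allI impI)
  fix I assume I: "connected I \<and> bounded I \<and> I \<inter> (N \<inter> {0..1} \<union> {0, 1}) = {}"
  show "uniformly_continuous_on I (cut01 f)"
  proof (cases "I \<inter> {0..1} = {}")
   case True
   then show ?thesis
    by (intro uniformly_continuous_on_eq[OF uniformly_continuous_on_const[of _ 0]]) (auto simp: cut01_def)
  next
   case False
   then obtain a where a: "a \<in> I" "0 \<le> a" "a \<le> 1" by auto
   have n: "0 \<notin> I" "1 \<notin> I" "I \<inter> N \<inter> {0..1} = {}" using I by auto
   have "0 < x \<and> x < 1" if x: "x \<in> I" for x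
   proof (rule ccontr)
    assume "\<not> ?thesis"
    then have "0 \<in> {x..a} \<or> 1 \<in> {a..x}" using a by auto
    then show False using connected_contains_Icc[of I x a] connected_contains_Icc[of I a x] I x a n by blast
   qed
   then have sub: "I \<subseteq> {0<..<1} - N" using n by fastforce
   show ?thesis
    by (rule uniformly_continuous_on_eq[OF f[OF _ _ sub]]) (use I a sub in \<open>auto simp: cut01_def\<close>)
  qed
 qed
qed (use N in auto)

lemma pc01_add: assumes "pc01 f" "pc01 g" shows "pc01 (\<lambda>z. f z + g z)"
proof -
 obtain S R where "finite S" "S \<subseteq> {0..1}" "pc S (cut01 f)" "finite R" "R \<subseteq> {0..1}" "pc R (cut01 g)"
  using assms unfolding pc01_def by blast
 moreover have "cut01 (\<lambda>z. f z + g z) = (\<lambda>z. cut01 f z + cut01 g z)" by (auto simp: cut01_def)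
 ultimately show ?thesis unfolding pc01_def
  by (intro exI[of _ "S \<union> R"]) (auto intro!: pc_add intro: pc_mono)
qed

lemma pc01_cmult: assumes "pc01 f" shows "pc01 (\<lambda>z. c * f z)"
proof -
 have "cut01 (\<lambda>z. c * f z) = (\<lambda>z. c * cut01 f z)" by (auto simp: cut01_def)
 then show ?thesis using assms unfolding pc01_def by (metis pc_cmult)
qed

lemma pc01_off_finite:
 assumes f: "pc01 f" and N: "finite N" "\<And>z. z \<in> {0..1} - N \<Longrightarrow> f z = g z" shows "pc01 g"
proof -
 obtain S where S: "finite S" "S \<subseteq> {0..1}" "pc S (cut01 f)" using f unfolding pc01_def by blast
 show ?thesis
 proof (rule pc01I[of "S \<union> N"])
  fix I assume I: "connected I" "bounded I" "I \<subseteq> {0<..<1} - (S \<union> N)"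
  then have "uniformly_continuous_on I (cut01 f)" using S(3) unfolding pc_def by blast
  then show "uniformly_continuous_on I g"
   by (rule uniformly_continuous_on_eq) (use I N(2) in \<open>force simp: cut01_def\<close>)
 qed (use S N in auto)
qed

text \<open>I is enlarged to the gap (a, b) between neighbouring exceptional points; with the
  one-sided limits as end values the function is continuous on [a, b], hence uniformly
  continuous.\<close>

lemma pw_continuous_pc01:
 fixes f :: "real \<Rightarrow> real"
 assumes "pw_continuous f" shows "pc01 f"
proof (rule pc01I)
 let ?N = "{x \<in> {0..1}. \<not> continuous (at x within {0..1}) f}"
 have c: "finite ?N" and r: "\<And>x. x \<in> {0..<1} \<Longrightarrow> \<exists>l. (f \<longlongrightarrow> l) (at_right x)"
  and l: "\<And>x. x \<in> {0<..1} \<Longrightarrow> \<exists>l. (f \<longlongrightarrow> l) (at_left x)"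
  using assms unfolding pw_continuous_def off_finite_def by auto
 show "finite ?N" by (rule c)
 fix I assume I: "connected I" "bounded I" "I \<subseteq> {0<..<1} - ?N" "I \<noteq> {}"
 then obtain x where x: "x \<in> I" by blast
 let ?M = "insert 0 (insert 1 ?N)"
 have fin: "finite ?M" using c by simp
 define a where "a = Max {e \<in> ?M. e < x}"
 define b where "b = Min {e \<in> ?M. x < e}"
 have x01: "0 < x" "x < 1" using x I(3) by auto
 have ne: "0 \<in> {e \<in> ?M. e < x}" "1 \<in> {e \<in> ?M. x < e}" using x01 by auto
 have a: "a \<in> ?M" "a < x" "\<And>e. e \<in> ?M \<Longrightarrow> e < x \<Longrightarrow> e \<le> a"
 proof -
  have f: "finite {e \<in> ?M. e < x}" "{e \<in> ?M. e < x} \<noteq> {}" using fin ne by (simp, blast)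
  show "a \<in> ?M" "a < x" using Max_in[OF f] unfolding a_def by blast+
  show "e \<le> a" if "e \<in> ?M" "e < x" for e using Max_ge[OF f(1)] that unfolding a_def by blast
 qed
 have b: "b \<in> ?M" "x < b" "\<And>e. e \<in> ?M \<Longrightarrow> x < e \<Longrightarrow> b \<le> e"
 proof -
  have f: "finite {e \<in> ?M. x < e}" "{e \<in> ?M. x < e} \<noteq> {}" using fin ne by (simp, blast)
  show "b \<in> ?M" "x < b" using Min_in[OF f] unfolding b_def by blast+
  show "b \<le> e" if "e \<in> ?M" "x < e" for e using Min_le[OF f(1)] that unfolding b_def by blast
 qed
 have ab: "0 \<le> a" "b \<le> 1" using a(3)[of 0] b(3)[of 1] x01 by auto
 have disj: "I \<inter> ?M = {}" using I(3) by auto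
 have sub: "I \<subseteq> {a<..<b}"
 proof
  fix y assume y: "y \<in> I"
  have "a \<notin> {y..x}" using connected_contains_Icc[OF I(1) y x] a(1) disj by blast
  moreover have "b \<notin> {x..y}" using connected_contains_Icc[OF I(1) x y] b(1) disj by blast
  ultimately show "y \<in> {a<..<b}" using a(2) b(2) by auto
 qed
 have cont: "continuous_on {a<..<b} f"
 proof (rule continuous_at_imp_continuous_on, intro ballI)
  fix y assume y: "y \<in> {a<..<b}"
  have "y \<notin> ?M" using a(3)[of y] b(3)[of y] y x disj by (cases y x rule: linorder_cases) auto
  then have "continuous (at y within {0..1}) f" using y ab by auto
  moreover have "at y within {0..1} = at y" using y ab by (intro at_within_interior) auto
  ultimately show "isCont f y" by simp
 qed
 obtain la lb where lim: "(f \<longlongrightarrow> la) (at_right a)" "(f \<longlongrightarrow> lb) (at_left b)"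
  using r[of a] l[of b] ab a(2) b(2) x01 by auto
 let ?h = "\<lambda>y. if y \<le> a then la else if b \<le> y then lb else f y"
 have lt: "a < b" using a(2) b(2) by simp
 have "continuous_on {a..b} ?h"
 proof (rule continuous_on_IccI[OF _ _ _ lt])
  have "\<forall>\<^sub>F y in at_right a. f y = ?h y" by (rule eventually_at_rightI[OF _ lt]) auto
  from Lim_transform_eventually[OF lim(1) this] show "(?h \<longlongrightarrow> ?h a) (at_right a)" by simp
  have "\<forall>\<^sub>F y in at_left b. f y = ?h y" by (rule eventually_at_leftI[OF _ lt]) auto
  from Lim_transform_eventually[OF lim(2) this] show "(?h \<longlongrightarrow> ?h b) (at_left b)" using lt by simp
  fix y assume y: "a < y" "y < b"
  have "\<forall>\<^sub>F u in at y. u \<in> {a<..<b}" using y by (intro eventually_at_in_open') auto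
  then have "\<forall>\<^sub>F u in at y. f u = ?h u" by (rule eventually_mono) auto
  moreover have "f \<midarrow>y\<rightarrow> f y" using cont y by (auto simp: continuous_on_eq_continuous_at isCont_def)
  ultimately show "?h \<midarrow>y\<rightarrow> ?h y" using Lim_transform_eventually[of f "f y" "at y" ?h] y by simp
 qed
 then have "uniformly_continuous_on {a..b} ?h" by (intro compact_uniformly_continuous) auto
 then have "uniformly_continuous_on I ?h" by (rule uniformly_continuous_on_subset') (use sub in force)
 then show "uniformly_continuous_on I f" by (rule uniformly_continuous_on_eq) (use sub in force)
qed

text \<open>All but finitely many points of the edge lie in a piece, and the trace is uniformly
  continuous on the part of the edge in each piece. Such a part need not be an interval and may
  consist of infinitely many portions; this is what
  \<open>uniformly_continuous_on_finite_cover\<close> is for. The continuity it asks for comes from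
  the pieces being relatively open.\<close>

lemma pw_C1_bottom_edge:
 fixes K :: "real \<Rightarrow> real \<Rightarrow> 'a::real_normed_vector" and l :: "'a \<Rightarrow> real"
 assumes K: "pw_C1 triangle K" and l: "bounded_linear l"
 shows "pc01 (\<lambda>z. l (K z 0))" "pc01 (\<lambda>z. l (pd_zeta triangle K z 0))"
proof -
 obtain \<U> where U: "finite \<U>" "finite (frontier triangle - \<Union>\<U>)"
  and op: "\<And>U. U \<in> \<U> \<Longrightarrow> openin (top_of_set triangle) U"
  and uc: "\<And>U. U \<in> \<U> \<Longrightarrow> uniformly_continuous_on U (\<lambda>(z, \<zeta>). K z \<zeta>)"
   "\<And>U. U \<in> \<U> \<Longrightarrow> uniformly_continuous_on U (\<lambda>(z, \<zeta>). pd_zeta triangle K z \<zeta>)"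
  using K unfolding pw_C1_def by blast
 have gen: "pc01 (\<lambda>z. l (F z 0))" if F: "\<And>U. U \<in> \<U> \<Longrightarrow> uniformly_continuous_on U (\<lambda>(z, \<zeta>). F z \<zeta>)" for F :: "real \<Rightarrow> real \<Rightarrow> 'a"
 proof (rule pc01I)
  let ?N = "fst ` (frontier triangle - \<Union>\<U>)"
  show "finite ?N" using U(2) by simp
  fix I assume I: "connected I" "bounded I" "I \<subseteq> {0<..<1} - ?N"
  have fr: "(z, 0) \<in> frontier triangle" if "z \<in> I" for z
  proof -
   have "(z, 0) \<in> triangle" using that I(3) by (auto simp: triangle_def)
   moreover have "(z, 0) \<notin> interior triangle" using interior_mono[OF triangle_sub] by (auto simp: interior_Times)
   moreover have "triangle \<subseteq> closure triangle" by (rule closure_subset)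
   ultimately show ?thesis unfolding frontier_def by blast
  qed
  have cov: "\<exists>U\<in>\<U>. (z, 0) \<in> U" if "z \<in> I" for z 
  proof (rule ccontr)
   assume "\<not> ?thesis"
   then have "(z, 0) \<in> frontier triangle - \<Union>\<U>" using fr[OF that] by blast
   then have "z \<in> ?N" by (rule image_eqI[rotated]) simp
   then show False using I(3) that by blast
  qed
  let ?s = "\<lambda>U. {z. (z, 0) \<in> U}"
  have ucs: "uniformly_continuous_on (?s U \<inter> I) (\<lambda>z. l (F z 0))" if "U \<in> \<U>" for U
  proof -
   have "uniformly_continuous_on U (\<lambda>u. l ((\<lambda>(z, \<zeta>). F z \<zeta>) u))"
    by (rule bounded_linear.uniformly_continuous_on[OF l F[OF that]])
   moreover have "(\<lambda>z. (z, 0)) ` (?s U \<inter> I) \<subseteq> U" by auto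
   ultimately have "uniformly_continuous_on ((\<lambda>z. (z, 0)) ` (?s U \<inter> I)) (\<lambda>u. l ((\<lambda>(z, \<zeta>). F z \<zeta>) u))"
    using uniformly_continuous_on_subset' by blast
   moreover have "uniformly_continuous_on (?s U \<inter> I) (\<lambda>z. (z, 0::real))"
    by (intro continuous_imp_uniformly_continuous_bounded bounded_subset[OF I(2)] continuous_intros) auto
   ultimately have "uniformly_continuous_on (?s U \<inter> I) (\<lambda>z. l ((\<lambda>(z, \<zeta>). F z \<zeta>) (z, 0)))"
    by (rule uniformly_continuous_on_compose[rotated])
   then show ?thesis by simp
  qed
  show "uniformly_continuous_on I (\<lambda>z. l (F z 0))"
  proof (rule uniformly_continuous_on_finite_cover[of "?s ` \<U>"])
   show "finite (?s ` \<U>)" using U(1) by simp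
   show "I \<subseteq> \<Union> (?s ` \<U>)" using cov by auto
   show "connected I" by fact
   show "uniformly_continuous_on (A \<inter> I) (\<lambda>z. l (F z 0))" if "A \<in> ?s ` \<U>" for A using ucs that by blast
   show "continuous_on I (\<lambda>z. l (F z 0))" unfolding continuous_on_eq_continuous_within
   proof
    fix z assume z: "z \<in> I"
    obtain V where V: "V \<in> \<U>" "(z, 0) \<in> V" using cov[OF z] by blast
    obtain O' where O': "open O'" "V = triangle \<inter> O'" using op[OF V(1)] by (auto simp: openin_open)
    have o: "open ((\<lambda>z. (z, 0::real)) -` O')" by (rule open_vimage[OF O'(1)]) (intro continuous_intros)
    have "at z within I = at z within (?s V \<inter> I)"
     by (rule at_within_nhd[OF _ o]) (use z V(2) O' I(3) in \<open>auto simp: triangle_def\<close>)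
    moreover have "continuous (at z within (?s V \<inter> I)) (\<lambda>z. l (F z 0))"
     using uniformly_continuous_imp_continuous[OF ucs[OF V(1)]] z V(2) unfolding continuous_on_eq_continuous_within by blast
    ultimately show "continuous (at z within I) (\<lambda>z. l (F z 0))" by simp
   qed
  qed
 qed
 show "pc01 (\<lambda>z. l (K z 0))" by (rule gen[OF uc(1)])
 show "pc01 (\<lambda>z. l (pd_zeta triangle K z 0))" by (rule gen[OF uc(2)])
qed

section \<open>Construction of the travel time coordinates\<close>

text \<open>A slope bounded below by \<delta> makes the antiderivative a bijection of the line,
  whose inverse is differentiable by the inverse function rule.\<close>

lemma increasing_homeomorphism:
 fixes r :: "real \<Rightarrow> real"
 assumes r: "continuous_on UNIV r" and d: "0 < \<delta>" "\<And>x. \<delta> \<le> r x"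
 obtains \<phi> \<xi> where "\<And>z. (\<phi> has_real_derivative r z) (at z)" "\<phi> 0 = 0" "\<And>x. \<phi> (\<xi> x) = x" "\<And>z. \<xi> (\<phi> z) = z"
  "\<And>x. (\<xi> has_real_derivative 1 / r (\<xi> x)) (at x)"
proof -
 have "\<exists>F. \<forall>x. - \<infinity> < ereal x \<longrightarrow> ereal x < \<infinity> \<longrightarrow> (F has_vector_derivative r x) (at x)"
  by (rule einterval_antiderivative) (use r in \<open>auto simp: continuous_on_eq_continuous_at\<close>)
 then obtain F where F: "\<And>x. (F has_real_derivative r x) (at x)"
  by (auto simp: has_real_derivative_iff_has_vector_derivative)
 define \<phi> where "\<phi> z = F z - F 0" for z
 have d\<phi>: "(\<phi> has_real_derivative r z) (at z)" for z unfolding \<phi>_def using DERIV_diff[OF F DERIV_const] by simp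
 have mono: "\<phi> y - \<phi> x \<ge> \<delta> * (y - x)" if "x \<le> y" for x y
 proof -
  have "\<phi> x - \<delta> * x \<le> \<phi> y - \<delta> * y"
  proof (rule DERIV_nonneg_imp_nondecreasing[OF that])
   fix z show "\<exists>y. ((\<lambda>z. \<phi> z - \<delta> * z) has_real_derivative y) (at z) \<and> 0 \<le> y"
    using DERIV_diff[OF d\<phi>[of z] DERIV_cmult_Id[of \<delta>]] d(2)[of z] by (intro exI[of _ "r z - \<delta>"]) auto
  qed
  then show ?thesis by (simp add: algebra_simps)
 qed
 have inj: "inj \<phi>"
 proof (rule linorder_injI)
  fix x y :: real assume "x < y"
  then have "0 < \<delta> * (y - x)" using d(1) by simp
  then show "\<phi> x \<noteq> \<phi> y" using mono[of x y] \<open>x < y\<close> by simp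
 qed
 have ic: "isCont \<phi> x" for x using d\<phi> DERIV_isCont by blast
 have surj: "\<exists>x. \<phi> x = y" for y
 proof -
  let ?M = "\<bar>y\<bar> / \<delta>"
  have M: "0 \<le> ?M" "\<delta> * ?M = \<bar>y\<bar>" using d(1) by simp_all
  have "\<phi> 0 = 0" by (simp add: \<phi>_def)
  then have "\<phi> (- ?M) \<le> y" "y \<le> \<phi> ?M" using mono[of 0 ?M] mono[of "- ?M" 0] M by (simp_all add: algebra_simps)
  then show ?thesis using IVT[of \<phi> "- ?M" y ?M] M(1) ic by fastforce
 qed
 define \<xi> where "\<xi> = inv \<phi>"
 have i1: "\<phi> (\<xi> x) = x" for x unfolding \<xi>_def using surj by (metis f_inv_into_f rangeI)
 have i2: "\<xi> (\<phi> z) = z" for z unfolding \<xi>_def using inj by simp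
 have c\<xi>: "isCont \<xi> x" for x
 proof -
  have "isCont \<xi> (\<phi> (\<xi> x))"
   by (rule isCont_inverse_function2[of "\<xi> x - 1" _ "\<xi> x + 1"]) (auto simp: i2 ic)
  then show ?thesis by (simp add: i1)
 qed
 have "(\<xi> has_real_derivative inverse (r (\<xi> x))) (at x)" for x
  by (rule DERIV_inverse_function[where a="x - 1" and b="x + 1", OF d\<phi> _ _ _ i1 c\<xi>])
   (use d(1) d(2)[of "\<xi> x"] in auto)
 then show ?thesis using that[OF d\<phi> _ i1 i2] by (simp add: \<phi>_def inverse_eq_divide)
qed

lemma chart_exists:
 fixes l l1 l2 :: "real \<Rightarrow> real"
 assumes pos: "\<And>z. z \<in> {0..1} \<Longrightarrow> 0 < l z"
  and d: "\<And>z. z \<in> {0..1} \<Longrightarrow> (l has_real_derivative l1 z) (at z within {0..1})"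
   "\<And>z. z \<in> {0..1} \<Longrightarrow> (l1 has_real_derivative l2 z) (at z within {0..1})"
  and c: "continuous_on {0..1} l2"
 shows "\<exists>p p1 p2 \<phi> \<xi>. chart p p1 p2 \<phi> \<xi> \<and> (\<forall>z\<in>{0..1}. p z = l z powr (1/4))"
proof -
 \<comment> \<open>Clamping to [0, 1] continues the coefficient and the formulas for its derivatives
   by constants to the line; \<open>p1\<close> and \<open>p2\<close> are claimed to be derivatives
   on [0, 1] only.\<close>
 let ?c = "\<lambda>z::real. max 0 (min 1 z)"
 have cl: "?c z \<in> {0..1}" for z by auto
 have cc: "continuous_on UNIV ?c" by (intro continuous_intros)
 have cont: "continuous_on {0..1} l" "continuous_on {0..1} l1"
  using d by (meson DERIV_continuous continuous_on_eq_continuous_within)+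
 have ct: "continuous_on UNIV (\<lambda>z. f (?c z))" if "continuous_on {0..1} f" for f :: "real \<Rightarrow> real"
  by (rule continuous_on_compose2[OF that cc]) auto
 define p where "p z = l (?c z) powr (1/4)" for z
 define p1 where "p1 z = 1/4 * l (?c z) powr (-3/4) * l1 (?c z)" for z
 define p2 where "p2 z = 1/4 * (-3/4 * l (?c z) powr (-7/4) * l1 (?c z)) * l1 (?c z) + 1/4 * l (?c z) powr (-3/4) * l2 (?c z)" for z
 have lp: "l (?c z) \<noteq> 0" for z using pos[OF cl[of z]] by simp
 have pc: "continuous_on UNIV p" "continuous_on UNIV p1" "continuous_on UNIV p2"
  unfolding p_def p1_def p2_def
  by (intro continuous_intros ct cont c ballI lp; simp add: lp)+
 have ppos: "0 < p z" for z using pos[OF cl[of z]] by (simp add: p_def)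
 have eq: "?c z = z" if "z \<in> {0..1}" for z using that by auto
 have dp: "(p has_real_derivative p1 z) (at z within {0..1})" if z: "z \<in> {0..1}" for z
 proof -
  have "((\<lambda>z. l z powr (1/4)) has_real_derivative p1 z) (at z within {0..1})"
   using DERIV_chain2[where f="\<lambda>y. y powr (1/4)" and g=l and x=z, OF has_real_derivative_powr[OF pos[OF z]] d(1)[OF z]]
   unfolding p1_def eq[OF z] by simp
  then show ?thesis by (rule has_field_derivative_transform_within[OF _ zero_less_one z]) (simp add: p_def eq)
 qed
 have dp1: "(p1 has_real_derivative p2 z) (at z within {0..1})" if z: "z \<in> {0..1}" for z
 proof -
  have "((\<lambda>z. l z powr (-3/4)) has_real_derivative -3/4 * l z powr (-7/4) * l1 z) (at z within {0..1})"
   using DERIV_chain2[where f="\<lambda>y. y powr (-3/4)" and g=l and x=z, OF has_real_derivative_powr[OF pos[OF z]] d(1)[OF z]] by simp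
  from DERIV_cmult[OF DERIV_mult[OF this d(2)[OF z]], of "1/4"]
  have "((\<lambda>z. 1/4 * l z powr (-3/4) * l1 z) has_real_derivative p2 z) (at z within {0..1})"
   unfolding p2_def eq[OF z] by (simp add: algebra_simps)
  then show ?thesis by (rule has_field_derivative_transform_within[OF _ zero_less_one z]) (simp add: p1_def eq)
 qed
 let ?r = "\<lambda>z. 1 / (p z)\<^sup>2"
 have pn: "p z \<noteq> 0" for z using ppos[of z] by simp
 have r: "continuous_on UNIV ?r" using pn by (intro continuous_intros pc(1)) auto
 \<comment> \<open>The minimum on [0, 1] bounds the slope 1 / p^2 on the whole line, since p is
   constant outside.\<close>
 obtain b where b: "b \<in> {0..1}" "\<And>z. z \<in> {0..1} \<Longrightarrow> ?r b \<le> ?r z"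
  using continuous_attains_inf[OF compact_Icc _ continuous_on_subset[OF r subset_UNIV], of 0 1] by auto
 have rc: "?r (?c z) = ?r z" for z by (simp add: p_def)
 have "?r b \<le> ?r z" for z using b(2)[OF cl[of z]] rc[of z] by simp
 from increasing_homeomorphism[OF r _ this] ppos[of b]
 obtain \<phi> \<xi> where h: "\<And>z. (\<phi> has_real_derivative ?r z) (at z)" "\<phi> 0 = 0" "\<And>x. \<phi> (\<xi> x) = x" "\<And>z. \<xi> (\<phi> z) = z"
  "\<And>x. (\<xi> has_real_derivative 1 / ?r (\<xi> x)) (at x)" by (metis zero_less_divide_1_iff zero_less_power)
 have "chart p p1 p2 \<phi> \<xi>"
  by unfold_locales (use pc ppos dp dp1 h in auto)
 moreover have "\<forall>z\<in>{0..1}. p z = l z powr (1/4)" by (simp add: p_def eq)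
 ultimately show ?thesis by blast
qed

context chart
begin

lemma pc01_chart:
 assumes S: "S \<subseteq> {0..1}" "pc S (cut01 f)" and h: "continuous_on UNIV h"
 shows "pc (\<phi> ` S) (\<lambda>x. cut01 f (\<xi> x) * h x)"
proof (rule pc_mult[OF pc_compose[OF S(2) \<xi>_cont] pc_continuous[OF h]])
 fix x assume "\<xi> x \<in> S"
 then have "\<phi> (\<xi> x) \<in> \<phi> ` S" by (rule imageI)
 then show "x \<in> \<phi> ` S" by (simp only: inv)
qed

end

context row_kernel
begin

lemma finite_slice: "finite {z. sc z b \<in> S \<or> tc z b \<in> S}" "finite {\<zeta>. sc a \<zeta> \<in> S \<or> tc a \<zeta> \<in> S}"
proof -
 have "{z. sc z b \<in> S \<or> tc z b \<in> S} \<subseteq> (\<lambda>e. \<xi> (e + \<theta> b)) ` S \<union> (\<lambda>e. \<xi> (e - \<theta> b)) ` S"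
 proof
  fix z assume "z \<in> {z. sc z b \<in> S \<or> tc z b \<in> S}"
  moreover have "z = \<xi> (sc z b + \<theta> b)" "z = \<xi> (tc z b - \<theta> b)" by (simp_all add: r.inv)
  ultimately show "z \<in> (\<lambda>e. \<xi> (e + \<theta> b)) ` S \<union> (\<lambda>e. \<xi> (e - \<theta> b)) ` S" by blast
 qed
 then show "finite {z. sc z b \<in> S \<or> tc z b \<in> S}" using finS finite_subset by blast
 have "{\<zeta>. sc a \<zeta> \<in> S \<or> tc a \<zeta> \<in> S} \<subseteq> (\<lambda>e. \<nu> (\<phi> a - e)) ` S \<union> (\<lambda>e. \<nu> (e - \<phi> a)) ` S"
 proof
  fix \<zeta> assume "\<zeta> \<in> {\<zeta>. sc a \<zeta> \<in> S \<or> tc a \<zeta> \<in> S}"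
  moreover have "\<zeta> = \<nu> (\<phi> a - sc a \<zeta>)" "\<zeta> = \<nu> (tc a \<zeta> - \<phi> a)" by (simp_all add: c.inv)
  ultimately show "\<zeta> \<in> (\<lambda>e. \<nu> (\<phi> a - e)) ` S \<union> (\<lambda>e. \<nu> (e - \<phi> a)) ` S" by blast
 qed
 then show "finite {\<zeta>. sc a \<zeta> \<in> S \<or> tc a \<zeta> \<in> S}" using finS finite_subset by blast
qed

lemma reflection_off_finite:
 assumes "bet kk = 1" "rb kk = q1 1 * q 1"
 shows "off_finite {0..1} (\<lambda>z. pd_zeta square Kf z 1 * q 1 ^ 4 + Kf z 1 * (4 * q 1 ^ 3 * q1 1) = 0)"
 unfolding off_finite_def
 by (rule finite_subset[OF _ finite_slice(1)[of 1]]) (use Kf_reflection[OF _ _ _ assms] in auto)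

lemma left_edge_off_finite: "off_finite {0..1} (\<lambda>\<zeta>. pd_z square Kf 0 \<zeta> = 0)"
 unfolding off_finite_def
proof (rule finite_subset[OF _ finite_slice(2)[of 0]], rule subsetI, rule ccontr)
 fix \<zeta> assume a: "\<zeta> \<in> {\<zeta> \<in> {0..1}. pd_z square Kf 0 \<zeta> \<noteq> 0}" "\<zeta> \<notin> {\<zeta>. sc 0 \<zeta> \<in> S \<or> tc 0 \<zeta> \<in> S}"
 then have D: "(0, \<zeta>) \<in> square" by (auto simp: square_def)
 have "sc 0 \<zeta> \<le> 0" using a ranges(3)[of 0 \<zeta>] by (simp add: r.\<phi>0)
 then show False using Kf_deriv_zero(1)[OF square_sub D thick_square[OF D]] a by auto
qed

text \<open>For q < p the diagonal runs in s < 0, where the kernel vanishes together with its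
  derivatives.\<close>

lemma diagonal_off_finite:
 assumes qp: "\<And>z. z \<in> {0..1} \<Longrightarrow> q z < p z"
 shows "off_finite {0..1} (\<lambda>z. pd_z triangle Kf z z = 0 \<and> pd_zeta triangle Kf z z = 0)"
 unfolding off_finite_def
proof (rule finite_subset[OF _ finite_UnI[OF finite_UnI[OF finite_char_diag_diff[OF qp finS] finite_char_diag[OF finS]] fin01]], rule subsetI, rule ccontr)
 fix z assume a: "z \<in> {z \<in> {0..1}. \<not> (pd_z triangle Kf z z = 0 \<and> pd_zeta triangle Kf z z = 0)}"
  "z \<notin> {z \<in> {0..1}. \<phi> z - \<theta> z \<in> S} \<union> {z. \<phi> z + \<theta> z \<in> S} \<union> {0, 1}"
 then have z: "0 < z" "z < 1" and s: "sc z z \<notin> S" "tc z z \<notin> S" by auto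
 have D: "(z, z) \<in> triangle" "thick triangle (z, z)" using z thick_triangle[of "(z, z)"] by (auto simp: triangle_def)
 have "sc z z \<le> 0" using char_decreasing[OF qp, of 0 z] z by (simp add: r.\<phi>0 c.\<phi>0)
 then show False using Kf_deriv_zero[OF triangle_sub D s] a by auto
qed simp

lemma bottom_off_finite:
 assumes D: "D = square \<or> D = triangle"
 shows "off_finite {0..1} (\<lambda>z. pd_zeta D Kf z 0 * q 0 ^ 4 + Kf z 0 * (4 * q 0 ^ 3 * q1 0)
  = p z * (1 / q 0 * (- vU U kk (\<phi> z) - cs U kk (\<phi> z, \<phi> z) + gU U kk (\<phi> z) + ct U kk (\<phi> z, \<phi> z)) + q1 0 * ww U kk (\<phi> z, \<phi> z)))"
 unfolding off_finite_def
proof (rule finite_subset[OF _ finite_UnI[OF finite_slice(1)[of 0] fin01]], rule subsetI, rule ccontr)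
 fix z assume a: "z \<in> {z \<in> {0..1}. pd_zeta D Kf z 0 * q 0 ^ 4 + Kf z 0 * (4 * q 0 ^ 3 * q1 0)
  \<noteq> p z * (1 / q 0 * (- vU U kk (\<phi> z) - cs U kk (\<phi> z, \<phi> z) + gU U kk (\<phi> z) + ct U kk (\<phi> z, \<phi> z)) + q1 0 * ww U kk (\<phi> z, \<phi> z))}"
  "z \<notin> {z. sc z 0 \<in> S \<or> tc z 0 \<in> S} \<union> {0, 1}"
 then have z: "0 < z" "z < 1" and s: "sc z 0 \<notin> S" "tc z 0 \<notin> S" by auto
 have "D \<subseteq> {0..1} \<times> {0..1}" "(z, 0) \<in> D" "thick D (z, 0)"
  using D z square_sub triangle_sub thick_square[of "(z, 0)"] thick_triangle[of "(z, 0)"] by (auto simp: square_def triangle_def)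
 from Kf_deriv(3)[OF this s] a show False by (simp add: c.\<phi>0 algebra_simps diff_divide_distrib add_divide_distrib)
qed

lemma Kf_bottom: "Kf z 0 * q 0 ^ 4 = p z * (q 0 * ww U kk (\<phi> z, \<phi> z))"
 using c.pos[of 0] by (simp add: Kf_def c.\<phi>0 field_simps eval_nat_numeral)

lemma Kf_pairing:
 assumes f: "pc01 f" and z: "z \<in> {0..1}"
 shows "((\<lambda>\<zeta>. Kf z \<zeta> * f \<zeta>) has_integral
  p z * integral {0..L kk} (\<lambda>y. cut01 f (\<nu> y) * (1 / q (\<nu> y)) * ww U kk (\<phi> z - y, \<phi> z + y))) {0..1}"
proof -
 obtain R where R: "finite R" "R \<subseteq> {0..1}" "pc R (cut01 f)" using f unfolding pc01_def by blast
 let ?B = "\<lambda>y. cut01 f (\<nu> y) * (1 / q (\<nu> y))"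
 have qn: "q x \<noteq> 0" for x using c.pos[of x] by simp
 have h: "continuous_on UNIV (\<lambda>y. 1 / q (\<nu> y))"
  by (intro continuous_intros c.cont1 c.\<xi>_cont) (auto simp: qn)
 have B: "locbm ?B" using pc_locbm[OF c.pc01_chart[OF R(2,3) h]] R(1) by simp
 have "?B y = 0" if "y \<notin> {0..L kk}" for y
  using that c.\<phi>_le_iff[of 0 "\<nu> y"] c.\<phi>_le_iff[of "\<nu> y" 1] by (auto simp: cut01_def c.\<phi>0 L\<theta> c.inv)
 note I = Kf_integral[OF B this z]
 show ?thesis
 proof (rule has_integral_eq[OF _ I])
  fix \<zeta> :: real assume "\<zeta> \<in> {0..1}"
  then show "Kf z \<zeta> * (q \<zeta> * ?B (\<theta> \<zeta>)) = Kf z \<zeta> * f \<zeta>" using qn[of \<zeta>] unfolding c.inv(2) cut01_def by simp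
 qed
qed

text \<open>Beyond \<zeta> = z one has s \<le> 0 and the kernel vanishes, so the integral up to z
  equals the one up to 1. Hence P and Q enter the coupling conditions in the same form.\<close>

lemma Kf_pairing_lower:
 assumes qp: "\<And>z. z \<in> {0..1} \<Longrightarrow> \<phi> z \<le> \<theta> z" and f: "pc01 f" and z: "z \<in> {0..1}"
 shows "((\<lambda>\<zeta>. Kf z \<zeta> * f \<zeta>) has_integral
  p z * integral {0..L kk} (\<lambda>y. cut01 f (\<nu> y) * (1 / q (\<nu> y)) * ww U kk (\<phi> z - y, \<phi> z + y))) {0..z}"
proof -
 have "((\<lambda>\<zeta>. if \<zeta> \<in> {0..z} then Kf z \<zeta> * f \<zeta> else 0) has_integral
  p z * integral {0..L kk} (\<lambda>y. cut01 f (\<nu> y) * (1 / q (\<nu> y)) * ww U kk (\<phi> z - y, \<phi> z + y))) {0..1}"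
 proof (rule has_integral_eq[OF _ Kf_pairing[OF f z]])
  fix \<zeta> :: real assume \<zeta>: "\<zeta> \<in> {0..1}"
  show "Kf z \<zeta> * f \<zeta> = (if \<zeta> \<in> {0..z} then Kf z \<zeta> * f \<zeta> else 0)"
  proof (cases "\<zeta> \<le> z")
   case False
   then have "\<phi> z \<le> \<theta> \<zeta>" using qp[OF z] c.\<phi>_le_iff[of z \<zeta>] by simp
   then show ?thesis using Kf_zero[OF z \<zeta>] by simp
  qed (use \<zeta> in auto)
 qed
 then show ?thesis by (rule has_integral_restrict[THEN iffD1, rotated]) (use z in auto)
qed

end

section \<open>The kernels of one row\<close>

lemma off_finite_combine:
 assumes "off_finite A P" "off_finite A Q" "finite F" "\<And>x. x \<in> A \<Longrightarrow> x \<notin> F \<Longrightarrow> P x \<Longrightarrow> Q x \<Longrightarrow> R x"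
 shows "off_finite A R"
 unfolding off_finite_def
proof (rule finite_subset)
 show "{x \<in> A. \<not> R x} \<subseteq> {x \<in> A. \<not> P x} \<union> {x \<in> A. \<not> Q x} \<union> F" using assms(4) by blast
qed (use assms(1-3) in \<open>auto simp: off_finite_def\<close>)

lemma off_finite_all: "(\<And>x. x \<in> A \<Longrightarrow> x \<notin> F \<Longrightarrow> R x) \<Longrightarrow> finite F \<Longrightarrow> off_finite A R"
 unfolding off_finite_def by (rule finite_subset[of _ F]) auto

lemma pd_zero:
 assumes "thick D (a, b)"
 shows "pd_z D (\<lambda>_ _. 0 :: real) a b = 0" "pd_zeta D (\<lambda>_ _. 0 :: real) a b = 0"
 using pd_eq[of "\<lambda>_ _. 0 :: real" "\<lambda>_. 0" a b D] assms by (simp_all add: case_prod_beta')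

text \<open>\<open>K (Inl j)\<close> and \<open>K (Inr j)\<close> are the entries (i, j) of P and Q.\<close>

definition row_system where
 "row_system p p1 zt0 Al0 Al1 Ab0 Ab1 (i :: 'n::{finite,linorder}) (K :: 'n + 'n \<Rightarrow> real \<Rightarrow> real \<Rightarrow> real) \<longleftrightarrow>
  (\<forall>k. ix k < i \<longrightarrow> K k = (\<lambda>_ _. 0)) \<and>
  (\<forall>k D \<psi> a b. D \<subseteq> {0..1} \<times> {0..1} \<longrightarrow> test_function D \<psi> \<longrightarrow> (\<forall>z\<in>{0..1}. a z = p (Inr i) z ^ 4) \<longrightarrow>
   (\<forall>z\<in>{0..1}. b z = p k z ^ 4) \<longrightarrow>
   integral D (\<lambda>(z, \<zeta>). K k z \<zeta> * Dz (Dz (\<lambda>z \<zeta>. a z * \<psi> z \<zeta>)) z \<zeta> - K k z \<zeta> * b \<zeta> * Dzeta (Dzeta \<psi>) z \<zeta>) = 0) \<and>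
  (\<forall>j. pwc square (K (Inl j))) \<and> (\<forall>j. pwc triangle (K (Inr j))) \<and>
  (\<forall>j. off_finite {0..1} (\<lambda>z. pd_zeta square (K (Inl j)) z 1 * p (Inl j) 1 ^ 4 + K (Inl j) z 1 * (4 * p (Inl j) 1 ^ 3 * p1 (Inl j) 1) = 0)) \<and>
  (\<forall>j \<zeta>. \<zeta> \<in> {0..1} \<longrightarrow> K (Inl j) 0 \<zeta> = 0) \<and>
  (\<forall>j. off_finite {0..1} (\<lambda>\<zeta>. pd_z square (K (Inl j)) 0 \<zeta> = 0)) \<and>
  (\<forall>j z. z \<in> {0..1} \<longrightarrow> K (Inr j) z z = 0) \<and>
  (\<forall>j. off_finite {0..1} (\<lambda>z. pd_zeta triangle (K (Inr j)) z z * p (Inr j) z ^ 4 + p (Inr i) z ^ 4 * pd_z triangle (K (Inr j)) z z = 0)) \<and>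
  (\<forall>f k z. pc01 f \<longrightarrow> z \<in> {0..1} \<longrightarrow> (\<lambda>\<zeta>. K (Inl k) z \<zeta> * f \<zeta>) integrable_on {0..1}) \<and>
  (\<forall>f k z. pc01 f \<longrightarrow> z \<in> {0..1} \<longrightarrow> (\<lambda>\<zeta>. K (Inr k) z \<zeta> * f \<zeta>) integrable_on {0..z}) \<and>
  (\<forall>j z. i \<le> j \<longrightarrow> z \<in> {0..1} \<longrightarrow> K (Inl j) z 0 * p (Inl j) 0 ^ 4 - 1 / zt0 * (K (Inr j) z 0 * p (Inr j) 0 ^ 4)
   = Ab1 i j z - (\<Sum>k\<in>UNIV. integral {0..z} (\<lambda>\<zeta>. K (Inr k) z \<zeta> * Ab1 k j \<zeta>))
    - (\<Sum>k\<in>UNIV. integral {0..1} (\<lambda>\<zeta>. K (Inl k) z \<zeta> * Al1 k j \<zeta>))) \<and>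
  (\<forall>j. i \<le> j \<longrightarrow> off_finite {0..1} (\<lambda>z.
   pd_zeta triangle (K (Inr j)) z 0 * p (Inr j) 0 ^ 4 + K (Inr j) z 0 * (4 * p (Inr j) 0 ^ 3 * p1 (Inr j) 0)
   + (pd_zeta square (K (Inl j)) z 0 * p (Inl j) 0 ^ 4 + K (Inl j) z 0 * (4 * p (Inl j) 0 ^ 3 * p1 (Inl j) 0))
   = - Ab0 i j z + (\<Sum>k\<in>UNIV. integral {0..z} (\<lambda>\<zeta>. K (Inr k) z \<zeta> * Ab0 k j \<zeta>))
    + (\<Sum>k\<in>UNIV. integral {0..1} (\<lambda>\<zeta>. K (Inl k) z \<zeta> * Al0 k j \<zeta>))))"

text \<open>Divided by p of the row at z and written in travel times, the coupling conditions take
  the form of \<open>coupled_solution\<close>: the value at \<zeta> = 0 has the weight p(0) for P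
  and - p(0) / zt0 for Q, the y-derivative the weight 1 / p(0), with p taken for the column. Entries
  with column index below i are solved for as well but then replaced by 0, so they must not feed
  back into the others.\<close>

lemma row_kernels_exist:
 fixes p p1 p2 \<phi> \<xi> :: "'n::{finite,linorder} + 'n \<Rightarrow> real \<Rightarrow> real" and i :: 'n
  and Al0 Al1 Ab0 Ab1 :: "'n \<Rightarrow> 'n \<Rightarrow> real \<Rightarrow> real" and dA :: "'n \<Rightarrow> real \<Rightarrow> real" and zt0 :: real
 assumes ch: "\<And>k. chart (p k) (p1 k) (p2 k) (\<phi> k) (\<xi> k)"
  and ord: "\<And>j z. i < j \<Longrightarrow> z \<in> {0..1} \<Longrightarrow> p (Inr j) z < p (Inr i) z"
  and zt0: "0 < zt0"
  and pcd: "\<And>k j. pc01 (Al0 k j)" "\<And>k j. pc01 (Al1 k j)" "\<And>k j. pc01 (Ab0 k j)" "\<And>k j. pc01 (Ab1 k j)"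
  and dA: "\<And>j. pc01 (dA j)" "finite N" "\<And>j z. z \<in> {0<..<1} - N \<Longrightarrow> (Ab1 i j has_real_derivative dA j z) (at z)"
  and Ab10: "\<And>j. Ab1 i j 0 = 0"
 shows "\<exists>K. row_system p p1 zt0 Al0 Al1 Ab0 Ab1 i K"
proof -
 let ?R = "Inr i :: 'n + 'n"
 let ?X = "\<phi> ?R 1" and ?L = "\<lambda>k. \<phi> k 1"
 define T where "T = ?X + (\<Sum>k\<in>UNIV. ?L k)"
 \<comment> \<open>x = (s + t) / 2 and y = (t - s) / 2 recover the travel times of row and
   column.\<close>
 define m where "m k u = ((p k (\<xi> k ((snd u - fst u) / 2))) ^ 3 * p2 k (\<xi> k ((snd u - fst u) / 2))
   - (p ?R (\<xi> ?R ((fst u + snd u) / 2))) ^ 3 * p2 ?R (\<xi> ?R ((fst u + snd u) / 2))) / 4" for k and u :: "real \<times> real"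
 define B1 where "B1 k j = (case k of Inl k' \<Rightarrow> Al1 k' j | Inr k' \<Rightarrow> Ab1 k' j)" for k :: "'n + 'n" and j
 define B0 where "B0 k j = (case k of Inl k' \<Rightarrow> Al0 k' j | Inr k' \<Rightarrow> Ab0 k' j)" for k :: "'n + 'n" and j
 \<comment> \<open>Coefficients paired with an entry that is going to be 0 are set to 0, so that it
   does not enter the other conditions; the division by p is the factor that turns the pairing in
   \<zeta> into one in y.\<close>
 define lift where "lift k f y = (if i \<le> ix k then cut01 f (\<xi> k y) * (1 / p k (\<xi> k y)) else 0)" for k f y
 have pos: "0 < p k z" for k z using chart.pos[OF ch] .
 have pn: "p k z \<noteq> 0" for k z using pos[of k z] by simp
 have L0: "0 < ?L k" for k using chart.\<phi>_mono[OF ch, of 0 1 k] chart.\<phi>0[OF ch, of k] by simp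
 have LT: "?X + ?L k \<le> T" for k unfolding T_def using member_le_sum[of k UNIV ?L] L0 by (simp add: less_imp_le)
 have mc: "continuous_on UNIV (m k)" for k
  unfolding m_def
  by (intro continuous_intros chart.cont1[OF ch] continuous_on_compose2[OF chart.pc(3)[OF ch]]
    continuous_on_compose2[OF chart.\<xi>_cont[OF ch]]) auto
 have icont: "continuous_on UNIV (\<lambda>y. 1 / p k (\<xi> k y))" for k
  by (intro continuous_intros chart.cont1[OF ch] chart.\<xi>_cont[OF ch]) (auto simp: pn)
 have pB1: "pc01 (B1 k j)" and pB0: "pc01 (B0 k j)" for k j
  using pcd by (cases k; simp add: B1_def B0_def)+
 have lift_pc: "\<exists>S. finite S \<and> pc S (lift k f)" if f: "pc01 f" for k f
 proof -
  obtain S where S: "finite S" "S \<subseteq> {0..1}" "pc S (cut01 f)" using f unfolding pc01_def by blast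
  from chart.pc01_chart[OF ch S(2,3) icont] have 1: "pc (\<phi> k ` S) (\<lambda>y. cut01 f (\<xi> k y) * (1 / p k (\<xi> k y)))" .
  have "pc (\<phi> k ` S) (lift k f)" using 1 pc_const[of _ 0] unfolding lift_def by (cases "i \<le> ix k") simp_all
  then show ?thesis using S(1) by blast
 qed
 have lift_zero: "lift k f y = 0" if "y < 0 \<or> ?L k < y" for k f y
  using that chart.\<phi>_le_iff[OF ch, of k 0 "\<xi> k y"] chart.\<phi>_le_iff[OF ch, of k "\<xi> k y" 1]
  by (auto simp: lift_def cut01_def chart.\<phi>0[OF ch] chart.inv[OF ch])
 define SF where "SF k j = (SOME S. finite S \<and> pc S (lift k (B1 k j)))" for k j
 have SF: "finite (SF k j) \<and> pc (SF k j) (lift k (B1 k j))" for k j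
  unfolding SF_def by (rule someI_ex[OF lift_pc[OF pB1]])
 define SA where "SA = (\<Union>k\<in>UNIV. \<Union>j\<in>UNIV. SF k j)"
 have SA: "finite SA" "pc SA (lift k (B1 k j))" for k j
 proof -
  show "finite SA" using SF unfolding SA_def by simp
  have "SF k j \<subseteq> SA" unfolding SA_def by blast
  with SF show "pc SA (lift k (B1 k j))" using pc_mono by blast
 qed
 have lB0: "locbm (lift k (B0 k j))" for k j
 proof -
  obtain S where "finite S" "pc S (lift k (B0 k j))" using lift_pc[OF pB0, of k k j] by blast
  then show ?thesis by (intro pc_locbm)
 qed
 have "\<exists>S. finite S \<and> S \<subseteq> {0..1} \<and> pc S (cut01 (dA j)) \<and> pc S (cut01 (Ab1 i j)) \<and> pc S (cut01 (Ab0 i j))" for j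
 proof -
  obtain S S' S'' where "finite S" "S \<subseteq> {0..1}" "pc S (cut01 (dA j))" "finite S'" "S' \<subseteq> {0..1}" "pc S' (cut01 (Ab1 i j))"
   "finite S''" "S'' \<subseteq> {0..1}" "pc S'' (cut01 (Ab0 i j))"
   using dA(1)[of j] pcd(4)[of i j] pcd(3)[of i j] unfolding pc01_def by metis
  then show ?thesis by (intro exI[of _ "S \<union> S' \<union> S''"]) (simp add: pc_mono[of S _ "S \<union> S' \<union> S''"] pc_mono[of S' _ "S \<union> S' \<union> S''"] pc_mono[of S'' _ "S \<union> S' \<union> S''"] subset_iff)
 qed
 then obtain SG where SG: "\<And>j. finite (SG j)" "\<And>j. SG j \<subseteq> {0..1}" "\<And>j. pc (SG j) (cut01 (dA j))"
  "\<And>j. pc (SG j) (cut01 (Ab1 i j))" "\<And>j. pc (SG j) (cut01 (Ab0 i j))" by metis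
 define S0 where "S0 = (\<Union>j\<in>UNIV. SG j) \<union> (N \<inter> {0..1})"
 have S0: "finite S0" "S0 \<subseteq> {0..1}" "pc S0 (cut01 (dA j))" "pc S0 (cut01 (Ab1 i j))" "pc S0 (cut01 (Ab0 i j))" for j
 proof -
  have "SG j \<subseteq> S0" unfolding S0_def by blast
  then show "pc S0 (cut01 (dA j))" "pc S0 (cut01 (Ab1 i j))" "pc S0 (cut01 (Ab0 i j))" using SG(3-5) pc_mono by blast+
 qed (use SG(1,2) dA(2) in \<open>auto simp: S0_def\<close>)
 define dat where "dat j x = Ab1 i j (\<xi> ?R x) / p ?R (\<xi> ?R x)" for j x
 \<comment> \<open>The derivative of \<open>dat\<close> in x; dz = p^2 dx cancels the denominators
   of the quotient rule.\<close>
 define dd where "dd j x = cut01 (dA j) (\<xi> ?R x) * p ?R (\<xi> ?R x) - cut01 (Ab1 i j) (\<xi> ?R x) * p1 ?R (\<xi> ?R x)" for j x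
 define E where "E j x = cut01 (Ab0 i j) (\<xi> ?R x) * (- 1 / p ?R (\<xi> ?R x))" for j x
 let ?SD = "\<phi> ?R ` S0"
 have pddc: "pc ?SD (dd j)" for j
  unfolding dd_def
  by (intro pc_diff chart.pc01_chart[OF ch S0(2)] S0 chart.cont1[OF ch] chart.\<xi>_cont[OF ch]
   continuous_on_compose2[OF chart.pc(2)[OF ch]]) auto
 have pE: "pc ?SD (E j)" for j
  unfolding E_def
  by (intro chart.pc01_chart[OF ch S0(2)] S0 continuous_intros chart.cont1[OF ch] chart.\<xi>_cont[OF ch]) (auto simp: pn)
 have ddat: "(dat j has_real_derivative dd j x) (at x)" if x: "0 < x" "x < ?X" "x \<notin> ?SD" for j x
 proof -
  let ?y = "\<xi> ?R x"
  have y: "0 < ?y" "?y < 1" using chart.\<phi>_less_iff[OF ch, of ?R 0 ?y] chart.\<phi>_less_iff[OF ch, of ?R ?y 1] x(1,2)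
   by (simp_all add: chart.inv[OF ch] chart.\<phi>0[OF ch])
  have "?y \<notin> S0" using x(3) chart.inv(1)[OF ch, of ?R x] by (metis imageI)
  then have "?y \<in> {0<..<1} - N" using y by (auto simp: S0_def)
  from DERIV_chain2[OF dA(3)[OF this] chart.d\<xi>[OF ch]]
  have 1: "((\<lambda>x. Ab1 i j (\<xi> ?R x)) has_real_derivative dA j ?y * (p ?R ?y)\<^sup>2) (at x)" .
  have 2: "((\<lambda>x. p ?R (\<xi> ?R x)) has_real_derivative p1 ?R ?y * (p ?R ?y)\<^sup>2) (at x)"
   by (rule DERIV_chain2[OF chart.dp_at(1)[OF ch] chart.d\<xi>[OF ch]]) (use y in simp)
  have "(dat j has_real_derivative (dA j ?y * (p ?R ?y)\<^sup>2 * p ?R ?y - Ab1 i j ?y * (p1 ?R ?y * (p ?R ?y)\<^sup>2)) / (p ?R ?y * p ?R ?y)) (at x)"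
   unfolding dat_def by (rule DERIV_divide[OF 1 2 pn])
  then show ?thesis
   by (rule DERIV_cong) (use y pn[of ?R ?y] in \<open>simp add: dd_def cut01_def field_simps power2_eq_square\<close>)
 qed
 let ?c = "\<lambda>k. case k of Inl j \<Rightarrow> p k 0 | Inr j \<Rightarrow> - (p k 0 / zt0)"
 obtain S fJ gJ e bet rb a1 a2 a3 a4 A A' U where
  rs: "row_sol S ?X T ?L m fJ gJ e bet rb a1 a2 a3 a4 A A' U"
  and fg: "\<And>j x. fJ (Inr j) x = 0" "\<And>j x. gJ (Inr j) x = 0" "\<And>j. bet (Inr j) = 0" "\<And>j. bet (Inl j) = 1"
   "\<And>j. rb (Inl j) = p1 (Inl j) 1 * p (Inl j) 1"
  and c1: "\<And>j x. 0 < x \<Longrightarrow> x \<le> ?X \<Longrightarrow> ?c (Inl j) * row.ww fJ gJ U (Inl j) (x, x) + ?c (Inr j) * row.ww fJ gJ U (Inr j) (x, x)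
    = dat j x - (\<Sum>k\<in>UNIV. integral {0..?L k} (\<lambda>y. lift k (B1 k j) y * row.ww fJ gJ U k (x - y, x + y)))"
  and c2: "\<And>j x. 0 < x \<Longrightarrow> x \<le> ?X \<Longrightarrow>
    1 / p (Inl j) 0 * (- vU U (Inl j) x - row.cs T m fJ gJ U (Inl j) (x, x) + gU U (Inl j) x + row.ct T m fJ gJ U (Inl j) (x, x))
     + p1 (Inl j) 0 * row.ww fJ gJ U (Inl j) (x, x)
    + (1 / p (Inr j) 0 * (- vU U (Inr j) x - row.cs T m fJ gJ U (Inr j) (x, x) + gU U (Inr j) x + row.ct T m fJ gJ U (Inr j) (x, x))
     + p1 (Inr j) 0 * row.ww fJ gJ U (Inr j) (x, x))
    = E j x + (\<Sum>k\<in>UNIV. integral {0..?L k} (\<lambda>y. lift k (B0 k j) y * row.ww fJ gJ U k (x - y, x + y)))"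
 proof (rule coupled_solution[where X="?X" and L="?L" and T=T and m=m and c="?c" and d="\<lambda>k. 1 / p k 0" and zc="\<lambda>k. p1 k 0"
   and r="\<lambda>j. p1 (Inl j) 1 * p (Inl j) 1" and ?A1.0="\<lambda>k j. lift k (B1 k j)" and ?A0.0="\<lambda>k j. lift k (B0 k j)"
   and dat=dat and dd=dd and E=E and SA=SA and SD="?SD"], goal_cases)
  case (13 s) then show ?case using S0(2) chart.\<phi>_le_iff[OF ch, of ?R 0] by (auto simp: chart.\<phi>0[OF ch])
 next
  case 17 show ?case by (rule that) (use 17 in \<open>assumption | simp\<close>)+
 qed (use L0 LT mc pos zt0 SA lift_zero lB0 S0(1) pddc pE ddat in auto)
 interpret rs: row_sol S "?X" T "?L" m fJ gJ e bet rb a1 a2 a3 a4 A A' U by (rule rs)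
 have RK: "row_kernel S ?X T ?L m fJ gJ e bet rb a1 a2 a3 a4 A A' U (p ?R) (p1 ?R) (p2 ?R) (\<phi> ?R) (\<xi> ?R) (p k) (p1 k) (p2 k) (\<phi> k) (\<xi> k) k" for k
  by (intro row_kernel.intro rs chart2.intro ch row_kernel_axioms.intro) (simp_all add: m_def)
 have gU0: "gU U (Inr j) t = 0" for j t
  using rs.gU_eq[of "Inr j" t] rs.g_0[OF rs.U, of t "Inr j"] fg(3) by (cases "2 * ?L (Inr j) < t \<and> t \<le> T") auto
 have gg0: "rs.gg U (Inr j) t = 0" for j t
 proof -
  have "gU U (Inr j) = (\<lambda>_. 0)" by (rule ext) (rule gU0)
  then show ?thesis by (simp add: rs.gg_def fg(2))
 qed
 have DK: "diag_row_kernel S ?X T ?L m fJ gJ e bet rb a1 a2 a3 a4 A A' U (p ?R) (p1 ?R) (p2 ?R) (\<phi> ?R) (\<xi> ?R) (p ?R) (p1 ?R) (p2 ?R) (\<phi> ?R) (\<xi> ?R) ?R"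
  by (intro diag_row_kernel.intro RK diag_row_kernel_axioms.intro) (simp_all add: gg0 gU0 fg(1))
 define Kf where "Kf k = row_kernel.Kf fJ gJ U (p ?R) (\<phi> ?R) (p k) (\<phi> k) k" for k
 note Kfd = Kf_def[symmetric]
 define K where "K k = (if i \<le> ix k then Kf k else (\<lambda>_ _. 0))" for k
 have act: "K k = Kf k" if "i \<le> ix k" for k using that by (simp add: K_def)
 have inact: "K k = (\<lambda>_ _. 0)" if "\<not> i \<le> ix k" for k using that by (simp add: K_def)
 have th: "thick square (z, \<zeta>)" if "z \<in> {0..1}" "\<zeta> \<in> {0..1}" for z \<zeta> using thick_square[of "(z, \<zeta>)"] that by (auto simp: square_def)
 have thd: "thick triangle (z, z)" if "z \<in> {0..1}" "z \<notin> {0, 1}" for z using thick_triangle[of "(z, z)"] that by (auto simp: triangle_def)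
 have le: "\<phi> ?R z \<le> \<phi> (Inr j) z" if j: "i \<le> j" and z: "z \<in> {0..1}" for j z
 proof (cases "i = j")
  case False
  then have o: "\<And>z. z \<in> {0..1} \<Longrightarrow> p (Inr j) z < p ?R z" using ord j by simp
  show ?thesis
  proof (cases "z = 0")
   case True then show ?thesis by (simp add: chart.\<phi>0[OF ch])
  next
   case False
   then show ?thesis using chart2.char_decreasing[OF row_kernel.axioms(2)[OF RK[of "Inr j"]] o, of 0 z] z
    by (simp add: chart.\<phi>0[OF ch])
  qed
 qed simp
 let ?dom = "\<lambda>(k :: 'n + 'n) (z::real). case k of Inl _ \<Rightarrow> {0..1} | Inr _ \<Rightarrow> {0..z}"
 have pair: "((\<lambda>\<zeta>. K k z \<zeta> * f \<zeta>) has_integral p ?R z * integral {0..?L k} (\<lambda>y. lift k f y * row.ww fJ gJ U k (\<phi> ?R z - y, \<phi> ?R z + y))) (?dom k z)"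
  if f: "pc01 f" and z: "z \<in> {0..1}" for f k z
 proof (cases "i \<le> ix k")
  case True
  show ?thesis
  proof (cases k)
   case (Inl j)
   show ?thesis using row_kernel.Kf_pairing[OF RK f z, of "Inl j"] True act[of "Inl j"] unfolding Kfd lift_def Inl by simp
  next
   case (Inr j)
   have "i \<le> j" using True Inr by simp
   from row_kernel.Kf_pairing_lower[OF RK le[OF this] f z] show ?thesis
    using True act[of "Inr j"] unfolding Kfd lift_def Inr by simp
  qed
 next
  case False
  then show ?thesis using inact[OF False] by (simp add: lift_def)
 qed
 have pint: "integral (?dom k z) (\<lambda>\<zeta>. K k z \<zeta> * f \<zeta>) = p ?R z * integral {0..?L k} (\<lambda>y. lift k f y * row.ww fJ gJ U k (\<phi> ?R z - y, \<phi> ?R z + y))"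
  if "pc01 f" "z \<in> {0..1}" for f k z using pair[OF that] by (rule integral_unique)
 have Kzero: "K k z \<zeta> = 0" if "z \<in> {0..1}" "\<zeta> \<in> {0..1}" "\<phi> ?R z \<le> \<phi> k \<zeta>" for k z \<zeta>
  using row_kernel.Kf_zero[OF RK that] by (simp add: K_def Kfd)
 have K0: "K k 0 \<zeta> = 0" if "\<zeta> \<in> {0..1}" for k \<zeta>
  by (rule Kzero) (use that chart.\<phi>_le_iff[OF ch, of k 0 \<zeta>] in \<open>auto simp: chart.\<phi>0[OF ch]\<close>)
 have sums: "p ?R z * (\<Sum>k\<in>UNIV. integral {0..?L k} (\<lambda>y. lift k (F k) y * row.ww fJ gJ U k (\<phi> ?R z - y, \<phi> ?R z + y)))
   = (\<Sum>k\<in>UNIV. integral {0..1} (\<lambda>\<zeta>. K (Inl k) z \<zeta> * F (Inl k) \<zeta>)) + (\<Sum>k\<in>UNIV. integral {0..z} (\<lambda>\<zeta>. K (Inr k) z \<zeta> * F (Inr k) \<zeta>))"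
  if F: "\<And>k. pc01 (F k)" and z: "z \<in> {0..1}" for F z
 proof -
  have "p ?R z * (\<Sum>k\<in>UNIV. integral {0..?L k} (\<lambda>y. lift k (F k) y * row.ww fJ gJ U k (\<phi> ?R z - y, \<phi> ?R z + y)))
   = (\<Sum>k\<in>UNIV. integral (?dom k z) (\<lambda>\<zeta>. K k z \<zeta> * F k \<zeta>))"
   unfolding sum_distrib_left by (rule sum.cong) (simp_all only: pint[OF F z])
  also have "\<dots> = (\<Sum>j\<in>UNIV. integral (?dom (Inl j) z) (\<lambda>\<zeta>. K (Inl j) z \<zeta> * F (Inl j) \<zeta>))
   + (\<Sum>j\<in>UNIV. integral (?dom (Inr j) z) (\<lambda>\<zeta>. K (Inr j) z \<zeta> * F (Inr j) \<zeta>))" by (simp only: sum_UNIV_Plus)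
  finally show ?thesis by simp
 qed
 have bottom: "K k z 0 * p k 0 ^ 4 = p ?R z * (p k 0 * row.ww fJ gJ U k (\<phi> ?R z, \<phi> ?R z))" if "i \<le> ix k" for k z
  using row_kernel.Kf_bottom[OF RK, of k z] unfolding Kfd act[OF that] .
 have xr: "0 < \<phi> ?R z" "\<phi> ?R z \<le> ?X" if "z \<in> {0..1}" "z \<noteq> 0" for z
  using that chart.\<phi>_mono[OF ch, of 0 z ?R] chart.\<phi>_le_iff[OF ch, of ?R z 1] by (auto simp: chart.\<phi>0[OF ch])
 show ?thesis
  unfolding row_system_def
 proof (intro exI[of _ K] conjI allI impI, goal_cases)
  case (1 k) then show ?case by (simp add: K_def not_le[symmetric])
 next
  case (2 k D \<psi> a b)
  show ?case
  proof (cases "i \<le> ix k")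
   case True
   from row_kernel.Kf_weak[OF RK 2(3,4)[rule_format] 2(1,2)] show ?thesis unfolding Kfd act[OF True] .
  next
   case False then show ?thesis by (simp add: inact case_prod_beta')
  qed
 next
  case (3 j)
  show ?case
  proof (cases "i \<le> j")
   case True
   then show ?thesis using row_kernel.Kf_pwc_square[OF RK, of "Inl j"] act[of "Inl j"] unfolding Kfd by simp
  next
   case False
   then show ?thesis using inact[of "Inl j"] pwc_zero[of "{}" square] thick_square compact_imp_closed[OF compact_square] by simp
  qed
 next
  case (4 j)
  consider "i < j" | "i = j" | "j < i" by (rule linorder_cases)
  then show ?case
  proof cases
   case 1
   show ?thesis using row_kernel.Kf_pwc_triangle[OF RK ord[OF 1]] act[of "Inr j"] 1 unfolding Kfd by simp
  next
   case 2
   show ?thesis using diag_row_kernel.Kf_pwc_row[OF DK] act[of "Inr j"] 2 unfolding Kfd by simp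
  next
   case 3
   then show ?thesis using inact[of "Inr j"] pwc_zero[OF _ thick_triangle compact_imp_closed[OF compact_triangle]] by (metis finite.emptyI finite.insertI linorder_not_le ix_simps(2))
  qed
 next
  case (5 j)
  show ?case
  proof (cases "i \<le> j")
   case True
   then show ?thesis using row_kernel.reflection_off_finite[OF RK fg(4,5)] act[of "Inl j"] unfolding Kfd by simp
  next
   case False
   then show ?thesis using inact[of "Inl j"] by (intro off_finite_all[of _ "{}"]) (auto simp: pd_zero th)
  qed
 next
  case (6 j \<zeta>) then show ?case by (rule K0)
 next
  case (7 j)
  show ?case
  proof (cases "i \<le> j")
   case True
   then show ?thesis using row_kernel.left_edge_off_finite[OF RK, of "Inl j"] act[of "Inl j"] unfolding Kfd by simp
  next
   case False
   then show ?thesis using inact[of "Inl j"] by (intro off_finite_all[of _ "{}"]) (auto simp: pd_zero th)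
  qed
 next
  case (8 j z)
  show ?case
  proof (cases "i \<le> j")
   case True then show ?thesis using Kzero[of z z "Inr j"] le[OF True] 8 by simp
  next
   case False then show ?thesis using inact[of "Inr j"] by simp
  qed
 next
  case (9 j)
  consider "i < j" | "i = j" | "j < i" by (rule linorder_cases)
  then show ?case
  proof cases
   case 1
   have a: "off_finite {0..1} (\<lambda>z. pd_z triangle (K (Inr j)) z z = 0 \<and> pd_zeta triangle (K (Inr j)) z z = 0)"
    using row_kernel.diagonal_off_finite[OF RK ord[OF 1]] act[of "Inr j"] 1 unfolding Kfd by simp
   show ?thesis by (rule off_finite_combine[OF a a finite.emptyI]) simp
  next
   case 2
   show ?thesis
   proof (rule off_finite_all)
    show "finite ({z. \<phi> ?R z + \<phi> ?R z \<in> S} \<union> {0, 1})"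
     using chart2.finite_char_diag[OF row_kernel.axioms(2)[OF RK[of ?R]] rs.finS] by simp
    fix z assume z: "z \<in> {0..1}" "z \<notin> {z. \<phi> ?R z + \<phi> ?R z \<in> S} \<union> {0, 1}"
    then have "0 < z" "z < 1" "\<phi> ?R z + \<phi> ?R z \<notin> S" by auto
    from diag_row_kernel.Kf_deriv_diag[OF DK this]
    have "pd_zeta triangle (K ?R) z z = - pd_z triangle (K ?R) z z" using act[of ?R] unfolding Kfd by simp
    then show "pd_zeta triangle (K (Inr j)) z z * p (Inr j) z ^ 4 + p ?R z ^ 4 * pd_z triangle (K (Inr j)) z z = 0" using 2 by simp
   qed
  next
   case 3
   then show ?thesis using inact[of "Inr j"] by (intro off_finite_all[of _ "{0, 1}"]) (auto simp: pd_zero thd)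
  qed
 next
  case (10 f k z) then show ?case using pair[of f z "Inl k"] by auto
 next
  case (11 f k z) then show ?case using pair[of f z "Inr k"] by auto
 next
  case (12 j z)
  have s: "p ?R z * (\<Sum>k\<in>UNIV. integral {0..?L k} (\<lambda>y. lift k (B1 k j) y * row.ww fJ gJ U k (\<phi> ?R z - y, \<phi> ?R z + y)))
   = (\<Sum>k\<in>UNIV. integral {0..1} (\<lambda>\<zeta>. K (Inl k) z \<zeta> * Al1 k j \<zeta>)) + (\<Sum>k\<in>UNIV. integral {0..z} (\<lambda>\<zeta>. K (Inr k) z \<zeta> * Ab1 k j \<zeta>))"
   using sums[OF pB1 12(2)] by (simp add: B1_def)
  show ?case
  \<comment> \<open>At x = 0 the coupled system says nothing; here all kernels vanish, and the datum
    does by \<open>Ab10\<close>.\<close>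
  proof (cases "z = 0")
   case True
   have "integral {0..1} (\<lambda>\<zeta>. K (Inl k) 0 \<zeta> * Al1 k j \<zeta>) = 0" for k
    using integral_cong[of "{0..1}" "\<lambda>\<zeta>. K (Inl k) 0 \<zeta> * Al1 k j \<zeta>" "\<lambda>_. 0"] K0 by simp
   then show ?thesis using True K0[of 0] Ab10 by simp
  next
   case False
   have "p ?R z * dat j (\<phi> ?R z) = Ab1 i j z" using pn by (simp add: dat_def chart.inv[OF ch])
   then show ?thesis using arg_cong[OF c1[OF xr[OF 12(2) False], of j], of "\<lambda>x. p ?R z * x"] s 12(1)
    by (simp add: bottom right_diff_distrib distrib_left mult.left_commute)
  qed
 next
  case (13 j)
  have b1: "off_finite {0..1} (\<lambda>z. pd_zeta square (K (Inl j)) z 0 * p (Inl j) 0 ^ 4 + K (Inl j) z 0 * (4 * p (Inl j) 0 ^ 3 * p1 (Inl j) 0)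
   = p ?R z * (1 / p (Inl j) 0 * (- vU U (Inl j) (\<phi> ?R z) - rs.cs U (Inl j) (\<phi> ?R z, \<phi> ?R z) + gU U (Inl j) (\<phi> ?R z) + rs.ct U (Inl j) (\<phi> ?R z, \<phi> ?R z)) + p1 (Inl j) 0 * rs.ww U (Inl j) (\<phi> ?R z, \<phi> ?R z)))"
   using row_kernel.bottom_off_finite[OF RK[of "Inl j"], of square] act[of "Inl j"] 13 unfolding Kfd by simp
  have b2: "off_finite {0..1} (\<lambda>z. pd_zeta triangle (K (Inr j)) z 0 * p (Inr j) 0 ^ 4 + K (Inr j) z 0 * (4 * p (Inr j) 0 ^ 3 * p1 (Inr j) 0)
   = p ?R z * (1 / p (Inr j) 0 * (- vU U (Inr j) (\<phi> ?R z) - rs.cs U (Inr j) (\<phi> ?R z, \<phi> ?R z) + gU U (Inr j) (\<phi> ?R z) + rs.ct U (Inr j) (\<phi> ?R z, \<phi> ?R z)) + p1 (Inr j) 0 * rs.ww U (Inr j) (\<phi> ?R z, \<phi> ?R z)))"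
   using row_kernel.bottom_off_finite[OF RK[of "Inr j"], of triangle] act[of "Inr j"] 13 unfolding Kfd by simp
  show ?case
  proof (rule off_finite_combine[OF b1 b2, of "{0}"], goal_cases)
   case (2 z)
   have s: "p ?R z * (\<Sum>k\<in>UNIV. integral {0..?L k} (\<lambda>y. lift k (B0 k j) y * row.ww fJ gJ U k (\<phi> ?R z - y, \<phi> ?R z + y)))
    = (\<Sum>k\<in>UNIV. integral {0..1} (\<lambda>\<zeta>. K (Inl k) z \<zeta> * Al0 k j \<zeta>)) + (\<Sum>k\<in>UNIV. integral {0..z} (\<lambda>\<zeta>. K (Inr k) z \<zeta> * Ab0 k j \<zeta>))"
    using sums[OF pB0 2(1)] by (simp add: B0_def)
   have "p ?R z * E j (\<phi> ?R z) = - Ab0 i j z" using pn 2(1) by (simp add: E_def chart.inv[OF ch] cut01_def)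
   note Ee = this
   have z0: "z \<noteq> 0" using 2(2) by simp
   have gen: "a * y + a * x = e' + s2 + s1" if "x + y = e + s" "a * s = s1 + s2" "a * e = e'" for a x y e s s1 s2 e' :: real
   proof -
    have "a * y + a * x = a * (x + y)" by (simp add: algebra_simps)
    then show ?thesis using that by (simp add: distrib_left)
   qed
   show ?case unfolding 2(3,4) by (rule gen[OF c2[OF xr[OF 2(1) z0]] s Ee])
  qed simp
 qed
qed

section \<open>Matrix kernels\<close>

lemma matrix_diag_right: "(M ** diag v) $ i $ j = M $ i $ j * v $ j"
 by (simp add: matrix_matrix_mult_def diag_def if_distrib[of "\<lambda>x. _ * x"] cong: if_cong)

lemma matrix_diag_left: "(diag v ** M) $ i $ j = v $ i * M $ i $ j"
 by (simp add: matrix_matrix_mult_def diag_def if_distrib[of "\<lambda>x. x * _"] cong: if_cong)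

lemma matrix_mult_entry: "(M ** N) $ i $ j = (\<Sum>k\<in>UNIV. M $ i $ k * N $ k $ j)"
 by (simp add: matrix_matrix_mult_def)

lemma diag'_eq:
 fixes v :: "real \<Rightarrow> real^'k"
 assumes d: "\<And>i. ((\<lambda>x. v x $ i) has_real_derivative d i) (at z within {0..1})" and z: "z \<in> {0..1}"
 shows "diag' v z = diag (\<chi> i. d i)"
proof -
 have e: "diag u = (\<Sum>i\<in>UNIV. u $ i *\<^sub>R diag (axis i 1))" for u :: "real^'k"
 proof -
  have "(\<Sum>k\<in>UNIV. u $ k * (if i = j then axis k 1 $ i else 0)) = (if i = j then u $ i else 0)" for i j
   by (simp add: axis_def if_distrib[of "\<lambda>x. _ * x"] cong: if_cong)
  then show ?thesis by (simp add: vec_eq_iff diag_def)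
 qed
 have "((\<lambda>x. \<Sum>i\<in>UNIV. v x $ i *\<^sub>R diag (axis i 1)) has_vector_derivative (\<Sum>i\<in>UNIV. d i *\<^sub>R diag (axis i 1 :: real^'k))) (at z within {0..1})"
  by (intro has_vector_derivative_sum bounded_linear.has_vector_derivative[OF bounded_linear_scaleR_left])
   (use d in \<open>simp add: has_real_derivative_iff_has_vector_derivative\<close>)
 then have "((\<lambda>x. diag (v x)) has_vector_derivative diag (\<chi> i. d i)) (at z within {0..1})"
  unfolding e[of "v _"] e[of "\<chi> i. d i"] by simp
 then show ?thesis unfolding diag'_def
  by (intro vector_derivative_within at_within_Icc_nontrivial) (use z in auto)
qed

lemma off_finite_matrix:
 fixes M N :: "'x \<Rightarrow> real^'c^'r"
 assumes "\<And>i j. off_finite A (\<lambda>z. M z $ i $ j = N z $ i $ j)"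
 shows "off_finite A (\<lambda>z. M z = N z)"
 unfolding off_finite_def
proof (rule finite_subset)
 show "{z \<in> A. \<not> M z = N z} \<subseteq> (\<Union>i\<in>UNIV. \<Union>j\<in>UNIV. {z \<in> A. \<not> M z $ i $ j = N z $ i $ j})"
  by (auto simp: vec_eq_iff)
qed (use assms in \<open>simp add: off_finite_def\<close>)

text \<open>At a point of a piece, the partial derivatives of the matrix kernel and of a linear
  functional of it come from the same total derivative. Off finitely many boundary points this links
  the conditions on matrices to those proved for the entries.\<close>

lemma pwc_pd_linear:
 assumes "pwc D K"
 obtains F where "finite F" "\<And>a b l. (a, b) \<in> frontier D \<Longrightarrow> (a, b) \<notin> F \<Longrightarrow> bounded_linear l \<Longrightarrow>
  l (pd_z D K a b) = pd_z D (\<lambda>z \<zeta>. l (K z \<zeta>) :: real) a b \<and> l (pd_zeta D K a b) = pd_zeta D (\<lambda>z \<zeta>. l (K z \<zeta>)) a b"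
proof -
 obtain \<U> where U0: "finite (frontier D - \<Union>\<U>)"
  "\<forall>U\<in>\<U>. openin (top_of_set D) U \<and> (\<forall>p\<in>U. thick D p) \<and> (\<forall>p\<in>U. (\<lambda>(z, \<zeta>). K z \<zeta>) differentiable (at p within D)) \<and>
    uniformly_continuous_on U (\<lambda>(z, \<zeta>). K z \<zeta>) \<and> uniformly_continuous_on U (\<lambda>(z, \<zeta>). pd_z D K z \<zeta>) \<and>
    uniformly_continuous_on U (\<lambda>(z, \<zeta>). pd_zeta D K z \<zeta>)"
  using assms unfolding pwc_def by blast
 have U: "finite (frontier D - \<Union>\<U>)" "\<And>U u. U \<in> \<U> \<Longrightarrow> u \<in> U \<Longrightarrow> thick D u"
  "\<And>U u. U \<in> \<U> \<Longrightarrow> u \<in> U \<Longrightarrow> (\<lambda>(z, \<zeta>). K z \<zeta>) differentiable (at u within D)"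
  using U0 by simp_all
 show ?thesis
 proof (rule that[OF U(1)])
  fix a b and l :: "'a \<Rightarrow> real" assume ab: "(a, b) \<in> frontier D" "(a, b) \<notin> frontier D - \<Union>\<U>" and l: "bounded_linear l"
  then obtain V where V: "V \<in> \<U>" "(a, b) \<in> V" by blast
  obtain f' where f: "((\<lambda>(z, \<zeta>). K z \<zeta>) has_derivative f') (at (a, b) within D)"
   using U(3)[OF V] unfolding differentiable_def by blast
  have g: "((\<lambda>(z, \<zeta>). l (K z \<zeta>)) has_derivative (\<lambda>d. l (f' d))) (at (a, b) within D)"
   using bounded_linear.has_derivative[OF l f] by (simp add: case_prod_beta')
  show "l (pd_z D K a b) = pd_z D (\<lambda>z \<zeta>. l (K z \<zeta>)) a b \<and> l (pd_zeta D K a b) = pd_zeta D (\<lambda>z \<zeta>. l (K z \<zeta>)) a b"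
   by (simp only: pd_eq[OF f U(2)[OF V]] pd_eq[OF g U(2)[OF V]])
 qed
qed

lemma bounded_linear_entry: "bounded_linear (\<lambda>M :: real^'c^'r. M $ i $ j)"
 by (rule bounded_linear_compose[OF bounded_linear_vec_nth bounded_linear_vec_nth])

lemma bounded_linear_matrix_entry: "bounded_linear (\<lambda>M :: real^'b^'a. (M ** D ** S) $ i $ j)"
 unfolding matrix_mult_entry
 by (intro bounded_linear_sum bounded_linear_mult_const bounded_linear_entry)

lemma pwc_edge_pd:
 fixes K :: "real \<Rightarrow> real \<Rightarrow> real^'c^'r" and \<gamma> :: "real \<Rightarrow> real \<times> real"
 assumes K: "pwc D K" and e: "inj_on \<gamma> {0..1}" "\<And>z. z \<in> {0..1} \<Longrightarrow> \<gamma> z \<in> frontier D"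
 shows "off_finite {0..1} (\<lambda>z. \<forall>i j. pd_z D K (fst (\<gamma> z)) (snd (\<gamma> z)) $ i $ j = pd_z D (\<lambda>z \<zeta>. K z \<zeta> $ i $ j) (fst (\<gamma> z)) (snd (\<gamma> z)) \<and>
  pd_zeta D K (fst (\<gamma> z)) (snd (\<gamma> z)) $ i $ j = pd_zeta D (\<lambda>z \<zeta>. K z \<zeta> $ i $ j) (fst (\<gamma> z)) (snd (\<gamma> z)))"
proof -
 obtain F where F: "finite F" "\<And>a b l. (a, b) \<in> frontier D \<Longrightarrow> (a, b) \<notin> F \<Longrightarrow> bounded_linear l \<Longrightarrow>
  l (pd_z D K a b) = pd_z D (\<lambda>z \<zeta>. l (K z \<zeta>) :: real) a b \<and> l (pd_zeta D K a b) = pd_zeta D (\<lambda>z \<zeta>. l (K z \<zeta>)) a b"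
  using pwc_pd_linear[OF K] by blast
 have "finite (\<gamma> -` F \<inter> {0..1})" by (rule finite_vimage_IntI[OF F(1) e(1)])
 then show ?thesis
 proof (rule off_finite_all[rotated], intro allI)
  fix z i j assume z: "z \<in> {0..1}" "z \<notin> \<gamma> -` F \<inter> {0..1}"
  then show "pd_z D K (fst (\<gamma> z)) (snd (\<gamma> z)) $ i $ j = pd_z D (\<lambda>z \<zeta>. K z \<zeta> $ i $ j) (fst (\<gamma> z)) (snd (\<gamma> z)) \<and>
   pd_zeta D K (fst (\<gamma> z)) (snd (\<gamma> z)) $ i $ j = pd_zeta D (\<lambda>z \<zeta>. K z \<zeta> $ i $ j) (fst (\<gamma> z)) (snd (\<gamma> z))"
   using e(2)[OF z(1)] by (intro F(2)[OF _ _ bounded_linear_entry]) auto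
 qed
qed

lemma frontier_edges:
 assumes "z \<in> {0..1}"
 shows "(z, 1) \<in> frontier square" "(0, z) \<in> frontier square" "(z, 0) \<in> frontier square" "(z, 0) \<in> frontier triangle" "(z, z) \<in> frontier triangle"
proof -
 have sq: "interior square = {0<..<1} \<times> {0<..<1}" unfolding square_def by (simp add: interior_Times)
 have tr: "interior triangle \<subseteq> {0<..<1} \<times> {0<..<1}" using interior_mono[OF triangle_sub] by (simp add: interior_Times)
 have cl: "square \<subseteq> closure square" "triangle \<subseteq> closure triangle" by (rule closure_subset)+
 show "(z, 1) \<in> frontier square" "(0, z) \<in> frontier square" "(z, 0) \<in> frontier square"
  using assms cl(1) unfolding frontier_def sq by (auto simp: square_def)
 show "(z, 0) \<in> frontier triangle" using assms cl(2) tr by (auto simp: frontier_def triangle_def)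
 have "(z, z) \<notin> interior triangle"
 proof
  assume "(z, z) \<in> interior triangle"
  then obtain e where e: "e > 0" "ball (z, z) e \<subseteq> triangle" unfolding mem_interior by blast
  have "dist (z, z) (z, z + e / 2) < e" using e(1) by (simp add: dist_Pair_Pair dist_real_def)
  then have "(z, z + e / 2) \<in> triangle" using e(2) by (auto simp: mem_ball)
  then show False using e(1) by (simp add: triangle_def)
 qed
 then show "(z, z) \<in> frontier triangle" using assms cl(2) by (auto simp: frontier_def triangle_def)
qed

lemma matrix_integral:
 fixes F :: "real \<Rightarrow> real^'c^'r"
 assumes "\<And>i j. (\<lambda>x. F x $ i $ j) integrable_on A"
 shows "F integrable_on A" "integral A F $ i $ j = integral A (\<lambda>x. F x $ i $ j)"
proof -
 show F: "F integrable_on A"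
  unfolding integrable_componentwise_iff[of F]
  by (auto simp: Basis_vec_def inner_axis assms)
 show "integral A F $ i $ j = integral A (\<lambda>x. F x $ i $ j)"
  using integral_linear[OF F bounded_linear_entry[of i j]] by (simp add: comp_def)
qed

lemma matrix_product_integral:
 fixes M :: "real \<Rightarrow> real^'b^'a" and N :: "real \<Rightarrow> real^'c^'b"
 assumes "\<And>i k j. (\<lambda>x. M x $ i $ k * N x $ k $ j) integrable_on A"
 shows "(\<lambda>x. M x ** N x) integrable_on A"
  "integral A (\<lambda>x. M x ** N x) $ i $ j = (\<Sum>k\<in>UNIV. integral A (\<lambda>x. M x $ i $ k * N x $ k $ j))"
proof -
 have 1: "(\<lambda>x. (M x ** N x) $ i $ j) integrable_on A" for i j
  unfolding matrix_mult_entry by (intro integrable_sum assms) auto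
 show "(\<lambda>x. M x ** N x) integrable_on A" by (rule matrix_integral(1)[OF 1])
 show "integral A (\<lambda>x. M x ** N x) $ i $ j = (\<Sum>k\<in>UNIV. integral A (\<lambda>x. M x $ i $ k * N x $ k $ j))"
  unfolding matrix_integral(2)[OF 1] matrix_mult_entry by (rule integral_sum) (use assms in auto)
qed

lemma pw_continuous_entry:
 fixes f :: "real \<Rightarrow> real^'c^'r"
 assumes "pw_continuous f" shows "pw_continuous (\<lambda>x. f x $ i $ j)"
 unfolding pw_continuous_def
proof (intro conjI ballI)
 show "off_finite {0..1} (\<lambda>x. continuous (at x within {0..1}) (\<lambda>x. f x $ i $ j))"
  using assms unfolding pw_continuous_def off_finite_def
  by (elim conjE finite_subset[rotated]) (auto intro!: continuous_intros)
 fix x :: real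
 show "\<exists>l. ((\<lambda>x. f x $ i $ j) \<longlongrightarrow> l) (at_right x)" if x: "x \<in> {0..<1}"
 proof -
  have "\<forall>x\<in>{0..<1}. \<exists>l. (f \<longlongrightarrow> l) (at_right x)" using assms unfolding pw_continuous_def by (elim conjE)
  then obtain l where "(f \<longlongrightarrow> l) (at_right x)" using x by blast
  from tendsto_vec_nth[OF tendsto_vec_nth[OF this]] show ?thesis by blast
 qed
 show "\<exists>l. ((\<lambda>x. f x $ i $ j) \<longlongrightarrow> l) (at_left x)" if x: "x \<in> {0<..1}"
 proof -
  have "\<forall>x\<in>{0<..1}. \<exists>l. (f \<longlongrightarrow> l) (at_left x)" using assms unfolding pw_continuous_def by (elim conjE)
  then obtain l where "(f \<longlongrightarrow> l) (at_left x)" using x by blast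
  from tendsto_vec_nth[OF tendsto_vec_nth[OF this]] show ?thesis by blast
 qed
qed

lemma C2_interval_affine_entry:
 fixes f :: "real \<Rightarrow> real^'n"
 assumes f: "C2_interval f" and ab: "\<And>z. z \<in> {0..1} \<Longrightarrow> a + b * z \<in> {0..1}"
 shows "\<exists>l1 l2. (\<forall>z\<in>{0..1}. ((\<lambda>z. f (a + b * z) $ i / c) has_real_derivative l1 z) (at z within {0..1})) \<and>
  (\<forall>z\<in>{0..1}. (l1 has_real_derivative l2 z) (at z within {0..1})) \<and> continuous_on {0..1} l2"
proof -
 obtain f' f'' where f': "\<forall>x\<in>{0..1}. (f has_vector_derivative f' x) (at x within {0..1})"
  "\<forall>x\<in>{0..1}. (f' has_vector_derivative f'' x) (at x within {0..1})" "continuous_on {0..1} f''"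
  using f unfolding C2_interval_def by blast
 have chain: "((\<lambda>z. g (a + b * z) $ i / c) has_real_derivative b * g' (a + b * z) $ i / c) (at z within {0..1})"
  if g: "\<forall>x\<in>{0..1}. (g has_vector_derivative g' x) (at x within {0..1})" and z: "z \<in> {0..1}" for g g' :: "real \<Rightarrow> real^'n" and z
 proof -
  have 1: "((\<lambda>z. a + b * z) has_vector_derivative b) (at z within {0..1})"
   unfolding has_real_derivative_iff_has_vector_derivative[symmetric] by (auto intro!: derivative_eq_intros)
  have 2: "(g has_vector_derivative g' (a + b * z)) (at (a + b * z) within (\<lambda>z. a + b * z) ` {0..1})"
   by (rule has_vector_derivative_within_subset[of g _ _ "{0..1}"]) (use g ab z in auto)
  have "((\<lambda>z. (g (a + b * z)) $ i / c) has_vector_derivative (b *\<^sub>R g' (a + b * z)) $ i / c) (at z within {0..1})"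
   by (rule bounded_linear.has_vector_derivative[of "\<lambda>v. v $ i / c", OF _ vector_diff_chain_within[OF 1 2, unfolded comp_def]])
    (rule bounded_linear_compose[OF bounded_linear_divide bounded_linear_vec_nth])
  then show ?thesis by (simp add: has_real_derivative_iff_has_vector_derivative)
 qed
 let ?l1 = "\<lambda>z. b * f' (a + b * z) $ i / c" and ?l2 = "\<lambda>z. b * (b * f'' (a + b * z) $ i / c)"
 show ?thesis
 proof (rule exI[of _ ?l1], rule exI[of _ ?l2], intro conjI ballI)
  fix z :: real assume z: "z \<in> {0..1}"
  show "((\<lambda>z. f (a + b * z) $ i / c) has_real_derivative ?l1 z) (at z within {0..1})" by (rule chain[OF f'(1) z])
  show "(?l1 has_real_derivative ?l2 z) (at z within {0..1})"
   using DERIV_cmult[OF chain[OF f'(2) z], of b] by simp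
 next
  show "continuous_on {0..1} ?l2"
  proof -
   have "continuous_on {0..1} (\<lambda>z. f'' (a + b * z))"
    by (rule continuous_on_compose2[OF f'(3)]) (use ab in \<open>auto intro!: continuous_intros\<close>)
   then show ?thesis unfolding divide_inverse by (intro continuous_intros)
  qed
 qed
qed

lemma fold_lam_C2:
 fixes lamc :: "real \<Rightarrow> real^'n"
 assumes "C2_interval lamc" and y0: "0 < y0" "y0 < 1"
 shows "\<exists>l1 l2. (\<forall>z\<in>{0..1}. ((\<lambda>z. fold_lam y0 lamc z $ k) has_real_derivative l1 z) (at z within {0..1})) \<and>
  (\<forall>z\<in>{0..1}. (l1 has_real_derivative l2 z) (at z within {0..1})) \<and> continuous_on {0..1} l2"
proof (cases k)
 case (Inl i)
 have "y0 + - y0 * z \<in> {0..1}" if "z \<in> {0..1}" for z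
 proof -
  have "0 \<le> y0 * z" "y0 * z \<le> y0 * 1" using that y0 by (auto intro!: mult_nonneg_nonneg mult_left_mono)
  then show ?thesis using y0 by simp
 qed
 from C2_interval_affine_entry[OF assms(1) this, of i "y0\<^sup>2"] show ?thesis by (simp add: fold_lam_def Inl)
next
 case (Inr i)
 have "y0 + (1 - y0) * z \<in> {0..1}" if "z \<in> {0..1}" for z
 proof -
  have "0 \<le> (1 - y0) * z" "(1 - y0) * z \<le> (1 - y0) * 1" using that y0 by (auto intro!: mult_nonneg_nonneg mult_left_mono)
  then show ?thesis using y0 by (simp add: algebra_simps)
 qed
 from C2_interval_affine_entry[OF assms(1) this, of i "(1 - y0)\<^sup>2"] show ?thesis by (simp add: fold_lam_def Inr)
qed

lemma S1_entry: "(M ** S1 zt0) $ k $ j = - zt0 * M $ k $ Inl j + M $ k $ Inr j"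
 unfolding matrix_mult_entry sum_UNIV_Plus
 by (simp add: S1_def if_distrib[of "\<lambda>x. _ * x"] cong: if_cong)

lemma S2_entry: "(M ** S2) $ k $ j = M $ k $ Inl j + M $ k $ Inr j"
 unfolding matrix_mult_entry sum_UNIV_Plus
 by (simp add: S2_def if_distrib[of "\<lambda>x. _ * x"] cong: if_cong)

text \<open>The given matrices inherit their regularity from K through the conditions at \<zeta> =
  0. Since their upper right blocks vanish, the products with \<open>S1\<close> and
  \<open>S2\<close> contain, up to constant factors, the left blocks alone in the first rows and
  precisely the combinations that define \<open>Ab1\<close> and \<open>Ab0\<close> in the last rows.
  The value 0 at z = 0 comes from K(0, 0) = 0.\<close>

lemma kernel_K_data:
 fixes K :: "real \<Rightarrow> real \<Rightarrow> real^('n+'n)^('n+'n::{finite,linorder})"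
 assumes K: "kernel_K lam A mu zt0 K At0 At1" and zt0: "0 < zt0"
 shows "pc01 (\<lambda>z. block_l (At0 z) $ i $ j)" "pc01 (\<lambda>z. block_l (At1 z) $ i $ j)"
  "pc01 (\<lambda>z. (block_lr (At0 z) + block_r (At0 z)) $ i $ j)"
  "pc01 (\<lambda>z. (block_lr (At1 z) - (1 / zt0) *\<^sub>R block_r (At1 z)) $ i $ j)"
  "(block_lr (At1 0) - (1 / zt0) *\<^sub>R block_r (At1 0)) $ i $ j = 0"
proof -
 have sl: "At0 z $ Inl i $ Inr j = 0" "At1 z $ Inl i $ Inr j = 0" if "z \<in> {0..1}" for z
  using K that unfolding kernel_K_def strictly_lower_def by (auto simp: less_eq_sum_def)
 have pw: "pw_C1 triangle K" and K0: "K 0 0 = 0"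
  and e1: "\<And>z. z \<in> {0..1} \<Longrightarrow> K z 0 ** diag (lam 0) ** S1 zt0 + At1 z ** S1 zt0 = 0"
  and e0: "off_finite {0..1} (\<lambda>z. pd_zeta triangle K z 0 ** diag (lam 0) ** S2 + K z 0 ** diag' lam 0 ** S2 - At0 z ** S2 = 0)"
  using K unfolding kernel_K_def by blast+
 let ?k1 = "\<lambda>z k. (K z 0 ** diag (lam 0) ** S1 zt0) $ k $ j"
 let ?k0 = "\<lambda>z k. (pd_zeta triangle K z 0 ** diag (lam 0) ** S2) $ k $ j + (K z 0 ** diag' lam 0 ** S2) $ k $ j"
 have p1: "pc01 (\<lambda>z. ?k1 z k)" for k by (rule pw_C1_bottom_edge(1)[OF pw bounded_linear_matrix_entry])
 have p0: "pc01 (\<lambda>z. ?k0 z k)" for k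
  by (intro pc01_add pw_C1_bottom_edge[OF pw bounded_linear_matrix_entry])
 have E1: "?k1 z k = zt0 * At1 z $ k $ Inl j - At1 z $ k $ Inr j" if "z \<in> {0..1}" for z k
  using arg_cong[OF e1[OF that], of "\<lambda>M. M $ k $ j"] by (simp add: S1_entry)
 let ?N = "{z \<in> {0..1}. pd_zeta triangle K z 0 ** diag (lam 0) ** S2 + K z 0 ** diag' lam 0 ** S2 - At0 z ** S2 \<noteq> 0}"
 have N: "finite ?N" using e0 by (simp add: off_finite_def)
 have E0: "?k0 z k = At0 z $ k $ Inl j + At0 z $ k $ Inr j" if "z \<in> {0..1} - ?N" for z k
 proof -
  have "pd_zeta triangle K z 0 ** diag (lam 0) ** S2 + K z 0 ** diag' lam 0 ** S2 - At0 z ** S2 = 0" using that by blast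
  from arg_cong[OF this, of "\<lambda>M. M $ k $ j"] show ?thesis by (simp add: S2_entry[of "At0 z"])
 qed
 show "pc01 (\<lambda>z. block_l (At0 z) $ i $ j)"
  by (rule pc01_off_finite[OF p0[of "Inl i"] N]) (use E0[of _ "Inl i"] sl in \<open>simp add: block_l_def\<close>)
 show "pc01 (\<lambda>z. (block_lr (At0 z) + block_r (At0 z)) $ i $ j)"
  by (rule pc01_off_finite[OF p0[of "Inr i"] N]) (simp add: E0 block_lr_def block_r_def del: Diff_iff)
 show "pc01 (\<lambda>z. block_l (At1 z) $ i $ j)"
  by (rule pc01_off_finite[OF pc01_cmult[OF p1[of "Inl i"], of "1 / zt0"] finite.emptyI])
   (use zt0 in \<open>simp add: E1 sl block_l_def\<close>)
 have A: "1 / zt0 * ?k1 z (Inr i) = (block_lr (At1 z) - (1 / zt0) *\<^sub>R block_r (At1 z)) $ i $ j" if "z \<in> {0..1}" for z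
  using zt0 unfolding E1[OF that] by (simp add: block_lr_def block_r_def field_simps)
 show "pc01 (\<lambda>z. (block_lr (At1 z) - (1 / zt0) *\<^sub>R block_r (At1 z)) $ i $ j)"
  by (rule pc01_off_finite[OF pc01_cmult[OF p1[of "Inr i"], of "1 / zt0"] finite.emptyI]) (use A in blast)
 show "(block_lr (At1 0) - (1 / zt0) *\<^sub>R block_r (At1 0)) $ i $ j = 0"
  using A[of 0] K0 by (simp add: matrix_mult_entry)
qed

section \<open>Assembly of the matrix kernels\<close>

theorem theorem4:
  fixes lamc :: "real \<Rightarrow> real^('n::{finite,linorder})"
    and Ac :: "real \<Rightarrow> real^('n::{finite,linorder})^('n::{finite,linorder})"
    and y0 mu lo hi zt0 :: real
    and lam :: "real \<Rightarrow> real^('n+'n)"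
    and A :: "real \<Rightarrow> real^('n+'n)^('n+'n)"
    and K :: "real \<Rightarrow> real \<Rightarrow> real^('n+'n)^('n+'n)"
    and At0 At1 :: "real \<Rightarrow> real^('n+'n)^('n+'n)"
    and Ab0 Ab1 :: "real \<Rightarrow> real^('n::{finite,linorder})^('n::{finite,linorder})"
  assumes lamc_C2: "C2_interval lamc"
    and bounds: "0 < lo" "0 < hi" "\<And>y i. y \<in> {0..1} \<Longrightarrow> lo \<le> lamc y $ i \<and> lamc y $ i \<le> hi"
    and lamc_order: "\<And>y i j. y \<in> {0..1} \<Longrightarrow> i < j \<Longrightarrow> lamc y $ i > lamc y $ j"
    and Ac_cont: "continuous_on {0..1} Ac"
    and y0: "0 < y0" "y0 < 1"
    and zt0: "zt0 = y0 / (1 - y0)"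
    and lam: "lam = fold_lam y0 lamc"
    and A: "A = fold_A y0 Ac"
    and lam_order: "\<And>z i j. z \<in> {0..1} \<Longrightarrow> i < j \<Longrightarrow> lam z $ i > lam z $ j"
    and lam_pos: "\<And>z i. z \<in> {0..1} \<Longrightarrow> lam z $ i > 0"
    and K: "kernel_K lam A mu zt0 K At0 At1"
    and Ab0: "Ab0 = (\<lambda>z. block_lr (At0 z) + block_r (At0 z))"
    and Ab1: "Ab1 = (\<lambda>z. block_lr (At1 z) - (1 / zt0) *\<^sub>R block_r (At1 z))"
    and Ab1_deriv: "pw_continuous_deriv Ab1"
  shows "\<exists>P Q Acr0 Acr1.
     (\<forall>z\<in>{0..1}. strictly_lower (Acr0 z) \<and> strictly_lower (Acr1 z)) \<and>
     kernel_PQ (lam_l lam) (lam_r lam) zt0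
       (\<lambda>z. block_l (At0 z)) (\<lambda>z. block_l (At1 z)) Ab0 Ab1 P Q Acr0 Acr1"
proof -
 have zt: "0 < zt0" using y0 zt0 by simp
 have ex: "\<exists>p p1 p2 \<phi> \<xi>. chart p p1 p2 \<phi> \<xi> \<and> (\<forall>z\<in>{0..1}. p z = lam z $ k powr (1/4))" for k
 proof -
  obtain l1 l2 where l: "\<forall>z\<in>{0..1}. ((\<lambda>z. lam z $ k) has_real_derivative l1 z) (at z within {0..1})"
   "\<forall>z\<in>{0..1}. (l1 has_real_derivative l2 z) (at z within {0..1})" "continuous_on {0..1} l2"
   using fold_lam_C2[OF lamc_C2 y0, of k] unfolding lam by blast
  show ?thesis by (rule chart_exists[where ?l1.0=l1 and ?l2.0=l2]) (use l lam_pos in auto)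
 qed
 have "\<exists>c. \<forall>k. case c k of (p, p1, p2, \<phi>, \<xi>) \<Rightarrow> chart p p1 p2 \<phi> \<xi> \<and> (\<forall>z\<in>{0..1}. p z = lam z $ k powr (1/4))"
  by (rule choice) (use ex in force)
 then obtain c where c: "\<And>k. case c k of (p, p1, p2, \<phi>, \<xi>) \<Rightarrow> chart p p1 p2 \<phi> \<xi> \<and> (\<forall>z\<in>{0..1}. p z = lam z $ k powr (1/4))" by blast
 define p p1 p2 \<phi> \<xi> where "p k = fst (c k)" and "p1 k = fst (snd (c k))" and "p2 k = fst (snd (snd (c k)))"
  and "\<phi> k = fst (snd (snd (snd (c k))))" and "\<xi> k = snd (snd (snd (snd (c k))))" for k
 have ch: "chart (p k) (p1 k) (p2 k) (\<phi> k) (\<xi> k)" and pl: "z \<in> {0..1} \<Longrightarrow> p k z = lam z $ k powr (1/4)" for k z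
  using c[of k] by (auto simp: p_def p1_def p2_def \<phi>_def \<xi>_def case_prod_beta')
 have p4: "lam z $ k = p k z ^ 4" if "z \<in> {0..1}" for z k
  using lam_pos[OF that, of k] by (simp add: pl[OF that] powr_power)
 \<comment> \<open>Columns to the right of i have smaller coefficients, hence longer travel times
   than row i; this makes the entries of Q above the diagonal vanish along \<zeta> = z.\<close>
 have ord: "p (Inr j) z < p (Inr i) z" if "i < j" "z \<in> {0..1}" for i j z
 proof -
  have "(Inr i :: 'n + 'n) < Inr j" using that(1) by (auto simp: less_sum_def less_eq_sum_def)
  from lam_order[OF that(2) this] show ?thesis
   unfolding pl[OF that(2)] by (intro powr_less_mono2) (use lam_pos[OF that(2)] in \<open>auto intro: less_imp_le\<close>)
 qed
 have dl: "((\<lambda>x. lam x $ k) has_real_derivative 4 * p k z ^ 3 * p1 k z) (at z within {0..1})" if z: "z \<in> {0..1}" for k z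
 proof -
  have "((\<lambda>x. p k x ^ 4) has_real_derivative 4 * p k z ^ 3 * p1 k z) (at z within {0..1})"
   using DERIV_power[OF chart.dp[OF ch[of k] z], of 4] by (simp add: mult_ac)
  then show ?thesis by (rule has_field_derivative_transform_within[OF _ zero_less_one z]) (simp add: p4)
 qed
 have dr: "diag' (lam_r lam) z = diag (\<chi> j. 4 * p (Inr j) z ^ 3 * p1 (Inr j) z)"
  and dll: "diag' (lam_l lam) z = diag (\<chi> j. 4 * p (Inl j) z ^ 3 * p1 (Inl j) z)" if "z \<in> {0..1}" for z
  by (rule diag'_eq[OF _ that]; simp add: lam_r_def lam_l_def dl[OF that])+
 have lr: "lam_r lam z $ j = p (Inr j) z ^ 4" and ll: "lam_l lam z $ j = p (Inl j) z ^ 4" if "z \<in> {0..1}" for z j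
  by (simp_all add: lam_r_def lam_l_def p4[OF that])
 define al0 al1 ab0 ab1 where "al0 k j z = block_l (At0 z) $ k $ j" and "al1 k j z = block_l (At1 z) $ k $ j"
  and "ab0 k j z = Ab0 z $ k $ j" and "ab1 k j z = Ab1 z $ k $ j" for k j z
 have pcd: "pc01 (al0 k j)" "pc01 (al1 k j)" "pc01 (ab0 k j)" "pc01 (ab1 k j)" and ab10: "ab1 k j 0 = 0" for k j
  using kernel_K_data[OF K zt, of k j] unfolding al0_def[abs_def] al1_def[abs_def] ab0_def[abs_def] ab1_def[abs_def] Ab0 Ab1 by blast+
 obtain f' where f': "off_finite {0..1} (\<lambda>x. (Ab1 has_vector_derivative f' x) (at x within {0..1}))" "pw_continuous f'"
  using Ab1_deriv unfolding pw_continuous_deriv_def by blast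
 let ?N = "{x \<in> {0..1}. \<not> (Ab1 has_vector_derivative f' x) (at x within {0..1})}"
 have N: "finite ?N" using f'(1) by (simp add: off_finite_def)
 have dab: "(ab1 i j has_real_derivative f' z $ i $ j) (at z)" if "z \<in> {0<..<1} - ?N" for i j z
 proof -
  have "(Ab1 has_vector_derivative f' z) (at z within {0..1})" using that by auto
  then have "(Ab1 has_vector_derivative f' z) (at z)" using that at_within_Icc_at[of 0 z 1] by simp
  from bounded_linear.has_vector_derivative[OF bounded_linear_entry[of i j] this] show ?thesis
   by (simp add: has_real_derivative_iff_has_vector_derivative ab1_def[abs_def])
 qed
 have "\<exists>K. row_system p p1 zt0 al0 al1 ab0 ab1 i K" for i
  by (rule row_kernels_exist[where p=p and ?p1.0=p1 and ?p2.0=p2 and \<phi>=\<phi> and \<xi>=\<xi> and i=i and ?zt0.0=zt0 and ?Al0.0=al0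
    and ?Al1.0=al1 and ?Ab0.0=ab0 and ?Ab1.0=ab1 and dA="\<lambda>j z. f' z $ i $ j" and N="?N", OF ch ord zt pcd pw_continuous_pc01[OF pw_continuous_entry[OF f'(2)]] N dab ab10])
 then obtain KK where KK: "\<And>i. row_system p p1 zt0 al0 al1 ab0 ab1 i (KK i)" by metis
 \<comment> \<open>The conjuncts of \<open>row_system\<close> are named r1 to r13 in their
   order.\<close>
 note R1 = KK[unfolded row_system_def]
 note r1 = R1[THEN conjunct1, rule_format] and R2 = R1[THEN conjunct2]
 note r2 = R2[THEN conjunct1, rule_format] and R3 = R2[THEN conjunct2]
 note r3 = R3[THEN conjunct1, rule_format] and R4 = R3[THEN conjunct2]
 note r4 = R4[THEN conjunct1, rule_format] and R5 = R4[THEN conjunct2]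
 note r5 = R5[THEN conjunct1, rule_format] and R6 = R5[THEN conjunct2]
 note r6 = R6[THEN conjunct1, rule_format] and R7 = R6[THEN conjunct2]
 note r7 = R7[THEN conjunct1, rule_format] and R8 = R7[THEN conjunct2]
 note r8 = R8[THEN conjunct1, rule_format] and R9 = R8[THEN conjunct2]
 note r9 = R9[THEN conjunct1, rule_format] and R10 = R9[THEN conjunct2]
 note r10 = R10[THEN conjunct1, rule_format] and R11 = R10[THEN conjunct2]
 note r11 = R11[THEN conjunct1, rule_format] and R12 = R11[THEN conjunct2]
 note r12 = R12[THEN conjunct1, rule_format] and r13 = R12[THEN conjunct2, rule_format]
 define P :: "real \<Rightarrow> real \<Rightarrow> real^('n::{finite,linorder})^('n::{finite,linorder})" where "P z \<zeta> = (\<chi> i j. KK i (Inl j) z \<zeta>)" for z \<zeta>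
 define Q :: "real \<Rightarrow> real \<Rightarrow> real^('n::{finite,linorder})^('n::{finite,linorder})" where "Q z \<zeta> = (\<chi> i j. KK i (Inr j) z \<zeta>)" for z \<zeta>
 have Pe: "P z \<zeta> $ i $ j = KK i (Inl j) z \<zeta>" and Qe: "Q z \<zeta> $ i $ j = KK i (Inr j) z \<zeta>" for z \<zeta> i j
  by (simp_all add: P_def Q_def)
 have pP: "pwc square P"
  by (rule pwc_matrix[where E="{}"]) (use r3 thick_square compact_imp_closed[OF compact_square] in \<open>simp_all add: Pe\<close>)
 have pQ: "pwc triangle Q"
  by (rule pwc_matrix[where E="{(0,0),(1,1)}", OF _ _ thick_triangle compact_imp_closed[OF compact_triangle]]) (use r4 in \<open>simp_all add: Qe\<close>)
 note edge_P1 = pwc_edge_pd[OF pP, of "\<lambda>z. (z, 1)", OF inj_onI frontier_edges(1), simplified, unfolded Pe]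
 note edge_P2 = pwc_edge_pd[OF pP, of "\<lambda>z. (0, z)", OF inj_onI frontier_edges(2), simplified, unfolded Pe]
 note edge_P3 = pwc_edge_pd[OF pP, of "\<lambda>z. (z, 0)", OF inj_onI frontier_edges(3), simplified, unfolded Pe]
 note edge_Q1 = pwc_edge_pd[OF pQ, of "\<lambda>z. (z, 0)", OF inj_onI frontier_edges(4), simplified, unfolded Qe]
 note edge_Q2 = pwc_edge_pd[OF pQ, of "\<lambda>z. (z, z)", OF inj_onI frontier_edges(5), simplified, unfolded Qe]
 have mz: "(0 :: real^('n::{finite,linorder})^('n::{finite,linorder})) ** M = 0" "M ** (0 :: real^('n::{finite,linorder})^('n::{finite,linorder})) = 0" for M by (simp_all add: vec_eq_iff matrix_mult_entry)
 have Qd: "Q z z = 0" if "z \<in> {0..1}" for z using r8[OF that] by (simp add: vec_eq_iff Qe)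
 have P0: "P 0 \<zeta> = 0" if "\<zeta> \<in> {0..1}" for \<zeta> using r6[OF that] by (simp add: vec_eq_iff Pe)
 \<comment> \<open>Q vanishes on the whole diagonal, so the total derivative of Q(z, z) drops out of
   the boundary condition.\<close>
 have vd: "vector_derivative (\<lambda>x. Q x x) (at z within {0..1}) = 0" if z: "z \<in> {0..1}" for z
 proof (rule vector_derivative_within)
  show "at z within {0..1} \<noteq> bot" by (rule at_within_Icc_nontrivial) (use z in auto)
  show "((\<lambda>x. Q x x) has_vector_derivative 0) (at z within {0..1})"
   by (rule has_vector_derivative_transform[OF z _ has_vector_derivative_const[of 0]]) (simp add: Qd)
 qed
 have iP0: "(\<lambda>\<zeta>. P z \<zeta> $ i $ k * block_l (At0 \<zeta>) $ k $ j) integrable_on {0..1}"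
  and iP1: "(\<lambda>\<zeta>. P z \<zeta> $ i $ k * block_l (At1 \<zeta>) $ k $ j) integrable_on {0..1}"
  and iQ0: "(\<lambda>\<zeta>. Q z \<zeta> $ i $ k * Ab0 \<zeta> $ k $ j) integrable_on {0..z}"
  and iQ1: "(\<lambda>\<zeta>. Q z \<zeta> $ i $ k * Ab1 \<zeta> $ k $ j) integrable_on {0..z}" if "z \<in> {0..1}" for z i k j
  using r10[OF pcd(1) that, of i k k j] r10[OF pcd(2) that, of i k k j] r11[OF pcd(3) that, of i k k j] r11[OF pcd(4) that, of i k k j]
  unfolding al0_def al1_def ab0_def ab1_def Pe Qe by auto
 note mP0 = matrix_product_integral[OF iP0, unfolded Pe] and mP1 = matrix_product_integral[OF iP1, unfolded Pe]
  and mQ0 = matrix_product_integral[OF iQ0, unfolded Qe] and mQ1 = matrix_product_integral[OF iQ1, unfolded Qe]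
 \<comment> \<open>Below the diagonal the entries of P and Q are 0, so there the coupling conditions
   merely define the free matrices; the integrals remain, because matrix products involve the other
   entries of the row.\<close>
 define Acr1 :: "real \<Rightarrow> real^('n::{finite,linorder})^('n::{finite,linorder})" where "Acr1 z = (\<chi> i j. if j < i then zt0 * (integral {0..z} (\<lambda>\<zeta>. Q z \<zeta> ** Ab1 \<zeta>) $ i $ j
  + integral {0..1} (\<lambda>\<zeta>. P z \<zeta> ** block_l (At1 \<zeta>)) $ i $ j - Ab1 z $ i $ j) else 0)" for z
 define Acr0 :: "real \<Rightarrow> real^('n::{finite,linorder})^('n::{finite,linorder})" where "Acr0 z = (\<chi> i j. if j < i then Ab0 z $ i $ j - integral {0..z} (\<lambda>\<zeta>. Q z \<zeta> ** Ab0 \<zeta>) $ i $ j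
  - integral {0..1} (\<lambda>\<zeta>. P z \<zeta> ** block_l (At0 \<zeta>)) $ i $ j else 0)" for z
 have off: "KK i (Inl j) = (\<lambda>_ _. 0)" "KK i (Inr j) = (\<lambda>_ _. 0)" if "j < i" for i j
  using r1[of "Inl j" i] r1[of "Inr j" i] that by simp_all
 have "kernel_PQ (lam_l lam) (lam_r lam) zt0 (\<lambda>z. block_l (At0 z)) (\<lambda>z. block_l (At1 z)) Ab0 Ab1 P Q Acr0 Acr1"
  unfolding kernel_PQ_def
 proof (intro conjI, goal_cases)
  case 1 show ?case by (rule pwc_imp_pw_C1[OF pP])
 next
  case 2 show ?case by (rule pwc_imp_pw_C1[OF pQ])
 next
  case 3
  show ?case unfolding weak_kernel_pde_def Pe
  proof (intro allI impI)
   fix \<psi> i j assume "test_function square \<psi>"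
   from r2[OF square_sub this, of "\<lambda>z. lam_r lam z $ i" i "\<lambda>z. lam_l lam z $ j" "Inl j"]
   show "integral square (\<lambda>(z, \<zeta>). KK i (Inl j) z \<zeta> * Dz (Dz (\<lambda>z \<zeta>. lam_r lam z $ i * \<psi> z \<zeta>)) z \<zeta>
    - KK i (Inl j) z \<zeta> * lam_l lam \<zeta> $ j * Dzeta (Dzeta \<psi>) z \<zeta>) = integral square (\<lambda>(z, \<zeta>). (0::real^('n::{finite,linorder})^('n::{finite,linorder})) $ i $ j * \<psi> z \<zeta>)"
    by (simp add: lr ll case_prod_beta')
  qed
 next
  case 4
  show ?case
  proof (rule off_finite_matrix)
   fix i j
   show "off_finite {0..1} (\<lambda>z. (pd_zeta square P z 1 ** diag (lam_l lam 1) + P z 1 ** diag' (lam_l lam) 1) $ i $ j = 0 $ i $ j)"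
    by (rule off_finite_combine[OF edge_P1 r5[of i j] finite.emptyI]) (simp add: matrix_diag_right dll ll Pe)
  qed
 next
  case 5 show ?case using P0 by blast
 next
  case 6
  show ?case
  proof (rule off_finite_matrix)
   show "off_finite {0..1} (\<lambda>\<zeta>. pd_z square P 0 \<zeta> $ i $ j = 0 $ i $ j)" for i j
    by (rule off_finite_combine[OF edge_P2 r7[of i j] finite.emptyI]) simp
  qed
 next
  case 7
  show ?case unfolding weak_kernel_pde_def Qe
  proof (intro allI impI)
   fix \<psi> i j assume "test_function triangle \<psi>"
   from r2[OF triangle_sub this, of "\<lambda>z. lam_r lam z $ i" i "\<lambda>z. lam_r lam z $ j" "Inr j"]
   show "integral triangle (\<lambda>(z, \<zeta>). KK i (Inr j) z \<zeta> * Dz (Dz (\<lambda>z \<zeta>. lam_r lam z $ i * \<psi> z \<zeta>)) z \<zeta>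
    - KK i (Inr j) z \<zeta> * lam_r lam \<zeta> $ j * Dzeta (Dzeta \<psi>) z \<zeta>) = integral triangle (\<lambda>(z, \<zeta>). (0::real^('n::{finite,linorder})^('n::{finite,linorder})) $ i $ j * \<psi> z \<zeta>)"
    by (simp add: lr case_prod_beta')
  qed
 next
  case 8
  show ?case
  proof (rule off_finite_matrix)
   fix i j
   show "off_finite {0..1} (\<lambda>z. (pd_zeta triangle Q z z ** diag (lam_r lam z) + Q z z ** diag' (lam_r lam) z
    + diag (lam_r lam z) ** vector_derivative (\<lambda>x. Q x x) (at z within {0..1}) + diag (lam_r lam z) ** pd_z triangle Q z z) $ i $ j = 0 $ i $ j)"
    by (rule off_finite_combine[OF edge_Q2 r9[of i j] finite.emptyI]) (simp add: matrix_diag_right matrix_diag_left Qd vd lr mz)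
  qed
 next
  case 9 show ?case by (simp add: Qd mz)
 next
  case 10 show ?case by (simp add: Qd)
 next
  case 11 show ?case using mP0(1) mP1(1) mQ0(1) mQ1(1) by blast
 next
  case 12
  show ?case
  proof
   fix z :: real assume z: "z \<in> {0..1}"
   have "(P z 0 ** diag (lam_l lam 0) - (1 / zt0) *\<^sub>R (Q z 0 ** diag (lam_r lam 0))) $ i $ j
   = (Ab1 z - integral {0..z} (\<lambda>\<zeta>. Q z \<zeta> ** Ab1 \<zeta>)
    - integral {0..1} (\<lambda>\<zeta>. P z \<zeta> ** block_l (At1 \<zeta>)) + (1 / zt0) *\<^sub>R Acr1 z) $ i $ j" for i j
   proof (cases "j < i")
    case True
    then show ?thesis using zt by (simp add: matrix_diag_right Pe Qe off Acr1_def field_simps)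
   next
    case False
    then have "i \<le> j" by simp
    from r12[OF this z] False show ?thesis
     by (simp add: matrix_diag_right Pe Qe Acr1_def mP1(2)[OF z] mQ1(2)[OF z] ll lr ab1_def al1_def)
   qed
   then show "P z 0 ** diag (lam_l lam 0) - (1 / zt0) *\<^sub>R (Q z 0 ** diag (lam_r lam 0))
   = Ab1 z - integral {0..z} (\<lambda>\<zeta>. Q z \<zeta> ** Ab1 \<zeta>)
    - integral {0..1} (\<lambda>\<zeta>. P z \<zeta> ** block_l (At1 \<zeta>)) + (1 / zt0) *\<^sub>R Acr1 z"
    by (simp only: vec_eq_iff) blast
  qed
 next
  case 13
  show ?case
  proof (rule off_finite_matrix)
   fix i j
   have e: "off_finite {0..1} (\<lambda>z. pd_zeta triangle Q z 0 $ i $ j = pd_zeta triangle (KK i (Inr j)) z 0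
     \<and> pd_zeta square P z 0 $ i $ j = pd_zeta square (KK i (Inl j)) z 0)"
    by (rule off_finite_combine[OF edge_Q1 edge_P3 finite.emptyI]) simp
   show "off_finite {0..1} (\<lambda>z. (pd_zeta triangle Q z 0 ** diag (lam_r lam 0) + Q z 0 ** diag' (lam_r lam) 0
   + pd_zeta square P z 0 ** diag (lam_l lam 0) + P z 0 ** diag' (lam_l lam) 0) $ i $ j
   = (- Ab0 z + integral {0..z} (\<lambda>\<zeta>. Q z \<zeta> ** Ab0 \<zeta>)
    + integral {0..1} (\<lambda>\<zeta>. P z \<zeta> ** block_l (At0 \<zeta>)) + Acr0 z) $ i $ j)"
   proof (cases "j < i")
    case True
    show ?thesis
    proof (rule off_finite_combine[OF e e fin01])
     fix z assume z: "z \<in> {0..1}" "z \<notin> {0, 1}"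
      and e: "pd_zeta triangle Q z 0 $ i $ j = pd_zeta triangle (KK i (Inr j)) z 0
     \<and> pd_zeta square P z 0 $ i $ j = pd_zeta square (KK i (Inl j)) z 0"
     have "thick triangle (z, 0)" "thick square (z, 0)"
      using z thick_triangle[of "(z, 0)"] thick_square[of "(z, 0)"] by (auto simp: triangle_def square_def)
     then show "(pd_zeta triangle Q z 0 ** diag (lam_r lam 0) + Q z 0 ** diag' (lam_r lam) 0
   + pd_zeta square P z 0 ** diag (lam_l lam 0) + P z 0 ** diag' (lam_l lam) 0) $ i $ j
   = (- Ab0 z + integral {0..z} (\<lambda>\<zeta>. Q z \<zeta> ** Ab0 \<zeta>)
    + integral {0..1} (\<lambda>\<zeta>. P z \<zeta> ** block_l (At0 \<zeta>)) + Acr0 z) $ i $ j"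
      using e True by (simp add: off pd_zero matrix_diag_right dr dll Pe Qe Acr0_def)
    qed
   next
    case False
    then have ij: "i \<le> j" by simp
    show ?thesis
     by (rule off_finite_combine[OF e r13[OF ij] finite.emptyI])
      (use False in \<open>simp add: matrix_diag_right dr dll ll lr Pe Qe Acr0_def mP0(2) mQ0(2) ab0_def al0_def\<close>)
   qed
  qed
 qed
 moreover have "strictly_lower (Acr0 z) \<and> strictly_lower (Acr1 z)" for z
  by (auto simp: strictly_lower_def Acr0_def Acr1_def)
 ultimately show ?thesis by blast
qed

end
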